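(* Let $(M,\mathcal{O})$ be a formal manifold, let $\mathcal{F}$ be a sheaf of $\mathcal{O}$-modules, let $E$ be a quasi-complete LCS, and let $\{U_\gamma\}_{\gamma\in\Gamma}$ be an open cover of $M$. If the inductive limit $\varinjlim_{(K,r)\in\mathcal{C}(M)}\mathrm{D}^\infty_{K,r}(M;\mathcal{F})$ is regular, then the linear map $$\mathrm{C}^{-\infty}(M;\mathcal{F};E)\to\prod_{\gamma\in\Gamma}\mathrm{C}^{-\infty}(U_\gamma;\mathcal{F};E),\qquad u\mapsto\{u|_{U_\gamma}\}_{\gamma\in\Gamma}$$ is a closed topological embedding (i.e. a homeomorphism onto a closed subspace).
   Context: Formal manifolds. For a smooth manifold $N$ and $k\in\mathbb{N}$, $N^{(k)}$ is the locally ringed space $(N,\mathcal{O}_N^{(k)})$ over $\mathrm{Spec}(\mathbb{C})$ with $\mathcal{O}_N^{(k)}(U)=\mathrm{C}^\infty(U)[[y_1,\dots,y_k]]$ (complex-valued smooth functions). A formal manifold is a locally ringed space $(M,\mathcal{O})$ over $\mathrm{Spec}(\mathbb{C})$ with $M$ paracompact Hausdorff such that every point has an open neighborhood $U$ with $(U,\mathcal{O}|_U)\cong(\mathbb{R}^n)^{(k)}$ for some $n,k\in\mathbb{N}$. For $f\in\mathcal{O}(U)$, $f(a)\in\mathbb{C}$ is the residue of the germ of $f$ at $a$. The reduction is the smooth manifold $\underline{M}=(M,\underline{\mathcal{O}})$, where $\underline{\mathcal{O}}$ is the quotient of $\mathcal{O}$ by the ideal sheaf of sections $f$ with $f(a)=0$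 for all $a$. $\underline{\mathcal{D}}$ is the sheaf of complex-valued smooth densities on $\underline{M}$, an $\mathcal{O}$-module via $\mathcal{O}\to\underline{\mathcal{O}}$. LCS. An LCS is a locally convex topological vector space over $\mathbb{C}$, possibly non-Hausdorff; (quasi-)complete LCS are by convention Hausdorff. $\mathcal{L}_b(X,Y)$ is the space of continuous linear maps with the strong topology (uniform convergence on bounded sets). Inductive limits are in the category of LCS. An inductive limit $\varinjlim_{i\in I}X_i$ over a directed set is strict if $X_i\to X_j$ is a linear topological embedding for all $i\le j$; it is regular if it is strict and every bounded subset of it is contained and bounded in some $X_i$. Differential operators. For sheaves $\mathcal{F}_1,\mathcal{F}_2$ of $\mathcal{O}$-modules, a $\mathbb{C}$-linear sheaf homomorphism $D:\mathcal{F}_1\to\mathcal{F}_2$ has order $\le r$ if for every open $U$ and $f_0,\dots,f_r\in\mathcal{O}(U)$, $[\cdots[[D|_U,f_0],f_1],\dots,f_r]=0$, where $[D,f]=D\circ f-f\circ D$. It is a differential operator if it is locally of finite order; $\mathrm{supp}\,D$ is the complement of the largest open set on which $D$ is zero. $\mathrm{Diff}_c$: differential operators with compact support; $\mathrm{Diff}_{K,r}$: those of order $\le r$ supported in the compact set $K$. Compactly supported formal densities. For $U\subset M$ open, $\mathrm{D}_c^\infty(U;\mathcal{F})$ is the image of $\rho_U:\mathrm{Diff}_c(\mathcal{F}|_U,\underline{\mathcal{D}}|_U)\to\mathrm{Hom}_{\mathbb{C}}(\mathcal{F}(U),\mathbb{C})$, $\rho_U(D)(u)=\int_U D(u)$.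 $\mathcal{C}(U)$ is the directed set of pairs $(K,r)$ with $K\subset U$ compact and $r\in\mathbb{N}$, ordered by $(K,r)\preceq(K',r')$ iff $K\subset K'$ and $r\le r'$. $\mathrm{Diff}_{K,r}(\mathcal{F}|_U,\underline{\mathcal{D}}|_U)$ has the topology of the seminorms $|D|_{X,u}=\sup_{a\in U}|(X(D(u)))(a)|$ ($X\in\mathrm{Diff}_c(\underline{\mathcal{D}}|_U,\underline{\mathcal{O}}|_U)$, $u\in\mathcal{F}(U)$), its image $\mathrm{D}^\infty_{K,r}(U;\mathcal{F})$ under $\rho_U$ has the quotient topology, and $\mathrm{D}_c^\infty(U;\mathcal{F})=\varinjlim_{(K,r)\in\mathcal{C}(U)}\mathrm{D}^\infty_{K,r}(U;\mathcal{F})$ has the inductive limit topology. For open $V\subset U$ the extension map $\mathrm{ext}_{U,V}:\mathrm{D}_c^\infty(V;\mathcal{F})\to\mathrm{D}_c^\infty(U;\mathcal{F})$, $\eta\mapsto(u\mapsto\eta(u|_V))$, is well defined and continuous. Generalized functions. $\mathrm{C}^{-\infty}(U;\mathcal{F};E)=\mathcal{L}_b(\mathrm{D}_c^\infty(U;\mathcal{F}),E)$, with restriction maps $u|_V=u\circ\mathrm{ext}_{U,V}$. *)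

theory Defs
  imports
    "HOL-Analysis.Analysis"
    "HOL-Algebra.QuotRing"
    "HOL-Algebra.Module"
    "HOL-Library.Function_Algebras"
begin

section \<open>Locally convex spaces\<close>

text \<open>A topological vector space over the complex numbers is a topology \<open>T\<close> whose carrier
  \<open>topspace T\<close> is a linear subspace of an ambient vector space with scalar multiplication
  \<open>sc\<close>.  The Hausdorff property is not part of \<open>lcs\<close>.\<close>

definition lcs :: "(complex \<Rightarrow> 'a::ab_group_add \<Rightarrow> 'a) \<Rightarrow> 'a topology \<Rightarrow> bool" where
  "lcs sc T \<longleftrightarrow>
     vector_space sc \<and>
     Modules.module.subspace sc (topspace T) \<and>
     continuous_map (prod_topology T T) T (\<lambda>(x, y). x + y) \<and>
     continuous_map (prod_topology euclidean T) T (\<lambda>(c, x). sc c x) \<and>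
     (\<forall>W. openin T W \<and> 0 \<in> W \<longrightarrow>
        (\<exists>C N. openin T N \<and> 0 \<in> N \<and> N \<subseteq> C \<and> C \<subseteq> W \<and>
          (\<forall>x\<in>C. \<forall>y\<in>C. \<forall>t::real. 0 \<le> t \<and> t \<le> 1 \<longrightarrow>
             sc (complex_of_real (1 - t)) x + sc (complex_of_real t) y \<in> C)))"

definition lcs_bounded :: "(complex \<Rightarrow> 'a::ab_group_add \<Rightarrow> 'a) \<Rightarrow> 'a topology \<Rightarrow> 'a set \<Rightarrow> bool" where
  "lcs_bounded sc T B \<longleftrightarrow>
     B \<subseteq> topspace T \<and>
     (\<forall>W. openin T W \<and> 0 \<in> W \<longrightarrow> (\<exists>r>0. \<forall>c. cmod c \<ge> r \<longrightarrow> B \<subseteq> sc c ` W))"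

definition lcs_cauchy :: "'a::ab_group_add topology \<Rightarrow> 'a filter \<Rightarrow> bool" where
  "lcs_cauchy T \<FF> \<longleftrightarrow>
     (\<forall>W. openin T W \<and> 0 \<in> W \<longrightarrow>
        (\<exists>A. eventually (\<lambda>x. x \<in> A) \<FF> \<and> (\<forall>x\<in>A. \<forall>y\<in>A. x - y \<in> W)))"

definition lcs_complete_set :: "'a::ab_group_add topology \<Rightarrow> 'a set \<Rightarrow> bool" where
  "lcs_complete_set T S \<longleftrightarrow>
     (\<forall>\<FF>. \<FF> \<noteq> bot \<and> eventually (\<lambda>x. x \<in> S) \<FF> \<and> lcs_cauchy T \<FF> \<longrightarrow>
        (\<exists>l\<in>S. limitin T (\<lambda>x. x) l \<FF>))"

definition quasi_complete_lcs :: "(complex \<Rightarrow> 'a::ab_group_add \<Rightarrow> 'a) \<Rightarrow> 'a topology \<Rightarrow> bool" where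
  "quasi_complete_lcs sc T \<longleftrightarrow>
     lcs sc T \<and> Hausdorff_space T \<and>
     (\<forall>B. closedin T B \<and> lcs_bounded sc T B \<longrightarrow> lcs_complete_set T B)"

definition seminorm_topology :: "'a::ab_group_add set \<Rightarrow> ('a \<Rightarrow> real) set \<Rightarrow> 'a topology" where
  "seminorm_topology S P =
     topology_generated_by
       (insert S {{y \<in> S. p (y - x) < \<epsilon>} | p x \<epsilon>. p \<in> P \<and> x \<in> S \<and> \<epsilon> > 0})"

definition quotient_topology :: "'a topology \<Rightarrow> ('a \<Rightarrow> 'b) \<Rightarrow> 'b topology" where
  "quotient_topology T q =
     topology (\<lambda>W. W \<subseteq> q ` topspace T \<and> openin T {x \<in> topspace T. q x \<in> W})"

text \<open>The inductive limit, in the category of LCS, of a directed family of subspaces \<open>T i\<close> of a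
  space \<open>S\<close> (their union), the transition maps being the inclusions: the finest locally convex
  topology on \<open>S\<close> for which all inclusions are continuous, obtained as the supremum of all such
  topologies.\<close>

definition lcs_ind_lim ::
  "(complex \<Rightarrow> 'a::ab_group_add \<Rightarrow> 'a) \<Rightarrow> 'a set \<Rightarrow> 'i set \<Rightarrow> ('i \<Rightarrow> 'a topology) \<Rightarrow> 'a topology" where
  "lcs_ind_lim sc S I T =
     topology_generated_by
       (insert S (\<Union>{{W. openin T' W} | T'.
          lcs sc T' \<and> topspace T' = S \<and> (\<forall>i\<in>I. continuous_map (T i) T' (\<lambda>x. x))}))"

definition strict_ind_lim :: "'i set \<Rightarrow> ('i \<Rightarrow> 'i \<Rightarrow> bool) \<Rightarrow> ('i \<Rightarrow> 'a topology) \<Rightarrow> bool" where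
  "strict_ind_lim I leq T \<longleftrightarrow>
     (\<forall>i\<in>I. \<forall>j\<in>I. leq i j \<longrightarrow> embedding_map (T i) (T j) (\<lambda>x. x))"

definition regular_ind_lim ::
  "(complex \<Rightarrow> 'a::ab_group_add \<Rightarrow> 'a) \<Rightarrow> 'a set \<Rightarrow> 'i set \<Rightarrow> ('i \<Rightarrow> 'i \<Rightarrow> bool) \<Rightarrow> ('i \<Rightarrow> 'a topology)
     \<Rightarrow> bool" where
  "regular_ind_lim sc S I leq T \<longleftrightarrow>
     strict_ind_lim I leq T \<and>
     (\<forall>B. lcs_bounded sc (lcs_ind_lim sc S I T) B \<longrightarrow> (\<exists>i\<in>I. lcs_bounded sc (T i) B))"

text \<open>A continuous linear map between the carriers is represented by its extension by \<open>0\<close> to the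
  ambient type, so that equality of maps is equality of functions.\<close>

definition cont_lin_maps ::
  "(complex \<Rightarrow> 'a::ab_group_add \<Rightarrow> 'a) \<Rightarrow> 'a topology \<Rightarrow> (complex \<Rightarrow> 'b::ab_group_add \<Rightarrow> 'b) \<Rightarrow> 'b topology
     \<Rightarrow> ('a \<Rightarrow> 'b) set" where
  "cont_lin_maps sX X sY Y =
     {f. continuous_map X Y f \<and>
         (\<forall>x\<in>topspace X. \<forall>y\<in>topspace X. f (x + y) = f x + f y) \<and>
         (\<forall>c. \<forall>x\<in>topspace X. f (sX c x) = sY c (f x)) \<and>
         (\<forall>x. x \<notin> topspace X \<longrightarrow> f x = 0)}"

definition strong_topology ::
  "(complex \<Rightarrow> 'a::ab_group_add \<Rightarrow> 'a) \<Rightarrow> 'a topology \<Rightarrow> (complex \<Rightarrow> 'b::ab_group_add \<Rightarrow> 'b) \<Rightarrow> 'b topology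
     \<Rightarrow> ('a \<Rightarrow> 'b) topology" where
  "strong_topology sX X sY Y =
     topology (\<lambda>\<U>. \<U> \<subseteq> cont_lin_maps sX X sY Y \<and>
       (\<forall>f\<in>\<U>. \<exists>B W. lcs_bounded sX X B \<and> openin Y W \<and> 0 \<in> W \<and>
          {g \<in> cont_lin_maps sX X sY Y. \<forall>x\<in>B. g x - f x \<in> W} \<subseteq> \<U>))"

definition fscale :: "complex \<Rightarrow> ('a \<Rightarrow> complex) \<Rightarrow> 'a \<Rightarrow> complex" where
  "fscale c \<eta> = (\<lambda>x. c * \<eta> x)"


section \<open>Ringed spaces over the complex numbers\<close>

text \<open>The same record serves for sheaves of algebras and for sheaves of modules; for the latter
  the fields \<open>mult\<close> and \<open>one\<close> of the modules of sections are irrelevant.\<close>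

record ('p, 'r, 'm) sheaf_data =
  secs :: "'p set \<Rightarrow> ('r, 'm) module"
  rest :: "'p set \<Rightarrow> 'p set \<Rightarrow> 'm \<Rightarrow> 'm"

record ('p, 's) ringed_space =
  base :: "'p topology"
  str :: "('p, complex, 's) sheaf_data"

definition complex_ring :: "complex ring" where
  "complex_ring = \<lparr>carrier = UNIV, mult = (*), one = 1, zero = 0, add = (+)\<rparr>"

definition is_sheaf :: "'p topology \<Rightarrow> ('p, 'r, 'm) sheaf_data \<Rightarrow> bool" where
  "is_sheaf X F \<longleftrightarrow>
     (\<forall>U V. openin X U \<and> openin X V \<and> V \<subseteq> U \<longrightarrow>
        rest F U V \<in> carrier (secs F U) \<rightarrow> carrier (secs F V)) \<and>
     (\<forall>U. openin X U \<longrightarrow> (\<forall>m\<in>carrier (secs F U). rest F U U m = m)) \<and>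
     (\<forall>U V W. openin X U \<and> openin X V \<and> openin X W \<and> W \<subseteq> V \<and> V \<subseteq> U \<longrightarrow>
        (\<forall>m\<in>carrier (secs F U). rest F V W (rest F U V m) = rest F U W m)) \<and>
     (\<forall>\<U> s. (\<forall>U\<in>\<U>. openin X U \<and> s U \<in> carrier (secs F U)) \<and>
            (\<forall>U\<in>\<U>. \<forall>V\<in>\<U>. rest F U (U \<inter> V) (s U) = rest F V (U \<inter> V) (s V)) \<longrightarrow>
        (\<exists>!m. m \<in> carrier (secs F (\<Union>\<U>)) \<and> (\<forall>U\<in>\<U>. rest F (\<Union>\<U>) U m = s U)))"

definition c_ringed_space :: "('p, 's) ringed_space \<Rightarrow> bool" where
  "c_ringed_space M \<longleftrightarrow>
     is_sheaf (base M) (str M) \<and>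
     (\<forall>U. openin (base M) U \<longrightarrow> algebra complex_ring (secs (str M) U)) \<and>
     (\<forall>U V. openin (base M) U \<and> openin (base M) V \<and> V \<subseteq> U \<longrightarrow>
        rest (str M) U V \<in> ring_hom (secs (str M) U) (secs (str M) V) \<and>
        (\<forall>c. \<forall>f\<in>carrier (secs (str M) U).
           rest (str M) U V (c \<odot>\<^bsub>secs (str M) U\<^esub> f) = c \<odot>\<^bsub>secs (str M) V\<^esub> rest (str M) U V f))"

definition germ :: "('p, 's) ringed_space \<Rightarrow> 'p \<Rightarrow> 'p set \<Rightarrow> 's \<Rightarrow> ('p set \<times> 's) set" where
  "germ M a U f =
     {(V, g). openin (base M) V \<and> a \<in> V \<and> g \<in> carrier (secs (str M) V) \<and>
        (\<exists>W. openin (base M) W \<and> a \<in> W \<and> W \<subseteq> U \<inter> V \<and> rest (str M) U W f = rest (str M) V W g)}"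

text \<open>In the operations below all members of the union are the same germ.\<close>

definition stalk :: "('p, 's) ringed_space \<Rightarrow> 'p \<Rightarrow> ('p set \<times> 's) set ring" where
  "stalk M a =
     \<lparr>carrier = {germ M a U f | U f. openin (base M) U \<and> a \<in> U \<and> f \<in> carrier (secs (str M) U)},
      mult = (\<lambda>G H. \<Union>{germ M a (U \<inter> V)
                 (rest (str M) U (U \<inter> V) f \<otimes>\<^bsub>secs (str M) (U \<inter> V)\<^esub> rest (str M) V (U \<inter> V) g)
               | U f V g. (U, f) \<in> G \<and> (V, g) \<in> H}),
      one = germ M a (topspace (base M)) \<one>\<^bsub>secs (str M) (topspace (base M))\<^esub>,
      zero = germ M a (topspace (base M)) \<zero>\<^bsub>secs (str M) (topspace (base M))\<^esub>,
      add = (\<lambda>G H. \<Union>{germ M a (U \<inter> V)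
                 (rest (str M) U (U \<inter> V) f \<oplus>\<^bsub>secs (str M) (U \<inter> V)\<^esub> rest (str M) V (U \<inter> V) g)
               | U f V g. (U, f) \<in> G \<and> (V, g) \<in> H})\<rparr>"

definition locally_ringed_space :: "('p, 's) ringed_space \<Rightarrow> bool" where
  "locally_ringed_space M \<longleftrightarrow>
     c_ringed_space M \<and> (\<forall>a\<in>topspace (base M). \<exists>!I. maximalideal I (stalk M a))"

definition residue_value :: "('p, 's) ringed_space \<Rightarrow> 'p set \<Rightarrow> 's \<Rightarrow> 'p \<Rightarrow> complex" where
  "residue_value M U f a =
     (THE c. germ M a U (f \<ominus>\<^bsub>secs (str M) U\<^esub> (c \<odot>\<^bsub>secs (str M) U\<^esub> \<one>\<^bsub>secs (str M) U\<^esub>))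
               \<in> (THE I. maximalideal I (stalk M a)))"

definition restrict_space_to :: "('p, 's) ringed_space \<Rightarrow> 'p set \<Rightarrow> ('p, 's) ringed_space" where
  "restrict_space_to M U = \<lparr>base = subtopology (base M) U, str = str M\<rparr>"

text \<open>An isomorphism of ringed spaces over the complex numbers is automatically local on stalks.\<close>

definition ringed_iso :: "('p, 's) ringed_space \<Rightarrow> ('q, 't) ringed_space \<Rightarrow> bool" where
  "ringed_iso M N \<longleftrightarrow>
     (\<exists>\<phi> \<psi>. homeomorphic_map (base M) (base N) \<phi> \<and>
        (\<forall>W. openin (base N) W \<longrightarrow>
           \<psi> W \<in> ring_iso (secs (str N) W) (secs (str M) {a \<in> topspace (base M). \<phi> a \<in> W}) \<and>
           (\<forall>c. \<forall>f\<in>carrier (secs (str N) W).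
              \<psi> W (c \<odot>\<^bsub>secs (str N) W\<^esub> f) =
              c \<odot>\<^bsub>secs (str M) {a \<in> topspace (base M). \<phi> a \<in> W}\<^esub> \<psi> W f)) \<and>
        (\<forall>W W'. openin (base N) W \<and> openin (base N) W' \<and> W' \<subseteq> W \<longrightarrow>
           (\<forall>f\<in>carrier (secs (str N) W).
              \<psi> W' (rest (str N) W W' f) =
              rest (str M) {a \<in> topspace (base M). \<phi> a \<in> W} {a \<in> topspace (base M). \<phi> a \<in> W'} (\<psi> W f))))"


section \<open>Smooth functions on open subsets of Euclidean spaces and formal manifolds\<close>

definition partial_deriv ::
  "nat \<Rightarrow> ((nat \<Rightarrow> real) \<Rightarrow> 'v::real_normed_vector) \<Rightarrow> (nat \<Rightarrow> real) \<Rightarrow> 'v" where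
  "partial_deriv i f x = vector_derivative (\<lambda>t. f (x(i := t))) (at (x i))"

definition smooth_on :: "nat \<Rightarrow> (nat \<Rightarrow> real) set \<Rightarrow> ((nat \<Rightarrow> real) \<Rightarrow> complex) \<Rightarrow> bool" where
  "smooth_on n U f \<longleftrightarrow>
     (\<forall>is. set is \<subseteq> {..<n} \<longrightarrow>
        continuous_map (subtopology (Euclidean_space n) U) euclidean (foldr partial_deriv is f) \<and>
        (\<forall>x\<in>U. \<forall>i<n. (\<lambda>t. foldr partial_deriv is f (x(i := t))) differentiable at (x i)))"

text \<open>\<open>euclidean_formal n k\<close> is the formal manifold \<open>(R^n)^(k)\<close>: a section over \<open>U\<close> is a power
  series in \<open>k\<close> variables, \<open>f \<alpha>\<close> being its coefficient at the monomial with exponents \<open>\<alpha>\<close>.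
  Coefficients vanish at exponents that involve other variables, and outside \<open>U\<close>.\<close>

definition euclidean_formal ::
  "nat \<Rightarrow> nat \<Rightarrow> (nat \<Rightarrow> real, (nat \<Rightarrow> nat) \<Rightarrow> (nat \<Rightarrow> real) \<Rightarrow> complex) ringed_space" where
  "euclidean_formal n k =
     \<lparr>base = Euclidean_space n,
      str = \<lparr>secs = (\<lambda>U.
          \<lparr>carrier = {f. \<forall>\<alpha>. smooth_on n U (f \<alpha>) \<and> (\<forall>x. x \<notin> U \<longrightarrow> f \<alpha> x = 0) \<and>
                             ((\<exists>i\<ge>k. \<alpha> i \<noteq> 0) \<longrightarrow> f \<alpha> = (\<lambda>x. 0))},
           mult = (\<lambda>f g \<alpha> x. \<Sum>\<beta> | \<forall>i. \<beta> i \<le> \<alpha> i. f \<beta> x * g (\<lambda>i. \<alpha> i - \<beta> i) x),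
           one = (\<lambda>\<alpha> x. if x \<in> U \<and> (\<forall>i. \<alpha> i = 0) then 1 else 0),
           zero = (\<lambda>\<alpha> x. 0),
           add = (\<lambda>f g \<alpha> x. f \<alpha> x + g \<alpha> x),
           smult = (\<lambda>c f \<alpha> x. c * f \<alpha> x)\<rparr>),
        rest = (\<lambda>U V f \<alpha> x. if x \<in> V then f \<alpha> x else 0)\<rparr>\<rparr>"

definition paracompact_space :: "'p topology \<Rightarrow> bool" where
  "paracompact_space X \<longleftrightarrow>
     (\<forall>\<U>. (\<forall>U\<in>\<U>. openin X U) \<and> \<Union>\<U> = topspace X \<longrightarrow>
        (\<exists>\<V>. (\<forall>V\<in>\<V>. openin X V \<and> (\<exists>U\<in>\<U>. V \<subseteq> U)) \<and> \<Union>\<V> = topspace X \<and> locally_finite_in X \<V>))"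

definition formal_manifold :: "('p, 's) ringed_space \<Rightarrow> bool" where
  "formal_manifold M \<longleftrightarrow>
     locally_ringed_space M \<and> paracompact_space (base M) \<and> Hausdorff_space (base M) \<and>
     (\<forall>a\<in>topspace (base M). \<exists>U n k. openin (base M) U \<and> a \<in> U \<and>
        ringed_iso (restrict_space_to M U) (euclidean_formal n k))"

definition sheaf_of_modules :: "('p, 's) ringed_space \<Rightarrow> ('p, 's, 'f) sheaf_data \<Rightarrow> bool" where
  "sheaf_of_modules M F \<longleftrightarrow>
     is_sheaf (base M) F \<and>
     (\<forall>U. openin (base M) U \<longrightarrow> Module.module (secs (str M) U) (secs F U)) \<and>
     (\<forall>U V. openin (base M) U \<and> openin (base M) V \<and> V \<subseteq> U \<longrightarrow>
        (\<forall>u\<in>carrier (secs F U). \<forall>v\<in>carrier (secs F U).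
           rest F U V (u \<oplus>\<^bsub>secs F U\<^esub> v) = rest F U V u \<oplus>\<^bsub>secs F V\<^esub> rest F U V v) \<and>
        (\<forall>f\<in>carrier (secs (str M) U). \<forall>u\<in>carrier (secs F U).
           rest F U V (f \<odot>\<^bsub>secs F U\<^esub> u) = rest (str M) U V f \<odot>\<^bsub>secs F V\<^esub> rest F U V u))"


section \<open>The reduction and its densities\<close>

text \<open>The presheaf quotient of the structure sheaf by the ideal sheaf of sections with vanishing
  residues is the presheaf of functions \<open>a \<mapsto> f(a)\<close>.  The quotient sheaf is its
  sheafification, i.e. the sheaf of functions that are locally of this form.  Here and for
  densities, functions on \<open>U\<close> are extended by \<open>0\<close>.\<close>

definition reduction :: "('p, 's) ringed_space \<Rightarrow> ('p, 's, 'p \<Rightarrow> complex) sheaf_data" where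
  "reduction M =
     \<lparr>secs = (\<lambda>U.
        \<lparr>carrier = {g. (\<forall>a. a \<notin> U \<longrightarrow> g a = 0) \<and>
           (\<forall>a\<in>U. \<exists>V f. openin (base M) V \<and> a \<in> V \<and> V \<subseteq> U \<and> f \<in> carrier (secs (str M) V) \<and>
              (\<forall>b\<in>V. g b = residue_value M V f b))},
         mult = (\<lambda>g h a. g a * h a),
         one = (\<lambda>a. if a \<in> U then 1 else 0),
         zero = (\<lambda>a. 0),
         add = (\<lambda>g h a. g a + h a),
         smult = (\<lambda>f g a. residue_value M U f a * g a)\<rparr>),
      rest = (\<lambda>U V g a. if a \<in> V then g a else 0)\<rparr>"

text \<open>\<open>(n, V, \<phi>)\<close>: a coordinate system \<open>\<phi>\<close> on \<open>V\<close> with values in \<open>R^n\<close>.\<close>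

type_synonym 'p chart = "nat \<times> 'p set \<times> ('p \<Rightarrow> nat \<Rightarrow> real)"

abbreviation chart_dom :: "'p chart \<Rightarrow> 'p set" where
  "chart_dom ch \<equiv> fst (snd ch)"

definition red_chart :: "('p, 's) ringed_space \<Rightarrow> 'p chart \<Rightarrow> bool" where
  "red_chart M = (\<lambda>(n, V, \<phi>).
     openin (base M) V \<and> openin (Euclidean_space n) (\<phi> ` V) \<and>
     homeomorphic_map (subtopology (base M) V) (subtopology (Euclidean_space n) (\<phi> ` V)) \<phi> \<and>
     (\<forall>W g. openin (base M) W \<and> W \<subseteq> V \<and> (\<forall>a. a \<notin> W \<longrightarrow> g a = 0) \<longrightarrow>
        (g \<in> carrier (secs (reduction M) W) \<longleftrightarrow> smooth_on n (\<phi> ` W) (g \<circ> inv_into V \<phi>))))"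

definition jacobian_det :: "nat \<Rightarrow> ((nat \<Rightarrow> real) \<Rightarrow> nat \<Rightarrow> real) \<Rightarrow> (nat \<Rightarrow> real) \<Rightarrow> real" where
  "jacobian_det n \<tau> x =
     (\<Sum>p | p permutes {..<n}. of_int (sign p) * (\<Prod>i<n. partial_deriv (p i) (\<lambda>y. \<tau> y i) x))"

text \<open>A smooth density \<open>\<omega>\<close> is given by its coefficient functions \<open>\<omega> ch\<close> with respect to
  \<open>|dx|\<close> in all charts \<open>ch\<close>, subject to the transformation law of densities.\<close>

definition densities :: "('p, 's) ringed_space \<Rightarrow> ('p, 's, 'p chart \<Rightarrow> 'p \<Rightarrow> complex) sheaf_data" where
  "densities M =
     \<lparr>secs = (\<lambda>U.
        \<lparr>carrier = {\<omega>.
           (\<forall>ch a. \<not> (red_chart M ch \<and> a \<in> U \<inter> chart_dom ch) \<longrightarrow> \<omega> ch a = 0) \<and>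
           (\<forall>n V \<phi>. red_chart M (n, V, \<phi>) \<longrightarrow>
              smooth_on n (\<phi> ` (U \<inter> V)) (\<omega> (n, V, \<phi>) \<circ> inv_into V \<phi>)) \<and>
           (\<forall>n V \<phi> m V' \<phi>'. red_chart M (n, V, \<phi>) \<and> red_chart M (m, V', \<phi>') \<longrightarrow>
              (\<forall>a \<in> U \<inter> V \<inter> V'. \<omega> (n, V, \<phi>) a =
                 complex_of_real \<bar>jacobian_det n (\<phi>' \<circ> inv_into V \<phi>) (\<phi> a)\<bar> * \<omega> (m, V', \<phi>') a))},
         mult = undefined,
         one = undefined,
         zero = (\<lambda>ch a. 0),
         add = (\<lambda>\<omega> \<omega>' ch a. \<omega> ch a + \<omega>' ch a),
         smult = (\<lambda>f \<omega> ch a. residue_value M U f a * \<omega> ch a)\<rparr>),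
      rest = (\<lambda>U V \<omega> ch a. if a \<in> V then \<omega> ch a else 0)\<rparr>"

definition smooth_partition_of_unity :: "('p, 's) ringed_space \<Rightarrow> ('p chart \<Rightarrow> 'p \<Rightarrow> real) \<Rightarrow> bool" where
  "smooth_partition_of_unity M \<theta> \<longleftrightarrow>
     (\<forall>ch. \<not> red_chart M ch \<longrightarrow> \<theta> ch = (\<lambda>a. 0)) \<and>
     (\<forall>ch. (\<lambda>a. complex_of_real (\<theta> ch a)) \<in> carrier (secs (reduction M) (topspace (base M)))) \<and>
     (\<forall>ch a. 0 \<le> \<theta> ch a) \<and>
     (\<forall>ch. base M closure_of {a. \<theta> ch a \<noteq> 0} \<subseteq> chart_dom ch) \<and>
     (\<forall>a\<in>topspace (base M). \<exists>N. openin (base M) N \<and> a \<in> N \<and> finite {ch. \<exists>b\<in>N. \<theta> ch b \<noteq> 0}) \<and>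
     (\<forall>a\<in>topspace (base M). (\<Sum>ch | \<theta> ch a \<noteq> 0. \<theta> ch a) = 1)"

text \<open>Points of the product measure space over \<open>{..<n}\<close> are undefined at indices \<open>\<ge> n\<close>, those of
  \<open>Euclidean_space n\<close> are \<open>0\<close> there.\<close>

definition chart_integral :: "'p chart \<Rightarrow> ('p \<Rightarrow> complex) \<Rightarrow> complex" where
  "chart_integral = (\<lambda>(n, V, \<phi>) h.
     (\<integral>x. (let y = (\<lambda>i. if i < n then x i else 0)
           in if y \<in> \<phi> ` V then h (inv_into V \<phi> y) else 0)
       \<partial>(Pi\<^sub>M {..<n} (\<lambda>_. lborel))))"

text \<open>The integral of a compactly supported smooth density, by means of a partition of unity; as
  usual it does not depend on the chosen one.  A density on an open set \<open>U\<close> is \<open>0\<close> outside \<open>U\<close>,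
  so this is also its integral over \<open>U\<close>.\<close>

definition density_integral :: "('p, 's) ringed_space \<Rightarrow> ('p chart \<Rightarrow> 'p \<Rightarrow> complex) \<Rightarrow> complex" where
  "density_integral M \<omega> =
     (let \<theta> = (SOME \<theta>. smooth_partition_of_unity M \<theta>)
      in \<Sum>ch | \<exists>a. complex_of_real (\<theta> ch a) * \<omega> ch a \<noteq> 0.
           chart_integral ch (\<lambda>a. complex_of_real (\<theta> ch a) * \<omega> ch a))"


section \<open>Differential operators\<close>

definition sheaf_cscale ::
  "('p, 's) ringed_space \<Rightarrow> ('p, 's, 'm) sheaf_data \<Rightarrow> 'p set \<Rightarrow> complex \<Rightarrow> 'm \<Rightarrow> 'm" where
  "sheaf_cscale M F U c u = (c \<odot>\<^bsub>secs (str M) U\<^esub> \<one>\<^bsub>secs (str M) U\<^esub>) \<odot>\<^bsub>secs F U\<^esub> u"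

text \<open>Complex linear sheaf homomorphisms between the restrictions of \<open>F\<close> and \<open>G\<close> to \<open>U\<close>.  They are
  \<open>0\<close> where they have no meaning, so that equality of homomorphisms is equality of functions.\<close>

definition sheaf_homs ::
  "('p, 's) ringed_space \<Rightarrow> 'p set \<Rightarrow> ('p, 's, 'm) sheaf_data \<Rightarrow> ('p, 's, 'n) sheaf_data
     \<Rightarrow> ('p set \<Rightarrow> 'm \<Rightarrow> 'n) set" where
  "sheaf_homs M U F G =
     {D. (\<forall>V. openin (base M) V \<and> V \<subseteq> U \<longrightarrow>
            D V \<in> carrier (secs F V) \<rightarrow> carrier (secs G V) \<and>
            (\<forall>u\<in>carrier (secs F V). \<forall>v\<in>carrier (secs F V).
               D V (u \<oplus>\<^bsub>secs F V\<^esub> v) = D V u \<oplus>\<^bsub>secs G V\<^esub> D V v) \<and>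
            (\<forall>c. \<forall>u\<in>carrier (secs F V).
               D V (sheaf_cscale M F V c u) = sheaf_cscale M G V c (D V u))) \<and>
         (\<forall>V W. openin (base M) V \<and> openin (base M) W \<and> W \<subseteq> V \<and> V \<subseteq> U \<longrightarrow>
            (\<forall>u\<in>carrier (secs F V). D W (rest F V W u) = rest G V W (D V u))) \<and>
         (\<forall>V u. \<not> (openin (base M) V \<and> V \<subseteq> U \<and> u \<in> carrier (secs F V)) \<longrightarrow>
            D V u = \<zero>\<^bsub>secs G V\<^esub>)}"

definition zero_on ::
  "('p, 's) ringed_space \<Rightarrow> ('p, 's, 'm) sheaf_data \<Rightarrow> ('p, 's, 'n) sheaf_data \<Rightarrow> 'p set
     \<Rightarrow> ('p set \<Rightarrow> 'm \<Rightarrow> 'n) \<Rightarrow> bool" where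
  "zero_on M F G V D \<longleftrightarrow>
     (\<forall>W. openin (base M) W \<and> W \<subseteq> V \<longrightarrow> (\<forall>u\<in>carrier (secs F W). D W u = \<zero>\<^bsub>secs G W\<^esub>))"

definition commutator ::
  "('p, 's) ringed_space \<Rightarrow> ('p, 's, 'm) sheaf_data \<Rightarrow> ('p, 's, 'n) sheaf_data \<Rightarrow> 'p set
     \<Rightarrow> 's \<Rightarrow> ('p set \<Rightarrow> 'm \<Rightarrow> 'n) \<Rightarrow> ('p set \<Rightarrow> 'm \<Rightarrow> 'n)" where
  "commutator M F G V f D =
     (\<lambda>W u. D W (rest (str M) V W f \<odot>\<^bsub>secs F W\<^esub> u) \<ominus>\<^bsub>secs G W\<^esub>
            (rest (str M) V W f \<odot>\<^bsub>secs G W\<^esub> D W u))"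

definition order_le ::
  "('p, 's) ringed_space \<Rightarrow> 'p set \<Rightarrow> ('p, 's, 'm) sheaf_data \<Rightarrow> ('p, 's, 'n) sheaf_data \<Rightarrow> nat
     \<Rightarrow> ('p set \<Rightarrow> 'm \<Rightarrow> 'n) \<Rightarrow> bool" where
  "order_le M U F G r D \<longleftrightarrow>
     (\<forall>V fs. openin (base M) V \<and> V \<subseteq> U \<and> length fs = Suc r \<and>
             set fs \<subseteq> carrier (secs (str M) V) \<longrightarrow>
        zero_on M F G V (fold (commutator M F G V) fs D))"

definition diff_ops ::
  "('p, 's) ringed_space \<Rightarrow> 'p set \<Rightarrow> ('p, 's, 'm) sheaf_data \<Rightarrow> ('p, 's, 'n) sheaf_data
     \<Rightarrow> ('p set \<Rightarrow> 'm \<Rightarrow> 'n) set" where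
  "diff_ops M U F G =
     {D \<in> sheaf_homs M U F G.
        \<forall>a\<in>U. \<exists>V r. openin (base M) V \<and> a \<in> V \<and> V \<subseteq> U \<and> order_le M V F G r D}"

definition op_support ::
  "('p, 's) ringed_space \<Rightarrow> 'p set \<Rightarrow> ('p, 's, 'm) sheaf_data \<Rightarrow> ('p, 's, 'n) sheaf_data
     \<Rightarrow> ('p set \<Rightarrow> 'm \<Rightarrow> 'n) \<Rightarrow> 'p set" where
  "op_support M U F G D = U - \<Union>{V. openin (base M) V \<and> V \<subseteq> U \<and> zero_on M F G V D}"

definition Diff_c ::
  "('p, 's) ringed_space \<Rightarrow> 'p set \<Rightarrow> ('p, 's, 'm) sheaf_data \<Rightarrow> ('p, 's, 'n) sheaf_data
     \<Rightarrow> ('p set \<Rightarrow> 'm \<Rightarrow> 'n) set" where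
  "Diff_c M U F G = {D \<in> diff_ops M U F G. compactin (base M) (op_support M U F G D)}"

definition Diff_Kr ::
  "('p, 's) ringed_space \<Rightarrow> 'p set \<Rightarrow> ('p, 's, 'm) sheaf_data \<Rightarrow> ('p, 's, 'n) sheaf_data
     \<Rightarrow> 'p set \<Rightarrow> nat \<Rightarrow> ('p set \<Rightarrow> 'm \<Rightarrow> 'n) set" where
  "Diff_Kr M U F G K r = {D \<in> Diff_c M U F G. order_le M U F G r D \<and> op_support M U F G D \<subseteq> K}"


section \<open>Compactly supported formal densities and generalized functions\<close>

text \<open>The value \<open>0\<close> is inserted into the supremum for the case \<open>U = {}\<close>.\<close>

definition diff_seminorm ::
  "('p, 's) ringed_space \<Rightarrow> 'p set \<Rightarrow> ('p set \<Rightarrow> ('p chart \<Rightarrow> 'p \<Rightarrow> complex) \<Rightarrow> 'p \<Rightarrow> complex) \<Rightarrow> 'f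
     \<Rightarrow> ('p set \<Rightarrow> 'f \<Rightarrow> 'p chart \<Rightarrow> 'p \<Rightarrow> complex) \<Rightarrow> real" where
  "diff_seminorm M U X u D = Sup (insert 0 ((\<lambda>a. cmod (X U (D U u) a)) ` U))"

definition Diff_Kr_topology ::
  "('p, 's) ringed_space \<Rightarrow> ('p, 's, 'f) sheaf_data \<Rightarrow> 'p set \<Rightarrow> 'p set \<Rightarrow> nat
     \<Rightarrow> ('p set \<Rightarrow> 'f \<Rightarrow> 'p chart \<Rightarrow> 'p \<Rightarrow> complex) topology" where
  "Diff_Kr_topology M F U K r =
     seminorm_topology (Diff_Kr M U F (densities M) K r)
       {diff_seminorm M U X u | X u.
          X \<in> Diff_c M U (densities M) (reduction M) \<and> u \<in> carrier (secs F U)}"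

text \<open>Linear functionals on \<open>F(U)\<close> are extended by \<open>0\<close>.\<close>

definition rho ::
  "('p, 's) ringed_space \<Rightarrow> ('p, 's, 'f) sheaf_data \<Rightarrow> 'p set
     \<Rightarrow> ('p set \<Rightarrow> 'f \<Rightarrow> 'p chart \<Rightarrow> 'p \<Rightarrow> complex) \<Rightarrow> 'f \<Rightarrow> complex" where
  "rho M F U D = (\<lambda>u. if u \<in> carrier (secs F U) then density_integral M (D U u) else 0)"

definition Dc_carrier ::
  "('p, 's) ringed_space \<Rightarrow> ('p, 's, 'f) sheaf_data \<Rightarrow> 'p set \<Rightarrow> ('f \<Rightarrow> complex) set" where
  "Dc_carrier M F U = rho M F U ` Diff_c M U F (densities M)"

definition D_Kr ::
  "('p, 's) ringed_space \<Rightarrow> ('p, 's, 'f) sheaf_data \<Rightarrow> 'p set \<Rightarrow> 'p set \<times> nat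
     \<Rightarrow> ('f \<Rightarrow> complex) topology" where
  "D_Kr M F U = (\<lambda>(K, r). quotient_topology (Diff_Kr_topology M F U K r) (rho M F U))"

definition C_index :: "('p, 's) ringed_space \<Rightarrow> 'p set \<Rightarrow> ('p set \<times> nat) set" where
  "C_index M U = {(K, r). compactin (base M) K \<and> K \<subseteq> U}"

definition C_le :: "'p set \<times> nat \<Rightarrow> 'p set \<times> nat \<Rightarrow> bool" where
  "C_le = (\<lambda>(K, r) (K', r'). K \<subseteq> K' \<and> r \<le> r')"

definition Dc ::
  "('p, 's) ringed_space \<Rightarrow> ('p, 's, 'f) sheaf_data \<Rightarrow> 'p set \<Rightarrow> ('f \<Rightarrow> complex) topology" where
  "Dc M F U = lcs_ind_lim fscale (Dc_carrier M F U) (C_index M U) (D_Kr M F U)"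

definition ext_map ::
  "('p, 's) ringed_space \<Rightarrow> ('p, 's, 'f) sheaf_data \<Rightarrow> 'p set \<Rightarrow> 'p set
     \<Rightarrow> ('f \<Rightarrow> complex) \<Rightarrow> 'f \<Rightarrow> complex" where
  "ext_map M F U V \<eta> = (\<lambda>u. if u \<in> carrier (secs F U) then \<eta> (rest F U V u) else 0)"

definition gen_functions ::
  "('p, 's) ringed_space \<Rightarrow> ('p, 's, 'f) sheaf_data
     \<Rightarrow> (complex \<Rightarrow> 'e::ab_group_add \<Rightarrow> 'e) \<Rightarrow> 'e topology \<Rightarrow> 'p set
     \<Rightarrow> (('f \<Rightarrow> complex) \<Rightarrow> 'e) topology" where
  "gen_functions M F sE E U = strong_topology fscale (Dc M F U) sE E"

definition gen_restrict ::
  "('p, 's) ringed_space \<Rightarrow> ('p, 's, 'f) sheaf_data \<Rightarrow> 'p set \<Rightarrow> 'p set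
     \<Rightarrow> (('f \<Rightarrow> complex) \<Rightarrow> 'e::zero) \<Rightarrow> ('f \<Rightarrow> complex) \<Rightarrow> 'e" where
  "gen_restrict M F U V u = (\<lambda>\<eta>. if \<eta> \<in> topspace (Dc M F V) then u (ext_map M F U V \<eta>) else 0)"

definition gen_restrict_family ::
  "('p, 's) ringed_space \<Rightarrow> ('p, 's, 'f) sheaf_data \<Rightarrow> 'g set \<Rightarrow> ('g \<Rightarrow> 'p set)
     \<Rightarrow> (('f \<Rightarrow> complex) \<Rightarrow> 'e::zero) \<Rightarrow> 'g \<Rightarrow> ('f \<Rightarrow> complex) \<Rightarrow> 'e" where
  "gen_restrict_family M F \<Gamma> U u = (\<lambda>\<gamma>\<in>\<Gamma>. gen_restrict M F (topspace (base M)) (U \<gamma>) u)"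

end

theory Submission imports Defs begin

text \<open>Near a compact set \<open>K\<close> write \<open>1 = \<Sum>\<^sub>i h\<^sub>i\<close> with finitely many \<open>h\<^sub>i \<in> \<O>(M)\<close>, each supported in a
  closed subset of some \<open>U\<^bsub>\<gamma>(i)\<^esub>\<close>.
  Since \<open>\<eta> = \<Sum>\<^sub>i \<eta>(h\<^sub>i \<cdot>)\<close> for \<open>\<eta> \<in> D\<^sub>K\<^sub>,\<^sub>r(M)\<close>, multiplication by the \<open>h\<^sub>i\<close> splits \<open>D\<^sub>K\<^sub>,\<^sub>r(M)\<close> continuously
  into extensions of densities from the \<open>U\<^sub>\<gamma>\<close>. By regularity a bounded set of densities on \<open>M\<close> is
  bounded in some \<open>D\<^sub>K\<^sub>,\<^sub>r(M)\<close>, hence a finite sum of extensions of bounded sets, and so the family of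
  restrictions determines a generalized function together with its topology. A family \<open>(v\<^sub>\<gamma>)\<close> comes
  from a generalized function on \<open>M\<close> if and only if \<open>\<Sum>\<^sub>i v\<^bsub>\<gamma>(i)\<^esub>(\<eta>\<^sub>i) = 0\<close> whenever the extensions of the
  \<open>\<eta>\<^sub>i\<close> sum to zero, and these conditions are closed.\<close>

section \<open>Locally convex topologies\<close>

text \<open>Functional analysis and geometry meet only in the locale
  \<open>decomposable_ind_lim\<close>, which turns a continuous splitting of every step of the limit
  into the embedding and the closedness. A formal density can come from many operators, so cutting
  off is defined on functionals (\<open>cut\<close>), while the topology of \<open>D_Kr\<close>
  lives on operators. Each map is therefore lifted to operators (\<open>mulres\<close>,
  \<open>zext\<close>), and continuity is proved there by matching every seminorm of the target with
  one seminorm of the source. For this the test operator \<open>X\<close> is moved in the opposite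
  direction: it is cut off when operators are extended, and extended when they are cut off.
  \<open>rho\<close> integrates by means of a partition of unity obtained by choice, so its
  linearity rests on the existence of such partitions and on integrability in charts. Bump sections
  serve twice: their residues build the partition of unity, the sections themselves build the
  cutoffs. They are made in charts, which is why the residue, defined by the maximal ideal of the
  stalk, is first computed as the constant coefficient of a power series.\<close>

lemma topspace_quotient_topology [simp]:
  "topspace (quotient_topology T q) = q ` topspace T"
  and openin_quotient_topology:
  "openin (quotient_topology T q) W \<longleftrightarrow> W \<subseteq> q ` topspace T \<and> openin T {x \<in> topspace T. q x \<in> W}"
proof -
  have "istopology (\<lambda>W. W \<subseteq> q ` topspace T \<and> openin T {x \<in> topspace T. q x \<in> W})"
    unfolding istopology_def
  proof (intro conjI allI impI)
    fix A B assume A: "A \<subseteq> q ` topspace T \<and> openin T {x \<in> topspace T. q x \<in> A}"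
      and B: "B \<subseteq> q ` topspace T \<and> openin T {x \<in> topspace T. q x \<in> B}"
    show "A \<inter> B \<subseteq> q ` topspace T" using A by auto
    have "{x \<in> topspace T. q x \<in> A \<inter> B} = {x \<in> topspace T. q x \<in> A} \<inter> {x \<in> topspace T. q x \<in> B}" by auto
    then show "openin T {x \<in> topspace T. q x \<in> A \<inter> B}" using A B by auto
  next
    fix K assume K: "\<forall>A\<in>K. A \<subseteq> q ` topspace T \<and> openin T {x \<in> topspace T. q x \<in> A}"
    show "\<Union>K \<subseteq> q ` topspace T" using K by auto
    have "{x \<in> topspace T. q x \<in> \<Union>K} = \<Union>((\<lambda>A. {x \<in> topspace T. q x \<in> A}) ` K)" by auto
    then show "openin T {x \<in> topspace T. q x \<in> \<Union>K}" using K by auto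
  qed
  then show *: "openin (quotient_topology T q) W \<longleftrightarrow>
      W \<subseteq> q ` topspace T \<and> openin T {x \<in> topspace T. q x \<in> W}" for W
    unfolding quotient_topology_def by (simp add: topology_inverse')
  have "{x \<in> topspace T. q x \<in> q ` topspace T} = topspace T" by auto
  then have "openin (quotient_topology T q) (q ` topspace T)" by (simp add: *)
  then have "q ` topspace T \<subseteq> topspace (quotient_topology T q)" by (rule openin_subset)
  moreover have "topspace (quotient_topology T q) \<subseteq> q ` topspace T"
    using openin_topspace[of "quotient_topology T q"] unfolding * by blast
  ultimately show "topspace (quotient_topology T q) = q ` topspace T" by blast
qed

lemma continuous_map_from_quotient_topology:
  assumes "continuous_map T Z (f \<circ> q)"
  shows "continuous_map (quotient_topology T q) Z f"
  unfolding continuous_map_def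
proof (intro conjI allI impI)
  show "f \<in> topspace (quotient_topology T q) \<rightarrow> topspace Z"
    using assms by (auto simp: continuous_map_def)
  fix V assume V: "openin Z V"
  have "{x \<in> topspace T. q x \<in> {y \<in> q ` topspace T. f y \<in> V}} = {x \<in> topspace T. (f \<circ> q) x \<in> V}" by auto
  then show "openin (quotient_topology T q) {x \<in> topspace (quotient_topology T q). f x \<in> V}"
    using openin_continuous_map_preimage[OF assms V] by (auto simp: openin_quotient_topology)
qed

lemma continuous_map_quotient_topology: "continuous_map T (quotient_topology T q) q"
  by (auto simp: continuous_map_def openin_quotient_topology)

section \<open>Topologies generated by seminorms\<close>

lemma topspace_seminorm_topology [simp]: "topspace (seminorm_topology S P) = S"
  unfolding seminorm_topology_def topology_generated_by_topspace by auto

text \<open>The triangle inequality is assumed only for differences of points of \<open>S'\<close>: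
  the functions in \<open>P'\<close> will be suprema, and boundedness is available only at such
  arguments. It then suffices to dominate each \<open>p\<close> along \<open>L\<close> by a single
  \<open>q\<close>, since a ball around \<open>L z\<close> of the remaining radius stays inside the
  given one.\<close>

lemma continuous_map_seminorm_topology:
  assumes L: "L \<in> S \<rightarrow> S'"
    and zero: "\<And>q. q \<in> P \<Longrightarrow> q 0 = 0"
    and P': "\<And>p. p \<in> P' \<Longrightarrow> \<exists>q\<in>P. \<forall>x\<in>S. \<forall>y\<in>S. p (L y - L x) \<le> q (y - x)"
    and tri: "\<And>p x y z. p \<in> P' \<Longrightarrow> x \<in> S' \<Longrightarrow> y \<in> S' \<Longrightarrow> z \<in> S' \<Longrightarrow> p (x - z) \<le> p (x - y) + p (y - z)"
  shows "continuous_map (seminorm_topology S P) (seminorm_topology S' P') L"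
  unfolding seminorm_topology_def[of S' P']
proof (rule continuous_on_generated_topo)
  let ?T = "seminorm_topology S P"
  fix U assume "U \<in> insert S' {{y \<in> S'. p (y - x) < \<epsilon>} | p x \<epsilon>. p \<in> P' \<and> x \<in> S' \<and> \<epsilon> > 0}"
  then consider "U = S'" | p x \<epsilon> where "U = {y \<in> S'. p (y - x) < \<epsilon>}" "p \<in> P'" "x \<in> S'" "\<epsilon> > 0"
    by blast
  then show "openin ?T (L -` U \<inter> topspace ?T)"
  proof cases
    case 1
    then have "L -` U \<inter> topspace ?T = topspace ?T" using L by auto
    then show ?thesis by (metis openin_topspace)
  next
    case 2
    obtain q where q: "q \<in> P" "\<And>x y. x \<in> S \<Longrightarrow> y \<in> S \<Longrightarrow> p (L y - L x) \<le> q (y - x)"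
      using P'[OF 2(2)] by blast
    show ?thesis
    proof (subst openin_subopen, intro ballI)
      fix z assume "z \<in> L -` U \<inter> topspace ?T"
      then have z: "z \<in> S" "L z \<in> S'" "p (L z - x) < \<epsilon>" by (auto simp: 2)
      define \<delta> where "\<delta> = \<epsilon> - p (L z - x)"
      have d: "\<delta> > 0" using z by (simp add: \<delta>_def)
      let ?B = "{y \<in> S. q (y - z) < \<delta>}"
      have "openin ?T ?B" unfolding seminorm_topology_def
        by (rule topology_generated_by_Basis) (use q z d in blast)
      moreover have "z \<in> ?B" using z d zero[OF q(1)] by simp
      moreover have "?B \<subseteq> L -` U \<inter> topspace ?T"
      proof
        fix y assume y: "y \<in> ?B"
        then have Ly: "L y \<in> S'" using L by auto
        have "p (L y - x) \<le> p (L y - L z) + p (L z - x)" by (rule tri) (use 2 Ly z in auto)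
        also have "p (L y - L z) \<le> q (y - z)" using q(2) y z by auto
        finally have "p (L y - x) < \<epsilon>" using y by (auto simp: \<delta>_def)
        then show "y \<in> L -` U \<inter> topspace ?T" using y Ly by (auto simp: 2)
      qed
      ultimately show "\<exists>T. openin ?T T \<and> z \<in> T \<and> T \<subseteq> L -` U \<inter> topspace ?T" by blast
    qed
  qed
qed (use L in auto)

section \<open>Inductive limits as suprema of locally convex topologies\<close>

definition ind_lim_topologies ::
  "(complex \<Rightarrow> 'a::ab_group_add \<Rightarrow> 'a) \<Rightarrow> 'a set \<Rightarrow> 'i set \<Rightarrow> ('i \<Rightarrow> 'a topology) \<Rightarrow> 'a topology set" where
  "ind_lim_topologies sc S I T =
     {T'. lcs sc T' \<and> topspace T' = S \<and> (\<forall>i\<in>I. continuous_map (T i) T' (\<lambda>x. x))}"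

lemma lcs_ind_lim_alt:
  "lcs_ind_lim sc S I T =
     topology_generated_by (insert S (\<Union>((\<lambda>T'. {W. openin T' W}) ` ind_lim_topologies sc S I T)))"
  unfolding lcs_ind_lim_def ind_lim_topologies_def by (rule arg_cong[where f=topology_generated_by]) blast

lemma topspace_lcs_ind_lim [simp]: "topspace (lcs_ind_lim sc S I T) = S"
  unfolding lcs_ind_lim_alt topology_generated_by_topspace
  by (auto simp: ind_lim_topologies_def dest: openin_subset)

text \<open>The limit topology is generated by all competing topologies together, so continuity into
  it can be tested against each of them. The condition on the range takes care of the generator
  \<open>S\<close>.\<close>

lemma continuous_map_into_lcs_ind_lim:
  assumes "f \<in> topspace Z \<rightarrow> S"
    and "\<And>T'. T' \<in> ind_lim_topologies sc S I T \<Longrightarrow> continuous_map Z T' f"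
  shows "continuous_map Z (lcs_ind_lim sc S I T) f"
  unfolding lcs_ind_lim_alt
proof (rule continuous_on_generated_topo)
  fix U assume "U \<in> insert S (\<Union>((\<lambda>T'. {W. openin T' W}) ` ind_lim_topologies sc S I T))"
  then consider "U = S" | T' where "T' \<in> ind_lim_topologies sc S I T" "openin T' U" by blast
  then show "openin Z (f -` U \<inter> topspace Z)"
  proof cases
    case 1
    then have "f -` U \<inter> topspace Z = topspace Z" using assms(1) by auto
    then show ?thesis by (metis openin_topspace)
  next
    case 2
    have "f -` U \<inter> topspace Z = {x \<in> topspace Z. f x \<in> U}" by auto
    then show ?thesis using openin_continuous_map_preimage[OF assms(2)[OF 2(1)] 2(2)] by simp
  qed
qed (use assms(1) in auto)

lemma continuous_map_from_finer:
  assumes "continuous_map T' Y f" "topspace T' = topspace T" "\<And>W. openin T' W \<Longrightarrow> openin T W"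
  shows "continuous_map T Y f"
  using assms unfolding continuous_map_def by auto

lemma openin_lcs_ind_lim:
  assumes "T' \<in> ind_lim_topologies sc S I T" "openin T' W"
  shows "openin (lcs_ind_lim sc S I T) W"
  unfolding lcs_ind_lim_alt by (rule topology_generated_by_Basis) (use assms in blast)

section \<open>Vector operations and pullbacks of locally convex topologies\<close>

lemma lcs_vector_space: "lcs sc T \<Longrightarrow> vector_space sc"
  and lcs_subspace: "lcs sc T \<Longrightarrow> Modules.module.subspace sc (topspace T)"
  by (simp_all add: lcs_def)

lemma vector_space_module: "vector_space sc \<Longrightarrow> Modules.module sc"
  by (simp add: Modules.module_def vector_space_def)

lemma lcs_zero_in: "lcs sc T \<Longrightarrow> 0 \<in> topspace T"
  by (metis lcs_subspace lcs_vector_space vector_space_module Modules.module.subspace_0)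

lemma lcs_add_in: "lcs sc T \<Longrightarrow> x \<in> topspace T \<Longrightarrow> y \<in> topspace T \<Longrightarrow> x + y \<in> topspace T"
  by (metis lcs_subspace lcs_vector_space vector_space_module Modules.module.subspace_add)

lemma lcs_continuous_add:
  assumes "lcs sc T" "continuous_map Z T f" "continuous_map Z T g"
  shows "continuous_map Z T (\<lambda>x. f x + g x)"
proof -
  have "continuous_map (prod_topology T T) T (\<lambda>(x, y). x + y)" using assms(1) by (simp add: lcs_def)
  moreover have "continuous_map Z (prod_topology T T) (\<lambda>x. (f x, g x))"
    using assms by (simp add: continuous_map_pairwise o_def)
  ultimately have "continuous_map Z T ((\<lambda>(x, y). x + y) \<circ> (\<lambda>x. (f x, g x)))"
    by (rule continuous_map_compose[rotated])
  then show ?thesis by (simp add: o_def)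
qed

lemma lcs_continuous_scale:
  assumes "lcs sc T" "continuous_map Z euclidean c" "continuous_map Z T g"
  shows "continuous_map Z T (\<lambda>x. sc (c x) (g x))"
proof -
  have "continuous_map (prod_topology euclidean T) T (\<lambda>(c, x). sc c x)" using assms(1) by (simp add: lcs_def)
  moreover have "continuous_map Z (prod_topology euclidean T) (\<lambda>x. (c x, g x))"
    using assms by (simp add: continuous_map_pairwise o_def)
  ultimately have "continuous_map Z T ((\<lambda>(c, x). sc c x) \<circ> (\<lambda>x. (c x, g x)))"
    by (rule continuous_map_compose[rotated])
  then show ?thesis by (simp add: o_def)
qed

lemma topspace_pullback_topology_eq:
  "f \<in> S \<rightarrow> topspace Y \<Longrightarrow> topspace (pullback_topology S f Y) = S"
  by (auto simp: topspace_pullback_topology)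

text \<open>Preimages of convex neighbourhoods under a linear map are convex, and the vector
  operations are continuous because they are so after applying \<open>f\<close>. This is how a
  linear map into an LCS produces a competitor for the inductive limit topology.\<close>

lemma lcs_pullback:
  assumes sX: "vector_space sX" and S: "Modules.module.subspace sX S" and Y: "lcs sY Y"
    and f: "f \<in> S \<rightarrow> topspace Y"
    and add: "\<And>x y. x \<in> S \<Longrightarrow> y \<in> S \<Longrightarrow> f (x + y) = f x + f y"
    and scale: "\<And>c x. x \<in> S \<Longrightarrow> f (sX c x) = sY c (f x)"
  shows "lcs sX (pullback_topology S f Y)"
proof -
  let ?T = "pullback_topology S f Y"
  interpret X: Modules.module sX by (rule vector_space_module[OF sX])
  interpret Y: Modules.module sY by (rule vector_space_module[OF lcs_vector_space[OF Y]])
  note SS = X.subspace_0[OF S] X.subspace_add[OF S] X.subspace_scale[OF S]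
  note top = topspace_pullback_topology_eq[of f, OF f]
  have "continuous_map ?T Y (id \<circ> f)" by (rule continuous_map_pullback) simp
  then have fc: "continuous_map ?T Y f" by simp
  have f0: "f 0 = 0" using scale[OF SS(1), of 0] by simp
  have "continuous_map (prod_topology ?T ?T) Y (\<lambda>z. f (fst z) + f (snd z))"
    by (rule lcs_continuous_add[OF Y]) (intro continuous_map_compose[OF _ fc, unfolded o_def] continuous_map_fst continuous_map_snd)+
  then have "continuous_map (prod_topology ?T ?T) Y (f \<circ> (\<lambda>(x, y). x + y))"
    by (rule continuous_map_eq) (auto simp: top add)
  then have c1: "continuous_map (prod_topology ?T ?T) ?T (\<lambda>(x, y). x + y)"
    by (rule continuous_map_pullback') (auto simp: top SS)
  have "continuous_map (prod_topology euclidean ?T) Y (\<lambda>z. sY (fst z) (f (snd z)))"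
    by (rule lcs_continuous_scale[OF Y]) (intro continuous_map_compose[OF _ fc, unfolded o_def] continuous_map_fst continuous_map_snd)+
  then have "continuous_map (prod_topology euclidean ?T) Y (f \<circ> (\<lambda>(c, x). sX c x))"
    by (rule continuous_map_eq) (auto simp: top scale)
  then have c2: "continuous_map (prod_topology euclidean ?T) ?T (\<lambda>(c, x). sX c x)"
    by (rule continuous_map_pullback') (auto simp: top SS)
  have c3: "\<exists>C N. openin ?T N \<and> 0 \<in> N \<and> N \<subseteq> C \<and> C \<subseteq> W \<and> (\<forall>x\<in>C. \<forall>y\<in>C. \<forall>t::real. 0 \<le> t \<and> t \<le> 1 \<longrightarrow>
             sX (complex_of_real (1 - t)) x + sX (complex_of_real t) y \<in> C)"
    if W: "openin ?T W" "0 \<in> W" for W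
  proof -
    obtain V where V: "openin Y V" "W = f -` V \<inter> S" using W by (auto simp: openin_pullback_topology)
    then have "0 \<in> V" using W f0 by auto
    have "\<forall>W. openin Y W \<and> 0 \<in> W \<longrightarrow> (\<exists>C N. openin Y N \<and> 0 \<in> N \<and> N \<subseteq> C \<and> C \<subseteq> W \<and>
        (\<forall>x\<in>C. \<forall>y\<in>C. \<forall>t::real. 0 \<le> t \<and> t \<le> 1 \<longrightarrow>
           sY (complex_of_real (1 - t)) x + sY (complex_of_real t) y \<in> C))"
      using Y unfolding lcs_def by (elim conjE)
    from this[rule_format, OF conjI[OF V(1) \<open>0 \<in> V\<close>]]
    obtain C N where C: "openin Y N" "0 \<in> N" "N \<subseteq> C" "C \<subseteq> V"
       and "\<forall>x\<in>C. \<forall>y\<in>C. \<forall>t::real. 0 \<le> t \<and> t \<le> 1 \<longrightarrow>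
           sY (complex_of_real (1 - t)) x + sY (complex_of_real t) y \<in> C"
      by (elim exE conjE) (rule that, assumption+)
    then have C2: "\<And>x y t. x \<in> C \<Longrightarrow> y \<in> C \<Longrightarrow> 0 \<le> t \<Longrightarrow> t \<le> 1 \<Longrightarrow>
       sY (complex_of_real (1 - t)) x + sY (complex_of_real t) y \<in> C"
      by simp
    show ?thesis
    proof (rule exI[of _ "f -` C \<inter> S"], rule exI[of _ "f -` N \<inter> S"], intro conjI)
      show "openin ?T (f -` N \<inter> S)" using C by (auto simp: openin_pullback_topology)
      show "f -` C \<inter> S \<subseteq> W" using C V by auto
      show "\<forall>x\<in>f -` C \<inter> S. \<forall>y\<in>f -` C \<inter> S. \<forall>t::real. 0 \<le> t \<and> t \<le> 1 \<longrightarrow>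
             sX (complex_of_real (1 - t)) x + sX (complex_of_real t) y \<in> f -` C \<inter> S"
      proof (intro ballI allI impI)
        fix x y and t :: real
        assume "x \<in> f -` C \<inter> S" "y \<in> f -` C \<inter> S" "0 \<le> t \<and> t \<le> 1"
        then show "sX (complex_of_real (1 - t)) x + sX (complex_of_real t) y \<in> f -` C \<inter> S"
          using C2[of "f x" "f y" t] by (simp only: add scale SS vimage_eq Int_iff)
      qed
    qed (use C SS(1) f0 in auto)
  qed
  show "lcs sX ?T" unfolding lcs_def top by (intro conjI allI impI; (elim conjE)?) (fact sX S c1 c2 | rule c3, assumption+)+
qed

lemma ind_lim_topologies_pullback:
  assumes "vector_space sX" "Modules.module.subspace sX S" "lcs sY Y" "f \<in> S \<rightarrow> topspace Y"
    and "\<And>x y. x \<in> S \<Longrightarrow> y \<in> S \<Longrightarrow> f (x + y) = f x + f y"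
    and "\<And>c x. x \<in> S \<Longrightarrow> f (sX c x) = sY c (f x)"
    and T: "\<And>i. i \<in> I \<Longrightarrow> topspace (T i) \<subseteq> S" "\<And>i. i \<in> I \<Longrightarrow> continuous_map (T i) Y f"
  shows "pullback_topology S f Y \<in> ind_lim_topologies sX S I T"
proof -
  have "continuous_map (T i) (pullback_topology S f Y) (\<lambda>x. x)" if "i \<in> I" for i
  proof (rule continuous_map_pullback')
    show "continuous_map (T i) Y (f \<circ> (\<lambda>x. x))" using T(2)[OF that] by (simp add: o_def)
    show "topspace (T i) \<subseteq> (\<lambda>x. x) -` S" using T(1)[OF that] by simp
  qed
  moreover have "lcs sX (pullback_topology S f Y)"
    by (rule lcs_pullback[OF assms(1-4)]) (fact assms(5) assms(6))+
  moreover have "topspace (pullback_topology S f Y) = S"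
    using assms(4) by (rule topspace_pullback_topology_eq)
  ultimately show ?thesis unfolding ind_lim_topologies_def by blast
qed

text \<open>The pullback of \<open>Y\<close> along \<open>f\<close> is one of the topologies whose
  supremum is the limit topology, and \<open>f\<close> is continuous already for that coarser
  one.\<close>

lemma continuous_map_from_lcs_ind_lim:
  assumes "vector_space sX" "Modules.module.subspace sX S" "lcs sY Y" "f \<in> S \<rightarrow> topspace Y"
    and "\<And>x y. x \<in> S \<Longrightarrow> y \<in> S \<Longrightarrow> f (x + y) = f x + f y"
    and "\<And>c x. x \<in> S \<Longrightarrow> f (sX c x) = sY c (f x)"
    and T: "\<And>i. i \<in> I \<Longrightarrow> topspace (T i) \<subseteq> S" "\<And>i. i \<in> I \<Longrightarrow> continuous_map (T i) Y f"
  shows "continuous_map (lcs_ind_lim sX S I T) Y f"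
proof (rule continuous_map_from_finer)
  have "continuous_map (pullback_topology S f Y) Y (id \<circ> f)" by (rule continuous_map_pullback) simp
  then show "continuous_map (pullback_topology S f Y) Y f" by simp
  show "topspace (pullback_topology S f Y) = topspace (lcs_ind_lim sX S I T)"
    using topspace_pullback_topology_eq[of f, OF assms(4)] by simp
qed (rule openin_lcs_ind_lim[OF ind_lim_topologies_pullback[OF assms]])

text \<open>Every test topology on the target receives all steps \<open>T' j\<close> continuously,
  so it is enough that each step of the source is sent continuously into some step of the
  target.\<close>

lemma continuous_map_lcs_ind_lim_lcs_ind_lim:
  assumes "vector_space sX" "Modules.module.subspace sX S" "f \<in> S \<rightarrow> S'"
    and "\<And>x y. x \<in> S \<Longrightarrow> y \<in> S \<Longrightarrow> f (x + y) = f x + f y"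
    and "\<And>c x. x \<in> S \<Longrightarrow> f (sX c x) = sY c (f x)"
    and "\<And>i. i \<in> I \<Longrightarrow> topspace (T i) \<subseteq> S"
    and "\<And>i. i \<in> I \<Longrightarrow> \<exists>j\<in>J. continuous_map (T i) (T' j) f"
  shows "continuous_map (lcs_ind_lim sX S I T) (lcs_ind_lim sY S' J T') f"
proof (rule continuous_map_into_lcs_ind_lim)
  fix Y assume Y: "Y \<in> ind_lim_topologies sY S' J T'"
  show "continuous_map (lcs_ind_lim sX S I T) Y f"
  proof (rule continuous_map_from_lcs_ind_lim[OF assms(1,2)])
    fix i assume "i \<in> I"
    then obtain j where j: "j \<in> J" "continuous_map (T i) (T' j) f" using assms(7) by blast
    have "continuous_map (T' j) Y (\<lambda>x. x)" using Y j(1) by (simp add: ind_lim_topologies_def)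
    from continuous_map_compose[OF j(2) this] show "continuous_map (T i) Y f" by (simp add: o_def)
    show "topspace (T i) \<subseteq> S" by (rule assms(6)) fact
  next
    show "lcs sY Y" "f \<in> S \<rightarrow> topspace Y" using Y assms(3) by (auto simp: ind_lim_topologies_def)
  qed (fact assms(4) assms(5))+
qed (use assms in auto)

lemma continuous_map_inclusion_lcs_ind_lim:
  assumes "i \<in> I" "topspace (T i) \<subseteq> S"
  shows "continuous_map (T i) (lcs_ind_lim sc S I T) (\<lambda>x. x)"
  by (rule continuous_map_into_lcs_ind_lim) (use assms in \<open>auto simp: ind_lim_topologies_def\<close>)

text \<open>The map \<open>c \<mapsto> sc c x\<close> is continuous into every competing topology,
  hence into the limit, and small multiples of \<open>x\<close> therefore lie in a given
  neighbourhood. Bounded points are what makes evaluation continuous for the strong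
  topology.\<close>

lemma lcs_ind_lim_bounded_singleton:
  assumes sc: "vector_space sc" and S: "Modules.module.subspace sc S" and x: "x \<in> S"
  shows "lcs_bounded sc (lcs_ind_lim sc S I T) {x}"
  unfolding lcs_bounded_def
proof (intro conjI allI impI)
  interpret Modules.module sc by (rule vector_space_module[OF sc])
  let ?X = "lcs_ind_lim sc S I T"
  have c: "continuous_map euclidean ?X (\<lambda>c. sc c x)"
  proof (rule continuous_map_into_lcs_ind_lim)
    fix T' assume "T' \<in> ind_lim_topologies sc S I T"
    then have "lcs sc T'" "x \<in> topspace T'" using x by (auto simp: ind_lim_topologies_def)
    then show "continuous_map euclidean T' (\<lambda>c. sc c x)"
      using lcs_continuous_scale[of sc T' euclidean "\<lambda>c. c" "\<lambda>_. x"] by simp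
  qed (use x S in \<open>auto simp: subspace_scale\<close>)
  fix W assume W: "openin ?X W \<and> 0 \<in> W"
  have "openin euclidean {c. sc c x \<in> W}"
    using openin_continuous_map_preimage[OF c, of W] W by simp
  then have "open {c. sc c x \<in> W}" "0 \<in> {c. sc c x \<in> W}" using W by (auto simp: scale_zero_left)
  then obtain \<delta> where d: "\<delta> > 0" "\<And>c. cmod c < \<delta> \<Longrightarrow> sc c x \<in> W"
    unfolding open_dist by (metis dist_0_norm dist_commute mem_Collect_eq)
  \<comment> \<open>The numerator 2 makes the estimate strict: the inverse of \<open>c\<close> has
    modulus at most \<open>\<delta> / 2\<close>, which is less than \<open>\<delta>\<close>.\<close>
  show "\<exists>r>0. \<forall>c. r \<le> cmod c \<longrightarrow> {x} \<subseteq> sc c ` W"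
  proof (intro exI[of _ "2 / \<delta>"] conjI allI impI)
    fix c assume c: "2 / \<delta> \<le> cmod c"
    have p: "0 < 2 / \<delta>" using d by simp
    then have "c \<noteq> 0" using c by auto
    have "cmod (inverse c) < \<delta>"
    proof -
      have "2 \<le> cmod c * \<delta>" using c d by (simp add: field_simps)
      then have "1 / cmod c < \<delta>" using \<open>c \<noteq> 0\<close> by (simp add: field_simps)
      then show ?thesis by (simp add: norm_inverse inverse_eq_divide norm_divide)
    qed
    then have "sc (inverse c) x \<in> W" by (rule d)
    moreover have "x = sc c (sc (inverse c) x)" using \<open>c \<noteq> 0\<close> by (simp add: scale_one)
    ultimately show "{x} \<subseteq> sc c ` W" by blast
  qed (use d in simp)
qed (use x in auto)

section \<open>Bounded sets and neighbourhoods of zero\<close>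

lemma lcs_bounded_image:
  assumes B: "lcs_bounded sX X B" and f: "continuous_map X Y f" and "0 \<in> topspace X" "f 0 = 0"
    and scale: "\<And>c x. x \<in> topspace X \<Longrightarrow> f (sX c x) = sY c (f x)"
  shows "lcs_bounded sY Y (f ` B)"
  unfolding lcs_bounded_def
proof (intro conjI allI impI)
  show "f ` B \<subseteq> topspace Y" using B f by (auto simp: lcs_bounded_def continuous_map_def)
  fix W assume W: "openin Y W \<and> 0 \<in> W"
  let ?W = "{x \<in> topspace X. f x \<in> W}"
  have "openin X ?W" "0 \<in> ?W" using openin_continuous_map_preimage[OF f] W assms by auto
  then obtain r where r: "r > 0" "\<And>c. cmod c \<ge> r \<Longrightarrow> B \<subseteq> sX c ` ?W"
    using B unfolding lcs_bounded_def by meson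
  have "f ` B \<subseteq> sY c ` W" if c: "cmod c \<ge> r" for c
  proof
    fix y assume "y \<in> f ` B"
    then obtain x w where "y = f x" "x = sX c w" "w \<in> ?W" using r(2)[OF c] by auto
    then show "y \<in> sY c ` W" using scale by auto
  qed
  then show "\<exists>r>0. \<forall>c. r \<le> cmod c \<longrightarrow> f ` B \<subseteq> sY c ` W" using r(1) by blast
qed

lemma lcs_bounded_Un:
  assumes "lcs_bounded sc T A" "lcs_bounded sc T B"
  shows "lcs_bounded sc T (A \<union> B)"
  unfolding lcs_bounded_def
proof (intro conjI allI impI)
  fix W assume W: "openin T W \<and> 0 \<in> W"
  obtain r where r: "r > 0" "\<And>c. cmod c \<ge> r \<Longrightarrow> A \<subseteq> sc c ` W"
    using assms(1) W unfolding lcs_bounded_def by meson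
  obtain r' where r': "r' > 0" "\<And>c. cmod c \<ge> r' \<Longrightarrow> B \<subseteq> sc c ` W"
    using assms(2) W unfolding lcs_bounded_def by meson
  show "\<exists>r>0. \<forall>c. r \<le> cmod c \<longrightarrow> A \<union> B \<subseteq> sc c ` W"
    by (rule exI[of _ "max r r'"]) (use r r' in auto)
qed (use assms in \<open>auto simp: lcs_bounded_def\<close>)

lemma lcs_bounded_empty: "lcs_bounded sc T {}"
  by (auto simp: lcs_bounded_def intro: exI[of _ 1])

text \<open>Continuity of addition, iterated. The neighbourhood \<open>W'\<close> depends only on
  the number of summands, which will be the length of a fixed decomposition.\<close>

lemma lcs_sum_list_nbhd:
  assumes E: "lcs sE E" and "openin E W" "0 \<in> W"
  shows "\<exists>W'. openin E W' \<and> 0 \<in> W' \<and> (\<forall>xs. length xs = n \<longrightarrow> set xs \<subseteq> W' \<longrightarrow> sum_list xs \<in> W)"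
  using assms(2,3)
proof (induction n arbitrary: W)
  case 0
  then show ?case by (intro exI[of _ W]) auto
next
  case (Suc n)
  have "continuous_map (prod_topology E E) E (\<lambda>(x, y). x + y)" using E by (simp add: lcs_def)
  from openin_continuous_map_preimage[OF this Suc.prems(1)]
  have o: "openin (prod_topology E E) {z \<in> topspace (prod_topology E E). (case z of (x, y) \<Rightarrow> x + y) \<in> W}" .
  have m: "(0, 0) \<in> {z \<in> topspace (prod_topology E E). (case z of (x, y) \<Rightarrow> x + y) \<in> W}"
    using Suc.prems(2) lcs_zero_in[OF E] by auto
  from o[unfolded openin_prod_topology_alt, rule_format, OF m]
  obtain V1 V2 where V: "openin E V1" "openin E V2" "0 \<in> V1" "0 \<in> V2"
    "V1 \<times> V2 \<subseteq> {z \<in> topspace (prod_topology E E). (case z of (x, y) \<Rightarrow> x + y) \<in> W}"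
    by (elim exE conjE) (rule that, assumption+)
  obtain W' where W': "openin E W'" "0 \<in> W'" "\<And>xs. length xs = n \<Longrightarrow> set xs \<subseteq> W' \<Longrightarrow> sum_list xs \<in> V2"
    using Suc.IH[OF V(2,4)] by blast
  show ?case
  proof (intro exI[of _ "W' \<inter> V1"] conjI allI impI)
    fix xs :: "'a list" assume "length xs = Suc n" "set xs \<subseteq> W' \<inter> V1"
    then obtain y ys where "xs = y # ys" "y \<in> V1" "length ys = n" "set ys \<subseteq> W'"
      by (cases xs) auto
    then show "sum_list xs \<in> W" using W'(3)[of ys] V(5) by auto
  qed (use V W' in auto)
qed

lemma lcs_translate_nbhd:
  assumes E: "lcs sE E" and W: "openin E W" "a \<in> W"
  shows "openin E {e \<in> topspace E. a + e \<in> W}"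
proof -
  have "a \<in> topspace E" using W openin_subset by blast
  then have "continuous_map E E (\<lambda>e. a + e)"
    using lcs_continuous_add[OF E, of E "\<lambda>_. a" "\<lambda>e. e"] by simp
  from openin_continuous_map_preimage[OF this W(1)] show ?thesis .
qed

subsection \<open>The strong topology\<close>

text \<open>The defining predicate is a topology because two neighbourhoods given by
  \<open>(B, W)\<close> and \<open>(B', W')\<close> contain the one given by
  \<open>B \<union> B'\<close> and \<open>W \<inter> W'\<close>, and unions of two bounded sets are
  bounded.\<close>

lemma openin_strong_topology:
  "openin (strong_topology sX X sY Y) \<U> \<longleftrightarrow> \<U> \<subseteq> cont_lin_maps sX X sY Y \<and>
       (\<forall>f\<in>\<U>. \<exists>B W. lcs_bounded sX X B \<and> openin Y W \<and> 0 \<in> W \<and>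
          {g \<in> cont_lin_maps sX X sY Y. \<forall>x\<in>B. g x - f x \<in> W} \<subseteq> \<U>)" (is "_ \<longleftrightarrow> ?P \<U>")
proof -
  have "istopology ?P"
    unfolding istopology_def
  proof (intro conjI allI impI ballI)
    fix A A' assume A: "?P A" and A': "?P A'"
    show "A \<inter> A' \<subseteq> cont_lin_maps sX X sY Y" using A by auto
    fix f assume f: "f \<in> A \<inter> A'"
    from f A[THEN conjunct2, rule_format, of f] obtain B W where
      1: "lcs_bounded sX X B" "openin Y W" "0 \<in> W"
      "{g \<in> cont_lin_maps sX X sY Y. \<forall>x\<in>B. g x - f x \<in> W} \<subseteq> A"
      by auto
    from f A'[THEN conjunct2, rule_format, of f] obtain B' W' where
      2: "lcs_bounded sX X B'" "openin Y W'" "0 \<in> W'"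
      "{g \<in> cont_lin_maps sX X sY Y. \<forall>x\<in>B'. g x - f x \<in> W'} \<subseteq> A'"
      by auto
    have "{g \<in> cont_lin_maps sX X sY Y. \<forall>x\<in>B \<union> B'. g x - f x \<in> W \<inter> W'} \<subseteq> A \<inter> A'"
      using 1(4) 2(4) by auto
    then show "\<exists>B W. lcs_bounded sX X B \<and> openin Y W \<and> 0 \<in> W \<and>
          {g \<in> cont_lin_maps sX X sY Y. \<forall>x\<in>B. g x - f x \<in> W} \<subseteq> A \<inter> A'"
      using lcs_bounded_Un[OF 1(1) 2(1)] openin_Int[OF 1(2) 2(2)] 1(3) 2(3)
      by (intro exI[of _ "B \<union> B'"] exI[of _ "W \<inter> W'"] conjI) simp_all
  next
    fix K assume K: "\<forall>A\<in>K. ?P A"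
    show "\<Union>K \<subseteq> cont_lin_maps sX X sY Y" using K by (simp add: Sup_le_iff)
    fix f assume "f \<in> \<Union>K"
    then obtain A where A: "A \<in> K" "f \<in> A" by blast
    from K[rule_format, OF A(1), THEN conjunct2, rule_format, OF A(2)]
    obtain B W where 1: "lcs_bounded sX X B" "openin Y W" "0 \<in> W"
      "{g \<in> cont_lin_maps sX X sY Y. \<forall>x\<in>B. g x - f x \<in> W} \<subseteq> A"
      by (elim exE conjE) (rule that, assumption+)
    show "\<exists>B W. lcs_bounded sX X B \<and> openin Y W \<and> 0 \<in> W \<and>
          {g \<in> cont_lin_maps sX X sY Y. \<forall>x\<in>B. g x - f x \<in> W} \<subseteq> \<Union>K"
      by (rule exI[of _ B], rule exI[of _ W], intro conjI 1 order_trans[OF 1(4)] Union_upper A)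
  qed
  then show ?thesis unfolding strong_topology_def by (simp add: topology_inverse')
qed

lemma topspace_strong_topology [simp]:
  assumes "lcs sY Y"
  shows "topspace (strong_topology sX X sY Y) = cont_lin_maps sX X sY Y"
proof -
  \<comment> \<open>The empty bounded set imposes no condition, so the set of all maps is
    open.\<close>
  have "openin (strong_topology sX X sY Y) (cont_lin_maps sX X sY Y)"
    unfolding openin_strong_topology using lcs_zero_in[OF assms]
    by (auto intro!: exI[of _ "{}"] exI[of _ "topspace Y"] lcs_bounded_empty)
  moreover have "topspace (strong_topology sX X sY Y) \<subseteq> cont_lin_maps sX X sY Y"
    using openin_topspace[of "strong_topology sX X sY Y"] unfolding openin_strong_topology by blast
  ultimately show ?thesis using openin_subset by blast
qed

lemma cont_lin_mapsD:
  assumes "f \<in> cont_lin_maps sX X sY Y"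
  shows "continuous_map X Y f" "x \<in> topspace X \<Longrightarrow> f x \<in> topspace Y"
    "x \<in> topspace X \<Longrightarrow> y \<in> topspace X \<Longrightarrow> f (x + y) = f x + f y"
    "x \<in> topspace X \<Longrightarrow> f (sX c x) = sY c (f x)"
    "x \<notin> topspace X \<Longrightarrow> f x = 0"
  using assms unfolding cont_lin_maps_def by (blast dest: continuous_map_funspace)+

text \<open>The basic set around \<open>f\<close> need not be open itself, since the differences
  over an infinite \<open>B\<close> may come arbitrarily close to the boundary of \<open>W\<close>.
  The set \<open>N\<close> collects the maps around which some basic set over \<open>B\<close> still
  fits; it is open because a neighbourhood \<open>V\<close> contains \<open>V' + V'\<close> for a
  smaller \<open>V'\<close>.\<close>

lemma strong_topology_nbhd:
  assumes Y: "lcs sY Y" and B: "lcs_bounded sX X B" and W: "openin Y W" "0 \<in> W"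
    and f: "f \<in> cont_lin_maps sX X sY Y"
  shows "\<exists>N. openin (strong_topology sX X sY Y) N \<and> f \<in> N \<and>
     N \<subseteq> {g \<in> cont_lin_maps sX X sY Y. \<forall>x\<in>B. g x - f x \<in> W}"
proof -
  let ?L = "cont_lin_maps sX X sY Y"
  define U where "U h V = {g \<in> ?L. \<forall>x\<in>B. g x - h x \<in> V}" for h V
  define N where "N = {g \<in> ?L. \<exists>V. openin Y V \<and> 0 \<in> V \<and> U g V \<subseteq> U f W}"
  have "openin (strong_topology sX X sY Y) N"
    unfolding openin_strong_topology
  proof (intro conjI ballI)
    fix g assume "g \<in> N"
    then obtain V where g: "g \<in> ?L" and V: "openin Y V" "0 \<in> V" "U g V \<subseteq> U f W"
      by (auto simp: N_def)
    obtain V' where V': "openin Y V'" "0 \<in> V'"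
      and s: "\<And>xs. length xs = 2 \<Longrightarrow> set xs \<subseteq> V' \<Longrightarrow> sum_list xs \<in> V"
      using lcs_sum_list_nbhd[OF Y V(1,2), of 2] by blast
    have s2: "a + b \<in> V" if "a \<in> V'" "b \<in> V'" for a b using s[of "[a, b]"] that by simp
    have "U g V' \<subseteq> N"
    proof
      fix h assume h: "h \<in> U g V'"
      have "U h V' \<subseteq> U g V"
      proof
        fix k assume k: "k \<in> U h V'"
        have "k x - g x \<in> V" if "x \<in> B" for x
          using s2[of "k x - h x" "h x - g x"] h k that by (auto simp: U_def)
        then show "k \<in> U g V" using k by (auto simp: U_def)
      qed
      then have "U h V' \<subseteq> U f W" using V(3) by blast
      then show "h \<in> N" using h V' unfolding N_def by (auto simp: U_def[of g])
    qed
    then show "\<exists>B W. lcs_bounded sX X B \<and> openin Y W \<and> 0 \<in> W \<and> {h \<in> ?L. \<forall>x\<in>B. h x - g x \<in> W} \<subseteq> N"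
      using B V' unfolding U_def by (intro exI[of _ B] exI[of _ V'] conjI)
  qed (auto simp: N_def)
  moreover have "f \<in> N" using f W by (auto simp: N_def)
  moreover have "N \<subseteq> U f W" using W by (auto simp: N_def U_def)
  ultimately show ?thesis unfolding U_def by blast
qed

lemma continuous_map_strong_evaluation:
  assumes Y: "lcs sY Y" and x: "lcs_bounded sX X {x}"
  shows "continuous_map (strong_topology sX X sY Y) Y (\<lambda>f. f x)"
  unfolding continuous_map_def
proof (intro conjI allI impI)
  have xX: "x \<in> topspace X" using x by (auto simp: lcs_bounded_def)
  then show "(\<lambda>f. f x) \<in> topspace (strong_topology sX X sY Y) \<rightarrow> topspace Y"
    using Y by (auto dest: cont_lin_mapsD)
  fix W assume W: "openin Y W"
  show "openin (strong_topology sX X sY Y) {f \<in> topspace (strong_topology sX X sY Y). f x \<in> W}"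
    unfolding openin_strong_topology topspace_strong_topology[OF Y]
  proof (intro conjI ballI)
    fix f assume f: "f \<in> {f \<in> cont_lin_maps sX X sY Y. f x \<in> W}"
    let ?V = "{e \<in> topspace Y. f x + e \<in> W}"
    have "{g \<in> cont_lin_maps sX X sY Y. \<forall>y\<in>{x}. g y - f y \<in> ?V} \<subseteq> {f \<in> cont_lin_maps sX X sY Y. f x \<in> W}"
      by auto
    moreover have "openin Y ?V" using lcs_translate_nbhd[OF Y W] f by auto
    moreover have "0 \<in> ?V" using f lcs_zero_in[OF Y] by auto
    ultimately show "\<exists>B V. lcs_bounded sX X B \<and> openin Y V \<and> 0 \<in> V \<and>
      {g \<in> cont_lin_maps sX X sY Y. \<forall>x\<in>B. g x - f x \<in> V} \<subseteq> {f \<in> cont_lin_maps sX X sY Y. f x \<in> W}"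
      using x by (intro exI[of _ "{x}"] exI[of _ ?V] conjI)
  qed auto
qed

subsection \<open>Embedding into a product of spaces of maps on pieces of an inductive limit\<close>

text \<open>The pieces \<open>X' \<gamma>\<close> are mapped linearly into the limit by
  \<open>e \<gamma>\<close>. Regularity enters as \<open>bounded_T\<close>.
  \<open>decompose_T\<close> splits a whole step by continuous maps and controls neighbourhoods,
  while \<open>decompose\<close> splits single points and reaches all of \<open>S\<close>, which is
  not presumed to be the union of the steps. The splitting maps are homogeneous; together with
  continuity this sends bounded sets to bounded sets.\<close>

locale decomposable_ind_lim =
  fixes sc :: "complex \<Rightarrow> 'a::ab_group_add \<Rightarrow> 'a" and S :: "'a set" and I :: "'i set"
    and T :: "'i \<Rightarrow> 'a topology" and \<Gamma> :: "'g set" and X' :: "'g \<Rightarrow> 'a topology"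
    and e :: "'g \<Rightarrow> 'a \<Rightarrow> 'a" and sE :: "complex \<Rightarrow> 'e::ab_group_add \<Rightarrow> 'e" and E :: "'e topology"
  assumes sc: "vector_space sc" and S: "Modules.module.subspace sc S"
    and E: "lcs sE E" and E2: "Hausdorff_space E"
    and T_subset: "\<And>i. i \<in> I \<Longrightarrow> topspace (T i) \<subseteq> S"
    and T_zero: "\<And>i. i \<in> I \<Longrightarrow> 0 \<in> topspace (T i)"
    and bounded_T: "\<And>B. lcs_bounded sc (lcs_ind_lim sc S I T) B \<Longrightarrow> \<exists>i\<in>I. lcs_bounded sc (T i) B"
    and X'_subspace: "\<And>\<gamma>. \<gamma> \<in> \<Gamma> \<Longrightarrow> Modules.module.subspace sc (topspace (X' \<gamma>))"
    and X'_bounded: "\<And>\<gamma> x. \<gamma> \<in> \<Gamma> \<Longrightarrow> x \<in> topspace (X' \<gamma>) \<Longrightarrow> lcs_bounded sc (X' \<gamma>) {x}"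
    and e_cont: "\<And>\<gamma>. \<gamma> \<in> \<Gamma> \<Longrightarrow> continuous_map (X' \<gamma>) (lcs_ind_lim sc S I T) (e \<gamma>)"
    and e_add: "\<And>\<gamma> x y. \<gamma> \<in> \<Gamma> \<Longrightarrow> x \<in> topspace (X' \<gamma>) \<Longrightarrow> y \<in> topspace (X' \<gamma>) \<Longrightarrow>
                  e \<gamma> (x + y) = e \<gamma> x + e \<gamma> y"
    and e_scale: "\<And>\<gamma> c x. \<gamma> \<in> \<Gamma> \<Longrightarrow> x \<in> topspace (X' \<gamma>) \<Longrightarrow> e \<gamma> (sc c x) = sc c (e \<gamma> x)"
    and decompose_T: "\<And>i. i \<in> I \<Longrightarrow> \<exists>L. (\<forall>p\<in>set L. fst p \<in> \<Gamma> \<and> continuous_map (T i) (X' (fst p)) (snd p) \<and>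
          (\<forall>a. \<forall>x\<in>topspace (T i). snd p (sc a x) = sc a (snd p x))) \<and>
          (\<forall>x\<in>topspace (T i). sum_list (map (\<lambda>p. e (fst p) (snd p x)) L) = x)"
    and decompose: "\<And>x. x \<in> S \<Longrightarrow> \<exists>L. (\<forall>p\<in>set L. fst p \<in> \<Gamma> \<and> snd p \<in> topspace (X' (fst p))) \<and>
          sum_list (map (\<lambda>p. e (fst p) (snd p)) L) = x"
begin

abbreviation "X \<equiv> lcs_ind_lim sc S I T"
abbreviation "L\<^sub>X \<equiv> cont_lin_maps sc X sE E"
abbreviation "L' \<gamma> \<equiv> cont_lin_maps sc (X' \<gamma>) sE E"

definition pieces :: "('g \<times> 'a) list \<Rightarrow> bool" where
  "pieces L \<longleftrightarrow> (\<forall>p\<in>set L. fst p \<in> \<Gamma> \<and> snd p \<in> topspace (X' (fst p)))"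

definition total :: "('g \<times> 'a) list \<Rightarrow> 'a" where
  "total L = sum_list (map (\<lambda>p. e (fst p) (snd p)) L)"

text \<open>The abstract form of \<open>gen_restrict\<close>. The value \<open>0\<close> off the
  carrier follows the convention of \<open>cont_lin_maps\<close>.\<close>

definition pull :: "('a \<Rightarrow> 'e) \<Rightarrow> 'g \<Rightarrow> 'a \<Rightarrow> 'e" where
  "pull u \<gamma> = (\<lambda>\<eta>. if \<eta> \<in> topspace (X' \<gamma>) then u (e \<gamma> \<eta>) else 0)"

definition family :: "('a \<Rightarrow> 'e) \<Rightarrow> 'g \<Rightarrow> 'a \<Rightarrow> 'e" where
  "family u = (\<lambda>\<gamma>\<in>\<Gamma>. pull u \<gamma>)"

definition prod_space :: "('g \<Rightarrow> 'a \<Rightarrow> 'e) topology" where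
  "prod_space = product_topology (\<lambda>\<gamma>. strong_topology sc (X' \<gamma>) sE E) \<Gamma>"

sublocale sc: Modules.module sc by (rule vector_space_module[OF sc])
sublocale sE: Modules.module sE by (rule vector_space_module[OF lcs_vector_space[OF E]])

lemma topspace_prod_space: "topspace prod_space = Pi\<^sub>E \<Gamma> L'"
  by (simp add: prod_space_def E)

lemmas S_closed = sc.subspace_0[OF S] sc.subspace_add[OF S] sc.subspace_scale[OF S]

lemma cont_lin_zero: "u \<in> cont_lin_maps sc Z sE E \<Longrightarrow> 0 \<in> topspace Z \<Longrightarrow> u 0 = 0"
  using cont_lin_mapsD(4)[of u sc Z sE E 0 0] by simp

lemma e_in: "\<gamma> \<in> \<Gamma> \<Longrightarrow> x \<in> topspace (X' \<gamma>) \<Longrightarrow> e \<gamma> x \<in> S"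
  using continuous_map_funspace[OF e_cont[of \<gamma>]] by auto

lemma pull_in:
  assumes u: "u \<in> L\<^sub>X" and g: "\<gamma> \<in> \<Gamma>"
  shows "pull u \<gamma> \<in> L' \<gamma>"
proof -
  note D = cont_lin_mapsD[OF u]
  have "continuous_map (X' \<gamma>) E (u \<circ> e \<gamma>)"
    by (rule continuous_map_compose[OF e_cont[OF g] D(1)])
  then have "continuous_map (X' \<gamma>) E (pull u \<gamma>)"
    by (rule continuous_map_eq) (simp add: pull_def)
  moreover have "pull u \<gamma> (x + y) = pull u \<gamma> x + pull u \<gamma> y"
    if "x \<in> topspace (X' \<gamma>)" "y \<in> topspace (X' \<gamma>)" for x y
    using that sc.subspace_add[OF X'_subspace[OF g]] D(3) e_in[OF g] by (simp add: pull_def e_add g)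
  moreover have "pull u \<gamma> (sc c x) = sE c (pull u \<gamma> x)" if "x \<in> topspace (X' \<gamma>)" for c x
    using that sc.subspace_scale[OF X'_subspace[OF g]] D(4) e_in[OF g] by (simp add: pull_def e_scale g)
  ultimately show ?thesis by (simp add: cont_lin_maps_def pull_def)
qed

lemma total_in: "pieces L \<Longrightarrow> total L \<in> S"
  by (induction L) (auto simp: pieces_def total_def S_closed e_in)

lemma eval_total:
  assumes u: "u \<in> L\<^sub>X" and "pieces L"
  shows "u (total L) = (\<Sum>p\<leftarrow>L. pull u (fst p) (snd p))"
  using assms(2)
proof (induction L)
  case Nil
  show ?case using cont_lin_zero[OF u] S_closed by (simp add: total_def)
next
  case (Cons p L)
  have "total L \<in> S" "e (fst p) (snd p) \<in> S"
    using Cons.prems by (auto simp: pieces_def e_in intro!: total_in)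
  moreover have "total (p # L) = e (fst p) (snd p) + total L" by (simp add: total_def)
  moreover have "pieces L" using Cons.prems by (simp add: pieces_def)
  ultimately show ?case using Cons.IH Cons.prems cont_lin_mapsD(3)[OF u]
    by (simp add: pieces_def pull_def)
qed

text \<open>A condition on \<open>pull u \<gamma>\<close> over a bounded set of the piece is the
  same condition on \<open>u\<close> over its image under \<open>e \<gamma>\<close>, and that image
  is bounded in the limit.\<close>

lemma continuous_pull:
  assumes g: "\<gamma> \<in> \<Gamma>"
  shows "continuous_map (strong_topology sc X sE E) (strong_topology sc (X' \<gamma>) sE E) (\<lambda>u. pull u \<gamma>)"
  unfolding continuous_map_def topspace_strong_topology[OF E]
proof (intro conjI allI impI)
  show "(\<lambda>u. pull u \<gamma>) \<in> L\<^sub>X \<rightarrow> L' \<gamma>" using pull_in g by auto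
  fix V assume V: "openin (strong_topology sc (X' \<gamma>) sE E) V"
  show "openin (strong_topology sc X sE E) {u \<in> L\<^sub>X. pull u \<gamma> \<in> V}"
    unfolding openin_strong_topology
  proof (intro conjI ballI)
    fix u assume u: "u \<in> {u \<in> L\<^sub>X. pull u \<gamma> \<in> V}"
    then obtain B W where B: "lcs_bounded sc (X' \<gamma>) B" and W: "openin E W" "0 \<in> W"
      and BW: "{g \<in> L' \<gamma>. \<forall>x\<in>B. g x - pull u \<gamma> x \<in> W} \<subseteq> V"
      using V[unfolded openin_strong_topology, THEN conjunct2, rule_format, of "pull u \<gamma>"] by auto
    have "e \<gamma> 0 = 0" using e_scale[OF g, of 0 0] sc.subspace_0[OF X'_subspace[OF g]] by simp
    then have "lcs_bounded sc X (e \<gamma> ` B)"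
      using sc.subspace_0[OF X'_subspace[OF g]] e_scale[OF g]
      by (intro lcs_bounded_image[OF B e_cont[OF g]]) auto
    moreover have "{v \<in> L\<^sub>X. \<forall>x\<in>e \<gamma> ` B. v x - u x \<in> W} \<subseteq> {u \<in> L\<^sub>X. pull u \<gamma> \<in> V}"
    proof
      fix v assume v: "v \<in> {v \<in> L\<^sub>X. \<forall>x\<in>e \<gamma> ` B. v x - u x \<in> W}"
      have "B \<subseteq> topspace (X' \<gamma>)" using B by (simp add: lcs_bounded_def)
      then have "pull v \<gamma> x - pull u \<gamma> x \<in> W" if "x \<in> B" for x
        using v that by (auto simp: pull_def)
      then show "v \<in> {u \<in> L\<^sub>X. pull u \<gamma> \<in> V}" using v BW pull_in[of v, OF _ g] by auto
    qed
    ultimately show "\<exists>B W. lcs_bounded sc X B \<and> openin E W \<and> 0 \<in> W \<and>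
        {v \<in> L\<^sub>X. \<forall>x\<in>B. v x - u x \<in> W} \<subseteq> {u \<in> L\<^sub>X. pull u \<gamma> \<in> V}"
      using W by (intro exI[of _ "e \<gamma> ` B"] exI[of _ W] conjI)
  qed auto
qed

lemma continuous_family: "continuous_map (strong_topology sc X sE E) prod_space family"
  unfolding prod_space_def continuous_map_componentwise
  using continuous_pull by (auto simp: family_def extensional_def)

lemma inj_family: "inj_on family L\<^sub>X"
proof (rule inj_onI)
  fix u v assume u: "u \<in> L\<^sub>X" and v: "v \<in> L\<^sub>X" and eq: "family u = family v"
  have eq': "pull u \<gamma> = pull v \<gamma>" if "\<gamma> \<in> \<Gamma>" for \<gamma>
    using fun_cong[OF eq, of \<gamma>] that by (simp add: family_def)
  show "u = v"
  proof
    fix x show "u x = v x"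
    proof (cases "x \<in> S")
      case True
      then obtain L where L: "pieces L" "total L = x"
        using decompose unfolding pieces_def total_def by blast
      then have "(\<Sum>p\<leftarrow>L. pull u (fst p) (snd p)) = (\<Sum>p\<leftarrow>L. pull v (fst p) (snd p))"
        using eq' by (intro arg_cong[where f=sum_list] map_cong) (auto simp: pieces_def)
      then show ?thesis using eval_total[OF u L(1)] eval_total[OF v L(1)] L(2) by simp
    next
      case False
      then show ?thesis using cont_lin_mapsD(5)[OF u] cont_lin_mapsD(5)[OF v] by simp
    qed
  qed
qed

lemma continuous_map_image: "continuous_map A B f \<Longrightarrow> x \<in> topspace A \<Longrightarrow> f x \<in> topspace B"
  by (auto simp: continuous_map_def)

lemma openin_prod_space_list:
  assumes "\<And>p. p \<in> set L \<Longrightarrow> fst p \<in> \<Gamma> \<and> openin (strong_topology sc (X' (fst p)) sE E) (N p)"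
  shows "openin prod_space {v \<in> topspace prod_space. \<forall>p\<in>set L. v (fst p) \<in> N p}"
  using assms
proof (induction L)
  case Nil
  then show ?case by simp
next
  case (Cons p L)
  have "continuous_map prod_space (strong_topology sc (X' (fst p)) sE E) (\<lambda>v. v (fst p))"
    unfolding prod_space_def using Cons.prems[of p] by (intro continuous_map_product_projection) auto
  then have "openin prod_space {v \<in> topspace prod_space. v (fst p) \<in> N p}"
    using Cons.prems[of p] by (intro openin_continuous_map_preimage) auto
  then have "openin prod_space ({v \<in> topspace prod_space. v (fst p) \<in> N p} \<inter>
      {v \<in> topspace prod_space. \<forall>p\<in>set L. v (fst p) \<in> N p})"
    using Cons by (intro openin_Int) auto
  moreover have "{v \<in> topspace prod_space. v (fst p) \<in> N p} \<inter>
      {v \<in> topspace prod_space. \<forall>p\<in>set L. v (fst p) \<in> N p} =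
      {v \<in> topspace prod_space. \<forall>p\<in>set (p # L). v (fst p) \<in> N p}" by auto
  ultimately show ?case by simp
qed

lemma decompose_TE:
  assumes "i \<in> I"
  obtains L where "\<And>p. p \<in> set L \<Longrightarrow> fst p \<in> \<Gamma>"
     "\<And>p. p \<in> set L \<Longrightarrow> continuous_map (T i) (X' (fst p)) (snd p)"
     "\<And>p a x. p \<in> set L \<Longrightarrow> x \<in> topspace (T i) \<Longrightarrow> snd p (sc a x) = sc a (snd p x)"
     "\<And>x. x \<in> topspace (T i) \<Longrightarrow> sum_list (map (\<lambda>p. e (fst p) (snd p x)) L) = x"
proof -
  from decompose_T[OF assms] obtain L where
    L: "\<forall>p\<in>set L. fst p \<in> \<Gamma> \<and> continuous_map (T i) (X' (fst p)) (snd p) \<and>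
          (\<forall>a. \<forall>x\<in>topspace (T i). snd p (sc a x) = sc a (snd p x))"
    and sum: "\<forall>x\<in>topspace (T i). sum_list (map (\<lambda>p. e (fst p) (snd p x)) L) = x"
    by (elim exE conjE) (rule that)
  show thesis
  proof (rule that)
    fix p assume p: "p \<in> set L"
    show "fst p \<in> \<Gamma>" "continuous_map (T i) (X' (fst p)) (snd p)" using L p by simp_all
    fix a x assume "x \<in> topspace (T i)"
    then show "snd p (sc a x) = sc a (snd p x)" using L p by simp
  next
    fix x assume "x \<in> topspace (T i)"
    then show "sum_list (map (\<lambda>p. e (fst p) (snd p x)) L) = x" using sum by simp
  qed
qed

text \<open>Openness of the map onto its image, at one point. The bounded set \<open>B\<close> is
  located in a step \<open>T i\<close>; its images under the finitely many splitting maps are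
  bounded in the pieces, and if two maps differ there by elements of \<open>W'\<close>, they differ
  on \<open>B\<close> by a sum of \<open>length L\<close> such elements, which lies in
  \<open>W\<close>.\<close>

lemma family_nbhd:
  assumes V: "openin (strong_topology sc X sE E) V" and u: "u \<in> V"
  shows "\<exists>Q. openin prod_space Q \<and> family u \<in> Q \<and> Q \<inter> family ` L\<^sub>X \<subseteq> family ` V"
proof -
  have uL: "u \<in> L\<^sub>X" using V u unfolding openin_strong_topology by blast
  obtain B W where B: "lcs_bounded sc X B" and W: "openin E W" "0 \<in> W"
      and BW: "{v \<in> L\<^sub>X. \<forall>x\<in>B. v x - u x \<in> W} \<subseteq> V"
    using V[unfolded openin_strong_topology, THEN conjunct2, rule_format, OF u] by auto
  obtain i where i: "i \<in> I" and Bi: "lcs_bounded sc (T i) B" using bounded_T[OF B] by auto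
  obtain L where L: "\<And>p. p \<in> set L \<Longrightarrow> fst p \<in> \<Gamma>"
     "\<And>p. p \<in> set L \<Longrightarrow> continuous_map (T i) (X' (fst p)) (snd p)"
     "\<And>p a x. p \<in> set L \<Longrightarrow> x \<in> topspace (T i) \<Longrightarrow> snd p (sc a x) = sc a (snd p x)"
     "\<And>x. x \<in> topspace (T i) \<Longrightarrow> sum_list (map (\<lambda>p. e (fst p) (snd p x)) L) = x"
    by (rule decompose_TE[OF i]) (rule that)
  obtain W' where W': "openin E W'" "0 \<in> W'"
    "\<And>xs. length xs = length L \<Longrightarrow> set xs \<subseteq> W' \<Longrightarrow> sum_list xs \<in> W"
    using lcs_sum_list_nbhd[OF E W, of "length L"] by blast
  have "\<exists>N. openin (strong_topology sc (X' (fst p)) sE E) N \<and> pull u (fst p) \<in> N \<and>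
     N \<subseteq> {g \<in> L' (fst p). \<forall>x\<in>snd p ` B. g x - pull u (fst p) x \<in> W'}" if p: "p \<in> set L" for p
  proof (rule strong_topology_nbhd[OF E _ W'(1,2) pull_in[OF uL L(1)[OF p]]])
    have "snd p 0 = 0" using L(3)[OF p T_zero[OF i], of 0] by simp
    then show "lcs_bounded sc (X' (fst p)) (snd p ` B)"
      using T_zero[OF i] L(3)[OF p] by (intro lcs_bounded_image[OF Bi L(2)[OF p]]) auto
  qed
  then have "\<forall>p\<in>set L. \<exists>N. openin (strong_topology sc (X' (fst p)) sE E) N \<and> pull u (fst p) \<in> N \<and>
     N \<subseteq> {g \<in> L' (fst p). \<forall>x\<in>snd p ` B. g x - pull u (fst p) x \<in> W'}" by (rule ballI)
  from bchoice[OF this] obtain N where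
    NN: "\<forall>p\<in>set L. openin (strong_topology sc (X' (fst p)) sE E) (N p) \<and> pull u (fst p) \<in> N p \<and>
     N p \<subseteq> {g \<in> L' (fst p). \<forall>x\<in>snd p ` B. g x - pull u (fst p) x \<in> W'}" ..
  note N = NN[rule_format, THEN conjunct1] NN[rule_format, THEN conjunct2, THEN conjunct1]
    NN[rule_format, THEN conjunct2, THEN conjunct2]
  \<comment> \<open>The neighbourhoods \<open>N p\<close> are indexed by the entries of
    \<open>L\<close> and not by \<open>\<gamma>\<close>, because one \<open>\<gamma>\<close> may
    occur in several entries.\<close>
  let ?Q = "{v \<in> topspace prod_space. \<forall>p\<in>set L. v (fst p) \<in> N p}"
  have "openin prod_space ?Q" using openin_prod_space_list[of L N] L(1) N(1) by blast
  moreover have "family u \<in> ?Q"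
    using N(2) L(1) uL pull_in by (auto simp: topspace_prod_space family_def)
  moreover have "?Q \<inter> family ` L\<^sub>X \<subseteq> family ` V"
  proof
    fix w assume "w \<in> ?Q \<inter> family ` L\<^sub>X"
    then obtain v where v: "v \<in> L\<^sub>X" "w = family v" "\<And>p. p \<in> set L \<Longrightarrow> family v (fst p) \<in> N p"
      by auto
    have "v x - u x \<in> W" if x: "x \<in> B" for x
    proof -
      have xT: "x \<in> topspace (T i)" using Bi x by (auto simp: lcs_bounded_def)
      define P where "P = map (\<lambda>p. (fst p, snd p x)) L"
      have P: "pieces P"
        using L(1) continuous_map_image[OF L(2) xT] by (auto simp: P_def pieces_def)
      have tot: "total P = x" using L(4)[OF xT] by (simp add: total_def P_def o_def)
      have "v x - u x = (\<Sum>p\<leftarrow>P. pull v (fst p) (snd p)) - (\<Sum>p\<leftarrow>P. pull u (fst p) (snd p))"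
        using eval_total[OF v(1) P] eval_total[OF uL P] tot by simp
      also have "\<dots> = (\<Sum>p\<leftarrow>L. pull v (fst p) (snd p x) - pull u (fst p) (snd p x))"
        by (simp add: P_def o_def sum_list_subtractf)
      also have "\<dots> \<in> W"
      proof (rule W'(3))
        show "set (map (\<lambda>p. pull v (fst p) (snd p x) - pull u (fst p) (snd p x)) L) \<subseteq> W'"
        proof clarsimp
          fix \<gamma> c assume p: "(\<gamma>, c) \<in> set L"
          have "pull v \<gamma> \<in> N (\<gamma>, c)" using v(3)[OF p] L(1)[OF p] by (simp add: family_def)
          then show "pull v \<gamma> (c x) - pull u \<gamma> (c x) \<in> W'" using N(3)[OF p] x by auto
        qed
      qed simp
      finally show ?thesis .
    qed
    then have "v \<in> V" using BW v(1) by blast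
    then show "w \<in> family ` V" using v(2) by blast
  qed
  ultimately show ?thesis by blast
qed

theorem embedding_family: "embedding_map (strong_topology sc X sE E) prod_space family"
  unfolding embedding_map_def topspace_strong_topology[OF E]
proof (rule bijective_open_imp_homeomorphic_map)
  let ?Z = "subtopology prod_space (family ` L\<^sub>X)"
  have im: "family ` L\<^sub>X \<subseteq> topspace prod_space"
    using pull_in by (auto simp: topspace_prod_space family_def)
  show "continuous_map (strong_topology sc X sE E) ?Z family"
    using continuous_family by (simp add: continuous_map_in_subtopology E)
  show "inj_on family (topspace (strong_topology sc X sE E))" using inj_family by (simp add: E)
  show "family ` topspace (strong_topology sc X sE E) = topspace ?Z" using im by (auto simp: E)
  show "open_map (strong_topology sc X sE E) ?Z family"
    unfolding open_map_def
  proof (intro allI impI)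
    fix V assume V: "openin (strong_topology sc X sE E) V"
    then have VL: "V \<subseteq> L\<^sub>X" using openin_subset[OF V] by (simp add: E)
    show "openin ?Z (family ` V)"
    proof (subst openin_subopen, intro ballI)
      fix w assume "w \<in> family ` V"
      then obtain u where u: "u \<in> V" "w = family u" by blast
      obtain Q where Q: "openin prod_space Q" "family u \<in> Q" "Q \<inter> family ` L\<^sub>X \<subseteq> family ` V"
        using family_nbhd[OF V u(1)] by blast
      have "openin ?Z (Q \<inter> family ` L\<^sub>X)" using Q(1) by (rule openin_subtopology_Int)
      moreover have "w \<in> Q \<inter> family ` L\<^sub>X" using u Q VL by blast
      ultimately show "\<exists>T. openin ?Z T \<and> w \<in> T \<and> T \<subseteq> family ` V" using Q(3) by blast
    qed
  qed
qed

text \<open>Lists stand for formal sums of points of the pieces; the relations are the kernel of the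
  map that sends a formal sum to its total in \<open>S\<close>.\<close>

definition relation :: "('g \<times> 'a) list \<Rightarrow> bool" where
  "relation L \<longleftrightarrow> pieces L \<and> total L = 0"

lemma continuous_sum_list:
  assumes "\<And>p. p \<in> set L \<Longrightarrow> continuous_map Z E (\<lambda>z. f p z)"
  shows "continuous_map Z E (\<lambda>z. \<Sum>p\<leftarrow>L. f p z)"
  using assms
proof (induction L)
  case Nil
  then show ?case using lcs_zero_in[OF E] by simp
next
  case (Cons p L)
  then show ?case using lcs_continuous_add[OF E, of Z "f p" "\<lambda>z. \<Sum>p\<leftarrow>L. f p z"] by simp
qed

lemma closedin_relation:
  assumes "pieces L"
  shows "closedin prod_space {v \<in> topspace prod_space. (\<Sum>p\<leftarrow>L. v (fst p) (snd p)) = 0}"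
proof -
  have "continuous_map prod_space E (\<lambda>v. \<Sum>p\<leftarrow>L. v (fst p) (snd p))"
  proof (rule continuous_sum_list)
    fix p assume p: "p \<in> set L"
    then have g: "fst p \<in> \<Gamma>" "snd p \<in> topspace (X' (fst p))" using assms by (auto simp: pieces_def)
    have "continuous_map prod_space (strong_topology sc (X' (fst p)) sE E) (\<lambda>v. v (fst p))"
      unfolding prod_space_def using g by (intro continuous_map_product_projection) auto
    from continuous_map_compose[OF this continuous_map_strong_evaluation[OF E X'_bounded[OF g]]]
    show "continuous_map prod_space E (\<lambda>v. v (fst p) (snd p))" by (simp add: o_def)
  qed
  moreover have "closedin E {0}"
    using E2 lcs_zero_in[OF E] by (simp add: closedin_Hausdorff_singleton)
  ultimately show ?thesis using closedin_continuous_map_preimage by fastforce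
qed

definition scale_pieces :: "complex \<Rightarrow> ('g \<times> 'a) list \<Rightarrow> ('g \<times> 'a) list" where
  "scale_pieces c L = map (\<lambda>p. (fst p, sc c (snd p))) L"

lemma scale_pieces_simps [simp]:
  "scale_pieces c [] = []" "scale_pieces c (p # L) = (fst p, sc c (snd p)) # scale_pieces c L"
  by (simp_all add: scale_pieces_def)

lemma pieces_Cons: "pieces (p # L) \<longleftrightarrow> fst p \<in> \<Gamma> \<and> snd p \<in> topspace (X' (fst p)) \<and> pieces L"
  by (auto simp: pieces_def)

lemma total_Cons: "total (p # L) = e (fst p) (snd p) + total L" "total [] = 0"
  by (simp_all add: total_def)

lemma pieces_scale_pieces:
  assumes "pieces L"
  shows "pieces (scale_pieces c L) \<and> total (scale_pieces c L) = sc c (total L)"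
  using assms
proof (induction L)
  case Nil
  then show ?case by (simp add: total_Cons)
next
  case (Cons p L)
  then have p: "fst p \<in> \<Gamma>" "snd p \<in> topspace (X' (fst p))" "pieces L" by (simp_all add: pieces_Cons)
  then show ?case using Cons.IH sc.subspace_scale[OF X'_subspace[OF p(1)] p(2)]
    by (simp add: pieces_Cons total_Cons e_scale sc.scale_right_distrib)
qed

lemma sum_scale_pieces:
  assumes "pieces L" and v: "\<And>\<gamma>. \<gamma> \<in> \<Gamma> \<Longrightarrow> v \<gamma> \<in> L' \<gamma>"
  shows "(\<Sum>p\<leftarrow>scale_pieces c L. v (fst p) (snd p)) = sE c (\<Sum>p\<leftarrow>L. v (fst p) (snd p))"
  using assms(1)
proof (induction L)
  case Nil
  show ?case by simp
next
  case (Cons p L)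
  then have p: "fst p \<in> \<Gamma>" "snd p \<in> topspace (X' (fst p))" "pieces L" by (simp_all add: pieces_Cons)
  then show ?case using Cons.IH cont_lin_mapsD(4)[OF v[OF p(1)] p(2), of c]
    by (simp add: sE.scale_right_distrib)
qed

text \<open>A family \<open>v\<close> glues if and only if it annihilates every relation between pieces, and each
  such condition is closed because \<open>E\<close> is Hausdorff.\<close>

lemma family_image:
  "family ` L\<^sub>X = topspace prod_space \<inter>
     (\<Inter>L\<in>Collect relation. {v \<in> topspace prod_space. (\<Sum>p\<leftarrow>L. v (fst p) (snd p)) = 0})"
  (is "?A = ?B")
proof
  show "?A \<subseteq> ?B"
  proof clarify
    fix u assume u: "u \<in> L\<^sub>X"
    have "(\<Sum>p\<leftarrow>L. family u (fst p) (snd p)) = 0" if "relation L" for L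
    proof -
      have "(\<Sum>p\<leftarrow>L. family u (fst p) (snd p)) = (\<Sum>p\<leftarrow>L. pull u (fst p) (snd p))"
        using that by (intro arg_cong[where f=sum_list] map_cong) (auto simp: relation_def pieces_def family_def)
      then show ?thesis
        using eval_total[OF u, of L] that cont_lin_zero[OF u] S_closed(1) by (simp add: relation_def)
    qed
    moreover have "family u \<in> topspace prod_space"
      using pull_in[OF u] by (auto simp: topspace_prod_space family_def)
    ultimately show "family u \<in> ?B" by simp
  qed
next
  show "?B \<subseteq> ?A"
  proof
    fix v assume v: "v \<in> ?B"
    then have vL: "v \<gamma> \<in> L' \<gamma>" if "\<gamma> \<in> \<Gamma>" for \<gamma> using that by (auto simp: topspace_prod_space)
    have v_ext: "v \<in> extensional \<Gamma>" using v by (auto simp: topspace_prod_space PiE_def)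
    define val where "val L = (\<Sum>p\<leftarrow>L. v (fst p) (snd p))" for L
    have rel: "val L = 0" if "relation L" for L using v that by (auto simp: val_def)
    let ?mul = scale_pieces
    have mul: "pieces (?mul c L) \<and> total (?mul c L) = sc c (total L) \<and> val (?mul c L) = sE c (val L)"
      if "pieces L" for c L
      unfolding val_def using pieces_scale_pieces[OF that] sum_scale_pieces[OF that vL] by blast
    have app: "pieces (K @ L) \<longleftrightarrow> pieces K \<and> pieces L" "total (K @ L) = total K + total L"
      "val (K @ L) = val K + val L" for K L
      by (auto simp: pieces_def total_def val_def)
    have uniq: "val K = val L" if "pieces K" "pieces L" "total K = total L" for K L
    proof -
      \<comment> \<open>Two decompositions of the same point differ by a relation: the second one is
        appended with all its entries multiplied by \<open>-1\<close>.\<close>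
      have "relation (K @ ?mul (-1) L)" using that mul[of L "-1"] by (simp add: relation_def app)
      from rel[OF this] have "val K + sE (-1) (val L) = 0" using mul[OF that(2), of "-1"] app(3) by simp
      then show ?thesis by simp
    qed
    \<comment> \<open>The glued map is read off from an arbitrary decomposition of the point;
      \<open>uniq\<close> makes the choice immaterial.\<close>
    define u where "u x = (if x \<in> S then val (SOME L. pieces L \<and> total L = x) else 0)" for x
    have u_eq: "u (total L) = val L" if L: "pieces L" for L
    proof -
      let ?K = "SOME K. pieces K \<and> total K = total L"
      have K: "pieces ?K \<and> total ?K = total L"
        by (rule someI[of _ L]) (use L in simp)
      have "u (total L) = val ?K" using total_in[OF L] by (simp only: u_def if_True)
      also have "\<dots> = val L" by (rule uniq) (use K L in simp_all)
      finally show ?thesis .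
    qed
    have ex: "\<exists>L. pieces L \<and> total L = x" if "x \<in> S" for x
      using decompose[OF that] unfolding pieces_def total_def by blast
    have val_in: "pieces L \<Longrightarrow> val L \<in> topspace E" for L
    proof (induction L)
      case Nil
      show ?case using lcs_zero_in[OF E] by (simp add: val_def)
    next
      case (Cons p L)
      then have p: "fst p \<in> \<Gamma>" "snd p \<in> topspace (X' (fst p))" "val L \<in> topspace E"
        by (simp_all add: pieces_Cons)
      have "val (p # L) = v (fst p) (snd p) + val L" by (simp add: val_def)
      then show ?case using lcs_add_in[OF E cont_lin_mapsD(2)[OF vL[OF p(1)] p(2)] p(3)] by (simp only:)
    qed
    have u_add: "u (x + y) = u x + u y" if xy: "x \<in> S" "y \<in> S" for x y
    proof -
      obtain K where K: "pieces K" "total K = x" using ex[OF xy(1)] by blast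
      obtain L where L: "pieces L" "total L = y" using ex[OF xy(2)] by blast
      have "u (total (K @ L)) = val (K @ L)" by (rule u_eq) (simp add: app K L)
      then show ?thesis using u_eq[OF K(1)] u_eq[OF L(1)] by (simp only: app K L)
    qed
    have u_scale: "u (sc c x) = sE c (u x)" if x: "x \<in> S" for c x
    proof -
      obtain K where K: "pieces K" "total K = x" using ex[OF x] by blast
      have "u (total (?mul c K)) = val (?mul c K)" by (rule u_eq) (simp add: mul K)
      then show ?thesis using u_eq[OF K(1)] mul[OF K(1), of c] by (simp only: K)
    qed
    have u_in: "u x \<in> topspace E" if x: "x \<in> S" for x
    proof -
      obtain K where K: "pieces K" "total K = x" using ex[OF x] by blast
      then show ?thesis using u_eq[OF K(1)] val_in[OF K(1)] by (simp only: K)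
    qed
    \<comment> \<open>On a single step the chosen decomposition may be replaced by the one of
      \<open>decompose_T\<close>, whose entries depend continuously on the point.\<close>
    have u_cont: "continuous_map (T i) E u" if i: "i \<in> I" for i
    proof -
      obtain L where L: "\<And>p. p \<in> set L \<Longrightarrow> fst p \<in> \<Gamma>"
         "\<And>p. p \<in> set L \<Longrightarrow> continuous_map (T i) (X' (fst p)) (snd p)"
         "\<And>p a x. p \<in> set L \<Longrightarrow> x \<in> topspace (T i) \<Longrightarrow> snd p (sc a x) = sc a (snd p x)"
         "\<And>x. x \<in> topspace (T i) \<Longrightarrow> sum_list (map (\<lambda>p. e (fst p) (snd p x)) L) = x"
        by (rule decompose_TE[OF i]) (rule that)
      have "continuous_map (T i) E (\<lambda>x. \<Sum>p\<leftarrow>L. v (fst p) (snd p x))"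
      proof (rule continuous_sum_list)
        fix p assume p: "p \<in> set L"
        from continuous_map_compose[OF L(2)[OF p] cont_lin_mapsD(1)[OF vL[OF L(1)[OF p]]]]
        show "continuous_map (T i) E (\<lambda>x. v (fst p) (snd p x))" by (simp add: o_def)
      qed
      moreover have "(\<Sum>p\<leftarrow>L. v (fst p) (snd p x)) = u x" if x: "x \<in> topspace (T i)" for x
      proof -
        let ?P = "map (\<lambda>p. (fst p, snd p x)) L"
        have "pieces ?P" using L(1) continuous_map_image[OF L(2) x] by (auto simp: pieces_def)
        moreover have "total ?P = x" using L(4)[OF x] by (simp add: total_def o_def)
        ultimately have "u x = val ?P" using u_eq[of ?P] by (simp only:)
        then show ?thesis by (simp add: val_def o_def)
      qed
      ultimately show ?thesis by (rule continuous_map_eq)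
    qed
    have "continuous_map X E u"
    proof (rule continuous_map_from_lcs_ind_lim[OF sc S E])
      show "u \<in> S \<rightarrow> topspace E" using u_in by auto
    qed (fact u_add u_scale | rule T_subset u_cont, assumption)+
    then have uL: "u \<in> L\<^sub>X"
      unfolding cont_lin_maps_def topspace_lcs_ind_lim mem_Collect_eq
      using u_add u_scale by (intro conjI ballI allI impI) (assumption | simp add: u_def)+
    have "family u \<gamma> = v \<gamma>" for \<gamma>
    proof (cases "\<gamma> \<in> \<Gamma>")
      case True
      have "pull u \<gamma> x = v \<gamma> x" for x
      proof (cases "x \<in> topspace (X' \<gamma>)")
        case xt: True
        have "pieces [(\<gamma>, x)]" using xt True by (simp add: pieces_def)
        from u_eq[OF this] show ?thesis using xt by (simp add: pull_def total_def val_def)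
      next
        case False
        then show ?thesis using cont_lin_mapsD(5)[OF vL[OF True]] by (simp add: pull_def)
      qed
      then show ?thesis using True by (auto simp: family_def)
    next
      case False
      then show ?thesis using v_ext by (simp add: family_def extensional_def)
    qed
    then show "v \<in> ?A" using uL by (metis (no_types) ext imageI)
  qed
qed

theorem closedin_family_image: "closedin prod_space (family ` L\<^sub>X)"
\<comment> \<open>The intersection rule for closed sets asks for a nonempty index set; without
  relations the image would be the whole product.\<close>
proof (cases "Collect relation = {}")
  case True
  then show ?thesis unfolding family_image True by simp
next
  case False
  show ?thesis unfolding family_image
    by (intro closedin_Int closedin_topspace closedin_INT False)
      (auto intro: closedin_relation simp: relation_def)
qed

end

section \<open>Smooth functions on open subsets of Euclidean spaces\<close>

lemma openin_Euclidean_space_subset: "openin (Euclidean_space n) U \<Longrightarrow> x \<in> U \<Longrightarrow> i \<ge> n \<Longrightarrow> x i = 0"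
  using openin_subset[of "Euclidean_space n" U] by (auto simp: topspace_Euclidean_space)

text \<open>Points of \<open>Euclidean_space n\<close> vanish at indices from \<open>n\<close> on,
  so changing a coordinate \<open>i < n\<close> stays in the space, continuously in
  \<open>t\<close>. Hence partial derivatives at a point of an open set depend only on the values in
  that set.\<close>

lemma eventually_upd_in:
  assumes U: "openin (Euclidean_space n) U" and x: "x \<in> U" and i: "i < n"
  shows "\<forall>\<^sub>F t in nhds (x i). x(i := t) \<in> U"
proof -
  have "continuous_map euclidean (Euclidean_space n) (\<lambda>t j. if j < n then (if j = i then t else x j) else 0)"
    unfolding continuous_map_componentwise_Euclidean_space by (auto simp: continuous_map_id[unfolded id_def])
  moreover have "(\<lambda>t j. if j < n then (if j = i then t else x j) else 0) = (\<lambda>t. x(i := t))"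
    using openin_Euclidean_space_subset[OF U x] i by (intro ext) auto
  ultimately have "continuous_map euclidean (Euclidean_space n) (\<lambda>t. x(i := t))" by simp
  from openin_continuous_map_preimage[OF this U] have "open {t. x(i := t) \<in> U}" by simp
  moreover have "x i \<in> {t. x(i := t) \<in> U}" using x by simp
  ultimately have "\<forall>\<^sub>F t in nhds (x i). t \<in> {t. x(i := t) \<in> U}" by (rule eventually_nhds_in_open)
  then show ?thesis by simp
qed

lemma partial_deriv_eqI:
  assumes "((\<lambda>t. f (x(i := t))) has_vector_derivative d) (at (x i))"
  shows "partial_deriv i f x = d"
  using assms unfolding partial_deriv_def by (rule vector_derivative_at)

lemma differentiable_partial:
  fixes f :: "(nat \<Rightarrow> real) \<Rightarrow> complex"
  assumes "(\<lambda>t. f (x(i := t))) differentiable at (x i)"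
  shows "((\<lambda>t. f (x(i := t))) has_vector_derivative partial_deriv i f x) (at (x i))"
  using assms unfolding partial_deriv_def by (simp add: vector_derivative_works)

lemma has_vector_derivative_partial_cong:
  assumes U: "openin (Euclidean_space n) U" and x: "x \<in> U" and i: "i < n"
    and fg: "\<And>y. y \<in> U \<Longrightarrow> f y = g y"
  shows "((\<lambda>t. f (x(i := t))) has_vector_derivative d) (at (x i)) \<longleftrightarrow>
         ((\<lambda>t. g (x(i := t))) has_vector_derivative d) (at (x i))"
proof -
  have "\<forall>\<^sub>F t in nhds (x i). f (x(i := t)) = g (x(i := t))"
    using eventually_upd_in[OF U x i] by eventually_elim (rule fg)
  moreover have "f (x(i := x i)) = g (x(i := x i))" using fg x by simp
  ultimately show ?thesis
    by (intro has_vector_derivative_cong_ev) (auto elim: eventually_mono)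
qed

lemma partial_deriv_cong:
  assumes U: "openin (Euclidean_space n) U" and x: "x \<in> U" and i: "i < n"
    and fg: "\<And>y. y \<in> U \<Longrightarrow> f y = g y"
  shows "partial_deriv i f x = partial_deriv i g x"
  unfolding partial_deriv_def vector_derivative_def
  by (rule arg_cong[where f=Eps], rule ext, rule has_vector_derivative_partial_cong[OF U x i fg])

lemma differentiable_partial_cong:
  fixes f g :: "(nat \<Rightarrow> real) \<Rightarrow> complex"
  assumes U: "openin (Euclidean_space n) U" and x: "x \<in> U" and i: "i < n"
    and fg: "\<And>y. y \<in> U \<Longrightarrow> f y = g y"
  shows "(\<lambda>t. f (x(i := t))) differentiable at (x i) \<longleftrightarrow> (\<lambda>t. g (x(i := t))) differentiable at (x i)"
proof -
  have *: "h differentiable at t \<longleftrightarrow> (\<exists>d. (h has_vector_derivative d) (at t))" for h :: "real \<Rightarrow> complex" and t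
    using vector_derivative_works[of h "at t"] differentiableI_vector[of h] by blast
  show ?thesis unfolding *
    by (rule arg_cong[where f=Ex], rule ext, rule has_vector_derivative_partial_cong[OF U x i fg])
qed

text \<open>\<open>smooth_on\<close> speaks about all iterated partial derivatives. Instead of
  computing them, it is enough to exhibit a class of functions that are continuous on
  \<open>U\<close> and have partial derivatives in the class. Functions are compared on
  \<open>U\<close> only, because \<open>partial_deriv\<close> is uncontrolled elsewhere.\<close>

lemma smooth_on_coinduct:
  assumes U: "openin (Euclidean_space n) U" and P: "P f"
    and cont: "\<And>f. P f \<Longrightarrow> continuous_map (subtopology (Euclidean_space n) U) euclidean f"
    and step: "\<And>f i. P f \<Longrightarrow> i < n \<Longrightarrow> \<exists>g. P g \<and>
        (\<forall>x\<in>U. ((\<lambda>t. f (x(i := t))) has_vector_derivative g x) (at (x i)))"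
  shows "smooth_on n U f"
proof -
  have *: "\<exists>g. P g \<and> (\<forall>x\<in>U. foldr partial_deriv is f x = g x)" if "set is \<subseteq> {..<n}" for "is"
    using that
  proof (induction "is")
    case Nil
    then show ?case using P by auto
  next
    case (Cons i "is")
    then obtain g where g: "P g" "\<And>x. x \<in> U \<Longrightarrow> foldr partial_deriv is f x = g x" by auto
    obtain h where h: "P h" "\<forall>x\<in>U. ((\<lambda>t. g (x(i := t))) has_vector_derivative h x) (at (x i))"
      using step[OF g(1), of i] Cons.prems by auto
    have "foldr partial_deriv (i # is) f x = h x" if x: "x \<in> U" for x
    proof -
      have "foldr partial_deriv (i # is) f x = partial_deriv i g x"
        using partial_deriv_cong[OF U x, of i "foldr partial_deriv is f" g] g(2) Cons.prems by simp
      also have "\<dots> = h x" by (rule partial_deriv_eqI) (use h x in auto)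
      finally show ?thesis .
    qed
    then show ?case using h(1) by blast
  qed
  show ?thesis unfolding smooth_on_def
  proof (intro allI impI conjI ballI)
    fix "is" assume "is": "set is \<subseteq> {..<n}"
    then obtain g where g: "P g" "\<And>x. x \<in> U \<Longrightarrow> foldr partial_deriv is f x = g x" using * by blast
    show "continuous_map (subtopology (Euclidean_space n) U) euclidean (foldr partial_deriv is f)"
      by (rule continuous_map_eq[OF cont[OF g(1)]]) (simp add: g(2))
    fix x i assume x: "x \<in> U" and i: "i < n"
    obtain h where h: "\<forall>x\<in>U. ((\<lambda>t. g (x(i := t))) has_vector_derivative h x) (at (x i))"
      using step[OF g(1) i] by blast
    then have "(\<lambda>t. g (x(i := t))) differentiable at (x i)" using x by (blast intro: differentiableI_vector)
    then show "(\<lambda>t. foldr partial_deriv is f (x(i := t))) differentiable at (x i)"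
      using differentiable_partial_cong[OF U x i, of "foldr partial_deriv is f" g] g(2) by simp
  qed
qed

lemma smooth_on_continuous: "smooth_on n U f \<Longrightarrow> continuous_map (subtopology (Euclidean_space n) U) euclidean f"
  unfolding smooth_on_def by (metis empty_subsetI foldr_Nil id_apply list.set(1))

lemma smooth_on_partial:
  assumes "smooth_on n U f" "x \<in> U" "i < n"
  shows "((\<lambda>t. f (x(i := t))) has_vector_derivative partial_deriv i f x) (at (x i))"
proof (rule differentiable_partial)
  show "(\<lambda>t. f (x(i := t))) differentiable at (x i)"
    using assms(1)[unfolded smooth_on_def, rule_format, of "[]"] assms(2,3) by simp
qed

lemma smooth_on_partial_deriv:
  assumes "smooth_on n U f" "i < n"
  shows "smooth_on n U (partial_deriv i f)"
  unfolding smooth_on_def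
proof (intro allI impI)
  fix "is" assume "set is \<subseteq> {..<n}"
  then have "set (is @ [i]) \<subseteq> {..<n}" using assms(2) by simp
  from assms(1)[unfolded smooth_on_def, rule_format, OF this]
  show "continuous_map (subtopology (Euclidean_space n) U) euclidean (foldr partial_deriv is (partial_deriv i f)) \<and>
    (\<forall>x\<in>U. \<forall>j<n. (\<lambda>t. foldr partial_deriv is (partial_deriv i f) (x(j := t))) differentiable at (x j))"
    using assms(1)[unfolded smooth_on_def, rule_format, of "is @ [i]"] assms(2) \<open>set is \<subseteq> {..<n}\<close> by simp
qed

text \<open>The closure of the smooth functions under sums, products and inverses. The product and
  quotient rules do not leave it, so it is a class for \<open>smooth_on_coinduct\<close>, and no
  Leibniz formula for iterated derivatives is required.\<close>

inductive smooth_alg :: "nat \<Rightarrow> (nat \<Rightarrow> real) set \<Rightarrow> ((nat \<Rightarrow> real) \<Rightarrow> complex) \<Rightarrow> bool" for n U where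
  base: "smooth_on n U f \<Longrightarrow> smooth_alg n U f"
| add: "smooth_alg n U f \<Longrightarrow> smooth_alg n U g \<Longrightarrow> smooth_alg n U (\<lambda>x. f x + g x)"
| mult: "smooth_alg n U f \<Longrightarrow> smooth_alg n U g \<Longrightarrow> smooth_alg n U (\<lambda>x. f x * g x)"
| inverse: "smooth_alg n U f \<Longrightarrow> (\<And>x. x \<in> U \<Longrightarrow> f x \<noteq> 0) \<Longrightarrow> smooth_alg n U (\<lambda>x. inverse (f x))"

lemma smooth_on_const:
  assumes "openin (Euclidean_space n) U"
  shows "smooth_on n U (\<lambda>x. c)"
proof (rule smooth_on_coinduct[OF assms, where P="\<lambda>f. \<exists>c. f = (\<lambda>x. c)"])
  fix f :: "(nat \<Rightarrow> real) \<Rightarrow> complex" and i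
  assume "\<exists>c. f = (\<lambda>x. c)"
  then show "\<exists>g. (\<exists>c. g = (\<lambda>x. c)) \<and> (\<forall>x\<in>U. ((\<lambda>t. f (x(i := t))) has_vector_derivative g x) (at (x i)))"
    by (intro exI[of _ "\<lambda>x. 0"]) auto
qed auto

lemma continuous_map_mult_complex:
  assumes "continuous_map X euclidean (f :: _ \<Rightarrow> complex)" "continuous_map X euclidean g"
  shows "continuous_map X euclidean (\<lambda>x. f x * g x)"
proof -
  have "continuous_map X (prod_topology euclidean euclidean) (\<lambda>x. (f x, g x))"
    using assms unfolding continuous_map_pairwise o_def by simp
  moreover have "continuous_map euclidean euclidean (\<lambda>p :: complex \<times> complex. fst p * snd p)"
    by (simp add: continuous_intros)
  ultimately have "continuous_map X euclidean ((\<lambda>p. fst p * snd p) \<circ> (\<lambda>x. (f x, g x)))"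
    unfolding prod_topology_euclidean by (rule continuous_map_compose)
  then show ?thesis by (simp add: o_def)
qed

lemma continuous_map_inverse_complex:
  assumes "continuous_map X euclidean (f :: _ \<Rightarrow> complex)" "\<And>x. x \<in> topspace X \<Longrightarrow> f x \<noteq> 0"
  shows "continuous_map X euclidean (\<lambda>x. inverse (f x))"
proof -
  have "continuous_map X (subtopology euclidean (- {0})) f"
    using assms by (auto simp: continuous_map_in_subtopology)
  moreover have "continuous_map (subtopology euclidean (- {0})) euclidean (inverse :: complex \<Rightarrow> complex)"
    by (auto intro!: continuous_intros)
  ultimately have "continuous_map X euclidean (inverse \<circ> f)" by (rule continuous_map_compose)
  then show ?thesis by (simp add: o_def)
qed

lemma smooth_alg_imp_smooth_on:
  assumes U: "openin (Euclidean_space n) U" and f: "smooth_alg n U f"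
  shows "smooth_on n U f"
proof (rule smooth_on_coinduct[OF U, where P="smooth_alg n U"])
  show "smooth_alg n U f" by (rule f)
next
  have tops: "topspace (subtopology (Euclidean_space n) U) = U"
    using openin_subset[OF U] by auto
  fix f assume "smooth_alg n U f"
  then show "continuous_map (subtopology (Euclidean_space n) U) euclidean f"
  proof induction
    case (inverse f)
    then show ?case by (intro continuous_map_inverse_complex) (auto simp: tops)
  qed (auto intro: smooth_on_continuous continuous_map_add continuous_map_mult_complex)
next
  fix f i assume f: "smooth_alg n U f" and i: "i < n"
  from f show "\<exists>g. smooth_alg n U g \<and> (\<forall>x\<in>U. ((\<lambda>t. f (x(i := t))) has_vector_derivative g x) (at (x i)))"
  proof induction
    case (base f)
    then show ?case using smooth_on_partial_deriv[OF _ i] smooth_on_partial[OF _ _ i] smooth_alg.base by blast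
  next
    case (add f g)
    obtain f' where f': "smooth_alg n U f'"
      "\<And>x. x \<in> U \<Longrightarrow> ((\<lambda>t. f (x(i := t))) has_vector_derivative f' x) (at (x i))" using add.IH(1) by blast
    obtain g' where g': "smooth_alg n U g'"
      "\<And>x. x \<in> U \<Longrightarrow> ((\<lambda>t. g (x(i := t))) has_vector_derivative g' x) (at (x i))" using add.IH(2) by blast
    show ?case
      by (rule exI[of _ "\<lambda>x. f' x + g' x"]) (intro conjI ballI smooth_alg.add has_vector_derivative_add f' g')
  next
    case (mult f g)
    obtain f' where f': "smooth_alg n U f'"
      "\<And>x. x \<in> U \<Longrightarrow> ((\<lambda>t. f (x(i := t))) has_vector_derivative f' x) (at (x i))" using mult.IH(1) by blast
    obtain g' where g': "smooth_alg n U g'"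
      "\<And>x. x \<in> U \<Longrightarrow> ((\<lambda>t. g (x(i := t))) has_vector_derivative g' x) (at (x i))" using mult.IH(2) by blast
    have "((\<lambda>t. f (x(i := t)) * g (x(i := t))) has_vector_derivative f x * g' x + f' x * g x) (at (x i))"
      if "x \<in> U" for x
      using has_vector_derivative_mult[OF f'(2)[OF that] g'(2)[OF that]] by simp
    moreover have "smooth_alg n U (\<lambda>x. f x * g' x + f' x * g x)"
      by (intro smooth_alg.add smooth_alg.mult f' g' mult.hyps)
    ultimately show ?case by blast
  next
    case (inverse f)
    then obtain f' where d:
      "smooth_alg n U f'" "\<forall>x\<in>U. ((\<lambda>t. f (x(i := t))) has_vector_derivative f' x) (at (x i))" by blast
    \<comment> \<open>The derivative is written with the constant factor \<open>- 1\<close>, since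
      \<open>smooth_alg\<close> is built from products and constants and has no rule for
      negation.\<close>
    have "((\<lambda>t. inverse (f (x(i := t)))) has_vector_derivative (- 1) * (inverse (f x) * f' x * inverse (f x))) (at (x i))"
      if x: "x \<in> U" for x
    proof -
      have "((\<lambda>t. inverse (f (x(i := t)))) has_derivative
          (\<lambda>h. - (inverse (f (x(i := x i))) * (h *\<^sub>R f' x) * inverse (f (x(i := x i)))))) (at (x i))"
        by (rule Deriv.has_derivative_inverse[OF _ d(2)[rule_format, OF x, unfolded has_vector_derivative_def]])
          (simp add: inverse.hyps(2)[OF x])
      then show ?thesis by (simp add: has_vector_derivative_def scaleR_conv_of_real algebra_simps)
    qed
    moreover have "smooth_alg n U (\<lambda>x. (- 1) * (inverse (f x) * f' x * inverse (f x)))"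
      using d(1) inverse.hyps smooth_on_const[OF U]
      by (intro smooth_alg.mult smooth_alg.inverse) (auto intro: smooth_alg.base)
    ultimately show ?case by blast
  qed
qed

context
  fixes n U assumes U: "openin (Euclidean_space n) U"
begin

lemma smooth_on_add: "smooth_on n U f \<Longrightarrow> smooth_on n U g \<Longrightarrow> smooth_on n U (\<lambda>x. f x + g x)"
  by (rule smooth_alg_imp_smooth_on[OF U]) (intro smooth_alg.add smooth_alg.base)

lemma smooth_on_mult: "smooth_on n U f \<Longrightarrow> smooth_on n U g \<Longrightarrow> smooth_on n U (\<lambda>x. f x * g x)"
  by (rule smooth_alg_imp_smooth_on[OF U]) (intro smooth_alg.mult smooth_alg.base)

lemma smooth_on_inverse:
  "smooth_on n U f \<Longrightarrow> (\<And>x. x \<in> U \<Longrightarrow> f x \<noteq> 0) \<Longrightarrow> smooth_on n U (\<lambda>x. inverse (f x))"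
  by (rule smooth_alg_imp_smooth_on[OF U]) (intro smooth_alg.inverse smooth_alg.base)

lemma smooth_on_sum: "(\<And>i. i \<in> A \<Longrightarrow> smooth_on n U (f i)) \<Longrightarrow> smooth_on n U (\<lambda>x. \<Sum>i\<in>A. f i x)"
  by (induction A rule: infinite_finite_induct) (auto intro: smooth_on_add smooth_on_const U)

lemma smooth_on_prod: "(\<And>i. i \<in> A \<Longrightarrow> smooth_on n U (f i)) \<Longrightarrow> smooth_on n U (\<lambda>x. \<Prod>i\<in>A. f i x)"
  by (induction A rule: infinite_finite_induct) (auto intro: smooth_on_mult smooth_on_const U)

end

lemma smooth_on_subset: "smooth_on n U f \<Longrightarrow> V \<subseteq> U \<Longrightarrow> smooth_on n V f"
  unfolding smooth_on_def by (meson continuous_map_from_subtopology_mono subsetD)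

lemma smooth_on_local:
  assumes U: "openin (Euclidean_space n) U"
    and loc: "\<And>x. x \<in> U \<Longrightarrow> \<exists>V. openin (Euclidean_space n) V \<and> x \<in> V \<and> smooth_on n V f"
  shows "smooth_on n U f"
  unfolding smooth_on_def
proof (intro allI impI conjI ballI)
  fix "is" assume "is": "set is \<subseteq> {..<n}"
  let ?f = "foldr partial_deriv is f" and ?X = "subtopology (Euclidean_space n) U"
  have tops: "topspace ?X = U" using openin_subset[OF U] by auto
  show "continuous_map ?X euclidean ?f"
    unfolding continuous_map_def
  proof (intro conjI allI impI)
    fix W :: "complex set" assume W: "openin euclidean W"
    show "openin ?X {x \<in> topspace ?X. ?f x \<in> W}"
    proof (subst openin_subopen, intro ballI)
      fix x assume x: "x \<in> {x \<in> topspace ?X. ?f x \<in> W}"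
      then obtain O' where O': "openin (Euclidean_space n) O'" "x \<in> O'" "smooth_on n O' f" using loc tops by blast
      let ?Y = "subtopology (Euclidean_space n) O'"
      have "continuous_map ?Y euclidean ?f"
        using O'(3) "is" by (simp add: smooth_on_def)
      from openin_continuous_map_preimage[OF this W]
      have "openin (Euclidean_space n) {x \<in> topspace ?Y. ?f x \<in> W}"
        using O'(1) openin_open_subtopology by blast
      then have "openin ?X ({x \<in> topspace ?Y. ?f x \<in> W} \<inter> U)" by (rule openin_subtopology_Int)
      moreover have "x \<in> {x \<in> topspace ?Y. ?f x \<in> W} \<inter> U"
        using x O' tops openin_subset[OF O'(1)] by auto
      moreover have "{x \<in> topspace ?Y. ?f x \<in> W} \<inter> U \<subseteq> {x \<in> topspace ?X. ?f x \<in> W}" using tops by auto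
      ultimately show "\<exists>T. openin ?X T \<and> x \<in> T \<and> T \<subseteq> {x \<in> topspace ?X. ?f x \<in> W}" by blast
    qed
  qed auto
  fix x i assume "x \<in> U" "i < n"
  then obtain O' where "x \<in> O'" "smooth_on n O' f" using loc by blast
  then show "(\<lambda>t. ?f (x(i := t))) differentiable at (x i)"
    using "is" \<open>i < n\<close> by (simp add: smooth_on_def)
qed

text \<open>The class for the coinduction consists of the functions that agree on \<open>U\<close>
  with some smooth function; as \<open>U\<close> is open, the derivatives agree there as
  well.\<close>

lemma smooth_on_cong:
  assumes U: "openin (Euclidean_space n) U" and f: "smooth_on n U f" and fg: "\<And>x. x \<in> U \<Longrightarrow> f x = g x"
  shows "smooth_on n U g"
proof (rule smooth_on_coinduct[OF U, where P="\<lambda>g. \<exists>f. smooth_on n U f \<and> (\<forall>x\<in>U. f x = g x)"])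
  fix g assume "\<exists>f. smooth_on n U f \<and> (\<forall>x\<in>U. f x = g x)"
  then obtain f where f: "smooth_on n U f" "\<And>x. x \<in> U \<Longrightarrow> f x = g x" by blast
  show "continuous_map (subtopology (Euclidean_space n) U) euclidean g"
    by (rule continuous_map_eq[OF smooth_on_continuous[OF f(1)]]) (simp add: f(2))
  fix i assume i: "i < n"
  have "\<forall>x\<in>U. ((\<lambda>t. g (x(i := t))) has_vector_derivative partial_deriv i f x) (at (x i))"
    using smooth_on_partial[OF f(1) _ i] has_vector_derivative_partial_cong[OF U _ i, of _ f g] f(2) by blast
  then show "\<exists>h. (\<exists>f. smooth_on n U f \<and> (\<forall>x\<in>U. f x = h x)) \<and>
      (\<forall>x\<in>U. ((\<lambda>t. g (x(i := t))) has_vector_derivative h x) (at (x i)))"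
    using smooth_on_partial_deriv[OF f(1) i] by blast
qed (use f fg in blast)

subsection \<open>Bump functions\<close>

text \<open>The functions \<open>p(1/t) exp(-1/t)\<close> on the positive axis, extended by zero. A
  polynomial factor is carried along so that the class is closed under differentiation.\<close>

definition flat :: "real poly \<Rightarrow> real \<Rightarrow> real" where
  "flat p t = (if t > 0 then poly p (inverse t) * exp (- inverse t) else 0)"

text \<open>With \<open>s = 1/t\<close> the chain rule contributes \<open>-s^2\<close>, and
  \<open>p(s) exp(-s)\<close> has derivative \<open>(p'(s) - p(s)) exp(-s)\<close> in
  \<open>s\<close>; the two \<open>pCons 0\<close> are the factor \<open>s^2\<close>.\<close>

definition flat_deriv :: "real poly \<Rightarrow> real poly" where
  "flat_deriv p = pCons 0 (pCons 0 (p - pderiv p))"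

lemma poly_times_exp_minus_tendsto_0: "((\<lambda>s. poly p s * exp (- s)) \<longlongrightarrow> (0::real)) at_top"
proof (induction p)
  case 0
  then show ?case by simp
next
  case (pCons a p)
  have *: "((\<lambda>s. s ^ k * exp (- s)) \<longlongrightarrow> (0::real)) at_top" for k
    using tendsto_power_div_exp_0[of k] by (simp add: exp_minus field_simps)
  have "((\<lambda>s. poly q s * exp (- s)) \<longlongrightarrow> (0::real)) at_top" for q
  proof -
    have "((\<lambda>s. \<Sum>i\<le>degree q. coeff q i * (s ^ i * exp (- s))) \<longlongrightarrow> (\<Sum>i\<le>degree q. coeff q i * 0)) at_top"
      by (intro tendsto_sum tendsto_mult tendsto_const *)
    then show ?thesis by (simp add: poly_altdef sum_distrib_right mult.assoc)
  qed
  then show ?case .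
qed

lemma flat_has_derivative: "(flat p has_real_derivative flat (flat_deriv p) t) (at t)"
proof (cases t "0::real" rule: linorder_cases)
  case less
  have "((\<lambda>t. 0) has_real_derivative 0) (at t)" by simp
  moreover have "\<forall>\<^sub>F s in nhds t. flat p s = 0"
    using eventually_nhds_in_open[of "{..<0}" t] less by (auto elim!: eventually_mono simp: flat_def)
  ultimately show ?thesis using less by (subst DERIV_cong_ev[OF refl _ refl]) (auto simp: flat_def)
next
  case greater
  have "((\<lambda>t. poly p (inverse t) * exp (- inverse t)) has_real_derivative flat (flat_deriv p) t) (at t)"
    using greater
    by (auto intro!: derivative_eq_intros simp: flat_def flat_deriv_def field_simps power2_eq_square)
  moreover have "\<forall>\<^sub>F s in nhds t. flat p s = poly p (inverse s) * exp (- inverse s)"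
    using eventually_nhds_in_open[of "{0<..}" t] greater by (auto elim!: eventually_mono simp: flat_def)
  ultimately show ?thesis by (subst DERIV_cong_ev[OF refl _ refl]) auto
next
  case equal
  \<comment> \<open>The difference quotient at zero from the right is again of the same form:
    dividing by \<open>h\<close> multiplies the polynomial in \<open>1/h\<close> by its variable,
    which is \<open>pCons 0 p\<close>.\<close>
  have "((\<lambda>h. poly (pCons 0 p) (inverse h) * exp (- inverse h)) \<longlongrightarrow> 0) (at_right 0)"
    using poly_times_exp_minus_tendsto_0[of "pCons 0 p"] filterlim_inverse_at_top_right
    by (rule filterlim_compose)
  then have r: "((\<lambda>h. flat p h / h) \<longlongrightarrow> 0) (at_right 0)"
    by (rule Lim_transform_eventually)
      (auto simp: flat_def eventually_at_right_less divide_inverse mult.commute mult.left_commute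
        intro!: eventually_mono[OF eventually_at_right_less[of 0]])
  have "((\<lambda>h. 0::real) \<longlongrightarrow> 0) (at_left 0)" by simp
  then have l: "((\<lambda>h. flat p h / h) \<longlongrightarrow> 0) (at_left 0)"
    by (rule Lim_transform_eventually)
      (auto simp: flat_def eventually_at_left_field intro!: exI[of _ "-1"])
  have "((\<lambda>h. flat p h / h) \<longlongrightarrow> 0) (at 0)" using l r by (simp add: filterlim_split_at)
  then show ?thesis using equal by (simp add: DERIV_def flat_def)
qed

lemma flat_pos: "t > 0 \<Longrightarrow> flat 1 t > 0" and flat_zero: "t \<le> 0 \<Longrightarrow> flat p t = 0"
  and flat_nonneg: "flat 1 t \<ge> 0"
  by (auto simp: flat_def)

text \<open>The scalar \<open>k\<close> in the class for the coinduction absorbs the factor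
  \<open>d\<close> of the chain rule, and \<open>k = 0\<close> represents the derivatives in the
  directions other than \<open>j\<close>.\<close>

lemma smooth_on_flat:
  assumes U: "openin (Euclidean_space n) U" and j: "j < n"
  shows "smooth_on n U (\<lambda>x. complex_of_real (flat p (c + d * x j)))"
proof (rule smooth_on_coinduct[OF U, where P="\<lambda>f. \<exists>k p. f = (\<lambda>x. complex_of_real (k * flat p (c + d * x j)))"])
  show "\<exists>k q. (\<lambda>x. complex_of_real (flat p (c + d * x j))) = (\<lambda>x. complex_of_real (k * flat q (c + d * x j)))"
    by (rule exI[of _ 1]) auto
next
  fix f :: "(nat \<Rightarrow> real) \<Rightarrow> complex" assume "\<exists>k p. f = (\<lambda>x. complex_of_real (k * flat p (c + d * x j)))"
  then obtain k p where f: "f = (\<lambda>x. complex_of_real (k * flat p (c + d * x j)))" by blast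
  have d: "((\<lambda>t. k * flat p (c + d * t)) has_real_derivative (k * d) * flat (flat_deriv p) (c + d * t)) (at t)" for t
    by (auto intro!: derivative_eq_intros DERIV_chain2[OF flat_has_derivative])
  have cf: "continuous_on UNIV (\<lambda>t. complex_of_real (k * flat p (c + d * t)))"
    by (rule continuous_on_of_real, rule continuous_at_imp_continuous_on) (blast intro: DERIV_isCont[OF d])
  have "continuous_map (subtopology (Euclidean_space n) U) euclideanreal (\<lambda>x. x j)"
    unfolding Euclidean_space_def by (intro continuous_map_from_subtopology continuous_map_product_projection) auto
  from continuous_map_compose[OF this cf[folded continuous_map_iff_continuous2]]
  show "continuous_map (subtopology (Euclidean_space n) U) euclidean f"
    by (simp add: f o_def)
  fix i assume "i < n"
  show "\<exists>g. (\<exists>k p. g = (\<lambda>x. complex_of_real (k * flat p (c + d * x j)))) \<and>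
     (\<forall>x\<in>U. ((\<lambda>t. f (x(i := t))) has_vector_derivative g x) (at (x i)))"
  proof (cases "i = j")
    case True
    have "((\<lambda>t. f (x(i := t))) has_vector_derivative complex_of_real ((k * d) * flat (flat_deriv p) (c + d * x j))) (at (x i))" for x
      unfolding f using has_vector_derivative_of_real[OF d[of "x i", folded has_real_derivative_iff_has_vector_derivative]]
      by (simp add: True)
    then show ?thesis by blast
  next
    case False
    then show ?thesis unfolding f
      by (intro exI[of _ "\<lambda>x. complex_of_real (0 * flat p (c + d * x j))"] conjI exI[of _ 0] exI[of _ p]) simp_all
  qed
qed

text \<open>A quotient \<open>f / (f + g)\<close>, where \<open>f\<close> is positive exactly for
  \<open>\<bar>t\<bar> < 2\<close> and \<open>g\<close> exactly for
  \<open>\<bar>t\<bar> > 1\<close>. The denominator has no zero, the quotient is 1 where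
  \<open>g\<close> vanishes and 0 where \<open>f\<close> vanishes.\<close>

definition bump1 :: "real \<Rightarrow> real" where
  "bump1 t = flat 1 (2 + t) * flat 1 (2 - t) / (flat 1 (2 + t) * flat 1 (2 - t) + (flat 1 (t - 1) + flat 1 (- 1 - t)))"

lemma bump1_denom_pos: "flat 1 (2 + t) * flat 1 (2 - t) + (flat 1 (t - 1) + flat 1 (- 1 - t)) > 0"
proof (cases "\<bar>t\<bar> < 2")
  case True
  then have "flat 1 (2 + t) * flat 1 (2 - t) > 0" by (intro mult_pos_pos flat_pos) auto
  then show ?thesis using flat_nonneg[of "t - 1"] flat_nonneg[of "- 1 - t"] by linarith
next
  case False
  then have "flat 1 (t - 1) + flat 1 (- 1 - t) > 0"
    using flat_pos[of "t - 1"] flat_pos[of "- 1 - t"] flat_nonneg[of "t - 1"] flat_nonneg[of "- 1 - t"] by linarith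
  moreover have "flat 1 (2 + t) * flat 1 (2 - t) \<ge> 0" by (intro mult_nonneg_nonneg flat_nonneg)
  ultimately show ?thesis by linarith
qed

lemma bump1_props: "bump1 t \<ge> 0" "\<bar>t\<bar> \<le> 1 \<Longrightarrow> bump1 t = 1" "\<bar>t\<bar> \<ge> 2 \<Longrightarrow> bump1 t = 0"
proof -
  show "bump1 t \<ge> 0" unfolding bump1_def
    using bump1_denom_pos[of t] by (intro divide_nonneg_pos mult_nonneg_nonneg flat_nonneg)
  show "bump1 t = 1" if "\<bar>t\<bar> \<le> 1"
    using that flat_pos[of "2 + t"] flat_pos[of "2 - t"] flat_zero[of "t - 1" 1] flat_zero[of "- 1 - t" 1]
    by (simp add: bump1_def abs_le_iff)
  show "bump1 t = 0" if "\<bar>t\<bar> \<ge> 2"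
    using that flat_zero[of "2 + t" 1] flat_zero[of "2 - t" 1] by (auto simp: bump1_def abs_if split: if_splits)
qed

lemma smooth_on_bump1:
  assumes U: "openin (Euclidean_space n) U" and j: "j < n"
  shows "smooth_on n U (\<lambda>x. complex_of_real (bump1 (c + d * x j)))"
proof -
  have fl: "smooth_on n U (\<lambda>x. complex_of_real (flat 1 (a + s * (c + d * x j))))" for a s
    using smooth_on_flat[OF U j, of 1 "a + s * c" "s * d"] by (simp add: algebra_simps)
  \<comment> \<open>All arguments of \<open>flat\<close> are written as \<open>a + s * t\<close>
    with \<open>s\<close> equal to 1 or -1, the affine form to which \<open>fl\<close>
    applies.\<close>
  define N where "N t = complex_of_real (flat 1 (2 + 1 * t)) * complex_of_real (flat 1 (2 + (-1) * t))" for t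
  define D where "D t = N t + (complex_of_real (flat 1 (-1 + 1 * t)) + complex_of_real (flat 1 (-1 + (-1) * t)))" for t
  have D: "D t = complex_of_real (flat 1 (2 + t) * flat 1 (2 - t) + (flat 1 (t - 1) + flat 1 (- 1 - t)))" for t
    by (simp add: D_def N_def)
  have nz: "D t \<noteq> 0" for t unfolding D of_real_eq_0_iff using bump1_denom_pos[of t] by linarith
  have sN: "smooth_on n U (\<lambda>x. N (c + d * x j))" unfolding N_def by (intro smooth_on_mult[OF U] fl)
  have "smooth_on n U (\<lambda>x. D (c + d * x j))" unfolding D_def by (intro smooth_on_add[OF U] sN fl)
  then have "smooth_on n U (\<lambda>x. N (c + d * x j) * inverse (D (c + d * x j)))"
    by (intro smooth_on_mult[OF U] sN smooth_on_inverse[OF U] nz)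
  moreover have "N t * inverse (D t) = complex_of_real (bump1 t)" for t
    unfolding D by (simp add: bump1_def divide_inverse N_def)
  ultimately show ?thesis by simp
qed

text \<open>A product over the coordinates and not a radial function: its support lies in a cube,
  and a cube of functions \<open>nat \<Rightarrow> real\<close> is compact as a product of compact
  factors.\<close>

definition bump :: "nat \<Rightarrow> (nat \<Rightarrow> real) \<Rightarrow> real \<Rightarrow> (nat \<Rightarrow> real) \<Rightarrow> real" where
  "bump n a r x = (\<Prod>j<n. bump1 ((x j - a j) / r))"

definition cube :: "nat \<Rightarrow> (nat \<Rightarrow> real) \<Rightarrow> real \<Rightarrow> (nat \<Rightarrow> real) set" where
  "cube n a r = {x. (\<forall>j<n. \<bar>x j - a j\<bar> \<le> r) \<and> (\<forall>j\<ge>n. x j = 0)}"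

lemma smooth_on_bump:
  assumes U: "openin (Euclidean_space n) U"
  shows "smooth_on n U (\<lambda>x. complex_of_real (bump n a r x))"
proof -
  have *: "smooth_on n U (\<lambda>x. complex_of_real (bump1 ((x j - a j) / r)))" if "j < n" for j
    using smooth_on_bump1[OF U that, of "- a j / r" "1 / r"] by (simp add: diff_divide_distrib)
  show ?thesis unfolding bump_def of_real_prod by (rule smooth_on_prod[OF U]) (simp add: *)
qed

lemma bump_nonneg: "bump n a r x \<ge> 0"
  unfolding bump_def by (intro prod_nonneg) (simp add: bump1_props)

lemma bump_one: "r > 0 \<Longrightarrow> x \<in> cube n a r \<Longrightarrow> bump n a r x = 1"
  unfolding bump_def by (intro prod.neutral) (auto simp: cube_def intro!: bump1_props(2))

lemma bump_zero:
  assumes "r > 0" "x \<in> topspace (Euclidean_space n)" "x \<notin> cube n a (2 * r)"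
  shows "bump n a r x = 0"
proof -
  obtain j where j: "j < n" "2 * r < \<bar>x j - a j\<bar>"
    using assms by (auto simp: cube_def topspace_Euclidean_space not_le)
  then have "bump1 ((x j - a j) / r) = 0" using assms(1) by (intro bump1_props(3)) (simp add: field_simps)
  then show ?thesis using j(1) unfolding bump_def by (intro prod_zero) auto
qed

text \<open>Inside the full power of the real line the cube is a product of intervals for the
  indices below \<open>n\<close> and of \<open>{0}\<close> for the others, hence compact by the
  theorem of Tychonoff.\<close>

lemma compactin_cube: "compactin (Euclidean_space n) (cube n a r)"
proof -
  have "cube n a r = Pi\<^sub>E UNIV (\<lambda>j. if j < n then cball (a j) r else {0})"
    by (auto simp: cube_def dist_real_def abs_minus_commute PiE_iff split: if_splits)
  then have "compactin (powertop_real UNIV) (cube n a r)"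
    by (simp add: compactin_PiE)
  then show ?thesis by (auto simp: Euclidean_space_def compactin_subtopology cube_def)
qed

lemma openin_open_cube: "openin (Euclidean_space n) {x \<in> topspace (Euclidean_space n). \<forall>j<n. \<bar>x j - a j\<bar> < r}"
proof -
  have "openin (Euclidean_space n) {x \<in> topspace (Euclidean_space n). \<forall>j<m. \<bar>x j - a j\<bar> < r}" for m
  proof (induction m)
    case (Suc m)
    have "continuous_map (Euclidean_space n) euclideanreal (\<lambda>x. \<bar>x m - a m\<bar>)"
      unfolding Euclidean_space_def
      by (intro continuous_map_real_abs continuous_map_diff continuous_map_from_subtopology continuous_map_product_projection) auto
    from openin_continuous_map_preimage[OF this, of "{..<r}"]
    have "openin (Euclidean_space n) {x \<in> topspace (Euclidean_space n). \<bar>x m - a m\<bar> < r}" by simp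
    from openin_Int[OF this Suc] show ?case
      by (rule back_subst[of "openin _"]) (auto simp: less_Suc_eq)
  qed simp
  then show ?thesis .
qed

lemma cube_in_open:
  assumes U: "openin (Euclidean_space n) U" and a: "a \<in> U"
  shows "\<exists>r>0. cube n a (2 * r) \<subseteq> U"
proof -
  obtain V where V: "openin (powertop_real UNIV) V" "U = V \<inter> {x. \<forall>i\<ge>n. x i = 0}"
    using U unfolding Euclidean_space_def openin_subtopology by blast
  then obtain Z where Z: "finite {i. Z i \<noteq> UNIV}" "\<And>i. open (Z i)" "a \<in> Pi\<^sub>E UNIV Z" "Pi\<^sub>E UNIV Z \<subseteq> V"
    using a unfolding openin_product_topology_alt by fastforce
  have "\<forall>i. \<exists>\<epsilon>>0. cball (a i) \<epsilon> \<subseteq> Z i"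
    using Z(2,3) open_contains_cball by (metis PiE_iff UNIV_I)
  then obtain \<epsilon> where e: "\<And>i. \<epsilon> i > 0" "\<And>i. cball (a i) (\<epsilon> i) \<subseteq> Z i" by metis
  \<comment> \<open>Only the finitely many radii below \<open>n\<close> matter; the additional 1
    keeps the set nonempty when \<open>n = 0\<close>, and the halving is due to the cube having
    radius \<open>2 * r\<close>.\<close>
  define r where "r = Min (insert 1 (\<epsilon> ` {..<n})) / 2"
  have r: "r > 0" "\<And>i. i < n \<Longrightarrow> 2 * r \<le> \<epsilon> i" using e(1) by (auto simp: r_def)
  have "cube n a (2 * r) \<subseteq> U"
  proof
    fix x assume x: "x \<in> cube n a (2 * r)"
    have "x i \<in> Z i" for i
    proof (cases "i < n")
      case True
      then have "x i \<in> cball (a i) (\<epsilon> i)"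
        using x r(2)[OF True] by (fastforce simp: cube_def dist_real_def)
      then show ?thesis using e(2) by blast
    next
      case False
      then have "x i = a i" using x openin_Euclidean_space_subset[OF U a] by (simp add: cube_def)
      then show ?thesis using Z(3) by auto
    qed
    then have "x \<in> V" using Z(4) by auto
    then show "x \<in> U" using V x by (auto simp: cube_def)
  qed
  then show ?thesis using r by blast
qed

section \<open>Sheaves of modules and differential operators\<close>

lemma is_sheafD:
  assumes "is_sheaf X F"
  shows "\<And>U V m. openin X U \<Longrightarrow> openin X V \<Longrightarrow> V \<subseteq> U \<Longrightarrow> m \<in> carrier (secs F U) \<Longrightarrow> rest F U V m \<in> carrier (secs F V)"
    and "\<And>U m. openin X U \<Longrightarrow> m \<in> carrier (secs F U) \<Longrightarrow> rest F U U m = m"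
    and "\<And>U V W m. openin X U \<Longrightarrow> openin X V \<Longrightarrow> openin X W \<Longrightarrow> W \<subseteq> V \<Longrightarrow> V \<subseteq> U \<Longrightarrow>
           m \<in> carrier (secs F U) \<Longrightarrow> rest F V W (rest F U V m) = rest F U W m"
    and "\<And>\<U> s. (\<And>U. U \<in> \<U> \<Longrightarrow> openin X U \<and> s U \<in> carrier (secs F U)) \<Longrightarrow>
            (\<And>U V. U \<in> \<U> \<Longrightarrow> V \<in> \<U> \<Longrightarrow> rest F U (U \<inter> V) (s U) = rest F V (U \<inter> V) (s V)) \<Longrightarrow>
        (\<exists>!m. m \<in> carrier (secs F (\<Union>\<U>)) \<and> (\<forall>U\<in>\<U>. rest F (\<Union>\<U>) U m = s U))"
proof -
  note A = assms[unfolded is_sheaf_def]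
  note A1 = A[THEN conjunct1] and A2 = A[THEN conjunct2, THEN conjunct1]
    and A3 = A[THEN conjunct2, THEN conjunct2, THEN conjunct1]
    and A4 = A[THEN conjunct2, THEN conjunct2, THEN conjunct2]
  fix U V W m
  assume U: "openin X U" and m: "m \<in> carrier (secs F U)"
  then show "rest F U U m = m" using A2 by simp
  assume V: "openin X V"
  {
    assume "V \<subseteq> U"
    then show "rest F U V m \<in> carrier (secs F V)" using A1 U V m by (simp add: Pi_iff)
  next
    assume "openin X W" "W \<subseteq> V" "V \<subseteq> U"
    then show "rest F V W (rest F U V m) = rest F U W m" using A3 U V m by simp
  }
next
  fix \<U> s
  assume a: "\<And>U. U \<in> \<U> \<Longrightarrow> openin X U \<and> s U \<in> carrier (secs F U)"
    and b: "\<And>U V. U \<in> \<U> \<Longrightarrow> V \<in> \<U> \<Longrightarrow> rest F U (U \<inter> V) (s U) = rest F V (U \<inter> V) (s V)"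
  have "(\<forall>U\<in>\<U>. openin X U \<and> s U \<in> carrier (secs F U)) \<and>
    (\<forall>U\<in>\<U>. \<forall>V\<in>\<U>. rest F U (U \<inter> V) (s U) = rest F V (U \<inter> V) (s V))"
    by (intro conjI ballI a b)
  then show "\<exists>!m. m \<in> carrier (secs F (\<Union>\<U>)) \<and> (\<forall>U\<in>\<U>. rest F (\<Union>\<U>) U m = s U)"
    by (rule assms[unfolded is_sheaf_def, THEN conjunct2, THEN conjunct2, THEN conjunct2, THEN spec, THEN spec, THEN mp])
qed

text \<open>The uniqueness half of the gluing axiom, applied to the family of restrictions of
  \<open>m\<close>, which both sections glue.\<close>

lemma is_sheaf_separated:
  assumes F: "is_sheaf X F" and op: "\<And>U. U \<in> \<U> \<Longrightarrow> openin X U"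
    and m: "m \<in> carrier (secs F (\<Union>\<U>))" "m' \<in> carrier (secs F (\<Union>\<U>))"
    and eq: "\<And>U. U \<in> \<U> \<Longrightarrow> rest F (\<Union>\<U>) U m = rest F (\<Union>\<U>) U m'"
  shows "m = m'"
proof -
  note D = is_sheafD[OF F]
  have oU: "openin X (\<Union>\<U>)" using op by blast
  have "\<exists>!n. n \<in> carrier (secs F (\<Union>\<U>)) \<and> (\<forall>U\<in>\<U>. rest F (\<Union>\<U>) U n = rest F (\<Union>\<U>) U m)"
  proof (rule D(4))
    fix U assume U: "U \<in> \<U>"
    then show "openin X U \<and> rest F (\<Union>\<U>) U m \<in> carrier (secs F U)"
      using D(1)[OF oU op[OF U] _ m(1)] op[OF U] by (simp add: Union_upper)
    fix V assume V: "V \<in> \<U>"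
    have "openin X (U \<inter> V)" using op U V by blast
    then show "rest F U (U \<inter> V) (rest F (\<Union>\<U>) U m) = rest F V (U \<inter> V) (rest F (\<Union>\<U>) V m)"
      using D(3)[OF oU op[OF U] _ _ _ m(1), of "U \<inter> V"] D(3)[OF oU op[OF V] _ _ _ m(1), of "U \<inter> V"] U V
      by (simp add: Union_upper)
  qed
  then show ?thesis using m eq by (metis (no_types, lifting))
qed

lemma is_sheaf_separated2:
  assumes F: "is_sheaf X F" and A: "openin X A" and B: "openin X B" and W: "W = A \<union> B"
    and m: "m \<in> carrier (secs F W)" "m' \<in> carrier (secs F W)"
    and eq: "rest F W A m = rest F W A m'" "rest F W B m = rest F W B m'"
  shows "m = m'"
proof -
  have W': "W = \<Union>{A, B}" using W by simp
  show ?thesis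
    by (rule is_sheaf_separated[OF F, of "{A, B}"]) (use A B m eq in \<open>auto simp: W' simp del: Union_insert\<close>)
qed

lemma is_sheaf_glue2:
  assumes F: "is_sheaf X F" and A: "openin X A" and B: "openin X B" and W: "W = A \<union> B"
    and s: "s \<in> carrier (secs F A)" and t: "t \<in> carrier (secs F B)"
    and eq: "rest F A (A \<inter> B) s = rest F B (A \<inter> B) t"
  shows "\<exists>m\<in>carrier (secs F W). rest F W A m = s \<and> rest F W B m = t"
proof -
  note D = is_sheafD[OF F]
  have W': "\<Union>{A, B} = W" using W by simp
  define s' where "s' U = (if U = A then s else t)" for U
  have "\<exists>!m. m \<in> carrier (secs F (\<Union>{A, B})) \<and> (\<forall>U\<in>{A, B}. rest F (\<Union>{A, B}) U m = s' U)"
  proof (rule D(4))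
    fix U V assume U: "U \<in> {A, B}" and V: "V \<in> {A, B}"
    then show "rest F U (U \<inter> V) (s' U) = rest F V (U \<inter> V) (s' V)"
      using eq by (auto simp: s'_def Int_commute)
  qed (use A B s t in \<open>auto simp: s'_def\<close>)
  then obtain m where m: "m \<in> carrier (secs F W)" "rest F W A m = s' A" "rest F W B m = s' B"
    unfolding W' by blast
  \<comment> \<open>For \<open>A = B\<close> the family \<open>s'\<close> has the value
    \<open>s\<close> at \<open>B\<close>; then agreement on the intersection is the equation
    \<open>s = t\<close>.\<close>
  have "s' B = t"
  proof (cases "A = B")
    case True
    then have "s = t" using eq D(2)[OF A s] D(2)[OF B t] by simp
    then show ?thesis by (simp add: s'_def)
  qed (auto simp: s'_def)
  then show ?thesis using m by (auto simp: s'_def)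
qed

section \<open>Rings and modules of sections\<close>

locale cringed =
  fixes M :: "('p, 's) ringed_space"
  assumes crs: "c_ringed_space M"
begin

abbreviation "opn \<equiv> openin (base M)"
abbreviation "TT \<equiv> topspace (base M)"
abbreviation "RR \<equiv> secs (str M)"

lemma sheafO: "is_sheaf (base M) (str M)" using crs by (simp add: c_ringed_space_def)
lemma algebraO: "opn U \<Longrightarrow> algebra complex_ring (RR U)" using crs by (simp add: c_ringed_space_def)
lemma cringO: "opn U \<Longrightarrow> cring (RR U)" using algebraO algebra_def by blast
lemmas O_rest = is_sheafD(1-3)[OF sheafO]

lemma cring_complex: "cring complex_ring"
  using algebraO[OF openin_topspace] by (simp add: algebra_def Module.module_def)

lemma O_rest_hom:
  assumes "opn U" "opn V" "V \<subseteq> U"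
  shows "rest (str M) U V \<in> ring_hom (RR U) (RR V)"
  using crs assms by (simp add: c_ringed_space_def)

lemma O_rest_smult:
  assumes "opn U" "opn V" "V \<subseteq> U" "f \<in> carrier (RR U)"
  shows "rest (str M) U V (c \<odot>\<^bsub>RR U\<^esub> f) = c \<odot>\<^bsub>RR V\<^esub> rest (str M) U V f"
  using crs assms by (simp add: c_ringed_space_def)

lemma O_one_in: "opn U \<Longrightarrow> \<one>\<^bsub>RR U\<^esub> \<in> carrier (RR U)"
  using cringO[of U] by (simp add: cring.cring_simprules)

lemma O_zero_in: "opn U \<Longrightarrow> \<zero>\<^bsub>RR U\<^esub> \<in> carrier (RR U)"
  using cringO[of U] by (simp add: cring.cring_simprules)

lemma O_const_in: "opn U \<Longrightarrow> c \<odot>\<^bsub>RR U\<^esub> \<one>\<^bsub>RR U\<^esub> \<in> carrier (RR U)"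
  using Module.module.smult_closed[of complex_ring "RR U" c "\<one>\<^bsub>RR U\<^esub>"] algebraO[of U] O_one_in[of U]
  by (simp add: algebra_def complex_ring_def)

lemma O_rest_const:
  assumes "opn U" "opn V" "V \<subseteq> U"
  shows "rest (str M) U V (c \<odot>\<^bsub>RR U\<^esub> \<one>\<^bsub>RR U\<^esub>) = c \<odot>\<^bsub>RR V\<^esub> \<one>\<^bsub>RR V\<^esub>"
  using O_rest_smult[OF assms O_one_in[OF assms(1)]] ring_hom_one[OF O_rest_hom[OF assms]] by simp

lemma O_rest_zero:
  assumes "opn U" "opn V" "V \<subseteq> U"
  shows "rest (str M) U V \<zero>\<^bsub>RR U\<^esub> = \<zero>\<^bsub>RR V\<^esub>"
  by (rule ring_hom_zero[OF O_rest_hom[OF assms]])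
    (use cringO assms cring.axioms(1) in auto)

end

locale msheaf = cringed M
  for M :: "('p, 's) ringed_space" +
  fixes F :: "('p, 's, 'f) sheaf_data"
  assumes mods: "sheaf_of_modules M F"
begin

abbreviation "FF \<equiv> secs F"

lemma sheafF: "is_sheaf (base M) F" using mods by (simp add: sheaf_of_modules_def)
lemma moduleF: "opn U \<Longrightarrow> Module.module (RR U) (FF U)" using mods by (simp add: sheaf_of_modules_def)
lemmas F_rest = is_sheafD(1-3)[OF sheafF]

lemma F_rest_add:
  "opn U \<Longrightarrow> opn V \<Longrightarrow> V \<subseteq> U \<Longrightarrow> u \<in> carrier (FF U) \<Longrightarrow> v \<in> carrier (FF U) \<Longrightarrow>
    rest F U V (u \<oplus>\<^bsub>FF U\<^esub> v) = rest F U V u \<oplus>\<^bsub>FF V\<^esub> rest F U V v"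
  using mods by (simp add: sheaf_of_modules_def)

lemma F_rest_smult:
  "opn U \<Longrightarrow> opn V \<Longrightarrow> V \<subseteq> U \<Longrightarrow> f \<in> carrier (RR U) \<Longrightarrow> u \<in> carrier (FF U) \<Longrightarrow>
    rest F U V (f \<odot>\<^bsub>FF U\<^esub> u) = rest (str M) U V f \<odot>\<^bsub>FF V\<^esub> rest F U V u"
  using mods by (simp add: sheaf_of_modules_def)

context
  fixes U assumes U: "opn U"
begin

interpretation m: Module.module "RR U" "FF U" by (rule moduleF[OF U])
lemma F_zero_in: "\<zero>\<^bsub>FF U\<^esub> \<in> carrier (FF U)" by simp
lemma F_add_in: "u \<in> carrier (FF U) \<Longrightarrow> v \<in> carrier (FF U) \<Longrightarrow> u \<oplus>\<^bsub>FF U\<^esub> v \<in> carrier (FF U)" by simp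
lemma F_minus_in: "u \<in> carrier (FF U) \<Longrightarrow> v \<in> carrier (FF U) \<Longrightarrow> u \<ominus>\<^bsub>FF U\<^esub> v \<in> carrier (FF U)" by simp
lemma F_smult_in: "f \<in> carrier (RR U) \<Longrightarrow> u \<in> carrier (FF U) \<Longrightarrow> f \<odot>\<^bsub>FF U\<^esub> u \<in> carrier (FF U)" by simp
lemma F_add_zero: "u \<in> carrier (FF U) \<Longrightarrow> u \<oplus>\<^bsub>FF U\<^esub> \<zero>\<^bsub>FF U\<^esub> = u" by simp
lemma F_minus_self: "u \<in> carrier (FF U) \<Longrightarrow> u \<ominus>\<^bsub>FF U\<^esub> u = \<zero>\<^bsub>FF U\<^esub>" by (simp add: a_minus_def m.M.r_neg)
lemma F_smult_zero: "u \<in> carrier (FF U) \<Longrightarrow> \<zero>\<^bsub>RR U\<^esub> \<odot>\<^bsub>FF U\<^esub> u = \<zero>\<^bsub>FF U\<^esub>" by simp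
lemma F_smult_zero_right: "f \<in> carrier (RR U) \<Longrightarrow> f \<odot>\<^bsub>FF U\<^esub> \<zero>\<^bsub>FF U\<^esub> = \<zero>\<^bsub>FF U\<^esub>" by simp
lemma F_smult_one: "u \<in> carrier (FF U) \<Longrightarrow> \<one>\<^bsub>RR U\<^esub> \<odot>\<^bsub>FF U\<^esub> u = u" by simp
lemma F_smult_add: "f \<in> carrier (RR U) \<Longrightarrow> u \<in> carrier (FF U) \<Longrightarrow> v \<in> carrier (FF U) \<Longrightarrow>
   f \<odot>\<^bsub>FF U\<^esub> (u \<oplus>\<^bsub>FF U\<^esub> v) = f \<odot>\<^bsub>FF U\<^esub> u \<oplus>\<^bsub>FF U\<^esub> f \<odot>\<^bsub>FF U\<^esub> v" by (simp add: m.smult_r_distr)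
lemma F_add_smult: "f \<in> carrier (RR U) \<Longrightarrow> g \<in> carrier (RR U) \<Longrightarrow> u \<in> carrier (FF U) \<Longrightarrow>
   (f \<oplus>\<^bsub>RR U\<^esub> g) \<odot>\<^bsub>FF U\<^esub> u = f \<odot>\<^bsub>FF U\<^esub> u \<oplus>\<^bsub>FF U\<^esub> g \<odot>\<^bsub>FF U\<^esub> u" by (simp add: m.smult_l_distr)
lemma F_smult_smult: "f \<in> carrier (RR U) \<Longrightarrow> g \<in> carrier (RR U) \<Longrightarrow> u \<in> carrier (FF U) \<Longrightarrow>
   (f \<otimes>\<^bsub>RR U\<^esub> g) \<odot>\<^bsub>FF U\<^esub> u = f \<odot>\<^bsub>FF U\<^esub> (g \<odot>\<^bsub>FF U\<^esub> u)" by (simp add: m.smult_assoc1)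
lemma F_smult_comm: "f \<in> carrier (RR U) \<Longrightarrow> g \<in> carrier (RR U) \<Longrightarrow> u \<in> carrier (FF U) \<Longrightarrow>
   f \<odot>\<^bsub>FF U\<^esub> (g \<odot>\<^bsub>FF U\<^esub> u) = g \<odot>\<^bsub>FF U\<^esub> (f \<odot>\<^bsub>FF U\<^esub> u)"
  by (metis F_smult_smult m.m_comm)
lemma F_cscale_in: "u \<in> carrier (FF U) \<Longrightarrow> sheaf_cscale M F U c u \<in> carrier (FF U)"
  unfolding sheaf_cscale_def by (intro F_smult_in O_const_in U)
lemma F_idem_zero: "u \<in> carrier (FF U) \<Longrightarrow> u \<oplus>\<^bsub>FF U\<^esub> u = u \<Longrightarrow> u = \<zero>\<^bsub>FF U\<^esub>"
  by (metis m.M.add.l_cancel_one')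
lemma F_uminus_eq: "u \<in> carrier (FF U) \<Longrightarrow> v \<in> carrier (FF U) \<Longrightarrow> v \<oplus>\<^bsub>FF U\<^esub> u = \<zero>\<^bsub>FF U\<^esub> \<Longrightarrow> \<ominus>\<^bsub>FF U\<^esub> u = v"
  by (rule m.M.minus_equality)
lemma F_uminus_in: "u \<in> carrier (FF U) \<Longrightarrow> \<ominus>\<^bsub>FF U\<^esub> u \<in> carrier (FF U)" by simp
lemma F_uminus_add: "u \<in> carrier (FF U) \<Longrightarrow> \<ominus>\<^bsub>FF U\<^esub> u \<oplus>\<^bsub>FF U\<^esub> u = \<zero>\<^bsub>FF U\<^esub>" by (rule m.M.l_neg)

end

lemma F_rest_zero:
  assumes "opn U" "opn V" "V \<subseteq> U"
  shows "rest F U V \<zero>\<^bsub>FF U\<^esub> = \<zero>\<^bsub>FF V\<^esub>"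
proof (rule F_idem_zero[OF assms(2)])
  note z = F_zero_in[OF assms(1)]
  show "rest F U V \<zero>\<^bsub>FF U\<^esub> \<in> carrier (FF V)" by (rule F_rest(1)[OF assms z])
  show "rest F U V \<zero>\<^bsub>FF U\<^esub> \<oplus>\<^bsub>FF V\<^esub> rest F U V \<zero>\<^bsub>FF U\<^esub> = rest F U V \<zero>\<^bsub>FF U\<^esub>"
    using F_rest_add[OF assms z z] F_add_zero[OF assms(1) z] by simp
qed

lemma F_rest_minus:
  assumes o: "opn U" "opn V" "V \<subseteq> U" and u: "u \<in> carrier (FF U)" "v \<in> carrier (FF U)"
  shows "rest F U V (u \<ominus>\<^bsub>FF U\<^esub> v) = rest F U V u \<ominus>\<^bsub>FF V\<^esub> rest F U V v"
proof -
  note v' = F_uminus_in[OF o(1) u(2)]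
  have "\<ominus>\<^bsub>FF V\<^esub> rest F U V v = rest F U V (\<ominus>\<^bsub>FF U\<^esub> v)"
    using F_rest_add[OF o v' u(2)] F_uminus_add[OF o(1) u(2)] F_rest_zero[OF o]
    by (intro F_uminus_eq[OF o(2)] F_rest(1)[OF o] u v') simp
  then show ?thesis unfolding a_minus_def using F_rest_add[OF o u(1) v'] by simp
qed

lemma F_rest_cscale:
  assumes "opn U" "opn V" "V \<subseteq> U" "u \<in> carrier (FF U)"
  shows "rest F U V (sheaf_cscale M F U c u) = sheaf_cscale M F V c (rest F U V u)"
  unfolding sheaf_cscale_def
  using F_rest_smult[OF assms(1-3) O_const_in[OF assms(1)] assms(4)] O_rest_const[OF assms(1-3)] by simp

text \<open>Extension by zero from \<open>W \<inter> V\<close> to \<open>W\<close>, for a section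
  that vanishes off the closed set \<open>C\<close>. It is applied both to sections on which
  operators act and to values of operators.\<close>

definition ext0 :: "'p set \<Rightarrow> 'p set \<Rightarrow> 'p set \<Rightarrow> 'f \<Rightarrow> 'f" where
  "ext0 W V C s = (THE m. m \<in> carrier (FF W) \<and> rest F W (W \<inter> V) m = s \<and>
      rest F W (W - C) m = \<zero>\<^bsub>FF (W - C)\<^esub>)"

text \<open>Since \<open>C \<subseteq> V\<close>, the open sets \<open>W \<inter> V\<close> and
  \<open>W - C\<close> cover \<open>W\<close>.\<close>

lemma ext0_unique:
  assumes W: "opn W" and V: "opn V" and C: "closedin (base M) C" "C \<subseteq> V"
    and m: "m \<in> carrier (FF W)" "m' \<in> carrier (FF W)"
    and eq: "rest F W (W \<inter> V) m = rest F W (W \<inter> V) m'" "rest F W (W - C) m = rest F W (W - C) m'"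
  shows "m = m'"
  by (rule is_sheaf_separated2[OF sheafF, of "W \<inter> V" "W - C" W])
    (use assms in \<open>auto intro: openin_diff\<close>)

lemma ext0:
  assumes W: "opn W" and V: "opn V" and C: "closedin (base M) C" "C \<subseteq> V"
    and s: "s \<in> carrier (FF (W \<inter> V))" "rest F (W \<inter> V) (W \<inter> V - C) s = \<zero>\<^bsub>FF (W \<inter> V - C)\<^esub>"
  shows "ext0 W V C s \<in> carrier (FF W)" "rest F W (W \<inter> V) (ext0 W V C s) = s"
    "rest F W (W - C) (ext0 W V C s) = \<zero>\<^bsub>FF (W - C)\<^esub>"
proof -
  have o: "opn (W \<inter> V)" "opn (W - C)" "opn (W \<inter> V - C)" using W V C by (auto intro: openin_diff)
  have i: "(W \<inter> V) \<inter> (W - C) = W \<inter> V - C" by auto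
  have "rest F (W - C) (W \<inter> V - C) \<zero>\<^bsub>FF (W - C)\<^esub> = \<zero>\<^bsub>FF (W \<inter> V - C)\<^esub>"
    by (rule F_rest_zero) (use o in auto)
  then have agree: "rest F (W \<inter> V) ((W \<inter> V) \<inter> (W - C)) s = rest F (W - C) ((W \<inter> V) \<inter> (W - C)) \<zero>\<^bsub>FF (W - C)\<^esub>"
    unfolding i using s(2) by simp
  have un: "W = (W \<inter> V) \<union> (W - C)" using C(2) by auto
  from is_sheaf_glue2[OF sheafF o(1,2) un s(1) F_zero_in[OF o(2)] agree]
  obtain m where m: "m \<in> carrier (FF W)" "rest F W (W \<inter> V) m = s" "rest F W (W - C) m = \<zero>\<^bsub>FF (W - C)\<^esub>"
    by (elim bexE conjE) (rule that)
  have "ext0 W V C s = m" unfolding ext0_def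
  proof (rule the_equality)
    show "m \<in> carrier (FF W) \<and> rest F W (W \<inter> V) m = s \<and> rest F W (W - C) m = \<zero>\<^bsub>FF (W - C)\<^esub>"
      by (intro conjI m)
    fix m' assume "m' \<in> carrier (FF W) \<and> rest F W (W \<inter> V) m' = s \<and> rest F W (W - C) m' = \<zero>\<^bsub>FF (W - C)\<^esub>"
    then show "m' = m" using ext0_unique[OF W V C _ m(1), of m'] m(2,3) by simp
  qed
  then show "ext0 W V C s \<in> carrier (FF W)" "rest F W (W \<inter> V) (ext0 W V C s) = s"
    "rest F W (W - C) (ext0 W V C s) = \<zero>\<^bsub>FF (W - C)\<^esub>" using m by auto
qed

end

section \<open>Operators between two sheaves of modules and their supports\<close>

locale msheaf2 = F: msheaf M F + G: msheaf M G
  for M :: "('p, 's) ringed_space" and F :: "('p, 's, 'f) sheaf_data" and G :: "('p, 's, 'g) sheaf_data"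
begin

abbreviation "opn \<equiv> openin (base M)"
abbreviation "RR \<equiv> secs (str M)"
abbreviation "FF \<equiv> secs F"
abbreviation "GG \<equiv> secs G"
abbreviation "comm \<equiv> commutator M F G"

lemma homD:
  assumes "D \<in> sheaf_homs M U F G" "opn V" "V \<subseteq> U" "u \<in> carrier (FF V)"
  shows "D V u \<in> carrier (GG V)"
    "v \<in> carrier (FF V) \<Longrightarrow> D V (u \<oplus>\<^bsub>FF V\<^esub> v) = D V u \<oplus>\<^bsub>GG V\<^esub> D V v"
    "D V (sheaf_cscale M F V c u) = sheaf_cscale M G V c (D V u)"
    "opn W \<Longrightarrow> W \<subseteq> V \<Longrightarrow> D W (rest F V W u) = rest G V W (D V u)"
  using assms by (auto simp: sheaf_homs_def)

lemma hom_outside: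
  assumes "D \<in> sheaf_homs M U F G" "\<not> (opn V \<and> V \<subseteq> U \<and> u \<in> carrier (FF V))"
  shows "D V u = \<zero>\<^bsub>GG V\<^esub>"
  using assms by (auto simp: sheaf_homs_def)

lemma hom_zero:
  assumes D: "D \<in> sheaf_homs M U F G" and V: "opn V" "V \<subseteq> U"
  shows "D V \<zero>\<^bsub>FF V\<^esub> = \<zero>\<^bsub>GG V\<^esub>"
proof (rule G.F_idem_zero[OF V(1)])
  note z = F.F_zero_in[OF V(1)]
  show "D V \<zero>\<^bsub>FF V\<^esub> \<in> carrier (GG V)" by (rule homD(1)[OF D V z])
  show "D V \<zero>\<^bsub>FF V\<^esub> \<oplus>\<^bsub>GG V\<^esub> D V \<zero>\<^bsub>FF V\<^esub> = D V \<zero>\<^bsub>FF V\<^esub>"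
    using homD(2)[OF D V z z] F.F_add_zero[OF V(1) z] by simp
qed

text \<open>The values of an operator are sections of a sheaf, so their vanishing can be tested on a
  cover. Consequently the complement of \<open>op_support\<close> is itself a set on which the
  operator is zero.\<close>

lemma zero_on_Union:
  assumes D: "D \<in> sheaf_homs M U F G"
    and Z: "\<And>V. V \<in> \<Z> \<Longrightarrow> opn V \<and> V \<subseteq> U \<and> zero_on M F G V D"
  shows "zero_on M F G (\<Union>\<Z>) D"
  unfolding zero_on_def
proof (intro allI impI ballI)
  fix W u assume W: "opn W \<and> W \<subseteq> \<Union>\<Z>" and u: "u \<in> carrier (FF W)"
  have WU: "W \<subseteq> U" using W Z by blast
  let ?\<W> = "(\<lambda>V. W \<inter> V) ` \<Z>"
  have UW: "\<Union>?\<W> = W" using W by auto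
  have z: "rest G W V (D W u) = \<zero>\<^bsub>GG V\<^esub>" if V: "V \<in> ?\<W>" for V
  proof -
    obtain V' where V': "V' \<in> \<Z>" "V = W \<inter> V'" using V by blast
    have o: "opn V" "V \<subseteq> W" "V \<subseteq> V'" using V' W Z by auto
    have "rest G W V (D W u) = D V (rest F W V u)" using homD(4)[OF D _ WU u o(1,2)] W by simp
    also have "\<dots> = \<zero>\<^bsub>GG V\<^esub>"
      using Z[OF V'(1)] o F.F_rest(1)[OF _ o(1,2) u] W by (simp add: zero_on_def)
    finally show ?thesis .
  qed
  show "D W u = \<zero>\<^bsub>GG W\<^esub>"
  proof (rule is_sheaf_separated[OF G.sheafF, of ?\<W>, unfolded UW])
    fix V assume V: "V \<in> ?\<W>"
    then show o: "opn V" using W Z by auto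
    show "rest G W V (D W u) = rest G W V \<zero>\<^bsub>GG W\<^esub>"
      using z[OF V] G.F_rest_zero[of W V] W o V by auto
  qed (use homD(1)[OF D _ WU u] G.F_zero_in W in auto)
qed

lemma zero_off_support:
  assumes D: "D \<in> sheaf_homs M U F G"
  shows "zero_on M F G (U - op_support M U F G D) D"
proof -
  have "U - op_support M U F G D = \<Union>{V. opn V \<and> V \<subseteq> U \<and> zero_on M F G V D}"
    by (auto simp: op_support_def)
  then show ?thesis using zero_on_Union[OF D, of "{V. opn V \<and> V \<subseteq> U \<and> zero_on M F G V D}"] by simp
qed

lemma op_support_subset:
  assumes "opn U" "closedin (base M) C" "zero_on M F G (U - C) D"
  shows "op_support M U F G D \<subseteq> C"
  using openin_diff[OF assms(1,2)] assms(3) by (auto simp: op_support_def)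

text \<open>By definition the support is closed only relative to \<open>U\<close>. Lying in a
  compact \<open>C \<subseteq> U\<close>, it is the intersection of \<open>C\<close> with a closed
  set of the whole space.\<close>

lemma compactin_op_support:
  assumes C: "compactin (base M) C" "op_support M U F G D \<subseteq> C" "C \<subseteq> U"
  shows "compactin (base M) (op_support M U F G D)"
proof -
  let ?Z = "\<Union>{V. opn V \<and> V \<subseteq> U \<and> zero_on M F G V D}"
  have "opn ?Z" by (rule openin_Union) auto
  then have "compactin (base M) (C \<inter> (topspace (base M) - ?Z))"
    by (intro compact_Int_closedin C(1) closedin_diff) auto
  moreover have "C \<inter> (topspace (base M) - ?Z) = op_support M U F G D"
    using C compactin_subset_topspace[OF C(1)] by (auto simp: op_support_def)
  ultimately show ?thesis by simp
qed

lemma zero_on_subset: "zero_on M F G V D \<Longrightarrow> W \<subseteq> V \<Longrightarrow> zero_on M F G W D"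
  unfolding zero_on_def by blast

subsection \<open>Precomposition with a section and restriction\<close>

text \<open>The operator \<open>u \<mapsto> D (h u)\<close> over \<open>V\<close>. Precomposition is
  used and not multiplication of the values, because on the level of functionals it is the passage
  from \<open>\<eta>\<close> to \<open>\<eta>(h u)\<close>; the two operations differ by a
  commutator.\<close>

definition mulres :: "'s \<Rightarrow> 'p set \<Rightarrow> ('p set \<Rightarrow> 'f \<Rightarrow> 'g) \<Rightarrow> 'p set \<Rightarrow> 'f \<Rightarrow> 'g" where
  "mulres h V D = (\<lambda>W u. if opn W \<and> W \<subseteq> V \<and> u \<in> carrier (FF W)
     then D W (rest (str M) (topspace (base M)) W h \<odot>\<^bsub>FF W\<^esub> u) else \<zero>\<^bsub>GG W\<^esub>)"

abbreviation "TT \<equiv> topspace (base M)"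

context
  fixes h assumes h: "h \<in> carrier (RR TT)"
begin

abbreviation "hr W \<equiv> rest (str M) TT W h"

lemma hr: "opn W \<Longrightarrow> hr W \<in> carrier (RR W)"
  by (rule F.O_rest(1)[OF _ _ _ h]) (auto dest: openin_subset)

lemma hr_smult: "opn W \<Longrightarrow> u \<in> carrier (FF W) \<Longrightarrow> hr W \<odot>\<^bsub>FF W\<^esub> u \<in> carrier (FF W)"
  by (intro F.F_smult_in hr)

lemma hr_rest: "opn W \<Longrightarrow> opn W' \<Longrightarrow> W' \<subseteq> W \<Longrightarrow> rest (str M) W W' (hr W) = hr W'"
  by (rule F.O_rest(3)[OF _ _ _ _ _ h]) (auto dest: openin_subset)

lemma mulres_hom:
  assumes D: "D \<in> sheaf_homs M TT F G" and V: "opn V"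
  shows "mulres h V D \<in> sheaf_homs M V F G"
proof -
  have VT: "V \<subseteq> TT" by (rule openin_subset[OF V])
  show ?thesis unfolding sheaf_homs_def mem_Collect_eq
  proof (intro conjI allI impI ballI funcsetI)
    fix W u assume W: "opn W \<and> W \<subseteq> V" and u: "u \<in> carrier (FF W)"
    then have o: "opn W" "W \<subseteq> TT" "W \<subseteq> V" using VT by auto
    note hu = hr_smult[OF o(1) u]
    show "mulres h V D W u \<in> carrier (GG W)" using homD(1)[OF D o(1,2) hu] o u by (simp add: mulres_def)
    {
      fix v assume v: "v \<in> carrier (FF W)"
      show "mulres h V D W (u \<oplus>\<^bsub>FF W\<^esub> v) = mulres h V D W u \<oplus>\<^bsub>GG W\<^esub> mulres h V D W v"
        using homD(2)[OF D o(1,2) hu hr_smult[OF o(1) v]] F.F_smult_add[OF o(1) hr[OF o(1)] u v] u v o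
          F.F_add_in[OF o(1) u v] by (simp add: mulres_def)
    next
      fix c
      have "hr W \<odot>\<^bsub>FF W\<^esub> sheaf_cscale M F W c u = sheaf_cscale M F W c (hr W \<odot>\<^bsub>FF W\<^esub> u)"
        unfolding sheaf_cscale_def by (rule F.F_smult_comm[OF o(1) hr[OF o(1)] F.O_const_in[OF o(1)] u])
      then show "mulres h V D W (sheaf_cscale M F W c u) = sheaf_cscale M G W c (mulres h V D W u)"
        using homD(3)[OF D o(1,2) hu] u o F.F_cscale_in[OF o(1) u] by (simp add: mulres_def)
    }
  next
    fix W W' u assume *: "opn W \<and> opn W' \<and> W' \<subseteq> W \<and> W \<subseteq> V" and u: "u \<in> carrier (FF W)"
    then have o: "opn W" "W \<subseteq> TT" "W \<subseteq> V" "opn W'" "W' \<subseteq> W" using VT by auto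
    have "hr W' \<odot>\<^bsub>FF W'\<^esub> rest F W W' u = rest F W W' (hr W \<odot>\<^bsub>FF W\<^esub> u)"
      using F.F_rest_smult[OF o(1,4,5) hr[OF o(1)] u] hr_rest[OF o(1,4,5)] by simp
    then show "mulres h V D W' (rest F W W' u) = rest G W W' (mulres h V D W u)"
      using homD(4)[OF D o(1,2) hr_smult[OF o(1) u] o(4,5)] u o F.F_rest(1)[OF o(1,4,5) u]
      by (simp add: mulres_def subset_trans[OF o(5,3)])
  qed (auto simp: mulres_def)
qed

text \<open>The structure sheaf is commutative, so multiplication by \<open>h\<close> on the
  argument passes through every commutator. Hence \<open>mulres\<close> does not raise the
  order.\<close>

lemma fold_comm_mulres:
  assumes V0: "opn V0" and "set fs \<subseteq> carrier (RR V0)"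
    and "\<And>W u. opn W \<Longrightarrow> W \<subseteq> V0 \<Longrightarrow> u \<in> carrier (FF W) \<Longrightarrow> D' W u = D W (hr W \<odot>\<^bsub>FF W\<^esub> u)"
    and "opn W" "W \<subseteq> V0" "u \<in> carrier (FF W)"
  shows "fold (comm V0) fs D' W u = fold (comm V0) fs D W (hr W \<odot>\<^bsub>FF W\<^esub> u)"
  using assms(2-)
proof (induction fs arbitrary: D D' W u)
  case (Cons f fs)
  have "fold (comm V0) fs (comm V0 f D') W u = fold (comm V0) fs (comm V0 f D) W (hr W \<odot>\<^bsub>FF W\<^esub> u)"
  proof (rule Cons.IH)
    fix W u assume W: "opn W" "W \<subseteq> V0" and u: "u \<in> carrier (FF W)"
    have f: "rest (str M) V0 W f \<in> carrier (RR W)" using Cons.prems(1) by (intro F.O_rest(1)[OF V0 W]) auto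
    show "comm V0 f D' W u = comm V0 f D W (hr W \<odot>\<^bsub>FF W\<^esub> u)"
      unfolding commutator_def
      using Cons.prems(2)[OF W u] Cons.prems(2)[OF W F.F_smult_in[OF W(1) f u]]
        F.F_smult_comm[OF W(1) hr[OF W(1)] f u] by simp
  qed (use Cons.prems in auto)
  then show ?case by simp
qed simp

lemma mulres_order:
  assumes D: "order_le M A F G r D" and A': "A' \<subseteq> A" "A' \<subseteq> V"
  shows "order_le M A' F G r (mulres h V D)"
  unfolding order_le_def zero_on_def
proof (intro allI impI ballI)
  fix V0 fs W u
  assume 1: "opn V0 \<and> V0 \<subseteq> A' \<and> length fs = Suc r \<and> set fs \<subseteq> carrier (RR V0)"
    and W: "opn W \<and> W \<subseteq> V0" and u: "u \<in> carrier (FF W)"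
  have "fold (comm V0) fs (mulres h V D) W u = fold (comm V0) fs D W (hr W \<odot>\<^bsub>FF W\<^esub> u)"
    by (rule fold_comm_mulres) (use 1 W u A' in \<open>auto simp: mulres_def\<close>)
  also have "\<dots> = \<zero>\<^bsub>GG W\<^esub>"
    using D 1 W A' hr_smult[of W u] u unfolding order_le_def zero_on_def by (meson subset_trans)
  finally show "fold (comm V0) fs (mulres h V D) W u = \<zero>\<^bsub>GG W\<^esub>" .
qed

lemma mulres_zero_on:
  assumes D: "D \<in> sheaf_homs M TT F G" and V: "opn V" and C: "closedin (base M) C"
    and h0: "hr (TT - C) = \<zero>\<^bsub>RR (TT - C)\<^esub>"
  shows "zero_on M F G (V - C) (mulres h V D)"
  unfolding zero_on_def
proof (intro allI impI ballI)
  fix W u assume W: "opn W \<and> W \<subseteq> V - C" and u: "u \<in> carrier (FF W)"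
  have o: "opn W" "opn (TT - C)" "W \<subseteq> TT - C" "W \<subseteq> TT"
    using W C openin_subset[of "base M" W] by auto
  have "hr W = \<zero>\<^bsub>RR W\<^esub>" using hr_rest[OF o(2,1,3)] F.O_rest_zero[OF o(2,1,3)] h0 by simp
  then show "mulres h V D W u = \<zero>\<^bsub>GG W\<^esub>"
    using F.F_smult_zero[OF o(1) u] hom_zero[OF D o(1,4)] by (simp add: mulres_def)
qed

lemma mulres_diff_ops:
  assumes D: "D \<in> diff_ops M TT F G" and V: "opn V"
  shows "mulres h V D \<in> diff_ops M V F G"
  unfolding diff_ops_def mem_Collect_eq
proof (intro conjI ballI)
  show "mulres h V D \<in> sheaf_homs M V F G" using D mulres_hom V by (auto simp: diff_ops_def)
  fix a assume a: "a \<in> V"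
  then have "a \<in> TT" using openin_subset[OF V] by auto
  then obtain V1 r where V1: "opn V1" "a \<in> V1" "order_le M V1 F G r D" using D by (auto simp: diff_ops_def)
  show "\<exists>V' r. opn V' \<and> a \<in> V' \<and> V' \<subseteq> V \<and> order_le M V' F G r (mulres h V D)"
    by (intro exI[of _ "V1 \<inter> V"] exI[of _ r] conjI mulres_order[OF V1(3)]) (use V1 V a in auto)
qed

lemma mulres_Diff_c:
  assumes D: "D \<in> diff_ops M TT F G" and V: "opn V"
    and C: "closedin (base M) C" "compactin (base M) C" "C \<subseteq> V" and h0: "hr (TT - C) = \<zero>\<^bsub>RR (TT - C)\<^esub>"
  shows "mulres h V D \<in> Diff_c M V F G" "op_support M V F G (mulres h V D) \<subseteq> C"
proof -
  have Dh: "D \<in> sheaf_homs M TT F G" using D by (simp add: diff_ops_def)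
  show s: "op_support M V F G (mulres h V D) \<subseteq> C"
    by (rule op_support_subset[OF V C(1) mulres_zero_on[OF Dh V C(1) h0]])
  show "mulres h V D \<in> Diff_c M V F G"
    using mulres_diff_ops[OF D V] compactin_op_support[OF C(2) s C(3)] by (simp add: Diff_c_def)
qed

end

subsection \<open>Extension of operators by zero\<close>

text \<open>\<open>C\<close> is a closed subset of \<open>V\<close> off which \<open>D\<close>
  vanishes, such as its support or a prescribed compact set. The result is an operator on the whole
  space.\<close>

definition zext :: "'p set \<Rightarrow> 'p set \<Rightarrow> ('p set \<Rightarrow> 'f \<Rightarrow> 'g) \<Rightarrow> 'p set \<Rightarrow> 'f \<Rightarrow> 'g" where
  "zext V C D = (\<lambda>W u. if opn W \<and> u \<in> carrier (FF W)
     then G.ext0 W V C (D (W \<inter> V) (rest F W (W \<inter> V) u)) else \<zero>\<^bsub>GG W\<^esub>)"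

context
  fixes V C D
  assumes D: "D \<in> sheaf_homs M V F G" and V: "opn V" and C: "closedin (base M) C" "C \<subseteq> V"
    and D0: "zero_on M F G (V - C) D"
begin

lemma zext:
  assumes W: "opn W" and u: "u \<in> carrier (FF W)"
  shows "zext V C D W u \<in> carrier (GG W)"
    "rest G W (W \<inter> V) (zext V C D W u) = D (W \<inter> V) (rest F W (W \<inter> V) u)"
    "rest G W (W - C) (zext V C D W u) = \<zero>\<^bsub>GG (W - C)\<^esub>"
proof -
  have o: "opn (W \<inter> V)" "opn (W \<inter> V - C)" using W V C by (auto intro: openin_diff)
  have ur: "rest F W (W \<inter> V) u \<in> carrier (FF (W \<inter> V))" by (rule F.F_rest(1)[OF W o(1) _ u]) auto
  have "rest G (W \<inter> V) (W \<inter> V - C) (D (W \<inter> V) (rest F W (W \<inter> V) u)) =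
     D (W \<inter> V - C) (rest F (W \<inter> V) (W \<inter> V - C) (rest F W (W \<inter> V) u))"
    using homD(4)[OF D o(1) Int_lower2 ur o(2) Diff_subset] by simp
  also have "\<dots> = \<zero>\<^bsub>GG (W \<inter> V - C)\<^esub>"
    using o F.F_rest(1)[OF o Diff_subset ur]
    by (intro D0[unfolded zero_on_def, rule_format]) auto
  finally have z: "rest G (W \<inter> V) (W \<inter> V - C) (D (W \<inter> V) (rest F W (W \<inter> V) u)) = \<zero>\<^bsub>GG (W \<inter> V - C)\<^esub>" .
  have "D (W \<inter> V) (rest F W (W \<inter> V) u) \<in> carrier (GG (W \<inter> V))"
    by (rule homD(1)[OF D o(1) _ ur]) auto
  note E = G.ext0[OF W V C this z]
  show "zext V C D W u \<in> carrier (GG W)"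
    "rest G W (W \<inter> V) (zext V C D W u) = D (W \<inter> V) (rest F W (W \<inter> V) u)"
    "rest G W (W - C) (zext V C D W u) = \<zero>\<^bsub>GG (W - C)\<^esub>"
    using E W u by (simp_all add: zext_def)
qed

lemma zext_eqI:
  assumes W: "opn W" and u: "u \<in> carrier (FF W)" and m: "m \<in> carrier (GG W)"
    "rest G W (W \<inter> V) m = D (W \<inter> V) (rest F W (W \<inter> V) u)"
    "rest G W (W - C) m = \<zero>\<^bsub>GG (W - C)\<^esub>"
  shows "zext V C D W u = m"
  by (rule G.ext0_unique[OF W V C zext(1)[OF W u] m(1)]) (use zext[OF W u] m in auto)

lemma zext_inside:
  assumes W: "opn W" "W \<subseteq> V" and u: "u \<in> carrier (FF W)"
  shows "zext V C D W u = D W u"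
proof (rule zext_eqI[OF W(1) u])
  have WV: "W \<inter> V = W" using W by auto
  have Du: "D W u \<in> carrier (GG W)" by (rule homD(1)[OF D W u])
  show "D W u \<in> carrier (GG W)" by fact
  show "rest G W (W \<inter> V) (D W u) = D (W \<inter> V) (rest F W (W \<inter> V) u)"
    unfolding WV using G.F_rest(2)[OF W(1) Du] F.F_rest(2)[OF W(1) u] by simp
  have o: "opn (W - C)" using W C by (auto intro: openin_diff)
  have "rest G W (W - C) (D W u) = D (W - C) (rest F W (W - C) u)"
    using homD(4)[OF D W u o Diff_subset] by simp
  also have "\<dots> = \<zero>\<^bsub>GG (W - C)\<^esub>"
    using o F.F_rest(1)[OF W(1) o Diff_subset u] W(2)
    by (intro D0[unfolded zero_on_def, rule_format]) auto
  finally show "rest G W (W - C) (D W u) = \<zero>\<^bsub>GG (W - C)\<^esub>" .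
qed

lemma zext_zero_on: "zero_on M F G (TT - C) (zext V C D)"
  unfolding zero_on_def
proof (intro allI impI ballI)
  fix W u assume W: "opn W \<and> W \<subseteq> TT - C" and u: "u \<in> carrier (FF W)"
  then have "W - C = W" by auto
  then show "zext V C D W u = \<zero>\<^bsub>GG W\<^esub>"
    using zext(1,3)[of W u] G.F_rest(2)[of W "zext V C D W u"] W u by simp
qed

lemma zext_hom: "zext V C D \<in> sheaf_homs M TT F G"
  unfolding sheaf_homs_def mem_Collect_eq
proof (intro conjI allI impI ballI funcsetI)
  fix W u assume W: "opn W \<and> W \<subseteq> TT" and u: "u \<in> carrier (FF W)"
  then have o: "opn W" "opn (W \<inter> V)" "opn (W - C)" using V C by (auto intro: openin_diff)
  note s = Int_lower1[of W V] Diff_subset[of W C]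
  have ur: "rest F W (W \<inter> V) w \<in> carrier (FF (W \<inter> V))" if "w \<in> carrier (FF W)" for w
    by (rule F.F_rest(1)[OF o(1,2) s(1) that])
  show "zext V C D W u \<in> carrier (GG W)" by (rule zext(1)[OF o(1) u])
  {
    fix v assume v: "v \<in> carrier (FF W)"
    show "zext V C D W (u \<oplus>\<^bsub>FF W\<^esub> v) = zext V C D W u \<oplus>\<^bsub>GG W\<^esub> zext V C D W v"
    proof (rule zext_eqI[OF o(1) F.F_add_in[OF o(1) u v]])
      show "zext V C D W u \<oplus>\<^bsub>GG W\<^esub> zext V C D W v \<in> carrier (GG W)"
        by (intro G.F_add_in o(1) zext(1) u v)
      show "rest G W (W \<inter> V) (zext V C D W u \<oplus>\<^bsub>GG W\<^esub> zext V C D W v) =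
        D (W \<inter> V) (rest F W (W \<inter> V) (u \<oplus>\<^bsub>FF W\<^esub> v))"
        using G.F_rest_add[OF o(1,2) s(1) zext(1)[OF o(1) u] zext(1)[OF o(1) v]] zext(2)[OF o(1)] u v
          F.F_rest_add[OF o(1,2) s(1) u v] homD(2)[OF D o(2) _ ur[OF u] ur[OF v]] by simp
      show "rest G W (W - C) (zext V C D W u \<oplus>\<^bsub>GG W\<^esub> zext V C D W v) = \<zero>\<^bsub>GG (W - C)\<^esub>"
        using G.F_rest_add[OF o(1,3) s(2) zext(1)[OF o(1) u] zext(1)[OF o(1) v]] zext(3)[OF o(1)] u v
          G.F_add_zero[OF o(3) G.F_zero_in[OF o(3)]] by simp
    qed
  next
    fix c
    show "zext V C D W (sheaf_cscale M F W c u) = sheaf_cscale M G W c (zext V C D W u)"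
    proof (rule zext_eqI[OF o(1) F.F_cscale_in[OF o(1) u]])
      show "sheaf_cscale M G W c (zext V C D W u) \<in> carrier (GG W)"
        by (intro G.F_cscale_in o(1) zext(1) u)
      show "rest G W (W \<inter> V) (sheaf_cscale M G W c (zext V C D W u)) =
        D (W \<inter> V) (rest F W (W \<inter> V) (sheaf_cscale M F W c u))"
        using G.F_rest_cscale[OF o(1,2) s(1) zext(1)[OF o(1) u]] zext(2)[OF o(1) u]
          F.F_rest_cscale[OF o(1,2) s(1) u] homD(3)[OF D o(2) _ ur[OF u]] by simp
      show "rest G W (W - C) (sheaf_cscale M G W c (zext V C D W u)) = \<zero>\<^bsub>GG (W - C)\<^esub>"
        using G.F_rest_cscale[OF o(1,3) s(2) zext(1)[OF o(1) u]] zext(3)[OF o(1) u]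
          G.F_smult_zero_right[OF o(3) F.O_const_in[OF o(3)]] by (simp add: sheaf_cscale_def)
    qed
  }
next
  fix W W' u assume *: "opn W \<and> opn W' \<and> W' \<subseteq> W \<and> W \<subseteq> TT" and u: "u \<in> carrier (FF W)"
  then have o: "opn W" "opn W'" "W' \<subseteq> W" by auto
  have o': "opn (W \<inter> V)" "opn (W' \<inter> V)" "opn (W - C)" "opn (W' - C)" using V C o by (auto intro: openin_diff)
  have s: "W \<inter> V \<subseteq> W" "W' \<inter> V \<subseteq> W'" "W' \<inter> V \<subseteq> W \<inter> V" "W - C \<subseteq> W" "W' - C \<subseteq> W'" "W' - C \<subseteq> W - C"
    "W \<inter> V \<subseteq> V" using o by auto
  note z = zext(1)[OF o(1) u]
  have ur: "rest F W (W \<inter> V) u \<in> carrier (FF (W \<inter> V))" by (rule F.F_rest(1)[OF o(1) o'(1) s(1) u])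
  show "zext V C D W' (rest F W W' u) = rest G W W' (zext V C D W u)"
  proof (rule zext_eqI[OF o(2) F.F_rest(1)[OF o u] G.F_rest(1)[OF o z]])
    have "rest G W' (W' \<inter> V) (rest G W W' (zext V C D W u)) =
        rest G (W \<inter> V) (W' \<inter> V) (rest G W (W \<inter> V) (zext V C D W u))"
      using G.F_rest(3)[OF o(1,2) o'(2) s(2) o(3) z] G.F_rest(3)[OF o(1) o'(1,2) s(3,1) z] by simp
    also have "\<dots> = D (W' \<inter> V) (rest F (W \<inter> V) (W' \<inter> V) (rest F W (W \<inter> V) u))"
      using zext(2)[OF o(1) u] homD(4)[OF D o'(1) s(7) ur o'(2) s(3)] by simp
    also have "\<dots> = D (W' \<inter> V) (rest F W' (W' \<inter> V) (rest F W W' u))"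
      using F.F_rest(3)[OF o(1,2) o'(2) s(2) o(3) u] F.F_rest(3)[OF o(1) o'(1,2) s(3,1) u] by simp
    finally show "rest G W' (W' \<inter> V) (rest G W W' (zext V C D W u)) =
      D (W' \<inter> V) (rest F W' (W' \<inter> V) (rest F W W' u))" .
    have "rest G W' (W' - C) (rest G W W' (zext V C D W u)) =
        rest G (W - C) (W' - C) (rest G W (W - C) (zext V C D W u))"
      using G.F_rest(3)[OF o(1,2) o'(4) s(5) o(3) z] G.F_rest(3)[OF o(1) o'(3,4) s(6,4) z] by simp
    then show "rest G W' (W' - C) (rest G W W' (zext V C D W u)) = \<zero>\<^bsub>GG (W' - C)\<^esub>"
      using zext(3)[OF o(1) u] G.F_rest_zero[OF o'(3,4) s(6)] by simp
  qed
qed (auto simp: zext_def dest: openin_subset)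

end

subsection \<open>Locality of the order\<close>

text \<open>The properties of a sheaf homomorphism that gluing arguments use and that iterated
  commutators inherit: sections go to sections, and restriction is respected. Values at arguments
  without meaning are left out.\<close>

definition natural_on :: "'p set \<Rightarrow> ('p set \<Rightarrow> 'f \<Rightarrow> 'g) \<Rightarrow> bool" where
  "natural_on V D \<longleftrightarrow> (\<forall>W u. opn W \<and> W \<subseteq> V \<and> u \<in> carrier (FF W) \<longrightarrow> D W u \<in> carrier (GG W) \<and>
     (\<forall>W'. opn W' \<and> W' \<subseteq> W \<longrightarrow> D W' (rest F W W' u) = rest G W W' (D W u)))"

lemma natural_onD:
  assumes "natural_on V D" "opn W" "W \<subseteq> V" "u \<in> carrier (FF W)"
  shows "D W u \<in> carrier (GG W)"
    "opn W' \<Longrightarrow> W' \<subseteq> W \<Longrightarrow> D W' (rest F W W' u) = rest G W W' (D W u)"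
  using assms unfolding natural_on_def by blast+

lemma natural_on_comm:
  assumes D: "natural_on V D" and V: "opn V" and f: "f \<in> carrier (RR V)"
  shows "natural_on V (comm V f D)"
  unfolding natural_on_def
proof (intro allI impI conjI)
  fix W u assume "opn W \<and> W \<subseteq> V \<and> u \<in> carrier (FF W)"
  then have W: "opn W" "W \<subseteq> V" and u: "u \<in> carrier (FF W)" by auto
  have fW: "rest (str M) V W f \<in> carrier (RR W)" by (rule F.O_rest(1)[OF V W f])
  have fu: "rest (str M) V W f \<odot>\<^bsub>FF W\<^esub> u \<in> carrier (FF W)" by (rule F.F_smult_in[OF W(1) fW u])
  note N = natural_onD[OF D W]
  note c1 = N(1)[OF fu] and c2 = G.F_smult_in[OF W(1) fW N(1)[OF u]]
  show "comm V f D W u \<in> carrier (GG W)"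
    unfolding commutator_def by (rule G.F_minus_in[OF W(1) c1 c2])
  fix W' assume "opn W' \<and> W' \<subseteq> W"
  then have W': "opn W'" "W' \<subseteq> W" by auto
  have "rest G W W' (comm V f D W u) =
     D W' (rest F W W' (rest (str M) V W f \<odot>\<^bsub>FF W\<^esub> u)) \<ominus>\<^bsub>GG W'\<^esub>
     rest (str M) W W' (rest (str M) V W f) \<odot>\<^bsub>GG W'\<^esub> D W' (rest F W W' u)"
    unfolding commutator_def using G.F_rest_minus[OF W(1) W' c1 c2]
      G.F_rest_smult[OF W(1) W' fW N(1)[OF u]] N(2)[OF u W'] N(2)[OF fu W'] by simp
  then show "comm V f D W' (rest F W W' u) = rest G W W' (comm V f D W u)"
    unfolding commutator_def using F.F_rest_smult[OF W(1) W' fW u] F.O_rest(3)[OF V W(1) W'(1) W'(2) W(2) f]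
    by simp
qed

lemma natural_on_fold:
  assumes "natural_on V D" and V: "opn V" and "set fs \<subseteq> carrier (RR V)"
  shows "natural_on V (fold (comm V) fs D)"
  using assms(1,3)
proof (induction fs arbitrary: D)
  case (Cons f fs)
  then have "natural_on V (comm V f D)" by (intro natural_on_comm V) auto
  from Cons.IH[OF this] Cons.prems show ?case by simp
qed simp

lemma natural_on_hom:
  assumes "D \<in> sheaf_homs M U F G" "V \<subseteq> U"
  shows "natural_on V D"
  unfolding natural_on_def using homD[OF assms(1)] assms(2) by (meson subset_trans)

text \<open>Over \<open>W\<close> an iterated commutator sees only the restrictions of its sections
  to \<open>W\<close>. The sections over \<open>V\<close> can thus be exchanged for sections over
  another set \<open>V'\<close> with the same restrictions, which is how the base set of the
  commutators is changed.\<close>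

lemma fold_comm_cong:
  assumes W: "opn W" and fs: "\<And>f. f \<in> set fs \<Longrightarrow> rest (str M) V W f \<in> carrier (RR W) \<and> rest (str M) V' W (\<sigma> f) = rest (str M) V W f"
    and eq: "\<And>u. u \<in> carrier (FF W) \<Longrightarrow> D W u = D' W u" and u: "u \<in> carrier (FF W)"
  shows "fold (comm V) fs D W u = fold (comm V') (map \<sigma> fs) D' W u"
  using fs eq u
proof (induction fs arbitrary: D D' u)
  case (Cons f fs)
  have "fold (comm V) fs (comm V f D) W u = fold (comm V') (map \<sigma> fs) (comm V' (\<sigma> f) D') W u"
  proof (rule Cons.IH)
    fix v assume v: "v \<in> carrier (FF W)"
    have "rest (str M) V W f \<in> carrier (RR W)" using Cons.prems(1) by simp
    from F.F_smult_in[OF W this v] show "comm V f D W v = comm V' (\<sigma> f) D' W v"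
      unfolding commutator_def using Cons.prems(1)[of f] Cons.prems(2) v by simp
  qed (use Cons.prems in auto)
  then show ?case by simp
qed simp

lemma fold_comm_zero:
  assumes W: "opn W" and fs: "\<And>f. f \<in> set fs \<Longrightarrow> rest (str M) V W f \<in> carrier (RR W)"
    and eq: "\<And>u. u \<in> carrier (FF W) \<Longrightarrow> D W u = \<zero>\<^bsub>GG W\<^esub>" and u: "u \<in> carrier (FF W)"
  shows "fold (comm V) fs D W u = \<zero>\<^bsub>GG W\<^esub>"
  using fs eq u
proof (induction fs arbitrary: D u)
  case (Cons f fs)
  have "fold (comm V) fs (comm V f D) W u = \<zero>\<^bsub>GG W\<^esub>"
  proof (rule Cons.IH)
    fix v assume v: "v \<in> carrier (FF W)"
    have f: "rest (str M) V W f \<in> carrier (RR W)" using Cons.prems(1) by simp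
    then show "comm V f D W v = \<zero>\<^bsub>GG W\<^esub>"
      unfolding commutator_def using Cons.prems(2)[OF v] Cons.prems(2)[OF F.F_smult_in[OF W f v]]
        G.F_smult_zero_right[OF W f] G.F_minus_self[OF W G.F_zero_in[OF W]] by simp
  qed (use Cons.prems in auto)
  then show ?case by simp
qed simp

lemma zero_on_order:
  assumes "zero_on M F G V D"
  shows "order_le M V F G r D"
  unfolding order_le_def zero_on_def
proof (intro allI impI ballI)
  fix V0 fs W u
  assume 1: "opn V0 \<and> V0 \<subseteq> V \<and> length fs = Suc r \<and> set fs \<subseteq> carrier (RR V0)"
    and W: "opn W \<and> W \<subseteq> V0" and u: "u \<in> carrier (FF W)"
  show "fold (comm V0) fs D W u = \<zero>\<^bsub>GG W\<^esub>"
  proof (rule fold_comm_zero)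
    fix v assume "v \<in> carrier (FF W)"
    then show "D W v = \<zero>\<^bsub>GG W\<^esub>" using assms W 1 unfolding zero_on_def by blast
  qed (use 1 W u F.O_rest(1) in auto)
qed

lemma order_le_cong:
  assumes "order_le M V F G r D" and "\<And>W u. opn W \<Longrightarrow> W \<subseteq> V \<Longrightarrow> u \<in> carrier (FF W) \<Longrightarrow> D' W u = D W u"
  shows "order_le M V F G r D'"
  unfolding order_le_def zero_on_def
proof (intro allI impI ballI)
  fix V0 fs W u
  assume 1: "opn V0 \<and> V0 \<subseteq> V \<and> length fs = Suc r \<and> set fs \<subseteq> carrier (RR V0)"
    and W: "opn W \<and> W \<subseteq> V0" and u: "u \<in> carrier (FF W)"
  have "fold (comm V0) fs D' W u = fold (comm V0) (map id fs) D W u"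
    by (rule fold_comm_cong) (use 1 W u assms(2)[of W] F.O_rest(1)[of V0 W] in auto)
  also have "\<dots> = \<zero>\<^bsub>GG W\<^esub>" using assms(1) 1 W u unfolding order_le_def zero_on_def by simp
  finally show "fold (comm V0) fs D' W u = \<zero>\<^bsub>GG W\<^esub>" .
qed

text \<open>The sections in the commutators are given over some \<open>V0\<close> that need lie
  neither in \<open>A\<close> nor in \<open>B\<close>. They are restricted to
  \<open>V0 \<inter> A\<close> and \<open>V0 \<inter> B\<close>, where the bounds apply, and the
  vanishing is put together by separatedness of \<open>G\<close>.\<close>

lemma order_le_union:
  assumes A: "opn A" "order_le M A F G r D" and B: "opn B" "order_le M B F G r D"
    and D: "natural_on (A \<union> B) D"
  shows "order_le M (A \<union> B) F G r D"
  unfolding order_le_def zero_on_def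
proof (intro allI impI ballI)
  fix V0 fs W u
  assume 1: "opn V0 \<and> V0 \<subseteq> A \<union> B \<and> length fs = Suc r \<and> set fs \<subseteq> carrier (RR V0)"
    and W': "opn W \<and> W \<subseteq> V0" and u: "u \<in> carrier (FF W)"
  then have V0: "opn V0" "V0 \<subseteq> A \<union> B" and fs: "length fs = Suc r" "set fs \<subseteq> carrier (RR V0)"
    and W: "opn W" "W \<subseteq> V0" by auto
  have "natural_on V0 D" using D V0(2) unfolding natural_on_def by (meson subset_trans)
  note N = natural_onD[OF natural_on_fold[OF this V0(1) fs(2)] W u]
  have part: "rest G W (W \<inter> A) (fold (comm V0) fs D W u) = \<zero>\<^bsub>GG (W \<inter> A)\<^esub>"
    if A: "opn A" "order_le M A F G r D" for A
  proof -
    have o: "opn (W \<inter> A)" "opn (V0 \<inter> A)" "W \<inter> A \<subseteq> V0 \<inter> A" "W \<inter> A \<subseteq> W" "V0 \<inter> A \<subseteq> V0"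
      using W V0 A by auto
    note ur = F.F_rest(1)[OF W(1) o(1,4) u]
    let ?\<sigma> = "rest (str M) V0 (V0 \<inter> A)"
    have "rest G W (W \<inter> A) (fold (comm V0) fs D W u) = fold (comm V0) fs D (W \<inter> A) (rest F W (W \<inter> A) u)"
      using N(2)[OF o(1,4)] by simp
    also have "\<dots> = fold (comm (V0 \<inter> A)) (map ?\<sigma> fs) D (W \<inter> A) (rest F W (W \<inter> A) u)"
    proof (rule fold_comm_cong[OF o(1)])
      fix f assume "f \<in> set fs"
      then have f: "f \<in> carrier (RR V0)" using fs by auto
      show "rest (str M) V0 (W \<inter> A) f \<in> carrier (RR (W \<inter> A)) \<and>
        rest (str M) (V0 \<inter> A) (W \<inter> A) (?\<sigma> f) = rest (str M) V0 (W \<inter> A) f"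
        using F.O_rest(1)[OF V0(1) o(1) _ f] F.O_rest(3)[OF V0(1) o(2,1,3,5) f] o by blast
    qed (use ur in auto)
    also have "\<dots> = \<zero>\<^bsub>GG (W \<inter> A)\<^esub>"
    proof -
      have "set (map ?\<sigma> fs) \<subseteq> carrier (RR (V0 \<inter> A))"
        using fs F.O_rest(1)[OF V0(1) o(2,5)] by auto
      then show ?thesis using A(2)[unfolded order_le_def zero_on_def, rule_format, of "V0 \<inter> A" "map ?\<sigma> fs" "W \<inter> A"]
        o fs ur by simp
    qed
    finally show ?thesis .
  qed
  have o: "opn (W \<inter> A)" "opn (W \<inter> B)" "W = (W \<inter> A) \<union> (W \<inter> B)" "W \<inter> A \<subseteq> W" "W \<inter> B \<subseteq> W"
    using W V0 A B by auto
  show "fold (comm V0) fs D W u = \<zero>\<^bsub>GG W\<^esub>"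
    by (rule is_sheaf_separated2[OF G.sheafF o(1-3) N(1) G.F_zero_in[OF W(1)]])
      (use part[OF A] part[OF B] G.F_rest_zero[OF W(1) o(1,4)] G.F_rest_zero[OF W(1) o(2,5)] in simp_all)
qed

text \<open>The extended operator agrees with \<open>D\<close> on \<open>V\<close> and is zero off
  \<open>C\<close>. These two open sets cover the space, and the order is bounded on each of
  them.\<close>

lemma zext_Diff_c:
  assumes D: "D \<in> diff_ops M V F G" and V: "opn V" and C: "closedin (base M) C" "compactin (base M) C" "C \<subseteq> V"
    and D0: "zero_on M F G (V - C) D"
  shows "zext V C D \<in> Diff_c M TT F G" "op_support M TT F G (zext V C D) \<subseteq> C"
    "order_le M V F G r D \<Longrightarrow> order_le M TT F G r (zext V C D)"
proof -
  have Dh: "D \<in> sheaf_homs M V F G" using D by (simp add: diff_ops_def)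
  note ctx = Dh V C(1,3) D0
  note z = zext_zero_on[OF ctx] and hom = zext_hom[OF ctx]
  have CT: "C \<subseteq> TT" using C(1) by (rule closedin_subset)
  have oC: "opn (TT - C)" using C(1) by blast
  show s: "op_support M TT F G (zext V C D) \<subseteq> C" by (rule op_support_subset[OF openin_topspace C(1) z])
  have ord: "order_le M A F G r (zext V C D)" if "order_le M A F G r D" "A \<subseteq> V" for A r
    by (rule order_le_cong[OF that(1)]) (use zext_inside[OF ctx] that(2) in auto)
  show "order_le M TT F G r (zext V C D)" if "order_le M V F G r D"
  proof -
    have VT: "V \<union> (TT - C) = TT" using openin_subset[OF V] C(3) by auto
    show ?thesis
      using order_le_union[OF V ord[OF that] oC zero_on_order[OF z]] natural_on_hom[OF hom, of TT]
      unfolding VT by simp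
  qed
  have "zext V C D \<in> diff_ops M TT F G"
    unfolding diff_ops_def mem_Collect_eq
  proof (intro conjI ballI hom)
    fix a assume a: "a \<in> TT"
    show "\<exists>V' r. opn V' \<and> a \<in> V' \<and> V' \<subseteq> TT \<and> order_le M V' F G r (zext V C D)"
    proof (cases "a \<in> V")
      case True
      then have "\<exists>V1 r. opn V1 \<and> a \<in> V1 \<and> V1 \<subseteq> V \<and> order_le M V1 F G r D"
        using D unfolding diff_ops_def mem_Collect_eq by (elim conjE) (erule bspec, assumption)
      then obtain V1 r where V1: "opn V1" "a \<in> V1" "V1 \<subseteq> V" "order_le M V1 F G r D"
        by (elim exE conjE) (rule that)
      show ?thesis
        by (intro exI[of _ V1] exI[of _ r] conjI V1 ord openin_subset)
    next
      case False
      then have "a \<in> TT - C" using a C(3) by auto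
      then show ?thesis
        by (intro exI[of _ "TT - C"] exI[of _ 0] conjI oC Diff_subset zero_on_order[OF z])
    qed
  qed
  then show "zext V C D \<in> Diff_c M TT F G"
    using compactin_op_support[OF C(2) s CT] by (simp add: Diff_c_def)
qed

end

section \<open>Charts of a formal manifold and residue values\<close>

abbreviation "zero_index \<equiv> (\<lambda>_. 0) :: nat \<Rightarrow> nat"

lemma euclidean_formal_simps:
  "base (euclidean_formal n k) = Euclidean_space n"
  "carrier (secs (str (euclidean_formal n k)) W) = {f. \<forall>\<alpha>. smooth_on n W (f \<alpha>) \<and> (\<forall>x. x \<notin> W \<longrightarrow> f \<alpha> x = 0) \<and>
                             ((\<exists>i\<ge>k. \<alpha> i \<noteq> 0) \<longrightarrow> f \<alpha> = (\<lambda>x. 0))}"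
  "(\<otimes>\<^bsub>secs (str (euclidean_formal n k)) W\<^esub>) = (\<lambda>f g \<alpha> x. \<Sum>\<beta> | \<forall>i. \<beta> i \<le> \<alpha> i. f \<beta> x * g (\<lambda>i. \<alpha> i - \<beta> i) x)"
  "\<one>\<^bsub>secs (str (euclidean_formal n k)) W\<^esub> = (\<lambda>\<alpha> x. if x \<in> W \<and> (\<forall>i. \<alpha> i = 0) then 1 else 0)"
  "\<zero>\<^bsub>secs (str (euclidean_formal n k)) W\<^esub> = (\<lambda>\<alpha> x. 0)"
  "(\<oplus>\<^bsub>secs (str (euclidean_formal n k)) W\<^esub>) = (\<lambda>f g \<alpha> x. f \<alpha> x + g \<alpha> x)"
  "(\<odot>\<^bsub>secs (str (euclidean_formal n k)) W\<^esub>) = (\<lambda>c f \<alpha> x. c * f \<alpha> x)"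
  "rest (str (euclidean_formal n k)) W W' = (\<lambda>f \<alpha> x. if x \<in> W' then f \<alpha> x else 0)"
  by (simp_all add: euclidean_formal_def)

locale formal_chart = cringed M
  for M :: "('p, 's) ringed_space" +
  fixes U0 :: "'p set" and n k :: nat and \<phi> :: "'p \<Rightarrow> nat \<Rightarrow> real"
    and \<psi> :: "(nat \<Rightarrow> real) set \<Rightarrow> ((nat \<Rightarrow> nat) \<Rightarrow> (nat \<Rightarrow> real) \<Rightarrow> complex) \<Rightarrow> 's"
  assumes lrs: "locally_ringed_space M" and U0: "openin (base M) U0"
    and hom: "homeomorphic_map (subtopology (base M) U0) (Euclidean_space n) \<phi>"
    and iso: "\<And>W. openin (Euclidean_space n) W \<Longrightarrow>
       \<psi> W \<in> ring_iso (secs (str (euclidean_formal n k)) W) (secs (str M) {a \<in> U0. \<phi> a \<in> W})"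
    and iso_smult: "\<And>W c f. openin (Euclidean_space n) W \<Longrightarrow> f \<in> carrier (secs (str (euclidean_formal n k)) W) \<Longrightarrow>
       \<psi> W (c \<odot>\<^bsub>secs (str (euclidean_formal n k)) W\<^esub> f) = c \<odot>\<^bsub>secs (str M) {a \<in> U0. \<phi> a \<in> W}\<^esub> \<psi> W f"
    and iso_rest: "\<And>W W' f. openin (Euclidean_space n) W \<Longrightarrow> openin (Euclidean_space n) W' \<Longrightarrow> W' \<subseteq> W \<Longrightarrow>
       f \<in> carrier (secs (str (euclidean_formal n k)) W) \<Longrightarrow>
       \<psi> W' (rest (str (euclidean_formal n k)) W W' f) =
         rest (str M) {a \<in> U0. \<phi> a \<in> W} {a \<in> U0. \<phi> a \<in> W'} (\<psi> W f)"
begin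

abbreviation "EE \<equiv> secs (str (euclidean_formal n k))"
abbreviation "opE \<equiv> openin (Euclidean_space n)"
abbreviation "TE \<equiv> topspace (Euclidean_space n)"

lemma U0T: "U0 \<subseteq> TT" by (rule openin_subset[OF U0])
lemma topsU0: "topspace (subtopology (base M) U0) = U0" using U0T by auto
lemma phi_inj: "inj_on \<phi> U0" by (rule homeomorphic_imp_injective_map[OF hom, unfolded topsU0])
lemma phi_img: "\<phi> ` U0 = TE" by (rule homeomorphic_imp_surjective_map[OF hom, unfolded topsU0])

lemma pre_open: "opE W \<Longrightarrow> opn {a \<in> U0. \<phi> a \<in> W}"
  using openin_continuous_map_preimage[OF homeomorphic_imp_continuous_map[OF hom], of W, unfolded topsU0]
  by (simp only: openin_open_subtopology[OF U0])

lemma img_open: "opn V \<Longrightarrow> V \<subseteq> U0 \<Longrightarrow> opE (\<phi> ` V)"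
  using homeomorphic_imp_open_map[OF hom] U0 unfolding open_map_def
  by (simp add: openin_open_subtopology)

lemma pre_img: "V \<subseteq> U0 \<Longrightarrow> {a \<in> U0. \<phi> a \<in> \<phi> ` V} = V"
  using phi_inj by (auto dest: inj_onD)

lemma EE_zero_in: "opE W \<Longrightarrow> (\<lambda>\<alpha> x. 0) \<in> carrier (EE W)"
  by (auto simp: euclidean_formal_simps intro: smooth_on_const)

text \<open>Power series that consist of their constant term: through them smooth functions on the
  chart lift to sections of the structure sheaf.\<close>

lemma EE_single_in:
  assumes "opE W" "smooth_on n W f" "\<And>x. x \<notin> W \<Longrightarrow> f x = 0"
  shows "(\<lambda>\<alpha> x. if \<forall>i. \<alpha> i = 0 then f x else 0) \<in> carrier (EE W)"
proof -
  have "smooth_on n W (\<lambda>x. if \<forall>i. \<alpha> i = 0 then f x else 0)" for \<alpha> :: "nat \<Rightarrow> nat"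
  proof (cases "\<forall>i. \<alpha> i = 0")
    case True
    then have "(\<lambda>x. if \<forall>i. \<alpha> i = 0 then f x else 0) = f" by simp
    then show ?thesis using assms(2) by (simp only:)
  next
    case False
    then have "(\<lambda>x. if \<forall>i. \<alpha> i = 0 then f x else 0) = (\<lambda>x. 0)" by (simp only: if_False)
    then show ?thesis using smooth_on_const[OF assms(1)] by (simp only:)
  qed
  moreover have "(\<lambda>x. if \<forall>i. \<alpha> i = 0 then f x else 0) = (\<lambda>x. 0)" if "\<exists>i\<ge>k. \<alpha> i \<noteq> 0" for \<alpha> :: "nat \<Rightarrow> nat"
  proof -
    from that obtain i where "\<alpha> i \<noteq> 0" by auto
    then have "\<not> (\<forall>i. \<alpha> i = 0)" by (metis (full_types))
    then show ?thesis by (simp only: if_False)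
  qed
  ultimately show ?thesis unfolding euclidean_formal_simps mem_Collect_eq using assms(3) by simp
qed

lemma EE_add_in: "opE W \<Longrightarrow> f \<in> carrier (EE W) \<Longrightarrow> g \<in> carrier (EE W) \<Longrightarrow> f \<oplus>\<^bsub>EE W\<^esub> g \<in> carrier (EE W)"
  by (auto simp: euclidean_formal_simps intro: smooth_on_add)

lemma EE_vanish: "g \<in> carrier (EE W) \<Longrightarrow> \<exists>i\<ge>k. \<alpha> i \<noteq> 0 \<Longrightarrow> g \<alpha> = (\<lambda>x. 0)"
  unfolding euclidean_formal_simps mem_Collect_eq by (drule spec[of _ \<alpha>]) (elim conjE, erule mp)

lemma EE_mult_in:
  assumes W: "opE W" and f: "f \<in> carrier (EE W)" and g: "g \<in> carrier (EE W)"
  shows "f \<otimes>\<^bsub>EE W\<^esub> g \<in> carrier (EE W)"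
  unfolding euclidean_formal_simps mem_Collect_eq
proof (intro allI conjI impI)
  fix \<alpha>
  show "smooth_on n W (\<lambda>x. \<Sum>\<beta> | \<forall>i. \<beta> i \<le> \<alpha> i. f \<beta> x * g (\<lambda>i. \<alpha> i - \<beta> i) x)"
    using f g by (intro smooth_on_sum[OF W] smooth_on_mult[OF W]) (simp_all add: euclidean_formal_simps)
  show "(\<Sum>\<beta> | \<forall>i. \<beta> i \<le> \<alpha> i. f \<beta> x * g (\<lambda>i. \<alpha> i - \<beta> i) x) = 0" if "x \<notin> W" for x
    using f that by (intro sum.neutral) (simp add: euclidean_formal_simps)
  assume "\<exists>i\<ge>k. \<alpha> i \<noteq> 0"
  then obtain i where i: "i \<ge> k" "\<alpha> i \<noteq> 0" by blast
  \<comment> \<open>If \<open>\<alpha>\<close> involves a variable of index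
    \<open>i \<ge> k\<close>, then \<open>\<beta>\<close> or \<open>\<alpha> - \<beta>\<close>
    involves it too, and the corresponding factor vanishes.\<close>
  have "f \<beta> x * g (\<lambda>i. \<alpha> i - \<beta> i) x = 0" for \<beta> x
  proof (cases "\<beta> i = 0")
    case True
    then have "\<exists>j\<ge>k. \<alpha> j - \<beta> j \<noteq> 0" using i by auto
    then have "g (\<lambda>i. \<alpha> i - \<beta> i) = (\<lambda>x. 0)" by (rule EE_vanish[OF g])
    then show ?thesis by simp
  next
    case False
    then have "f \<beta> = (\<lambda>x. 0)" using i by (intro EE_vanish[OF f]) auto
    then show ?thesis by simp
  qed
  then show "(\<lambda>x. \<Sum>\<beta> | \<forall>i. \<beta> i \<le> \<alpha> i. f \<beta> x * g (\<lambda>i. \<alpha> i - \<beta> i) x) = (\<lambda>x. 0)"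
    by (intro ext sum.neutral ballI)
qed

lemma EE_one_in:
  assumes "opE W"
  shows "\<one>\<^bsub>EE W\<^esub> \<in> carrier (EE W)"
proof -
  let ?f = "\<lambda>x. if x \<in> W then 1 else 0 :: complex"
  have "smooth_on n W ?f" by (rule smooth_on_cong[OF assms smooth_on_const[OF assms, of 1]]) simp
  then have "(\<lambda>\<alpha> x. if \<forall>i. \<alpha> i = 0 then ?f x else 0) \<in> carrier (EE W)"
    using EE_single_in[OF assms] by simp
  moreover have "\<one>\<^bsub>EE W\<^esub> = (\<lambda>\<alpha> x. if \<forall>i. \<alpha> i = 0 then ?f x else 0)"
    unfolding euclidean_formal_simps by (intro ext) auto
  ultimately show ?thesis by (simp only:)
qed

lemma EE_smult_in: "opE W \<Longrightarrow> f \<in> carrier (EE W) \<Longrightarrow> c \<odot>\<^bsub>EE W\<^esub> f \<in> carrier (EE W)"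
  by (auto simp: euclidean_formal_simps intro: smooth_on_mult smooth_on_const)

lemma EE_rest_in:
  assumes "opE W" "opE W'" "W' \<subseteq> W" "f \<in> carrier (EE W)"
  shows "rest (str (euclidean_formal n k)) W W' f \<in> carrier (EE W')"
proof -
  have "smooth_on n W' (\<lambda>x. if x \<in> W' then f \<alpha> x else 0)" for \<alpha>
    by (rule smooth_on_cong[OF assms(2) smooth_on_subset[OF _ assms(3), of n "f \<alpha>"]])
      (use assms(4) in \<open>auto simp: euclidean_formal_simps\<close>)
  then show ?thesis using assms(4) by (auto simp: euclidean_formal_simps fun_eq_iff)
qed

lemma iso_inj: "opE W \<Longrightarrow> inj_on (\<psi> W) (carrier (EE W))"
  and iso_img: "opE W \<Longrightarrow> \<psi> W ` carrier (EE W) = carrier (RR {a \<in> U0. \<phi> a \<in> W})"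
  and iso_hom: "opE W \<Longrightarrow> \<psi> W \<in> ring_hom (EE W) (RR {a \<in> U0. \<phi> a \<in> W})"
  using iso[of W] by (simp_all add: ring_iso_def bij_betw_def)

text \<open>The power series of \<open>f\<close> on the part of \<open>V\<close> inside the chart.
  The inverse appears because \<open>\<psi>\<close> leads from sections of the model to sections of
  the manifold.\<close>

definition coord :: "'p set \<Rightarrow> 's \<Rightarrow> (nat \<Rightarrow> nat) \<Rightarrow> (nat \<Rightarrow> real) \<Rightarrow> complex" where
  "coord V f = inv_into (carrier (EE (\<phi> ` (V \<inter> U0)))) (\<psi> (\<phi> ` (V \<inter> U0))) (rest (str M) V (V \<inter> U0) f)"

context
  fixes V assumes V: "opn V"
begin

lemma V': "opn (V \<inter> U0)" "opE (\<phi> ` (V \<inter> U0))" "{a \<in> U0. \<phi> a \<in> \<phi> ` (V \<inter> U0)} = V \<inter> U0"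
  using V U0 by (auto intro!: img_open pre_img)

lemma coord:
  assumes "f \<in> carrier (RR V)"
  shows "coord V f \<in> carrier (EE (\<phi> ` (V \<inter> U0)))" "\<psi> (\<phi> ` (V \<inter> U0)) (coord V f) = rest (str M) V (V \<inter> U0) f"
proof -
  have "rest (str M) V (V \<inter> U0) f \<in> \<psi> (\<phi> ` (V \<inter> U0)) ` carrier (EE (\<phi> ` (V \<inter> U0)))"
    using iso_img[OF V'(2)] O_rest(1)[OF V V'(1) _ assms] by (simp add: V'(3))
  then show "coord V f \<in> carrier (EE (\<phi> ` (V \<inter> U0)))"
    "\<psi> (\<phi> ` (V \<inter> U0)) (coord V f) = rest (str M) V (V \<inter> U0) f"
    unfolding coord_def by (rule inv_into_into, rule f_inv_into_f)
qed

lemma coord_eqI: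
  assumes "s \<in> carrier (EE (\<phi> ` (V \<inter> U0)))" "\<psi> (\<phi> ` (V \<inter> U0)) s = rest (str M) V (V \<inter> U0) f"
  shows "coord V f = s"
  unfolding coord_def assms(2)[symmetric] by (rule inv_into_f_f[OF iso_inj[OF V'(2)] assms(1)])

lemma coord_add:
  assumes "f \<in> carrier (RR V)" "g \<in> carrier (RR V)"
  shows "coord V (f \<oplus>\<^bsub>RR V\<^esub> g) = coord V f \<oplus>\<^bsub>EE (\<phi> ` (V \<inter> U0))\<^esub> coord V g"
  by (rule coord_eqI[OF EE_add_in[OF V'(2)]])
    (use coord assms ring_hom_add[OF iso_hom[OF V'(2)]] ring_hom_add[OF O_rest_hom[OF V V'(1)]] V'(3) in simp_all)

lemma coord_mult:
  assumes "f \<in> carrier (RR V)" "g \<in> carrier (RR V)"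
  shows "coord V (f \<otimes>\<^bsub>RR V\<^esub> g) = coord V f \<otimes>\<^bsub>EE (\<phi> ` (V \<inter> U0))\<^esub> coord V g"
  by (rule coord_eqI[OF EE_mult_in[OF V'(2)]])
    (use coord assms ring_hom_mult[OF iso_hom[OF V'(2)]] ring_hom_mult[OF O_rest_hom[OF V V'(1)]] V'(3) in simp_all)

lemma coord_one: "coord V \<one>\<^bsub>RR V\<^esub> = \<one>\<^bsub>EE (\<phi> ` (V \<inter> U0))\<^esub>"
  by (rule coord_eqI[OF EE_one_in[OF V'(2)]])
    (use ring_hom_one[OF iso_hom[OF V'(2)]] ring_hom_one[OF O_rest_hom[OF V V'(1)]] V'(3) in simp_all)

lemma coord_const: "coord V (c \<odot>\<^bsub>RR V\<^esub> \<one>\<^bsub>RR V\<^esub>) = c \<odot>\<^bsub>EE (\<phi> ` (V \<inter> U0))\<^esub> \<one>\<^bsub>EE (\<phi> ` (V \<inter> U0))\<^esub>"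
proof (rule coord_eqI[OF EE_smult_in[OF V'(2) EE_one_in[OF V'(2)]]])
  have "rest (str M) V (V \<inter> U0) (c \<odot>\<^bsub>RR V\<^esub> \<one>\<^bsub>RR V\<^esub>) = c \<odot>\<^bsub>RR (V \<inter> U0)\<^esub> \<one>\<^bsub>RR (V \<inter> U0)\<^esub>"
    using O_rest_const[OF V V'(1)] by simp
  then show "\<psi> (\<phi> ` (V \<inter> U0)) (c \<odot>\<^bsub>EE (\<phi> ` (V \<inter> U0))\<^esub> \<one>\<^bsub>EE (\<phi> ` (V \<inter> U0))\<^esub>) =
      rest (str M) V (V \<inter> U0) (c \<odot>\<^bsub>RR V\<^esub> \<one>\<^bsub>RR V\<^esub>)"
    using iso_smult[OF V'(2) EE_one_in[OF V'(2)], of c] ring_hom_one[OF iso_hom[OF V'(2)]] V'(3) by simp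
qed

end

lemma coord_rest:
  assumes V: "opn V" and W: "opn W" "W \<subseteq> V" and f: "f \<in> carrier (RR V)"
  shows "coord W (rest (str M) V W f) = (\<lambda>\<alpha> x. if x \<in> \<phi> ` (W \<inter> U0) then coord V f \<alpha> x else 0)"
proof -
  let ?V = "\<phi> ` (V \<inter> U0)" and ?W = "\<phi> ` (W \<inter> U0)"
  have s: "?W \<subseteq> ?V" "W \<inter> U0 \<subseteq> V \<inter> U0" using W by auto
  have "coord W (rest (str M) V W f) = rest (str (euclidean_formal n k)) ?V ?W (coord V f)"
  proof (rule coord_eqI[OF W(1) EE_rest_in[OF V'(2)[OF V] V'(2)[OF W(1)] s(1) coord(1)[OF V f]]])
    have "\<psi> ?W (rest (str (euclidean_formal n k)) ?V ?W (coord V f)) =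
        rest (str M) (V \<inter> U0) (W \<inter> U0) (rest (str M) V (V \<inter> U0) f)"
      using iso_rest[OF V'(2)[OF V] V'(2)[OF W(1)] s(1) coord(1)[OF V f]] coord(2)[OF V f] V'(3)[OF V] V'(3)[OF W(1)]
      by simp
    also have "\<dots> = rest (str M) W (W \<inter> U0) (rest (str M) V W f)"
      using O_rest(3)[OF V V'(1)[OF V] V'(1)[OF W(1)] s(2) _ f] O_rest(3)[OF V W(1) V'(1)[OF W(1)] _ W(2) f]
      by simp
    finally show "\<psi> ?W (rest (str (euclidean_formal n k)) ?V ?W (coord V f)) = rest (str M) W (W \<inter> U0) (rest (str M) V W f)" .
  qed
  then show ?thesis by (simp add: euclidean_formal_simps)
qed

text \<open>The constant coefficient of the power series at the point, which turns out to be the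
  residue of the germ.\<close>

definition ev :: "'p \<Rightarrow> 'p set \<Rightarrow> 's \<Rightarrow> complex" where
  "ev a V f = coord V f zero_index (\<phi> a)"

lemma ev_rest:
  assumes "opn V" "opn W" "W \<subseteq> V" "f \<in> carrier (RR V)" "a \<in> W \<inter> U0"
  shows "ev a W (rest (str M) V W f) = ev a V f"
  unfolding ev_def coord_rest[OF assms(1-4)] using assms(5) by auto

lemma ev_add:
  assumes "opn V" "f \<in> carrier (RR V)" "g \<in> carrier (RR V)"
  shows "ev a V (f \<oplus>\<^bsub>RR V\<^esub> g) = ev a V f + ev a V g"
  by (simp add: ev_def coord_add assms euclidean_formal_simps)

lemma ev_mult:
  assumes "opn V" "f \<in> carrier (RR V)" "g \<in> carrier (RR V)"
  shows "ev a V (f \<otimes>\<^bsub>RR V\<^esub> g) = ev a V f * ev a V g"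
proof -
  have "{\<beta> :: nat \<Rightarrow> nat. \<forall>i. \<beta> i \<le> 0} = {zero_index}" by auto
  then show ?thesis by (simp add: ev_def coord_mult assms euclidean_formal_simps)
qed

lemma ev_one: "opn V \<Longrightarrow> a \<in> V \<inter> U0 \<Longrightarrow> ev a V \<one>\<^bsub>RR V\<^esub> = 1"
  by (auto simp: ev_def coord_one euclidean_formal_simps)

lemma ev_const: "opn V \<Longrightarrow> a \<in> V \<inter> U0 \<Longrightarrow> ev a V (c \<odot>\<^bsub>RR V\<^esub> \<one>\<^bsub>RR V\<^esub>) = c"
  by (auto simp: ev_def coord_const euclidean_formal_simps)

lemma ev_zero: assumes "opn V" shows "ev a V \<zero>\<^bsub>RR V\<^esub> = 0"
proof -
  interpret cring "RR V" by (rule cringO[OF assms])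
  show ?thesis using ev_add[OF assms, of "\<zero>\<^bsub>RR V\<^esub>" "\<zero>\<^bsub>RR V\<^esub>" a] by simp
qed

lemma ev_minus:
  assumes V: "opn V" and f: "f \<in> carrier (RR V)" "g \<in> carrier (RR V)"
  shows "ev a V (f \<ominus>\<^bsub>RR V\<^esub> g) = ev a V f - ev a V g"
proof -
  interpret cring "RR V" by (rule cringO[OF V])
  have "ev a V (\<ominus>\<^bsub>RR V\<^esub> g) + ev a V g = 0"
    using ev_add[OF V, of "\<ominus>\<^bsub>RR V\<^esub> g" g a] ev_zero[OF V] f(2) by (simp add: l_neg)
  then show ?thesis using ev_add[OF V f(1), of "\<ominus>\<^bsub>RR V\<^esub> g" a] f(2)
    by (simp add: a_minus_def add_eq_0_iff2)
qed

subsection \<open>The maximal ideal of the stalk\<close>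

context
  fixes a assumes a: "a \<in> U0"
begin

lemma germ_self: "opn V \<Longrightarrow> a \<in> V \<Longrightarrow> f \<in> carrier (RR V) \<Longrightarrow> (V, f) \<in> germ M a V f"
  unfolding germ_def by auto

lemma germ_eq_iff:
  assumes V: "opn V" "a \<in> V" "f \<in> carrier (RR V)" and W: "opn W" "a \<in> W" "g \<in> carrier (RR W)"
  shows "germ M a V f = germ M a W g \<longleftrightarrow>
    (\<exists>Z. opn Z \<and> a \<in> Z \<and> Z \<subseteq> V \<inter> W \<and> rest (str M) V Z f = rest (str M) W Z g)" (is "_ \<longleftrightarrow> ?R")
proof
  assume "germ M a V f = germ M a W g"
  then have "(W, g) \<in> germ M a V f" using germ_self[OF W] by simp
  then show ?R unfolding germ_def by auto
next
  assume ?R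
  then obtain Z where Z: "opn Z" "a \<in> Z" "Z \<subseteq> V" "Z \<subseteq> W" "rest (str M) V Z f = rest (str M) W Z g" by auto
  have sub: "germ M a A p \<subseteq> germ M a B q"
    if A: "opn A" "p \<in> carrier (RR A)" "Z \<subseteq> A" and B: "opn B" "q \<in> carrier (RR B)" "Z \<subseteq> B"
      and eq: "rest (str M) A Z p = rest (str M) B Z q" for A p B q
  proof
    fix x assume "x \<in> germ M a A p"
    then obtain C r Y where x: "x = (C, r)" "opn C" "a \<in> C" "r \<in> carrier (RR C)"
      and Y: "opn Y" "a \<in> Y" "Y \<subseteq> A" "Y \<subseteq> C" "rest (str M) A Y p = rest (str M) C Y r"
      unfolding germ_def by auto
    have o: "opn (Y \<inter> Z)" "Y \<inter> Z \<subseteq> Y" "Y \<inter> Z \<subseteq> Z" using Y Z by auto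
    have "rest (str M) B (Y \<inter> Z) q = rest (str M) C (Y \<inter> Z) r"
      using O_rest(3)[OF B(1) Z(1) o(1,3) B(3,2)] O_rest(3)[OF A(1) Z(1) o(1,3) A(3,2)]
        O_rest(3)[OF A(1) Y(1) o(1,2) Y(3) A(2)] O_rest(3)[OF x(2) Y(1) o(1,2) Y(4) x(4)] eq Y(5) by simp
    then show "x \<in> germ M a B q" unfolding germ_def using x o Y Z B
      by (auto intro!: exI[of _ "Y \<inter> Z"])
  qed
  show "germ M a V f = germ M a W g"
    by (rule equalityI; rule sub) (use V W Z in auto)
qed

lemma germ_memD:
  assumes V: "opn V" "a \<in> V" "f \<in> carrier (RR V)" and m: "(W, g) \<in> germ M a V f"
  shows "opn W" "a \<in> W" "g \<in> carrier (RR W)" "germ M a W g = germ M a V f"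
proof -
  show W: "opn W" "a \<in> W" "g \<in> carrier (RR W)" using m unfolding germ_def by auto
  have "germ M a V f = germ M a W g"
    unfolding germ_eq_iff[OF V W] using m unfolding germ_def by auto
  then show "germ M a W g = germ M a V f" ..
qed

lemma ev_germ:
  assumes V: "opn V" "a \<in> V" "f \<in> carrier (RR V)" and W: "opn W" "a \<in> W" "g \<in> carrier (RR W)"
    and eq: "germ M a V f = germ M a W g"
  shows "ev a V f = ev a W g"
proof -
  obtain Z where Z: "opn Z" "a \<in> Z" "Z \<subseteq> V" "Z \<subseteq> W" "rest (str M) V Z f = rest (str M) W Z g"
    using eq germ_eq_iff[OF V W] by auto
  then show ?thesis
    using ev_rest[OF V(1) Z(1,3) V(3), of a] ev_rest[OF W(1) Z(1,4) W(3), of a] a by simp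
qed

text \<open>A germ is encoded as the set of all its representatives; by \<open>ev_germ\<close> any
  of them gives the value.\<close>

definition evs :: "('p set \<times> 's) set \<Rightarrow> complex" where
  "evs G = (let p = (SOME p. p \<in> G) in ev a (fst p) (snd p))"

lemma evs_germ:
  assumes V: "opn V" "a \<in> V" "f \<in> carrier (RR V)"
  shows "evs (germ M a V f) = ev a V f"
proof -
  let ?p = "SOME p. p \<in> germ M a V f"
  have "?p \<in> germ M a V f" using someI[of "\<lambda>p. p \<in> germ M a V f", OF germ_self[OF V]] .
  then have "(fst ?p, snd ?p) \<in> germ M a V f" by simp
  note m = germ_memD[OF V this]
  show ?thesis unfolding evs_def Let_def by (rule ev_germ[OF m(1-3) V m(4)])
qed

text \<open>The operations of \<open>stalk\<close> are unions over all pairs of representatives. All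
  members of such a union are one and the same germ, so the union collapses. The operation
  \<open>b\<close> is a parameter in order to treat sums and products at once.\<close>

lemma germ_binop:
  assumes op: "\<And>V W f g. opn V \<Longrightarrow> opn W \<Longrightarrow> W \<subseteq> V \<Longrightarrow> f \<in> carrier (RR V) \<Longrightarrow> g \<in> carrier (RR V) \<Longrightarrow>
       b V f g \<in> carrier (RR V) \<and> rest (str M) V W (b V f g) = b W (rest (str M) V W f) (rest (str M) V W g)"
    and V: "opn V" "a \<in> V" "f \<in> carrier (RR V)" and W: "opn W" "a \<in> W" "g \<in> carrier (RR W)"
  shows "\<Union>{germ M a (A \<inter> B) (b (A \<inter> B) (rest (str M) A (A \<inter> B) p) (rest (str M) B (A \<inter> B) q))
     | A p B q. (A, p) \<in> germ M a V f \<and> (B, q) \<in> germ M a W g} =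
     germ M a (V \<inter> W) (b (V \<inter> W) (rest (str M) V (V \<inter> W) f) (rest (str M) W (V \<inter> W) g))" (is "\<Union>?S = ?G")
proof -
  have in_op: "opn (A \<inter> B) \<and> b (A \<inter> B) (rest (str M) A (A \<inter> B) p) (rest (str M) B (A \<inter> B) q) \<in> carrier (RR (A \<inter> B))"
    if "opn A" "p \<in> carrier (RR A)" "opn B" "q \<in> carrier (RR B)" for A B p q
  proof -
    have o: "opn (A \<inter> B)" using that by auto
    then show ?thesis
      using op[OF o o order_refl O_rest(1)[OF that(1) o _ that(2)] O_rest(1)[OF that(3) o _ that(4)]] by auto
  qed
  have rest_op: "rest (str M) (A \<inter> B) Z (b (A \<inter> B) (rest (str M) A (A \<inter> B) p) (rest (str M) B (A \<inter> B) q)) =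
      b Z (rest (str M) A Z p) (rest (str M) B Z q)"
    if A: "opn A" "p \<in> carrier (RR A)" "opn B" "q \<in> carrier (RR B)" and Z: "opn Z" "Z \<subseteq> A \<inter> B" for A B p q Z
  proof -
    have o: "opn (A \<inter> B)" using A by auto
    show ?thesis
      using op[OF o Z O_rest(1)[OF A(1) o _ A(2)] O_rest(1)[OF A(3) o _ A(4)]]
        O_rest(3)[OF A(1) o Z(1,2) _ A(2)] O_rest(3)[OF A(3) o Z(1,2) _ A(4)] by simp
  qed
  have "germ M a (A \<inter> B) (b (A \<inter> B) (rest (str M) A (A \<inter> B) p) (rest (str M) B (A \<inter> B) q)) = ?G"
    if p: "(A, p) \<in> germ M a V f" and q: "(B, q) \<in> germ M a W g" for A p B q
  proof -
    note A = germ_memD[OF V p] and B = germ_memD[OF W q]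
    obtain Y where Y: "opn Y" "a \<in> Y" "Y \<subseteq> A" "Y \<subseteq> V" "rest (str M) A Y p = rest (str M) V Y f"
      using A(4) germ_eq_iff[OF A(1-3) V] by auto
    obtain Z where Z: "opn Z" "a \<in> Z" "Z \<subseteq> B" "Z \<subseteq> W" "rest (str M) B Z q = rest (str M) W Z g"
      using B(4) germ_eq_iff[OF B(1-3) W] by auto
    have o: "opn (Y \<inter> Z)" "a \<in> Y \<inter> Z" "Y \<inter> Z \<subseteq> Y" "Y \<inter> Z \<subseteq> Z" "Y \<inter> Z \<subseteq> A \<inter> B" "Y \<inter> Z \<subseteq> V \<inter> W"
      using Y Z by auto
    have e1: "rest (str M) A (Y \<inter> Z) p = rest (str M) V (Y \<inter> Z) f"
      using O_rest(3)[OF A(1) Y(1) o(1,3) Y(3) A(3)] O_rest(3)[OF V(1) Y(1) o(1,3) Y(4) V(3)] Y(5) by simp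
    have e2: "rest (str M) B (Y \<inter> Z) q = rest (str M) W (Y \<inter> Z) g"
      using O_rest(3)[OF B(1) Z(1) o(1,4) Z(3) B(3)] O_rest(3)[OF W(1) Z(1) o(1,4) Z(4) W(3)] Z(5) by simp
    have l: "opn (A \<inter> B)" "a \<in> A \<inter> B" "opn (V \<inter> W)" "a \<in> V \<inter> W" using A B V W by auto
    show ?thesis
      unfolding germ_eq_iff[OF l(1,2) in_op[OF A(1,3) B(1,3), THEN conjunct2] l(3,4) in_op[OF V(1,3) W(1,3), THEN conjunct2]]
    proof (rule exI[of _ "Y \<inter> Z"], intro conjI o)
      show "Y \<inter> Z \<subseteq> (A \<inter> B) \<inter> (V \<inter> W)" using o by blast
      show "rest (str M) (A \<inter> B) (Y \<inter> Z) (b (A \<inter> B) (rest (str M) A (A \<inter> B) p) (rest (str M) B (A \<inter> B) q)) =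
        rest (str M) (V \<inter> W) (Y \<inter> Z) (b (V \<inter> W) (rest (str M) V (V \<inter> W) f) (rest (str M) W (V \<inter> W) g))"
        using rest_op[OF A(1,3) B(1,3) o(1,5)] rest_op[OF V(1,3) W(1,3) o(1,6)] e1 e2 by simp
    qed
  qed
  moreover have "(V, f) \<in> germ M a V f" "(W, g) \<in> germ M a W g"
    using germ_self[OF V] germ_self[OF W] by auto
  ultimately have "?S = {?G}" by blast
  then show ?thesis by simp
qed

lemma stalk_carrier:
  "G \<in> carrier (stalk M a) \<longleftrightarrow> (\<exists>V f. opn V \<and> a \<in> V \<and> f \<in> carrier (RR V) \<and> G = germ M a V f)"
  by (auto simp: stalk_def)

lemma germ_in_stalk: "opn V \<Longrightarrow> a \<in> V \<Longrightarrow> f \<in> carrier (RR V) \<Longrightarrow> germ M a V f \<in> carrier (stalk M a)"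
  unfolding stalk_carrier by blast

lemma stalk_binop:
  assumes V: "opn V" "a \<in> V" "f \<in> carrier (RR V)" and W: "opn W" "a \<in> W" "g \<in> carrier (RR W)"
  shows "germ M a V f \<otimes>\<^bsub>stalk M a\<^esub> germ M a W g =
      germ M a (V \<inter> W) (rest (str M) V (V \<inter> W) f \<otimes>\<^bsub>RR (V \<inter> W)\<^esub> rest (str M) W (V \<inter> W) g)"
    "germ M a V f \<oplus>\<^bsub>stalk M a\<^esub> germ M a W g =
      germ M a (V \<inter> W) (rest (str M) V (V \<inter> W) f \<oplus>\<^bsub>RR (V \<inter> W)\<^esub> rest (str M) W (V \<inter> W) g)"
proof -
  have m: "f \<otimes>\<^bsub>RR V\<^esub> g \<in> carrier (RR V) \<and> rest (str M) V W (f \<otimes>\<^bsub>RR V\<^esub> g) = rest (str M) V W f \<otimes>\<^bsub>RR W\<^esub> rest (str M) V W g"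
    "f \<oplus>\<^bsub>RR V\<^esub> g \<in> carrier (RR V) \<and> rest (str M) V W (f \<oplus>\<^bsub>RR V\<^esub> g) = rest (str M) V W f \<oplus>\<^bsub>RR W\<^esub> rest (str M) V W g"
    if V: "opn V" "opn W" "W \<subseteq> V" and f: "f \<in> carrier (RR V)" "g \<in> carrier (RR V)" for V W f g
    using ring_hom_mult[OF O_rest_hom[OF V] f] ring_hom_add[OF O_rest_hom[OF V] f]
      cringO[OF V(1)] f by (auto simp: cring.cring_simprules)
  show "germ M a V f \<otimes>\<^bsub>stalk M a\<^esub> germ M a W g =
      germ M a (V \<inter> W) (rest (str M) V (V \<inter> W) f \<otimes>\<^bsub>RR (V \<inter> W)\<^esub> rest (str M) W (V \<inter> W) g)"
    unfolding stalk_def using germ_binop[of "\<lambda>V. (\<otimes>\<^bsub>RR V\<^esub>)", OF m(1) V W] by simp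
  show "germ M a V f \<oplus>\<^bsub>stalk M a\<^esub> germ M a W g =
      germ M a (V \<inter> W) (rest (str M) V (V \<inter> W) f \<oplus>\<^bsub>RR (V \<inter> W)\<^esub> rest (str M) W (V \<inter> W) g)"
    unfolding stalk_def using germ_binop[of "\<lambda>V. (\<oplus>\<^bsub>RR V\<^esub>)", OF m(2) V W] by simp
qed

lemma evs_binop:
  assumes G: "G \<in> carrier (stalk M a)" and H: "H \<in> carrier (stalk M a)"
  shows "evs (G \<otimes>\<^bsub>stalk M a\<^esub> H) = evs G * evs H" "evs (G \<oplus>\<^bsub>stalk M a\<^esub> H) = evs G + evs H"
proof -
  obtain V f where V: "opn V" "a \<in> V" "f \<in> carrier (RR V)" and G': "G = germ M a V f"
    using G unfolding stalk_carrier by blast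
  obtain W g where W: "opn W" "a \<in> W" "g \<in> carrier (RR W)" and H': "H = germ M a W g"
    using H unfolding stalk_carrier by blast
  have o: "opn (V \<inter> W)" "a \<in> V \<inter> W" "V \<inter> W \<subseteq> V" "V \<inter> W \<subseteq> W" using V W by auto
  note r = O_rest(1)[OF V(1) o(1,3) V(3)] O_rest(1)[OF W(1) o(1,4) W(3)]
  interpret cring "RR (V \<inter> W)" by (rule cringO[OF o(1)])
  show "evs (G \<otimes>\<^bsub>stalk M a\<^esub> H) = evs G * evs H" "evs (G \<oplus>\<^bsub>stalk M a\<^esub> H) = evs G + evs H"
    unfolding G' H' stalk_binop[OF V W] using r o a V W
    by (simp_all add: evs_germ ev_mult ev_add ev_rest)
qed

lemma evs_one: "evs \<one>\<^bsub>stalk M a\<^esub> = 1"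
  using a U0T evs_germ[OF openin_topspace _ O_one_in[OF openin_topspace]] ev_one[OF openin_topspace]
  by (auto simp: stalk_def)

text \<open>Evaluation at \<open>a\<close> is a ring homomorphism from the stalk to the complex
  numbers, and it is onto because the stalk contains the constants. Its kernel is therefore
  maximal.\<close>

lemma maximalideal_evs: "maximalideal {G \<in> carrier (stalk M a). evs G = 0} (stalk M a)"
proof -
  \<comment> \<open>That the stalk is a ring is extracted from the existence of a maximal ideal,
    since \<open>maximalideal\<close> includes the ring axioms.\<close>
  have "\<exists>!I. maximalideal I (stalk M a)" using lrs a U0T by (auto simp: locally_ringed_space_def)
  then obtain I0 where "maximalideal I0 (stalk M a)" by blast
  then have R: "ring (stalk M a)" by (simp add: maximalideal_def ideal_def)
  interpret R: ring "stalk M a" by (rule R)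
  interpret C: cring complex_ring by (rule cring_complex)
  have "evs \<in> ring_hom (stalk M a) complex_ring"
    by (rule ring_hom_memI) (auto simp: evs_binop evs_one complex_ring_def)
  then interpret h: ring_hom_ring "stalk M a" complex_ring evs
    by (intro ring_hom_ringI2 R C.ring_axioms)
  have ker: "a_kernel (stalk M a) complex_ring evs = {G \<in> carrier (stalk M a). evs G = 0}" (is "_ = ?J")
    unfolding a_kernel_def' by (simp add: complex_ring_def)
  have J: "ideal ?J (stalk M a)" using h.kernel_is_ideal unfolding ker .
  define k where "k c = germ M a TT (c \<odot>\<^bsub>RR TT\<^esub> \<one>\<^bsub>RR TT\<^esub>)" for c
  have aT: "a \<in> TT" using a U0T by auto
  have k: "k c \<in> carrier (stalk M a)" "evs (k c) = c" for c
    unfolding k_def using aT a O_const_in[OF openin_topspace]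
    by (auto simp: evs_germ ev_const intro: germ_in_stalk)
  show ?thesis
  proof (rule maximalidealI[OF J])
    show "carrier (stalk M a) \<noteq> ?J"
    proof
      assume "carrier (stalk M a) = ?J"
      then have "k 1 \<in> ?J" using k(1)[of 1] by simp
      then show False using k(2)[of 1] by simp
    qed
    fix J' assume J': "ideal J' (stalk M a)" "?J \<subseteq> J'" "J' \<subseteq> carrier (stalk M a)"
    interpret J': ideal J' "stalk M a" by (rule J'(1))
    show "J' = ?J \<or> J' = carrier (stalk M a)"
    proof (cases "J' \<subseteq> ?J")
      case False
      then obtain x where x: "x \<in> J'" "x \<in> carrier (stalk M a)" "evs x \<noteq> 0" using J' by auto
      \<comment> \<open>After scaling by this constant, \<open>x\<close> has value 1 and differs
        from the unit by an element of the kernel. An ideal that contains the kernel and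
        \<open>x\<close> thus contains the unit.\<close>
      let ?k = "k (inverse (evs x))"
      have "?k \<otimes>\<^bsub>stalk M a\<^esub> x \<in> J'" by (rule J'.I_l_closed[OF x(1) k(1)])
      moreover have "\<one>\<^bsub>stalk M a\<^esub> \<ominus>\<^bsub>stalk M a\<^esub> ?k \<otimes>\<^bsub>stalk M a\<^esub> x \<in> ?J"
      proof -
        have kx: "?k \<otimes>\<^bsub>stalk M a\<^esub> x \<in> carrier (stalk M a)" using k x by auto
        have n: "evs (\<ominus>\<^bsub>stalk M a\<^esub> (?k \<otimes>\<^bsub>stalk M a\<^esub> x)) + evs (?k \<otimes>\<^bsub>stalk M a\<^esub> x) = evs \<zero>\<^bsub>stalk M a\<^esub>"
          using evs_binop(2)[of "\<ominus>\<^bsub>stalk M a\<^esub> (?k \<otimes>\<^bsub>stalk M a\<^esub> x)" "?k \<otimes>\<^bsub>stalk M a\<^esub> x"] kx by (simp add: R.l_neg)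
        have z: "evs \<zero>\<^bsub>stalk M a\<^esub> = 0" using h.hom_zero by (simp add: complex_ring_def)
        have e: "evs (?k \<otimes>\<^bsub>stalk M a\<^esub> x) = 1" using evs_binop(1)[OF k(1) x(2)] k(2) x(3) by simp
        have "evs (\<ominus>\<^bsub>stalk M a\<^esub> (?k \<otimes>\<^bsub>stalk M a\<^esub> x)) = -1" using n unfolding e z by (simp add: add_eq_0_iff2)
        then show ?thesis
          using kx evs_binop(2)[of "\<one>\<^bsub>stalk M a\<^esub>" "\<ominus>\<^bsub>stalk M a\<^esub> (?k \<otimes>\<^bsub>stalk M a\<^esub> x)"] evs_one
          by (simp add: a_minus_def)
      qed
      ultimately have "(\<one>\<^bsub>stalk M a\<^esub> \<ominus>\<^bsub>stalk M a\<^esub> ?k \<otimes>\<^bsub>stalk M a\<^esub> x) \<oplus>\<^bsub>stalk M a\<^esub> ?k \<otimes>\<^bsub>stalk M a\<^esub> x \<in> J'"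
        using J'(2) by (intro J'.a_closed) auto
      moreover have "(\<one>\<^bsub>stalk M a\<^esub> \<ominus>\<^bsub>stalk M a\<^esub> ?k \<otimes>\<^bsub>stalk M a\<^esub> x) \<oplus>\<^bsub>stalk M a\<^esub> ?k \<otimes>\<^bsub>stalk M a\<^esub> x = \<one>\<^bsub>stalk M a\<^esub>"
        using k(1)[of "inverse (evs x)"] x(2) by (simp add: a_minus_def R.a_assoc R.l_neg)
      ultimately show ?thesis using J'.one_imp_carrier by simp
    next
      case True
      then have "J' = ?J" using J'(2) by (rule equalityI)
      then show ?thesis by (rule disjI1)
    qed
  qed
qed

text \<open>Uniqueness of the maximal ideal identifies the ideal in \<open>residue_value\<close>
  with the kernel of evaluation, and \<open>f - c\<close> lies in the kernel exactly for
  \<open>c = ev a V f\<close>.\<close>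

lemma residue_value_ev:
  assumes V: "opn V" "a \<in> V" "f \<in> carrier (RR V)"
  shows "residue_value M V f a = ev a V f"
proof -
  have "\<exists>!I. maximalideal I (stalk M a)" using lrs a U0T by (auto simp: locally_ringed_space_def)
  then have I: "(THE I. maximalideal I (stalk M a)) = {G \<in> carrier (stalk M a). evs G = 0}"
    using maximalideal_evs by (rule the1_equality)
  interpret cring "RR V" by (rule cringO[OF V(1)])
  have c: "c \<odot>\<^bsub>RR V\<^esub> \<one>\<^bsub>RR V\<^esub> \<in> carrier (RR V)" for c by (rule O_const_in[OF V(1)])
  have "germ M a V (f \<ominus>\<^bsub>RR V\<^esub> (c \<odot>\<^bsub>RR V\<^esub> \<one>\<^bsub>RR V\<^esub>)) \<in> {G \<in> carrier (stalk M a). evs G = 0} \<longleftrightarrow> c = ev a V f" for c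
    using V a c germ_in_stalk[OF V(1,2), of "f \<ominus>\<^bsub>RR V\<^esub> (c \<odot>\<^bsub>RR V\<^esub> \<one>\<^bsub>RR V\<^esub>)"]
    by (auto simp: evs_germ ev_minus ev_const)
  then show ?thesis unfolding residue_value_def I by simp
qed

end

lemma ev_smooth:
  assumes V: "opn V" and f: "f \<in> carrier (RR V)"
  shows "smooth_on n (\<phi> ` (V \<inter> U0)) (coord V f zero_index)"
  using coord(1)[OF V f] by (simp add: euclidean_formal_simps)

text \<open>Residues are constant coefficients, so a section of the reduction is locally a smooth
  function of the coordinates. Conversely a smooth function is the residue of the power series that
  consists of this function alone.\<close>

lemma red_chart: "red_chart M (n, U0, \<phi>)"
proof -
  have main: "g \<in> carrier (secs (reduction M) W) \<longleftrightarrow> smooth_on n (\<phi> ` W) (g \<circ> inv_into U0 \<phi>)"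
    if W: "opn W" "W \<subseteq> U0" and g0: "\<forall>a. a \<notin> W \<longrightarrow> g a = 0" for W g
  proof
    assume g: "g \<in> carrier (secs (reduction M) W)"
    show "smooth_on n (\<phi> ` W) (g \<circ> inv_into U0 \<phi>)"
    proof (rule smooth_on_local[OF img_open[OF W]])
      fix x assume "x \<in> \<phi> ` W"
      then obtain a where a: "a \<in> W" "x = \<phi> a" by blast
      then obtain V f where V: "opn V" "a \<in> V" "V \<subseteq> W" "f \<in> carrier (RR V)" "\<And>b. b \<in> V \<Longrightarrow> g b = residue_value M V f b"
        using g by (auto simp: reduction_def)
      have VU: "V \<inter> U0 = V" using V W by auto
      have o: "opE (\<phi> ` V)" using V W by (intro img_open) auto
      have "smooth_on n (\<phi> ` V) (g \<circ> inv_into U0 \<phi>)"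
      proof (rule smooth_on_cong[OF o])
        show "smooth_on n (\<phi> ` V) (coord V f zero_index)" using ev_smooth[OF V(1,4)] by (simp add: VU)
        fix y assume "y \<in> \<phi> ` V"
        then obtain b where b: "b \<in> V" "y = \<phi> b" by blast
        then have "b \<in> U0" using V W by auto
        then show "coord V f zero_index y = (g \<circ> inv_into U0 \<phi>) y"
          using b V residue_value_ev[of b V f] by (simp add: inv_into_f_f[OF phi_inj] ev_def)
      qed
      then show "\<exists>Z. opE Z \<and> x \<in> Z \<and> smooth_on n Z (g \<circ> inv_into U0 \<phi>)" using o V a by blast
    qed
  next
    assume s: "smooth_on n (\<phi> ` W) (g \<circ> inv_into U0 \<phi>)"
    have o: "opE (\<phi> ` W)" by (rule img_open[OF W])
    have WU: "W \<inter> U0 = W" using W by auto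
    define q where "q x = (if x \<in> \<phi> ` W then g (inv_into U0 \<phi> x) else 0)" for x
    define t :: "(nat \<Rightarrow> nat) \<Rightarrow> (nat \<Rightarrow> real) \<Rightarrow> complex" where "t \<alpha> x = (if \<forall>i. \<alpha> i = 0 then q x else 0)" for \<alpha> x
    have "smooth_on n (\<phi> ` W) q" by (rule smooth_on_cong[OF o s]) (simp add: q_def)
    then have t: "t \<in> carrier (EE (\<phi> ` W))"
      using EE_single_in[OF o, of q] by (simp add: q_def t_def[abs_def])
    define f where "f = \<psi> (\<phi> ` W) t"
    have f: "f \<in> carrier (RR W)"
      using iso_img[OF o] t pre_img[OF W(2)] by (auto simp: f_def)
    have "coord W f = t"
      by (rule coord_eqI[OF W(1)]) (use t O_rest(2)[OF W(1) f] in \<open>simp_all add: WU f_def\<close>)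
    then have "g b = residue_value M W f b" if "b \<in> W" for b
      using that W residue_value_ev[of b W f] f
      by (auto simp: ev_def t_def q_def inv_into_f_f[OF phi_inj])
    then show "g \<in> carrier (secs (reduction M) W)"
      using g0 W f by (auto simp: reduction_def)
  qed
  have "homeomorphic_map (subtopology (base M) U0) (subtopology (Euclidean_space n) (\<phi> ` U0)) \<phi>"
    using hom by (simp add: phi_img)
  then show ?thesis using U0 img_open[OF U0] main by (auto simp: red_chart_def)
qed

text \<open>\<open>K\<close> and \<open>N\<close> are the preimages of the closed cube of radius
  \<open>2 * r\<close> and of the open cube of radius \<open>r\<close>. The power series has only a
  constant term, hence \<open>h\<close> restricts to the unit section on \<open>N\<close>, which is
  stronger than having residue 1 there. The function \<open>\<rho>\<close> records that the residues
  are real and nonnegative, as needed for partitions of unity.\<close>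

lemma chart_bump:
  assumes a: "a \<in> U0" and U: "opn U" "a \<in> U" and T2: "Hausdorff_space (base M)"
  shows "\<exists>h \<rho> K N. h \<in> carrier (RR TT) \<and> compactin (base M) K \<and> K \<subseteq> U \<inter> U0 \<and> opn N \<and> a \<in> N \<and> N \<subseteq> K \<and>
     rest (str M) TT (TT - K) h = \<zero>\<^bsub>RR (TT - K)\<^esub> \<and> rest (str M) TT N h = \<one>\<^bsub>RR N\<^esub> \<and>
     (\<forall>b\<in>U0. residue_value M TT h b = complex_of_real (\<rho> b)) \<and> (\<forall>b. \<rho> b \<ge> 0 \<and> (b \<notin> K \<longrightarrow> \<rho> b = 0))"
proof -
  have o: "opE (\<phi> ` (U \<inter> U0))" by (rule V'(2)[OF U(1)])
  obtain r where r: "r > 0" "cube n (\<phi> a) (2 * r) \<subseteq> \<phi> ` (U \<inter> U0)"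
    using cube_in_open[OF o, of "\<phi> a"] a U by blast
  let ?c = "cube n (\<phi> a) (2 * r)"
  define K where "K = {b \<in> U0. \<phi> b \<in> ?c}"
  have KU: "K \<subseteq> U"
  proof
    fix b assume "b \<in> K"
    then obtain b' where "b' \<in> U \<inter> U0" "\<phi> b = \<phi> b'" "b \<in> U0" using r by (auto simp: K_def)
    then show "b \<in> U" using inj_onD[OF phi_inj, of b b'] by auto
  qed
  obtain \<xi> where \<xi>: "homeomorphic_maps (subtopology (base M) U0) (Euclidean_space n) \<phi> \<xi>"
    using hom by (auto simp: homeomorphic_map_maps)
  have cT: "?c \<subseteq> TE" by (auto simp: cube_def topspace_Euclidean_space)
  have "K = \<xi> ` ?c"
  proof
    show "K \<subseteq> \<xi> ` ?c" using \<xi> unfolding homeomorphic_maps_def topsU0 K_def by force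
    show "\<xi> ` ?c \<subseteq> K" using \<xi> cT unfolding homeomorphic_maps_def topsU0 K_def
      by (auto simp: continuous_map_def topsU0 Pi_iff subset_iff)
  qed
  moreover have "compactin (subtopology (base M) U0) (\<xi> ` ?c)"
    using \<xi> compactin_cube by (intro image_compactin) (auto simp: homeomorphic_maps_def)
  ultimately have K: "compactin (base M) K" by (simp add: compactin_subtopology)
  have KU0: "K \<subseteq> U0" by (auto simp: K_def)
  have Kc: "closedin (base M) K" by (rule compactin_imp_closedin[OF T2 K])
  define N where "N = {b \<in> U0. \<phi> b \<in> {x \<in> TE. \<forall>j<n. \<bar>x j - \<phi> a j\<bar> < r}}"
  have N: "opn N" unfolding N_def by (rule pre_open[OF openin_open_cube])
  have aN: "a \<in> N" using a r phi_img by (auto simp: N_def)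
  have NK: "N \<subseteq> K" using r by (force simp: N_def K_def cube_def topspace_Euclidean_space)
  define q where "q x = (if x \<in> TE then complex_of_real (bump n (\<phi> a) r x) else 0)" for x
  define t :: "(nat \<Rightarrow> nat) \<Rightarrow> (nat \<Rightarrow> real) \<Rightarrow> complex" where "t \<alpha> x = (if \<forall>i. \<alpha> i = 0 then q x else 0)" for \<alpha> x
  have oT: "opE TE" by simp
  have "smooth_on n TE q" by (rule smooth_on_cong[OF oT smooth_on_bump[OF oT]]) (simp add: q_def)
  then have t: "t \<in> carrier (EE TE)"
    using EE_single_in[OF oT, of q] by (simp add: q_def t_def[abs_def])
  have preT: "{b \<in> U0. \<phi> b \<in> TE} = U0" using phi_img by auto
  define f where "f = \<psi> TE t"
  have f: "f \<in> carrier (RR U0)" using iso_img[OF oT] t by (auto simp: f_def preT)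
  have q0: "q x = 0" if "x \<notin> ?c" for x using bump_zero[OF r(1) _ that] by (simp add: q_def)
  have oc: "opE (TE - ?c)"
    by (rule openin_diff[OF oT compactin_imp_closedin[OF _ compactin_cube]])
      (simp add: Euclidean_space_def Hausdorff_space_subtopology Hausdorff_space_product_topology)
  have pc: "{b \<in> U0. \<phi> b \<in> TE - ?c} = U0 - K" using phi_img by (auto simp: K_def)
  have f0: "rest (str M) U0 (U0 - K) f = \<zero>\<^bsub>RR (U0 - K)\<^esub>"
  proof -
    have "rest (str (euclidean_formal n k)) TE (TE - ?c) t = (\<lambda>\<alpha> x. 0)"
      using q0 by (auto simp: euclidean_formal_simps t_def fun_eq_iff)
    then have "rest (str M) U0 (U0 - K) f = \<psi> (TE - ?c) (\<lambda>\<alpha> x. 0)"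
      using iso_rest[OF oT oc Diff_subset t] unfolding preT pc f_def by simp
    \<comment> \<open>That \<open>\<psi>\<close> preserves zero follows from additivity alone: the
      image of zero equals its own double in the ring of sections over
      \<open>U0 - K\<close>.\<close>
    moreover have "\<psi> (TE - ?c) \<zero>\<^bsub>EE (TE - ?c)\<^esub> = \<zero>\<^bsub>RR (U0 - K)\<^esub>"
    proof -
      let ?z = "\<lambda>\<alpha> x. 0 :: complex"
      have z: "?z \<in> carrier (EE (TE - ?c))" by (rule EE_zero_in[OF oc])
      have "\<psi> (TE - ?c) (?z \<oplus>\<^bsub>EE (TE - ?c)\<^esub> ?z) = \<psi> (TE - ?c) ?z \<oplus>\<^bsub>RR (U0 - K)\<^esub> \<psi> (TE - ?c) ?z"
        using ring_hom_add[OF iso_hom[OF oc] z z] unfolding pc .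
      then have e: "\<psi> (TE - ?c) ?z \<oplus>\<^bsub>RR (U0 - K)\<^esub> \<psi> (TE - ?c) ?z = \<psi> (TE - ?c) ?z"
        by (simp add: euclidean_formal_simps)
      interpret cring "RR (U0 - K)" by (rule cringO) (use U0 Kc in \<open>auto intro: openin_diff\<close>)
      have "\<psi> (TE - ?c) ?z \<in> carrier (RR (U0 - K))" using iso_img[OF oc, unfolded pc] z by auto
      then show ?thesis using e by (simp add: euclidean_formal_simps add.l_cancel_one')
    qed
    ultimately show ?thesis by (simp add: euclidean_formal_simps)
  qed
  have oK: "opn (TT - K)" using Kc by auto
  have oUK: "opn (U0 - K)" using U0 Kc by (auto intro: openin_diff)
  have i: "U0 \<inter> (TT - K) = U0 - K" using U0T by auto
  have un: "TT = U0 \<union> (TT - K)" using U0T KU0 by auto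
  have ag: "rest (str M) U0 (U0 \<inter> (TT - K)) f = rest (str M) (TT - K) (U0 \<inter> (TT - K)) \<zero>\<^bsub>RR (TT - K)\<^esub>"
    unfolding i f0 by (rule O_rest_zero[OF oK oUK, symmetric]) (use U0T in auto)
  from is_sheaf_glue2[OF sheafO U0 oK un f O_zero_in[OF oK] ag]
  obtain h where h: "h \<in> carrier (RR TT)" "rest (str M) TT U0 h = f" "rest (str M) TT (TT - K) h = \<zero>\<^bsub>RR (TT - K)\<^esub>"
    by (elim bexE conjE) (rule that)
  have NU: "N \<subseteq> U0" by (auto simp: N_def)
  have h1: "rest (str M) TT N h = \<one>\<^bsub>RR N\<^esub>"
  proof -
    let ?N = "{x \<in> TE. \<forall>j<n. \<bar>x j - \<phi> a j\<bar> < r}"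
    have "rest (str (euclidean_formal n k)) TE ?N t = \<one>\<^bsub>EE ?N\<^esub>"
    proof -
      have "q x = 1" if "x \<in> ?N" for x
      proof -
        have "x \<in> cube n (\<phi> a) r" using that by (auto simp: cube_def topspace_Euclidean_space intro: less_imp_le)
        then show ?thesis using bump_one[OF r(1)] that by (simp add: q_def)
      qed
      then show ?thesis by (auto simp: euclidean_formal_simps t_def fun_eq_iff)
    qed
    then have "rest (str M) U0 N f = \<one>\<^bsub>RR N\<^esub>"
      using iso_rest[OF oT openin_open_cube _ t, of "\<phi> a" r] ring_hom_one[OF iso_hom[OF openin_open_cube[of n "\<phi> a" r]]]
      unfolding N_def[symmetric] by (simp add: preT f_def)
    then show ?thesis using O_rest(3)[OF openin_topspace U0 N NU U0T h(1)] h(2) by simp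
  qed
  define \<rho> where "\<rho> b = (if b \<in> U0 then bump n (\<phi> a) r (\<phi> b) else 0)" for b
  have res: "residue_value M TT h b = complex_of_real (\<rho> b)" if b: "b \<in> TT" "b \<in> U0" for b
  proof -
    have iU: "TT \<inter> U0 = U0" using U0T by auto
    have "coord TT h = t"
      by (rule coord_eqI[OF openin_topspace]) (use t h(2) in \<open>simp_all add: iU phi_img f_def\<close>)
    then show ?thesis using residue_value_ev[OF b(2) openin_topspace b(1) h(1)] phi_img b
      by (auto simp: ev_def t_def q_def \<rho>_def)
  qed
  have \<rho>: "\<rho> b \<ge> 0" "b \<notin> K \<Longrightarrow> \<rho> b = 0" for b
    using bump_nonneg bump_zero[OF r(1), of "\<phi> b" n "\<phi> a"] imageI[of b U0 \<phi>, unfolded phi_img]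
    by (auto simp: \<rho>_def K_def)
  have KUU: "K \<subseteq> U \<inter> U0" using KU KU0 by simp
  have res': "residue_value M TT h b = complex_of_real (\<rho> b)" if "b \<in> U0" for b
    by (rule res) (use that U0T in auto)
  show ?thesis
    by (rule exI[of _ h], rule exI[of _ \<rho>], rule exI[of _ K], rule exI[of _ N],
        intro conjI ballI allI impI h(1) K KUU N aN NK h(3) h1 res' \<rho>)
qed

end

section \<open>Sheaves of functions as sheaves of modules\<close>

locale fmfd =
  fixes M :: "('p, 's) ringed_space"
  assumes fm: "formal_manifold M"
begin

lemma lrs: "locally_ringed_space M" and paracompact: "paracompact_space (base M)"
  and T2: "Hausdorff_space (base M)"
  using fm by (simp_all add: formal_manifold_def)

sublocale cringed M using lrs by unfold_locales (simp add: locally_ringed_space_def)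

lemma chart_at:
  assumes "a \<in> TT"
  shows "\<exists>U0 n k \<phi> \<psi>. formal_chart M U0 n k \<phi> \<psi> \<and> a \<in> U0"
proof -
  obtain U n k where U: "opn U" "a \<in> U" and iso: "ringed_iso (restrict_space_to M U) (euclidean_formal n k)"
    using fm assms unfolding formal_manifold_def by blast
  have top: "topspace (base (restrict_space_to M U)) = U"
    using openin_subset[OF U(1)] by (auto simp: restrict_space_to_def)
  from iso obtain \<phi> \<psi> where
    1: "homeomorphic_map (base (restrict_space_to M U)) (base (euclidean_formal n k)) \<phi>"
    and 2: "\<forall>W. openin (base (euclidean_formal n k)) W \<longrightarrow>
           \<psi> W \<in> ring_iso (secs (str (euclidean_formal n k)) W) (secs (str (restrict_space_to M U)) {a \<in> U. \<phi> a \<in> W}) \<and>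
           (\<forall>c. \<forall>f\<in>carrier (secs (str (euclidean_formal n k)) W).
              \<psi> W (c \<odot>\<^bsub>secs (str (euclidean_formal n k)) W\<^esub> f) =
              c \<odot>\<^bsub>secs (str (restrict_space_to M U)) {a \<in> U. \<phi> a \<in> W}\<^esub> \<psi> W f)"
    and 3: "\<forall>W W'. openin (base (euclidean_formal n k)) W \<and> openin (base (euclidean_formal n k)) W' \<and> W' \<subseteq> W \<longrightarrow>
           (\<forall>f\<in>carrier (secs (str (euclidean_formal n k)) W).
              \<psi> W' (rest (str (euclidean_formal n k)) W W' f) =
              rest (str (restrict_space_to M U)) {a \<in> U. \<phi> a \<in> W} {a \<in> U. \<phi> a \<in> W'} (\<psi> W f))"
    unfolding ringed_iso_def top by (elim exE conjE) (rule that)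
  have b: "base (restrict_space_to M U) = subtopology (base M) U" "str (restrict_space_to M U) = str M"
    by (simp_all add: restrict_space_to_def)
  have "formal_chart M U n k \<phi> \<psi>"
  proof (unfold_locales)
    show "homeomorphic_map (subtopology (base M) U) (Euclidean_space n) \<phi>"
      using 1 unfolding b euclidean_formal_simps(1) .
  next
    fix W assume "openin (Euclidean_space n) W"
    then show "\<psi> W \<in> ring_iso (secs (str (euclidean_formal n k)) W) (secs (str M) {a \<in> U. \<phi> a \<in> W})"
      using 2 unfolding b euclidean_formal_simps(1) by blast
  next
    fix W c f assume "openin (Euclidean_space n) W" "f \<in> carrier (secs (str (euclidean_formal n k)) W)"
    then show "\<psi> W (c \<odot>\<^bsub>secs (str (euclidean_formal n k)) W\<^esub> f) = c \<odot>\<^bsub>secs (str M) {a \<in> U. \<phi> a \<in> W}\<^esub> \<psi> W f"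
      using 2 unfolding b euclidean_formal_simps(1) by blast
  next
    fix W W' f assume "openin (Euclidean_space n) W" "openin (Euclidean_space n) W'" "W' \<subseteq> W"
      "f \<in> carrier (secs (str (euclidean_formal n k)) W)"
    then show "\<psi> W' (rest (str (euclidean_formal n k)) W W' f) = rest (str M) {a \<in> U. \<phi> a \<in> W} {a \<in> U. \<phi> a \<in> W'} (\<psi> W f)"
      using 3 unfolding b euclidean_formal_simps(1) by blast
  qed (fact lrs U(1))+
  then show ?thesis using U(2) by blast
qed

abbreviation "resv \<equiv> residue_value M"

context
  fixes V a assumes V: "opn V" and a: "a \<in> V"
begin

lemma aT: "a \<in> TT" using V a openin_subset by blast

text \<open>All these rules are read off from a chart around the point, where the residue is
  \<open>ev\<close>.\<close>

lemma resv_add: "f \<in> carrier (RR V) \<Longrightarrow> g \<in> carrier (RR V) \<Longrightarrow> resv V (f \<oplus>\<^bsub>RR V\<^esub> g) a = resv V f a + resv V g a"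
  and resv_mult: "f \<in> carrier (RR V) \<Longrightarrow> g \<in> carrier (RR V) \<Longrightarrow> resv V (f \<otimes>\<^bsub>RR V\<^esub> g) a = resv V f a * resv V g a"
  and resv_one: "resv V \<one>\<^bsub>RR V\<^esub> a = 1"
  and resv_zero: "resv V \<zero>\<^bsub>RR V\<^esub> a = 0"
  and resv_const: "resv V (c \<odot>\<^bsub>RR V\<^esub> \<one>\<^bsub>RR V\<^esub>) a = c"
  and resv_rest: "opn W \<Longrightarrow> W \<subseteq> V \<Longrightarrow> a \<in> W \<Longrightarrow> f \<in> carrier (RR V) \<Longrightarrow> resv W (rest (str M) V W f) a = resv V f a"
proof -
  obtain U0 n k \<phi> \<psi> where c: "formal_chart M U0 n k \<phi> \<psi>" "a \<in> U0" using chart_at[OF aT] by blast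
  interpret c: formal_chart M U0 n k \<phi> \<psi> by (rule c(1))
  interpret R: cring "RR V" by (rule cringO[OF V])
  note e = c.residue_value_ev[OF c(2) V a]
  have aV: "a \<in> V \<inter> U0" using a c(2) by simp
  show "f \<in> carrier (RR V) \<Longrightarrow> g \<in> carrier (RR V) \<Longrightarrow> resv V (f \<oplus>\<^bsub>RR V\<^esub> g) a = resv V f a + resv V g a"
    by (simp add: e c.ev_add[OF V])
  show "f \<in> carrier (RR V) \<Longrightarrow> g \<in> carrier (RR V) \<Longrightarrow> resv V (f \<otimes>\<^bsub>RR V\<^esub> g) a = resv V f a * resv V g a"
    by (simp add: e c.ev_mult[OF V])
  show "resv V \<one>\<^bsub>RR V\<^esub> a = 1" by (simp add: e c.ev_one[OF V aV])
  show "resv V \<zero>\<^bsub>RR V\<^esub> a = 0" by (simp add: e c.ev_zero[OF V])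
  show "resv V (c \<odot>\<^bsub>RR V\<^esub> \<one>\<^bsub>RR V\<^esub>) a = c" by (simp add: e[OF O_const_in[OF V]] c.ev_const[OF V aV])
  assume W: "opn W" "W \<subseteq> V" "a \<in> W" and f: "f \<in> carrier (RR V)"
  then show "resv W (rest (str M) V W f) a = resv V f a"
    using c.residue_value_ev[OF c(2) W(1,3) O_rest(1)[OF V W(1,2) f]] e[OF f] c.ev_rest[OF V W(1,2) f] c(2) by simp
qed

end

end

text \<open>The common pattern of the reduction and of the densities: sections are functions of a
  point and an index, extended by zero, with pointwise operations. The index type is
  \<open>unit\<close> for functions and the type of charts for densities; \<open>val\<close> and
  \<open>mk\<close> translate to this shape. The last assumption, that membership is a local
  condition, carries the gluing axiom.\<close>

locale function_sheaf = fmfd M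
  for M :: "('p, 's) ringed_space" +
  fixes F :: "('p, 's, 'm) sheaf_data" and val :: "'m \<Rightarrow> 'i \<Rightarrow> 'p \<Rightarrow> complex" and mk :: "('i \<Rightarrow> 'p \<Rightarrow> complex) \<Rightarrow> 'm"
  assumes val_mk: "\<And>h. val (mk h) = h" and val_inj: "\<And>m m'. val m = val m' \<Longrightarrow> m = m'"
    and val_add: "\<And>W m m'. val (m \<oplus>\<^bsub>secs F W\<^esub> m') = (\<lambda>i a. val m i a + val m' i a)"
    and val_zero: "\<And>W. val \<zero>\<^bsub>secs F W\<^esub> = (\<lambda>i a. 0)"
    and val_smult: "\<And>W f m. val (f \<odot>\<^bsub>secs F W\<^esub> m) = (\<lambda>i a. residue_value M W f a * val m i a)"
    and val_rest: "\<And>W V m. val (rest F W V m) = (\<lambda>i a. if a \<in> V then val m i a else 0)"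
    and off: "\<And>W m i a. m \<in> carrier (secs F W) \<Longrightarrow> a \<notin> W \<Longrightarrow> val m i a = 0"
    and add_in: "\<And>W m m'. openin (base M) W \<Longrightarrow> m \<in> carrier (secs F W) \<Longrightarrow> m' \<in> carrier (secs F W) \<Longrightarrow>
       m \<oplus>\<^bsub>secs F W\<^esub> m' \<in> carrier (secs F W)"
    and zero_in: "\<And>W. openin (base M) W \<Longrightarrow> \<zero>\<^bsub>secs F W\<^esub> \<in> carrier (secs F W)"
    and smult_in: "\<And>W f m. openin (base M) W \<Longrightarrow> f \<in> carrier (secs (str M) W) \<Longrightarrow> m \<in> carrier (secs F W) \<Longrightarrow>
       f \<odot>\<^bsub>secs F W\<^esub> m \<in> carrier (secs F W)"
    and rest_in: "\<And>W V m. openin (base M) W \<Longrightarrow> openin (base M) V \<Longrightarrow> V \<subseteq> W \<Longrightarrow> m \<in> carrier (secs F W) \<Longrightarrow>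
       rest F W V m \<in> carrier (secs F V)"
    and local: "\<And>W m. openin (base M) W \<Longrightarrow> (\<And>i a. a \<notin> W \<Longrightarrow> val m i a = 0) \<Longrightarrow>
       (\<And>a. a \<in> W \<Longrightarrow> \<exists>V. openin (base M) V \<and> a \<in> V \<and> V \<subseteq> W \<and> rest F W V m \<in> carrier (secs F V)) \<Longrightarrow>
       m \<in> carrier (secs F W)"
begin

abbreviation "FF \<equiv> secs F"

lemma eqI: "(\<And>i a. val m i a = val m' i a) \<Longrightarrow> m = m'"
  by (rule val_inj) (intro ext)

text \<open>Negatives are obtained by multiplying with the constant section \<open>-1\<close>, so no
  closure under subtraction has to be assumed for the sheaf.\<close>

lemma abelian: assumes W: "opn W" shows "abelian_group (FF W)"
proof (rule abelian_groupI)
  fix m assume m: "m \<in> carrier (FF W)"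
  let ?n = "((-1) \<odot>\<^bsub>RR W\<^esub> \<one>\<^bsub>RR W\<^esub>) \<odot>\<^bsub>FF W\<^esub> m"
  have "?n \<in> carrier (FF W)" by (intro smult_in W O_const_in m)
  moreover have "?n \<oplus>\<^bsub>FF W\<^esub> m = \<zero>\<^bsub>FF W\<^esub>"
  proof (rule eqI)
    fix i a show "val (?n \<oplus>\<^bsub>FF W\<^esub> m) i a = val \<zero>\<^bsub>FF W\<^esub> i a"
      by (cases "a \<in> W") (simp_all add: val_add val_smult val_zero resv_const[OF W] off[OF m])
  qed
  ultimately show "\<exists>n\<in>carrier (FF W). n \<oplus>\<^bsub>FF W\<^esub> m = \<zero>\<^bsub>FF W\<^esub>" by blast
qed (auto intro!: eqI add_in zero_in W simp: val_add val_zero)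

lemma module: assumes W: "opn W" shows "Module.module (RR W) (FF W)"
proof (rule Module.moduleI[OF cringO[OF W] abelian[OF W]])
  interpret R: cring "RR W" by (rule cringO[OF W])
  fix m assume m: "m \<in> carrier (FF W)"
  show "\<one>\<^bsub>RR W\<^esub> \<odot>\<^bsub>FF W\<^esub> m = m"
  proof (rule eqI)
    fix i a show "val (\<one>\<^bsub>RR W\<^esub> \<odot>\<^bsub>FF W\<^esub> m) i a = val m i a"
      by (cases "a \<in> W") (simp_all add: val_smult resv_one[OF W] off[OF m])
  qed
  fix f assume f: "f \<in> carrier (RR W)"
  show "f \<odot>\<^bsub>FF W\<^esub> m \<in> carrier (FF W)" by (rule smult_in[OF W f m])
  fix n
  show "f \<odot>\<^bsub>FF W\<^esub> (m \<oplus>\<^bsub>FF W\<^esub> n) = f \<odot>\<^bsub>FF W\<^esub> m \<oplus>\<^bsub>FF W\<^esub> f \<odot>\<^bsub>FF W\<^esub> n"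
    by (rule eqI) (simp add: val_smult val_add distrib_left)
  fix g
  assume g: "g \<in> carrier (RR W)"
  show "(f \<oplus>\<^bsub>RR W\<^esub> g) \<odot>\<^bsub>FF W\<^esub> m = f \<odot>\<^bsub>FF W\<^esub> m \<oplus>\<^bsub>FF W\<^esub> g \<odot>\<^bsub>FF W\<^esub> m"
  proof (rule eqI)
    fix i a show "val ((f \<oplus>\<^bsub>RR W\<^esub> g) \<odot>\<^bsub>FF W\<^esub> m) i a = val (f \<odot>\<^bsub>FF W\<^esub> m \<oplus>\<^bsub>FF W\<^esub> g \<odot>\<^bsub>FF W\<^esub> m) i a"
      by (cases "a \<in> W") (simp_all add: val_smult val_add resv_add[OF W _ f g] distrib_right off[OF m])
  qed
  show "(f \<otimes>\<^bsub>RR W\<^esub> g) \<odot>\<^bsub>FF W\<^esub> m = f \<odot>\<^bsub>FF W\<^esub> (g \<odot>\<^bsub>FF W\<^esub> m)"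
  proof (rule eqI)
    fix i a show "val ((f \<otimes>\<^bsub>RR W\<^esub> g) \<odot>\<^bsub>FF W\<^esub> m) i a = val (f \<odot>\<^bsub>FF W\<^esub> (g \<odot>\<^bsub>FF W\<^esub> m)) i a"
      by (cases "a \<in> W") (simp_all add: val_smult resv_mult[OF W _ f g] off[OF m])
  qed
qed

lemma rest_self: "m \<in> carrier (FF W) \<Longrightarrow> rest F W W m = m"
  by (rule eqI) (simp add: val_rest off)

lemma is_sheaf: "is_sheaf (base M) F"
  unfolding is_sheaf_def
proof (intro conjI allI impI ballI)
  fix \<U> and s
  assume "(\<forall>U\<in>\<U>. opn U \<and> s U \<in> carrier (FF U)) \<and>
    (\<forall>U\<in>\<U>. \<forall>V\<in>\<U>. rest F U (U \<inter> V) (s U) = rest F V (U \<inter> V) (s V))"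
  then have s: "\<And>U. U \<in> \<U> \<Longrightarrow> opn U" "\<And>U. U \<in> \<U> \<Longrightarrow> s U \<in> carrier (FF U)"
    and agree: "\<And>U V. U \<in> \<U> \<Longrightarrow> V \<in> \<U> \<Longrightarrow> rest F U (U \<inter> V) (s U) = rest F V (U \<inter> V) (s V)" by auto
  have agr: "val (s U) i a = val (s V) i a" if "U \<in> \<U>" "V \<in> \<U>" "a \<in> U" "a \<in> V" for U V i a
    using arg_cong[OF agree[OF that(1,2)], of "\<lambda>m. val m i a"] that by (simp add: val_rest)
  \<comment> \<open>The glued function takes at each point the value of an arbitrary member of the
    family whose domain contains the point.\<close>
  define m where "m = mk (\<lambda>i a. if a \<in> \<Union>\<U> then val (s (SOME U. U \<in> \<U> \<and> a \<in> U)) i a else 0)"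
  have m: "val m i a = val (s U) i a" if U: "U \<in> \<U>" "a \<in> U" for U i a
  proof -
    have "(SOME U. U \<in> \<U> \<and> a \<in> U) \<in> \<U> \<and> a \<in> (SOME U. U \<in> \<U> \<and> a \<in> U)"
      by (rule someI[of "\<lambda>U. U \<in> \<U> \<and> a \<in> U" U]) (use U in simp)
    then show ?thesis using U agr[of "SOME U. U \<in> \<U> \<and> a \<in> U" U a i] by (auto simp: m_def val_mk)
  qed
  have mr: "rest F (\<Union>\<U>) U m = s U" if U: "U \<in> \<U>" for U
    by (rule eqI) (use U m off[OF s(2)[OF U]] in \<open>simp add: val_rest\<close>)
  have oU: "opn (\<Union>\<U>)" using s(1) by blast
  have m_in: "m \<in> carrier (FF (\<Union>\<U>))"
  proof (rule local[OF oU])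
    fix i a assume "a \<notin> \<Union>\<U>" then show "val m i a = 0" by (simp add: m_def val_mk)
  next
    fix a assume "a \<in> \<Union>\<U>"
    then obtain U where U: "U \<in> \<U>" "a \<in> U" by blast
    then show "\<exists>V. opn V \<and> a \<in> V \<and> V \<subseteq> \<Union>\<U> \<and> rest F (\<Union>\<U>) V m \<in> carrier (FF V)"
      using mr[OF U(1)] s(1,2)[OF U(1)] by (intro exI[of _ U]) auto
  qed
  show "\<exists>!m. m \<in> carrier (FF (\<Union>\<U>)) \<and> (\<forall>U\<in>\<U>. rest F (\<Union>\<U>) U m = s U)"
  proof (rule ex1I[of _ m])
    show "m \<in> carrier (FF (\<Union>\<U>)) \<and> (\<forall>U\<in>\<U>. rest F (\<Union>\<U>) U m = s U)" using m_in mr by simp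
    fix m' assume m': "m' \<in> carrier (FF (\<Union>\<U>)) \<and> (\<forall>U\<in>\<U>. rest F (\<Union>\<U>) U m' = s U)"
    show "m' = m"
    proof (rule eqI)
      fix i a show "val m' i a = val m i a"
      proof (cases "a \<in> \<Union>\<U>")
        case True
        then obtain U where U: "U \<in> \<U>" "a \<in> U" by blast
        then have "val (rest F (\<Union>\<U>) U m') i a = val (s U) i a" using m' by simp
        then show ?thesis using U m[OF U, of i] by (simp add: val_rest)
      next
        case False
        then show ?thesis using off[OF m_in False] off[of m' "\<Union>\<U>" a] m' by simp
      qed
    qed
  qed
next
  fix U V W m assume 1: "opn U \<and> opn V \<and> opn W \<and> W \<subseteq> V \<and> V \<subseteq> U"
  show "rest F V W (rest F U V m) = rest F U W m"
    by (rule eqI) (use 1 in \<open>auto simp: val_rest\<close>)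
next
  fix U m assume "m \<in> carrier (FF U)"
  then show "rest F U U m = m" by (rule rest_self)
next
  fix U V assume "opn U \<and> opn V \<and> V \<subseteq> U"
  then show "rest F U V \<in> carrier (FF U) \<rightarrow> carrier (FF V)" using rest_in by auto
qed

lemma sheaf_of_modules: "sheaf_of_modules M F"
  unfolding sheaf_of_modules_def
proof (intro conjI allI impI ballI is_sheaf module)
  fix U V u v assume "opn U \<and> opn V \<and> V \<subseteq> U" "u \<in> carrier (FF U)" "v \<in> carrier (FF U)"
  show "rest F U V (u \<oplus>\<^bsub>FF U\<^esub> v) = rest F U V u \<oplus>\<^bsub>FF V\<^esub> rest F U V v"
    by (rule eqI) (simp add: val_rest val_add)
next
  fix U V f u assume 1: "opn U \<and> opn V \<and> V \<subseteq> U" and f: "f \<in> carrier (RR U)" and u: "u \<in> carrier (FF U)"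
  show "rest F U V (f \<odot>\<^bsub>FF U\<^esub> u) = rest (str M) U V f \<odot>\<^bsub>FF V\<^esub> rest F U V u"
  proof (rule eqI)
    fix i a
    show "val (rest F U V (f \<odot>\<^bsub>FF U\<^esub> u)) i a = val (rest (str M) U V f \<odot>\<^bsub>FF V\<^esub> rest F U V u) i a"
      using 1 resv_rest[of U a V f] f by (auto simp: val_rest val_smult)
  qed
qed

lemma val_cscale:
  assumes W: "opn W" and m: "m \<in> carrier (FF W)"
  shows "val (sheaf_cscale M F W c m) i a = c * val m i a"
  by (cases "a \<in> W") (simp_all add: sheaf_cscale_def val_smult resv_const[OF W] off[OF m])

end

subsection \<open>The reduction\<close>

context fmfd begin

abbreviation "RED \<equiv> secs (reduction M)"
abbreviation "DEN \<equiv> secs (densities M)"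

lemma reduction_simps:
  "g \<in> carrier (RED W) \<longleftrightarrow> (\<forall>a. a \<notin> W \<longrightarrow> g a = 0) \<and>
           (\<forall>a\<in>W. \<exists>V f. opn V \<and> a \<in> V \<and> V \<subseteq> W \<and> f \<in> carrier (RR V) \<and> (\<forall>b\<in>V. g b = resv V f b))"
  "(\<oplus>\<^bsub>RED W\<^esub>) = (\<lambda>g h a. g a + h a)" "\<zero>\<^bsub>RED W\<^esub> = (\<lambda>a. 0)"
  "(\<odot>\<^bsub>RED W\<^esub>) = (\<lambda>f g a. resv W f a * g a)"
  "rest (reduction M) W V = (\<lambda>g a. if a \<in> V then g a else 0)"
  by (simp_all add: reduction_def)

lemma RED_off: "g \<in> carrier (RED W) \<Longrightarrow> a \<notin> W \<Longrightarrow> g a = 0"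
  by (simp add: reduction_simps)

lemma RED_local:
  assumes "g \<in> carrier (RED W)" "a \<in> W"
  obtains V f where "opn V" "a \<in> V" "V \<subseteq> W" "f \<in> carrier (RR V)" "\<And>b. b \<in> V \<Longrightarrow> g b = resv V f b"
proof -
  have "\<exists>V f. opn V \<and> a \<in> V \<and> V \<subseteq> W \<and> f \<in> carrier (RR V) \<and> (\<forall>b\<in>V. g b = resv V f b)"
    using assms unfolding reduction_simps by blast
  then show thesis by (elim exE conjE) (rule that, assumption+, simp)
qed

lemma REDI:
  assumes "\<And>a. a \<notin> W \<Longrightarrow> g a = 0"
    and "\<And>a. a \<in> W \<Longrightarrow> \<exists>V f. opn V \<and> a \<in> V \<and> V \<subseteq> W \<and> f \<in> carrier (RR V) \<and> (\<forall>b\<in>V. g b = resv V f b)"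
  shows "g \<in> carrier (RED W)"
  unfolding reduction_simps by (intro conjI allI impI ballI assms)

text \<open>Local representability by residues for a pointwise operation \<open>q\<close> that is
  induced by an operation \<open>b\<close> on sections; sums and products are the two
  instances.\<close>

lemma RED_binop:
  assumes g: "g \<in> carrier (RED W)" and h: "h \<in> carrier (RED W)"
    and q0: "q 0 0 = 0"
    and b: "\<And>V f f'. opn V \<Longrightarrow> f \<in> carrier (RR V) \<Longrightarrow> f' \<in> carrier (RR V) \<Longrightarrow> b V f f' \<in> carrier (RR V)"
    and q: "\<And>V f f' a. opn V \<Longrightarrow> a \<in> V \<Longrightarrow> f \<in> carrier (RR V) \<Longrightarrow> f' \<in> carrier (RR V) \<Longrightarrow>
       resv V (b V f f') a = q (resv V f a) (resv V f' a)"
  shows "(\<lambda>a. q (g a) (h a)) \<in> carrier (RED W)"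
proof (rule REDI)
  fix a assume "a \<notin> W" then show "q (g a) (h a) = 0" using RED_off[OF g] RED_off[OF h] q0 by simp
next
  fix a assume a: "a \<in> W"
  obtain V f where V: "opn V" "a \<in> V" "V \<subseteq> W" "f \<in> carrier (RR V)" "\<And>b. b \<in> V \<Longrightarrow> g b = resv V f b"
    by (rule RED_local[OF g a]) (rule that)
  obtain V' f' where V': "opn V'" "a \<in> V'" "V' \<subseteq> W" "f' \<in> carrier (RR V')" "\<And>b. b \<in> V' \<Longrightarrow> h b = resv V' f' b"
    by (rule RED_local[OF h a]) (rule that)
  have o: "opn (V \<inter> V')" "V \<inter> V' \<subseteq> V" "V \<inter> V' \<subseteq> V'" using V V' by auto
  note r = O_rest(1)[OF V(1) o(1,2) V(4)] O_rest(1)[OF V'(1) o(1,3) V'(4)]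
  show "\<exists>V f. opn V \<and> a \<in> V \<and> V \<subseteq> W \<and> f \<in> carrier (RR V) \<and> (\<forall>b\<in>V. q (g b) (h b) = resv V f b)"
  proof (intro exI[of _ "V \<inter> V'"] exI[of _ "b (V \<inter> V') (rest (str M) V (V \<inter> V') f) (rest (str M) V' (V \<inter> V') f')"] conjI ballI)
    fix c assume c: "c \<in> V \<inter> V'"
    then show "q (g c) (h c) = resv (V \<inter> V') (b (V \<inter> V') (rest (str M) V (V \<inter> V') f) (rest (str M) V' (V \<inter> V') f')) c"
      using q[OF o(1) c r] resv_rest[OF V(1) _ o(1,2) c V(4)] resv_rest[OF V'(1) _ o(1,3) c V'(4)] V(5) V'(5) by simp
  qed (use V V' o b[OF o(1) r] in auto)
qed

lemma RED_add: "g \<in> carrier (RED W) \<Longrightarrow> h \<in> carrier (RED W) \<Longrightarrow> (\<lambda>a. g a + h a) \<in> carrier (RED W)"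
  by (rule RED_binop[where q="(+)" and b="\<lambda>V. (\<oplus>\<^bsub>RR V\<^esub>)"])
    (use cringO in \<open>auto simp: resv_add cring.cring_simprules\<close>)

lemma RED_mult: "g \<in> carrier (RED W) \<Longrightarrow> h \<in> carrier (RED W) \<Longrightarrow> (\<lambda>a. g a * h a) \<in> carrier (RED W)"
  by (rule RED_binop[where q="(*)" and b="\<lambda>V. (\<otimes>\<^bsub>RR V\<^esub>)"])
    (use cringO in \<open>auto simp: resv_mult cring.cring_simprules\<close>)

lemma RED_resv:
  assumes W: "opn W" and f: "f \<in> carrier (RR W)"
  shows "(\<lambda>a. if a \<in> W then resv W f a else 0) \<in> carrier (RED W)"
  by (rule REDI) (use W f in auto)

lemma RED_const: "opn W \<Longrightarrow> (\<lambda>a. if a \<in> W then c else 0) \<in> carrier (RED W)"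
  using RED_resv[OF _ O_const_in, of W c] by (simp add: resv_const cong: if_cong)

lemma RED_rest:
  assumes V: "opn V" "V \<subseteq> W" and g: "g \<in> carrier (RED W)"
  shows "(\<lambda>a. if a \<in> V then g a else 0) \<in> carrier (RED V)"
proof (rule REDI)
  fix a assume a: "a \<in> V"
  then obtain Z f where Z: "opn Z" "a \<in> Z" "Z \<subseteq> W" "f \<in> carrier (RR Z)" "\<And>b. b \<in> Z \<Longrightarrow> g b = resv Z f b"
    using V RED_local[OF g, of a] by blast
  have o: "opn (Z \<inter> V)" "Z \<inter> V \<subseteq> Z" using Z V by auto
  show "\<exists>V' f. opn V' \<and> a \<in> V' \<and> V' \<subseteq> V \<and> f \<in> carrier (RR V') \<and> (\<forall>b\<in>V'. (if b \<in> V then g b else 0) = resv V' f b)"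
    by (intro exI[of _ "Z \<inter> V"] exI[of _ "rest (str M) Z (Z \<inter> V) f"] conjI ballI)
      (use o a Z O_rest(1)[OF Z(1) o Z(4)] resv_rest[OF Z(1) _ o _ Z(4)] in auto)
qed simp

lemma RED_localI:
  assumes "\<And>a. a \<notin> W \<Longrightarrow> g a = 0"
    and "\<And>a. a \<in> W \<Longrightarrow> \<exists>V. opn V \<and> a \<in> V \<and> V \<subseteq> W \<and> (\<lambda>b. if b \<in> V then g b else 0) \<in> carrier (RED V)"
  shows "g \<in> carrier (RED W)"
proof (rule REDI[OF assms(1)])
  fix a assume "a \<in> W"
  then obtain V where V: "opn V" "a \<in> V" "V \<subseteq> W" "(\<lambda>b. if b \<in> V then g b else 0) \<in> carrier (RED V)"
    using assms(2) by blast
  obtain Z f where Z: "opn Z" "a \<in> Z" "Z \<subseteq> V" "f \<in> carrier (RR Z)" "\<And>b. b \<in> Z \<Longrightarrow> (if b \<in> V then g b else 0) = resv Z f b"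
    by (rule RED_local[OF V(4,2)]) (rule that)
  have "g b = resv Z f b" if "b \<in> Z" for b using Z(5)[OF that] that Z(3) by auto
  then show "\<exists>V f. opn V \<and> a \<in> V \<and> V \<subseteq> W \<and> f \<in> carrier (RR V) \<and> (\<forall>b\<in>V. g b = resv V f b)"
    using Z V by blast
qed

sublocale red: function_sheaf M "reduction M" "\<lambda>g (_ :: unit). g" "\<lambda>h. h ()"
proof unfold_locales
  fix W f m assume W: "opn W" and f: "f \<in> carrier (RR W)" and m: "m \<in> carrier (RED W)"
  have "(\<lambda>a. (if a \<in> W then resv W f a else 0) * m a) \<in> carrier (RED W)" by (intro RED_mult RED_resv W f m)
  moreover have "(\<lambda>a. (if a \<in> W then resv W f a else 0) * m a) = f \<odot>\<^bsub>RED W\<^esub> m"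
    using RED_off[OF m] by (auto simp: reduction_simps(4))
  ultimately show "f \<odot>\<^bsub>RED W\<^esub> m \<in> carrier (RED W)" by simp
next
  fix W m assume "opn W" and 1: "\<And>(i :: unit) a. a \<notin> W \<Longrightarrow> m a = 0"
    and 2: "\<And>a. a \<in> W \<Longrightarrow> \<exists>V. opn V \<and> a \<in> V \<and> V \<subseteq> W \<and> rest (reduction M) W V m \<in> carrier (RED V)"
  show "m \<in> carrier (RED W)"
    by (rule RED_localI) (use 1 2 in \<open>auto simp: reduction_simps(5)\<close>)
next
  fix W m m' assume "m \<in> carrier (RED W)" "m' \<in> carrier (RED W)"
  then show "m \<oplus>\<^bsub>RED W\<^esub> m' \<in> carrier (RED W)" unfolding reduction_simps(2) by (rule RED_add)
next
  fix W assume "opn W" from RED_const[OF this, of 0]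
  show "\<zero>\<^bsub>RED W\<^esub> \<in> carrier (RED W)" by (simp add: reduction_simps(3))
next
  fix W V m assume "opn V" "V \<subseteq> W" "m \<in> carrier (RED W)"
  then show "rest (reduction M) W V m \<in> carrier (RED V)" unfolding reduction_simps(5) by (rule RED_rest)
next
  fix W m and a assume "m \<in> carrier (RED W)" "a \<notin> W" then show "m a = 0" by (rule RED_off)
qed (auto simp: reduction_simps fun_eq_iff)

subsection \<open>Densities\<close>

lemma densities_simps:
  "(\<oplus>\<^bsub>DEN W\<^esub>) = (\<lambda>\<omega> \<omega>' ch a. \<omega> ch a + \<omega>' ch a)" "\<zero>\<^bsub>DEN W\<^esub> = (\<lambda>ch a. 0)"
  "(\<odot>\<^bsub>DEN W\<^esub>) = (\<lambda>f \<omega> ch a. resv W f a * \<omega> ch a)"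
  "rest (densities M) W V = (\<lambda>\<omega> ch a. if a \<in> V then \<omega> ch a else 0)"
  by (simp_all add: densities_def)

lemma red_chartD:
  assumes "red_chart M (n, V, \<phi>)"
  shows "opn V" "openin (Euclidean_space n) (\<phi> ` V)"
    "homeomorphic_map (subtopology (base M) V) (subtopology (Euclidean_space n) (\<phi> ` V)) \<phi>"
    "inj_on \<phi> V" "opn W \<Longrightarrow> openin (Euclidean_space n) (\<phi> ` (W \<inter> V))"
    "opn W \<Longrightarrow> W \<subseteq> V \<Longrightarrow> g \<in> carrier (RED W) \<Longrightarrow> smooth_on n (\<phi> ` W) (g \<circ> inv_into V \<phi>)"
    "opn W \<Longrightarrow> W \<subseteq> V \<Longrightarrow> (\<And>a. a \<notin> W \<Longrightarrow> g a = 0) \<Longrightarrow> smooth_on n (\<phi> ` W) (g \<circ> inv_into V \<phi>) \<Longrightarrow> g \<in> carrier (RED W)"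
proof -
  show V: "opn V" and oV: "openin (Euclidean_space n) (\<phi> ` V)"
    and hom: "homeomorphic_map (subtopology (base M) V) (subtopology (Euclidean_space n) (\<phi> ` V)) \<phi>"
    using assms by (auto simp: red_chart_def)
  have sm: "\<And>W g. opn W \<Longrightarrow> W \<subseteq> V \<Longrightarrow> (\<forall>a. a \<notin> W \<longrightarrow> g a = 0) \<Longrightarrow>
     g \<in> carrier (RED W) \<longleftrightarrow> smooth_on n (\<phi> ` W) (g \<circ> inv_into V \<phi>)"
    using assms by (simp add: red_chart_def)
  have top: "topspace (subtopology (base M) V) = V" using openin_subset[OF V] by auto
  show inj: "inj_on \<phi> V" using homeomorphic_imp_injective_map[OF hom] unfolding top .
  show "openin (Euclidean_space n) (\<phi> ` (W \<inter> V))" if "opn W"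
  proof -
    have "openin (subtopology (base M) V) (W \<inter> V)" by (rule openin_subtopology_Int[OF that])
    then have "openin (subtopology (Euclidean_space n) (\<phi> ` V)) (\<phi> ` (W \<inter> V))"
      using homeomorphic_imp_open_map[OF hom] unfolding open_map_def by blast
    then show ?thesis using openin_open_subtopology[OF oV] by blast
  qed
  show "smooth_on n (\<phi> ` W) (g \<circ> inv_into V \<phi>)" if "opn W" "W \<subseteq> V" "g \<in> carrier (RED W)"
    using sm[OF that(1,2), of g] that(3) RED_off[OF that(3)] by blast
  show "g \<in> carrier (RED W)" if "opn W" "W \<subseteq> V" "\<And>a. a \<notin> W \<Longrightarrow> g a = 0" "smooth_on n (\<phi> ` W) (g \<circ> inv_into V \<phi>)"
    using sm[OF that(1,2), of g] that(3,4) by blast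
qed

lemma RED_smooth:
  assumes ch: "red_chart M (n, V, \<phi>)" and W: "opn W" and g: "g \<in> carrier (RED W)"
  shows "smooth_on n (\<phi> ` (W \<inter> V)) (g \<circ> inv_into V \<phi>)"
proof -
  note c = red_chartD[OF ch]
  have o: "opn (W \<inter> V)" using W c(1) by auto
  have "smooth_on n (\<phi> ` (W \<inter> V)) ((\<lambda>a. if a \<in> W \<inter> V then g a else 0) \<circ> inv_into V \<phi>)"
    by (rule c(6)[OF o _ RED_rest[OF o _ g]]) auto
  then show ?thesis
    by (rule smooth_on_cong[OF c(5)[OF W]]) (auto simp: inv_into_f_f[OF c(4)])
qed

lemma densities_carrier:
  "\<omega> \<in> carrier (DEN W) \<longleftrightarrow>
     (\<forall>ch a. \<not> (red_chart M ch \<and> a \<in> W \<inter> chart_dom ch) \<longrightarrow> \<omega> ch a = 0) \<and>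
     (\<forall>n V \<phi>. red_chart M (n, V, \<phi>) \<longrightarrow> smooth_on n (\<phi> ` (W \<inter> V)) (\<omega> (n, V, \<phi>) \<circ> inv_into V \<phi>)) \<and>
     (\<forall>n V \<phi> m V' \<phi>'. red_chart M (n, V, \<phi>) \<and> red_chart M (m, V', \<phi>') \<longrightarrow>
        (\<forall>a \<in> W \<inter> V \<inter> V'. \<omega> (n, V, \<phi>) a =
           complex_of_real \<bar>jacobian_det n (\<phi>' \<circ> inv_into V \<phi>) (\<phi> a)\<bar> * \<omega> (m, V', \<phi>') a))"
  by (simp add: densities_def)

lemma DEN_D:
  assumes "\<omega> \<in> carrier (DEN W)"
  shows "\<not> (red_chart M ch \<and> a \<in> W \<inter> chart_dom ch) \<Longrightarrow> \<omega> ch a = 0"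
    "red_chart M (n, V, \<phi>) \<Longrightarrow> smooth_on n (\<phi> ` (W \<inter> V)) (\<omega> (n, V, \<phi>) \<circ> inv_into V \<phi>)"
    "red_chart M (n, V, \<phi>) \<Longrightarrow> red_chart M (m, V', \<phi>') \<Longrightarrow> a \<in> W \<Longrightarrow> a \<in> V \<Longrightarrow> a \<in> V' \<Longrightarrow>
        \<omega> (n, V, \<phi>) a = complex_of_real \<bar>jacobian_det n (\<phi>' \<circ> inv_into V \<phi>) (\<phi> a)\<bar> * \<omega> (m, V', \<phi>') a"
proof -
  note A = assms[unfolded densities_carrier]
  show "\<not> (red_chart M ch \<and> a \<in> W \<inter> chart_dom ch) \<Longrightarrow> \<omega> ch a = 0"
    by (rule A[THEN conjunct1, THEN spec, THEN spec, THEN mp])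
  show "red_chart M (n, V, \<phi>) \<Longrightarrow> smooth_on n (\<phi> ` (W \<inter> V)) (\<omega> (n, V, \<phi>) \<circ> inv_into V \<phi>)"
    by (rule A[THEN conjunct2, THEN conjunct1, THEN spec, THEN spec, THEN spec, THEN mp])
  show "\<omega> (n, V, \<phi>) a = complex_of_real \<bar>jacobian_det n (\<phi>' \<circ> inv_into V \<phi>) (\<phi> a)\<bar> * \<omega> (m, V', \<phi>') a"
    if "red_chart M (n, V, \<phi>)" "red_chart M (m, V', \<phi>')" "a \<in> W" "a \<in> V" "a \<in> V'"
    by (rule A[THEN conjunct2, THEN conjunct2, THEN spec, THEN spec, THEN spec, THEN spec, THEN spec, THEN spec, THEN mp, THEN bspec])
      (intro conjI IntI that)+
qed

lemma DEN_I:
  assumes "\<And>ch a. \<not> (red_chart M ch \<and> a \<in> W \<inter> chart_dom ch) \<Longrightarrow> \<omega> ch a = 0"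
    "\<And>n V \<phi>. red_chart M (n, V, \<phi>) \<Longrightarrow> smooth_on n (\<phi> ` (W \<inter> V)) (\<omega> (n, V, \<phi>) \<circ> inv_into V \<phi>)"
    "\<And>n V \<phi> m V' \<phi>' a. red_chart M (n, V, \<phi>) \<Longrightarrow> red_chart M (m, V', \<phi>') \<Longrightarrow> a \<in> W \<Longrightarrow> a \<in> V \<Longrightarrow> a \<in> V' \<Longrightarrow>
        \<omega> (n, V, \<phi>) a = complex_of_real \<bar>jacobian_det n (\<phi>' \<circ> inv_into V \<phi>) (\<phi> a)\<bar> * \<omega> (m, V', \<phi>') a"
  shows "\<omega> \<in> carrier (DEN W)"
  unfolding densities_carrier
proof (intro conjI allI impI ballI; (elim conjE IntE)?)
  fix ch a assume "\<not> (red_chart M ch \<and> a \<in> W \<inter> chart_dom ch)"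
  then show "\<omega> ch a = 0" by (rule assms(1))
next
  fix n V \<phi> assume "red_chart M (n, V, \<phi>)"
  then show "smooth_on n (\<phi> ` (W \<inter> V)) (\<omega> (n, V, \<phi>) \<circ> inv_into V \<phi>)" by (rule assms(2))
next
  fix n V \<phi> m V' \<phi>' a assume "red_chart M (n, V, \<phi>)" "red_chart M (m, V', \<phi>')" "a \<in> W" "a \<in> V" "a \<in> V'"
  then show "\<omega> (n, V, \<phi>) a = complex_of_real \<bar>jacobian_det n (\<phi>' \<circ> inv_into V \<phi>) (\<phi> a)\<bar> * \<omega> (m, V', \<phi>') a"
    by (rule assms(3))
qed

text \<open>The transformation law is pointwise and linear over functions, so all operations
  preserve it. For locality it is checked at one point, inside a neighbourhood where the restriction
  is known to be a density.\<close>

sublocale den: function_sheaf M "densities M" "\<lambda>\<omega>. \<omega>" "\<lambda>\<omega>. \<omega>"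
proof unfold_locales
  fix W \<omega> \<omega>' assume W: "opn W" and w: "\<omega> \<in> carrier (DEN W)" "\<omega>' \<in> carrier (DEN W)"
  show "\<omega> \<oplus>\<^bsub>DEN W\<^esub> \<omega>' \<in> carrier (DEN W)"
    unfolding densities_simps
  proof (rule DEN_I)
    fix n V \<phi> assume ch: "red_chart M (n, V, \<phi>)"
    show "smooth_on n (\<phi> ` (W \<inter> V)) ((\<lambda>a. \<omega> (n, V, \<phi>) a + \<omega>' (n, V, \<phi>) a) \<circ> inv_into V \<phi>)"
      using smooth_on_add[OF red_chartD(5)[OF ch W] DEN_D(2)[OF w(1) ch] DEN_D(2)[OF w(2) ch]] by (simp add: o_def)
    fix m V' \<phi>' a assume *: "red_chart M (m, V', \<phi>')" "a \<in> W" "a \<in> V" "a \<in> V'"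
    show "\<omega> (n, V, \<phi>) a + \<omega>' (n, V, \<phi>) a =
      complex_of_real \<bar>jacobian_det n (\<phi>' \<circ> inv_into V \<phi>) (\<phi> a)\<bar> * (\<omega> (m, V', \<phi>') a + \<omega>' (m, V', \<phi>') a)"
      using DEN_D(3)[OF w(1) ch *] DEN_D(3)[OF w(2) ch *] by (simp only: distrib_left)
  next
    fix ch a assume "\<not> (red_chart M ch \<and> a \<in> W \<inter> chart_dom ch)"
    then show "\<omega> ch a + \<omega>' ch a = 0" using DEN_D(1)[OF w(1)] DEN_D(1)[OF w(2)] by simp
  qed
next
  fix W f \<omega> assume W: "opn W" and f: "f \<in> carrier (RR W)" and w: "\<omega> \<in> carrier (DEN W)"
  show "f \<odot>\<^bsub>DEN W\<^esub> \<omega> \<in> carrier (DEN W)"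
    unfolding densities_simps
  proof (rule DEN_I)
    fix n V \<phi> assume ch: "red_chart M (n, V, \<phi>)"
    have "smooth_on n (\<phi> ` (W \<inter> V)) (\<lambda>x. ((\<lambda>a. if a \<in> W then resv W f a else 0) \<circ> inv_into V \<phi>) x * (\<omega> (n, V, \<phi>) \<circ> inv_into V \<phi>) x)"
      by (intro smooth_on_mult[OF red_chartD(5)[OF ch W]] DEN_D(2)[OF w ch] RED_smooth[OF ch W RED_resv[OF W f]])
    then show "smooth_on n (\<phi> ` (W \<inter> V)) ((\<lambda>a. resv W f a * \<omega> (n, V, \<phi>) a) \<circ> inv_into V \<phi>)"
      by (rule smooth_on_cong[OF red_chartD(5)[OF ch W]]) (auto simp: inv_into_f_f[OF red_chartD(4)[OF ch]])
    fix m V' \<phi>' a assume *: "red_chart M (m, V', \<phi>')" "a \<in> W" "a \<in> V" "a \<in> V'"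
    show "resv W f a * \<omega> (n, V, \<phi>) a =
      complex_of_real \<bar>jacobian_det n (\<phi>' \<circ> inv_into V \<phi>) (\<phi> a)\<bar> * (resv W f a * \<omega> (m, V', \<phi>') a)"
      unfolding DEN_D(3)[OF w ch *] by (simp only: mult.left_commute)
  next
    fix ch a assume "\<not> (red_chart M ch \<and> a \<in> W \<inter> chart_dom ch)"
    then show "resv W f a * \<omega> ch a = 0" using DEN_D(1)[OF w] by simp
  qed
next
  fix W V \<omega> assume W: "opn W" and V: "opn V" "V \<subseteq> W" and w: "\<omega> \<in> carrier (DEN W)"
  show "rest (densities M) W V \<omega> \<in> carrier (DEN V)"
    unfolding densities_simps
  proof (rule DEN_I)
    fix n Z \<phi> assume ch: "red_chart M (n, Z, \<phi>)"
    have "smooth_on n (\<phi> ` (V \<inter> Z)) (\<omega> (n, Z, \<phi>) \<circ> inv_into Z \<phi>)"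
      by (rule smooth_on_subset[OF DEN_D(2)[OF w ch]]) (use V in auto)
    then show "smooth_on n (\<phi> ` (V \<inter> Z)) ((\<lambda>a. if a \<in> V then \<omega> (n, Z, \<phi>) a else 0) \<circ> inv_into Z \<phi>)"
      by (rule smooth_on_cong[OF red_chartD(5)[OF ch V(1)]]) (auto simp: inv_into_f_f[OF red_chartD(4)[OF ch]])
    fix m Z' \<phi>' a assume *: "red_chart M (m, Z', \<phi>')" "a \<in> V" "a \<in> Z" "a \<in> Z'"
    have aW: "a \<in> W" using V * by auto
    show "(if a \<in> V then \<omega> (n, Z, \<phi>) a else 0) =
      complex_of_real \<bar>jacobian_det n (\<phi>' \<circ> inv_into Z \<phi>) (\<phi> a)\<bar> * (if a \<in> V then \<omega> (m, Z', \<phi>') a else 0)"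
      using DEN_D(3)[OF w ch *(1) aW *(3,4)] *(2) by (simp only: if_True)
  next
    fix ch a assume "\<not> (red_chart M ch \<and> a \<in> V \<inter> chart_dom ch)"
    then show "(if a \<in> V then \<omega> ch a else 0) = 0" using DEN_D(1)[OF w, of ch a] by auto
  qed
next
  fix W \<omega> assume W: "opn W" and 1: "\<And>ch a. a \<notin> W \<Longrightarrow> \<omega> ch a = 0"
    and 2: "\<And>a. a \<in> W \<Longrightarrow> \<exists>V. opn V \<and> a \<in> V \<and> V \<subseteq> W \<and> rest (densities M) W V \<omega> \<in> carrier (DEN V)"
  note 2 = 2[unfolded densities_simps]
  show "\<omega> \<in> carrier (DEN W)"
  proof (rule DEN_I)
    fix n Z \<phi> assume ch: "red_chart M (n, Z, \<phi>)"
    note c = red_chartD[OF ch]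
    show "smooth_on n (\<phi> ` (W \<inter> Z)) (\<omega> (n, Z, \<phi>) \<circ> inv_into Z \<phi>)"
    proof (rule smooth_on_local[OF c(5)[OF W]])
      fix x assume "x \<in> \<phi> ` (W \<inter> Z)"
      then obtain a where a: "a \<in> W" "a \<in> Z" "x = \<phi> a" by blast
      obtain V where V: "opn V" "a \<in> V" "V \<subseteq> W" "(\<lambda>ch a. if a \<in> V then \<omega> ch a else 0) \<in> carrier (DEN V)"
        using 2[OF a(1)] by blast
      have "smooth_on n (\<phi> ` (V \<inter> Z)) (\<omega> (n, Z, \<phi>) \<circ> inv_into Z \<phi>)"
        by (rule smooth_on_cong[OF c(5)[OF V(1)] DEN_D(2)[OF V(4) ch]]) (auto simp: inv_into_f_f[OF c(4)])
      then show "\<exists>Y. openin (Euclidean_space n) Y \<and> x \<in> Y \<and> smooth_on n Y (\<omega> (n, Z, \<phi>) \<circ> inv_into Z \<phi>)"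
        using c(5)[OF V(1)] a V(2) by blast
    qed
    fix m Z' \<phi>' a assume *: "red_chart M (m, Z', \<phi>')" "a \<in> W" "a \<in> Z" "a \<in> Z'"
    obtain V where V: "opn V" "a \<in> V" "V \<subseteq> W" "(\<lambda>ch a. if a \<in> V then \<omega> ch a else 0) \<in> carrier (DEN V)"
      using 2[OF *(2)] by blast
    show "\<omega> (n, Z, \<phi>) a = complex_of_real \<bar>jacobian_det n (\<phi>' \<circ> inv_into Z \<phi>) (\<phi> a)\<bar> * \<omega> (m, Z', \<phi>') a"
      using DEN_D(3)[OF V(4) ch *(1) V(2) *(3,4)] V(2) by (simp only: if_True)
  next
    fix ch a assume n: "\<not> (red_chart M ch \<and> a \<in> W \<inter> chart_dom ch)"
    show "\<omega> ch a = 0"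
    proof (cases "a \<in> W")
      case True
      then obtain V where V: "opn V" "a \<in> V" "V \<subseteq> W" "(\<lambda>ch a. if a \<in> V then \<omega> ch a else 0) \<in> carrier (DEN V)"
        using 2 by blast
      then show ?thesis using DEN_D(1)[OF V(4), of ch a] n True by auto
    qed (rule 1)
  qed
next
  fix W assume W: "opn W"
  show "\<zero>\<^bsub>DEN W\<^esub> \<in> carrier (DEN W)" unfolding densities_simps
    by (rule DEN_I) (use smooth_on_const[OF red_chartD(5)[OF _ W], of _ _ _ 0] in \<open>auto simp: o_def\<close>)
next
  fix W \<omega> ch a assume "\<omega> \<in> carrier (DEN W)" "a \<notin> W"
  then show "\<omega> ch a = 0" by (intro DEN_D(1)) auto
qed (simp_all add: densities_simps)

subsection \<open>Bump sections\<close>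

text \<open>The bump of a chart, with its residues known everywhere: off the chart the section
  vanishes, and so do its residue and \<open>\<rho>\<close>.\<close>

lemma bump_section:
  assumes U: "opn U" "a \<in> U"
  shows "\<exists>h \<rho> K N. h \<in> carrier (RR TT) \<and> compactin (base M) K \<and> K \<subseteq> U \<and> opn N \<and> a \<in> N \<and> N \<subseteq> K \<and>
     rest (str M) TT (TT - K) h = \<zero>\<^bsub>RR (TT - K)\<^esub> \<and> rest (str M) TT N h = \<one>\<^bsub>RR N\<^esub> \<and>
     (\<forall>b\<in>TT. resv TT h b = complex_of_real (\<rho> b)) \<and> (\<forall>b. \<rho> b \<ge> 0 \<and> (b \<notin> K \<longrightarrow> \<rho> b = 0))"
proof -
  have aT: "a \<in> TT" using openin_subset[OF U(1)] U(2) by blast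
  obtain U0 n k \<phi> \<psi> where c: "formal_chart M U0 n k \<phi> \<psi>" "a \<in> U0" using chart_at[OF aT] by blast
  interpret c: formal_chart M U0 n k \<phi> \<psi> by (rule c(1))
  from c.chart_bump[OF c(2) U T2] obtain h \<rho> K N where
    h: "h \<in> carrier (RR TT)" and K: "compactin (base M) K" "K \<subseteq> U \<inter> U0" and N: "opn N" "a \<in> N" "N \<subseteq> K"
    and h0: "rest (str M) TT (TT - K) h = \<zero>\<^bsub>RR (TT - K)\<^esub>" and h1: "rest (str M) TT N h = \<one>\<^bsub>RR N\<^esub>"
    and r: "\<forall>b\<in>U0. resv TT h b = complex_of_real (\<rho> b)" "\<forall>b. \<rho> b \<ge> 0 \<and> (b \<notin> K \<longrightarrow> \<rho> b = 0)"
    by (elim exE conjE) (rule that)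
  have oK: "opn (TT - K)" using compactin_imp_closedin[OF T2 K(1)] by blast
  have r': "\<forall>b\<in>TT. resv TT h b = complex_of_real (\<rho> b)"
  proof
    fix b assume b: "b \<in> TT"
    show "resv TT h b = complex_of_real (\<rho> b)"
    proof (cases "b \<in> U0")
      case False
      then have bK: "b \<in> TT - K" using b K by auto
      have "resv TT h b = 0"
        using resv_rest[OF openin_topspace b oK Diff_subset bK h] resv_zero[OF oK bK] h0 by simp
      then show ?thesis using r(2) bK by simp
    qed (use r in blast)
  qed
  have KU: "K \<subseteq> U" using K by auto
  show ?thesis
    by (rule exI[of _ h], rule exI[of _ \<rho>], rule exI[of _ K], rule exI[of _ N], intro conjI h K(1) KU N h0 h1 r' r(2))
qed

end

section \<open>Smooth partitions of unity\<close>

context fmfd begin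

lemma red_chart_at:
  assumes "a \<in> TT"
  shows "\<exists>n V \<phi>. red_chart M (n, V, \<phi>) \<and> a \<in> V"
proof -
  obtain U0 n k \<phi> \<psi> where c: "formal_chart M U0 n k \<phi> \<psi>" "a \<in> U0" using chart_at[OF assms] by blast
  show ?thesis using formal_chart.red_chart[OF c(1)] c(2) by blast
qed

text \<open>The functions of the partition of unity will be indexed by charts whose domains are the
  members of a cover, so charts have to be shrunk to these members.\<close>

lemma red_chart_restrict:
  assumes ch: "red_chart M (n, V, \<phi>)" and W: "opn W" "W \<subseteq> V"
  shows "red_chart M (n, W, \<phi>)"
proof -
  note c = red_chartD[OF ch]
  have WV: "W \<inter> V = W" "V \<inter> W = W" using W by auto
  have iW: "\<phi> ` V \<inter> \<phi> ` W = \<phi> ` W" using W by auto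
  have oW: "openin (Euclidean_space n) (\<phi> ` W)" using c(5)[OF W(1)] by (simp add: WV)
  have "homeomorphic_map (subtopology (subtopology (base M) V) W)
      (subtopology (subtopology (Euclidean_space n) (\<phi> ` V)) (\<phi> ` W)) \<phi>"
    by (rule homeomorphic_map_subtopologies_alt[OF c(3)])
      (use W openin_subset[OF c(1)] c(4) in \<open>auto dest: inj_onD\<close>)
  then have hom: "homeomorphic_map (subtopology (base M) W) (subtopology (Euclidean_space n) (\<phi> ` W)) \<phi>"
    by (simp add: subtopology_subtopology WV iW)
  have injW: "inj_on \<phi> W" using c(4) W(2) by (rule inj_on_subset)
  have eq: "smooth_on n (\<phi> ` Z) (g \<circ> inv_into W \<phi>) \<longleftrightarrow> smooth_on n (\<phi> ` Z) (g \<circ> inv_into V \<phi>)"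
    if Z: "opn Z" "Z \<subseteq> W" for Z and g :: "'p \<Rightarrow> complex"
  proof -
    have "Z \<inter> V = Z" using Z W by auto
    then have oZ: "openin (Euclidean_space n) (\<phi> ` Z)" using c(5)[OF Z(1)] by simp
    have e: "(g \<circ> inv_into W \<phi>) x = (g \<circ> inv_into V \<phi>) x" if "x \<in> \<phi> ` Z" for x
      using that Z W by (auto simp: inv_into_f_f[OF injW] inv_into_f_f[OF c(4)] subset_iff)
    show ?thesis using smooth_on_cong[OF oZ] e by metis
  qed
  have "g \<in> carrier (RED Z) \<longleftrightarrow> smooth_on n (\<phi> ` Z) (g \<circ> inv_into W \<phi>)"
    if Z: "opn Z" "Z \<subseteq> W" and g0: "\<forall>a. a \<notin> Z \<longrightarrow> g a = 0" for Z g
  proof -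
    have ZV: "Z \<subseteq> V" using Z W by auto
    show ?thesis unfolding eq[OF Z] using c(6)[OF Z(1) ZV, of g] c(7)[OF Z(1) ZV, of g] g0 by blast
  qed
  then show ?thesis unfolding red_chart_def using W(1) oW hom by auto
qed

lemma RED_inverse:
  assumes W: "opn W" and g: "g \<in> carrier (RED W)" and nz: "\<And>a. a \<in> W \<Longrightarrow> g a \<noteq> 0"
  shows "(\<lambda>a. if a \<in> W then inverse (g a) else 0) \<in> carrier (RED W)"
proof (rule RED_localI)
  fix a assume a: "a \<in> W"
  then have "a \<in> TT" using openin_subset[OF W] by auto
  then obtain n V \<phi> where ch: "red_chart M (n, V, \<phi>)" and aV: "a \<in> V" using red_chart_at by blast
  note c = red_chartD[OF ch]
  have o: "opn (W \<inter> V)" using W c(1) by auto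
  have s: "smooth_on n (\<phi> ` (W \<inter> V)) (\<lambda>x. inverse ((g \<circ> inv_into V \<phi>) x))"
    using nz by (intro smooth_on_inverse[OF c(5)[OF W]] RED_smooth[OF ch W g]) (auto simp: inv_into_f_f[OF c(4)])
  have "(\<lambda>b. if b \<in> W \<inter> V then inverse (g b) else 0) \<in> carrier (RED (W \<inter> V))"
  proof (rule c(7)[OF o])
    show "smooth_on n (\<phi> ` (W \<inter> V)) ((\<lambda>b. if b \<in> W \<inter> V then inverse (g b) else 0) \<circ> inv_into V \<phi>)"
      by (rule smooth_on_cong[OF c(5)[OF W] s]) (auto simp: inv_into_f_f[OF c(4)])
  qed auto
  moreover have "(\<lambda>b. if b \<in> W \<inter> V then if b \<in> W then inverse (g b) else 0 else 0) =
      (\<lambda>b. if b \<in> W \<inter> V then inverse (g b) else 0)" by auto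
  ultimately show "\<exists>V. opn V \<and> a \<in> V \<and> V \<subseteq> W \<and>
      (\<lambda>b. if b \<in> V then if b \<in> W then inverse (g b) else 0 else 0) \<in> carrier (RED V)"
    using o a aV by (intro exI[of _ "W \<inter> V"]) auto
qed simp

lemma RED_sum:
  assumes "opn W" "finite A" "\<And>i. i \<in> A \<Longrightarrow> g i \<in> carrier (RED W)"
  shows "(\<lambda>a. \<Sum>i\<in>A. g i a) \<in> carrier (RED W)"
  using assms(2,3)
proof (induction A rule: finite_induct)
  case empty
  then show ?case using RED_const[OF assms(1), of 0] by simp
next
  case (insert i A)
  then show ?case using RED_add[of "g i" W "\<lambda>a. \<Sum>i\<in>A. g i a"] by simp
qed

text \<open>A finite sum of bumps. Positivity on \<open>C\<close> is asked for instead of the value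
  1, because the functions are normalised by division later on.\<close>

lemma bump_compact:
  assumes C: "compactin (base M) C" and W: "opn W" "C \<subseteq> W"
  shows "\<exists>\<eta> K. compactin (base M) K \<and> K \<subseteq> W \<and> (\<forall>b. \<eta> b \<ge> 0 \<and> (b \<notin> K \<longrightarrow> \<eta> b = 0)) \<and> (\<forall>b\<in>C. \<eta> b > 0) \<and>
     (\<lambda>b. complex_of_real (\<eta> b)) \<in> carrier (RED TT)"
proof -
  define P where "P a \<rho> K N \<longleftrightarrow> compactin (base M) K \<and> K \<subseteq> W \<and> opn N \<and> a \<in> N \<and>
     (\<forall>b. \<rho> b \<ge> 0 \<and> (b \<notin> K \<longrightarrow> \<rho> b = 0)) \<and> (\<forall>b\<in>N. \<rho> b = 1) \<and>
     (\<lambda>b. complex_of_real (\<rho> b)) \<in> carrier (RED TT)" for a \<rho> K N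
  have ex: "\<exists>\<rho> K N. P a \<rho> K N" if a: "a \<in> W" for a
  proof -
    from bump_section[OF W(1) a] obtain h \<rho> K N where
      h: "h \<in> carrier (RR TT)" and K: "compactin (base M) K" "K \<subseteq> W" and N: "opn N" "a \<in> N" "N \<subseteq> K"
      and h1: "rest (str M) TT N h = \<one>\<^bsub>RR N\<^esub>"
      and r: "\<forall>b\<in>TT. resv TT h b = complex_of_real (\<rho> b)" "\<forall>b. \<rho> b \<ge> 0 \<and> (b \<notin> K \<longrightarrow> \<rho> b = 0)"
      by (elim exE conjE) (rule that)
    have KT: "K \<subseteq> TT" by (rule compactin_subset_topspace[OF K(1)])
    have "(\<lambda>b. if b \<in> TT then resv TT h b else 0) = (\<lambda>b. complex_of_real (\<rho> b))"
      using r KT by (auto simp: fun_eq_iff)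
    then have "(\<lambda>b. complex_of_real (\<rho> b)) \<in> carrier (RED TT)"
      using RED_resv[OF openin_topspace h] by simp
    moreover have "\<rho> b = 1" if b: "b \<in> N" for b
    proof -
      have bT: "b \<in> TT" using b N KT by auto
      have NT: "N \<subseteq> TT" using N KT by auto
      have "resv TT h b = 1"
        using resv_rest[OF openin_topspace bT N(1) NT b h] resv_one[OF N(1) b] h1 by simp
      then show ?thesis using r(1) bT by simp
    qed
    ultimately have "P a \<rho> K N" unfolding P_def using K N r(2) by (intro conjI ballI)
    then show ?thesis by blast
  qed
  define \<rho> where "\<rho> a = (SOME \<rho>. \<exists>K N. P a \<rho> K N)" for a
  define K where "K a = (SOME K. \<exists>N. P a (\<rho> a) K N)" for a
  define N where "N a = (SOME N. P a (\<rho> a) (K a) N)" for a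
  have P: "P a (\<rho> a) (K a) (N a)" if "a \<in> W" for a
  proof -
    have "\<exists>K N. P a (\<rho> a) K N" unfolding \<rho>_def by (rule someI_ex[OF ex[OF that]])
    then have "\<exists>N. P a (\<rho> a) (K a) N" unfolding K_def by (rule someI_ex)
    then show ?thesis unfolding N_def by (rule someI_ex)
  qed
  have PD: "compactin (base M) (K a)" "K a \<subseteq> W" "opn (N a)" "a \<in> N a" "\<rho> a b \<ge> 0"
    "b \<notin> K a \<Longrightarrow> \<rho> a b = 0" "b \<in> N a \<Longrightarrow> \<rho> a b = 1"
    "(\<lambda>b. complex_of_real (\<rho> a b)) \<in> carrier (RED TT)" if "a \<in> W" for a b
    using P[OF that] unfolding P_def by simp_all
  have "\<exists>\<F>. finite \<F> \<and> \<F> \<subseteq> N ` C \<and> C \<subseteq> \<Union>\<F>"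
  proof (rule compactinD[OF C])
    show "opn U" if "U \<in> N ` C" for U using that PD(3) W(2) by blast
    show "C \<subseteq> \<Union>(N ` C)"
    proof
      fix x assume x: "x \<in> C"
      then have "x \<in> N x" using W(2) by (intro PD(4)) blast
      then show "x \<in> \<Union>(N ` C)" using x by blast
    qed
  qed
  then obtain A where A: "finite A" "A \<subseteq> C" "C \<subseteq> \<Union>(N ` A)"
    by (metis finite_subset_image)
  have AW: "a \<in> W" if "a \<in> A" for a using that A W by auto
  define \<eta> where "\<eta> b = (\<Sum>a\<in>A. \<rho> a b)" for b
  show ?thesis
  proof (rule exI[of _ \<eta>], rule exI[of _ "\<Union>(K ` A)"], intro conjI allI impI ballI)
    show "compactin (base M) (\<Union>(K ` A))"
      by (rule compactin_Union) (use A AW PD(1) in auto)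
    show "\<Union>(K ` A) \<subseteq> W" using PD(2) AW by blast
    show "\<eta> b \<ge> 0" for b unfolding \<eta>_def using PD(5) AW by (intro sum_nonneg) blast
    show "\<eta> b = 0" if "b \<notin> \<Union>(K ` A)" for b unfolding \<eta>_def
    proof (rule sum.neutral, rule ballI)
      fix a assume "a \<in> A"
      then show "\<rho> a b = 0" using PD(6)[OF AW, of a b] that by blast
    qed
    show "\<eta> b > 0" if b: "b \<in> C" for b
    proof -
      obtain a where a: "a \<in> A" "b \<in> N a" using A(3) b by blast
      have "0 < \<rho> a b" using PD(7)[OF AW[OF a(1)] a(2)] by simp
      then show ?thesis unfolding \<eta>_def using PD(5) AW by (intro sum_pos2[OF A(1) a(1)]) blast+
    qed
    have "(\<lambda>b. \<Sum>a\<in>A. complex_of_real (\<rho> a b)) \<in> carrier (RED TT)"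
      by (rule RED_sum[OF openin_topspace A(1)]) (use PD(8) AW in blast)
    then show "(\<lambda>b. complex_of_real (\<eta> b)) \<in> carrier (RED TT)" by (simp add: \<eta>_def)
  qed
qed

lemma closure_in_compact: "compactin (base M) K \<Longrightarrow> N \<subseteq> K \<Longrightarrow> base M closure_of N \<subseteq> K"
  by (rule closure_of_minimal) (auto intro: compactin_imp_closedin[OF T2])

text \<open>Paracompactness is applied twice. The first refinement \<open>\<W>\<close> consists of
  relatively compact chart domains. The second one, \<open>\<V>\<close>, serves to shrink them: it
  provides compact sets \<open>C W \<subseteq> W\<close> that still cover. Functions positive on
  \<open>C W\<close> and supported in \<open>W\<close> have a locally finite, positive sum, by which
  they are divided.\<close>

lemma partition_of_unity_exists: "\<exists>\<theta>. smooth_partition_of_unity M \<theta>"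
proof -
  \<comment> \<open>The compact sets \<open>K\<close> make every member of a refinement relatively
    compact; this turns the closed sets \<open>C W\<close> into compact ones.\<close>
  define \<U> where "\<U> = {N. opn N \<and> (\<exists>K n V \<phi>. compactin (base M) K \<and> N \<subseteq> K \<and> K \<subseteq> V \<and> red_chart M (n, V, \<phi>))}"
  have "\<Union>\<U> = TT"
  proof
    show "\<Union>\<U> \<subseteq> TT" unfolding \<U>_def using openin_subset by blast
    show "TT \<subseteq> \<Union>\<U>"
    proof
      fix a assume "a \<in> TT"
      then obtain n V \<phi> where ch: "red_chart M (n, V, \<phi>)" and aV: "a \<in> V" using red_chart_at by blast
      from bump_section[OF red_chartD(1)[OF ch] aV] obtain h \<rho> K N where
        "compactin (base M) K" "K \<subseteq> V" "opn N" "a \<in> N" "N \<subseteq> K" by (elim exE conjE) (rule that)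
      then show "a \<in> \<Union>\<U>" unfolding \<U>_def using ch by blast
    qed
  qed
  moreover have "\<forall>U\<in>\<U>. opn U" by (simp add: \<U>_def)
  ultimately obtain \<W> where W: "\<forall>V\<in>\<W>. opn V \<and> (\<exists>U\<in>\<U>. V \<subseteq> U)" "\<Union>\<W> = TT" "locally_finite_in (base M) \<W>"
    using paracompact unfolding paracompact_space_def by meson
  have W_open: "opn W" if "W \<in> \<W>" for W using W(1) that by blast
  have W_K: "\<exists>K. compactin (base M) K \<and> W \<subseteq> K" if "W \<in> \<W>" for W
  proof -
    have "\<exists>U\<in>\<U>. W \<subseteq> U" by (rule W(1)[THEN bspec, THEN conjunct2, OF that])
    then obtain U where U: "U \<in> \<U>" "W \<subseteq> U" by (elim bexE) (rule that)
    from U(1) obtain K where "compactin (base M) K" "U \<subseteq> K"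
      unfolding \<U>_def mem_Collect_eq by (elim exE conjE) (rule that)
    then show ?thesis using U(2) by (intro exI[of _ K]) auto
  qed
  have W_ch: "\<exists>p. red_chart M (fst p, W, snd p)" if "W \<in> \<W>" for W
  proof -
    have "\<exists>U\<in>\<U>. W \<subseteq> U" by (rule W(1)[THEN bspec, THEN conjunct2, OF that])
    then obtain U where "U \<in> \<U>" "W \<subseteq> U" by (elim bexE) (rule that)
    from \<open>U \<in> \<U>\<close> obtain K n V \<phi> where "U \<subseteq> K" "K \<subseteq> V" and ch: "red_chart M (n, V, \<phi>)"
      unfolding \<U>_def mem_Collect_eq by (elim exE conjE) (rule that)
    then have "red_chart M (n, W, \<phi>)" using red_chart_restrict[OF ch W_open[OF that]] \<open>W \<subseteq> U\<close> by blast
    then show ?thesis by (intro exI[of _ "(n, \<phi>)"]) simp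
  qed
  define pc where "pc W = (SOME p. red_chart M (fst p, W, snd p))" for W
  define ch where "ch W = (fst (pc W), W, snd (pc W))" for W
  have ch: "red_chart M (ch W)" if "W \<in> \<W>" for W
    unfolding ch_def pc_def by (rule someI_ex[OF W_ch[OF that]])
  have dom_ch: "chart_dom (ch W) = W" for W by (simp add: ch_def)
  define \<Z> where "\<Z> = {Z. opn Z \<and> (\<exists>W\<in>\<W>. base M closure_of Z \<subseteq> W)}"
  have "\<Union>\<Z> = TT"
  proof
    show "\<Union>\<Z> \<subseteq> TT" unfolding \<Z>_def using openin_subset by blast
    show "TT \<subseteq> \<Union>\<Z>"
    proof
      fix a assume "a \<in> TT"
      then obtain W where aW: "W \<in> \<W>" "a \<in> W" using W(2) by blast
      from bump_section[OF W_open[OF aW(1)] aW(2)] obtain h \<rho> K N where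
        "compactin (base M) K" "K \<subseteq> W" "opn N" "a \<in> N" "N \<subseteq> K" by (elim exE conjE) (rule that)
      then show "a \<in> \<Union>\<Z>" unfolding \<Z>_def using aW(1) closure_in_compact[of K N] by blast
    qed
  qed
  moreover have "\<forall>U\<in>\<Z>. opn U" by (simp add: \<Z>_def)
  ultimately obtain \<V> where V: "\<forall>V\<in>\<V>. opn V \<and> (\<exists>U\<in>\<Z>. V \<subseteq> U)" "\<Union>\<V> = TT" "locally_finite_in (base M) \<V>"
    using paracompact unfolding paracompact_space_def by meson
  \<comment> \<open>A union of closures of members of a locally finite family is closed, although
    infinitely many of them may occur.\<close>
  define C where "C W = \<Union>((\<lambda>V. base M closure_of V) ` {V \<in> \<V>. base M closure_of V \<subseteq> W})" for W
  have C_cover: "\<exists>W\<in>\<W>. a \<in> C W" if a: "a \<in> TT" for a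
  proof -
    obtain V1 where V1: "V1 \<in> \<V>" "a \<in> V1" using a V(2) by blast
    then obtain Z where Z: "Z \<in> \<Z>" "V1 \<subseteq> Z" using V(1) by blast
    then obtain W1 where W1: "W1 \<in> \<W>" "base M closure_of Z \<subseteq> W1" unfolding \<Z>_def by blast
    have "base M closure_of V1 \<subseteq> W1" using closure_of_mono[OF Z(2)] W1(2) by (rule order_trans)
    moreover have "a \<in> base M closure_of V1" using V1 V(1) closure_of_subset[OF openin_subset] by blast
    ultimately show ?thesis using V1 W1(1) unfolding C_def by blast
  qed
  have CW: "C W \<subseteq> W" for W unfolding C_def by blast
  have C_compact: "compactin (base M) (C W)" if "W \<in> \<W>" for W
  proof -
    obtain K where K: "compactin (base M) K" "W \<subseteq> K" using W_K[OF \<open>W \<in> \<W>\<close>] by blast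
    have "closedin (base M) (C W)" unfolding C_def
      by (rule closedin_Union_locally_finite_closure[OF locally_finite_in_subset[OF V(3)]]) blast
    then show ?thesis using closed_compactin[OF K(1)] CW[of W] K(2) by blast
  qed
  define P where "P W p \<longleftrightarrow> compactin (base M) (snd p) \<and> snd p \<subseteq> W \<and>
      (\<forall>b. fst p b \<ge> 0 \<and> (b \<notin> snd p \<longrightarrow> fst p b = 0)) \<and> (\<forall>b\<in>C W. fst p b > 0) \<and>
      (\<lambda>b. complex_of_real (fst p b)) \<in> carrier (RED TT)" for W and p :: "('p \<Rightarrow> real) \<times> 'p set"
  have exP: "\<exists>p. P W p" if W': "W \<in> \<W>" for W
    using bump_compact[OF C_compact[OF W'] W_open[OF W'] CW] unfolding P_def
    by (elim exE) (rule exI[where x="(_, _)"], simp)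
  define \<eta> where "\<eta> W = fst (SOME p. P W p)" for W
  define K where "K W = snd (SOME p. P W p)" for W
  have P: "P W (\<eta> W, K W)" if "W \<in> \<W>" for W
    unfolding \<eta>_def K_def prod.collapse by (rule someI_ex[OF exP[OF that]])
  have PD: "compactin (base M) (K W)" "K W \<subseteq> W" "\<eta> W b \<ge> 0" "b \<notin> K W \<Longrightarrow> \<eta> W b = 0" "b \<in> C W \<Longrightarrow> \<eta> W b > 0"
    "(\<lambda>b. complex_of_real (\<eta> W b)) \<in> carrier (RED TT)" if "W \<in> \<W>" for W b
    using P[OF that] unfolding P_def by simp_all
  have lf: "\<exists>N. opn N \<and> a \<in> N \<and> finite {W \<in> \<W>. W \<inter> N \<noteq> {}}" if "a \<in> TT" for a
    using W(3) that unfolding locally_finite_in_def by blast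
  define \<sigma> where "\<sigma> b = (\<Sum>W | W \<in> \<W> \<and> \<eta> W b \<noteq> 0. \<eta> W b)" for b
  have sub: "{W. W \<in> \<W> \<and> \<eta> W b \<noteq> 0} \<subseteq> {W \<in> \<W>. W \<inter> N \<noteq> {}}" if "b \<in> N" for b N
  proof
    fix W assume "W \<in> {W. W \<in> \<W> \<and> \<eta> W b \<noteq> 0}"
    then have "W \<in> \<W>" "b \<in> K W" using PD(4) by blast+
    then show "W \<in> {W \<in> \<W>. W \<inter> N \<noteq> {}}" using PD(2) \<open>b \<in> N\<close> by blast
  qed
  have fin: "finite {W. W \<in> \<W> \<and> \<eta> W b \<noteq> 0}" if "b \<in> TT" for b
    using lf[OF that] sub finite_subset by meson
  have \<sigma>_eq: "\<sigma> b = (\<Sum>W\<in>{W \<in> \<W>. W \<inter> N \<noteq> {}}. \<eta> W b)" if "b \<in> N" "finite {W \<in> \<W>. W \<inter> N \<noteq> {}}" for b N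
    unfolding \<sigma>_def by (rule sum.mono_neutral_left[OF that(2) sub[OF that(1)]]) auto
  have \<sigma>_pos: "\<sigma> b > 0" if b: "b \<in> TT" for b
  proof -
    obtain W1 where W1: "W1 \<in> \<W>" "b \<in> C W1" using C_cover[OF b] by blast
    have p: "\<eta> W1 b > 0" by (rule PD(5)[OF W1])
    show ?thesis unfolding \<sigma>_def
      by (rule sum_pos2[OF fin[OF b], of W1]) (use W1 p PD(3) in auto)
  qed
  have \<sigma>_off: "\<sigma> b = 0" if "b \<notin> TT" for b
  proof -
    have "\<eta> W b = 0" if "W \<in> \<W>" for W
      using PD(4)[OF that, of b] compactin_subset_topspace[OF PD(1)[OF that]] \<open>b \<notin> TT\<close> by blast
    then show ?thesis unfolding \<sigma>_def by (intro sum.neutral) auto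
  qed
  have \<sigma>_red: "(\<lambda>b. complex_of_real (\<sigma> b)) \<in> carrier (RED TT)"
  proof (rule RED_localI)
    fix a assume a: "a \<in> TT"
    then obtain N where N: "opn N" "a \<in> N" "finite {W \<in> \<W>. W \<inter> N \<noteq> {}}" using lf by blast
    have NT: "N \<subseteq> TT" by (rule openin_subset[OF N(1)])
    have "(\<lambda>b. \<Sum>W\<in>{W \<in> \<W>. W \<inter> N \<noteq> {}}. complex_of_real (\<eta> W b)) \<in> carrier (RED TT)"
      by (rule RED_sum[OF openin_topspace N(3)]) (use PD(6) in blast)
    from RED_rest[OF N(1) NT this]
    have "(\<lambda>b. if b \<in> N then complex_of_real (\<sigma> b) else 0) \<in> carrier (RED N)"
      using \<sigma>_eq[OF _ N(3)] by (simp cong: if_cong)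
    then show "\<exists>V. opn V \<and> a \<in> V \<and> V \<subseteq> TT \<and> (\<lambda>b. if b \<in> V then complex_of_real (\<sigma> b) else 0) \<in> carrier (RED V)"
      using N NT by blast
  qed (simp add: \<sigma>_off)
  have inv_red: "(\<lambda>b. if b \<in> TT then inverse (complex_of_real (\<sigma> b)) else 0) \<in> carrier (RED TT)"
    by (rule RED_inverse[OF openin_topspace \<sigma>_red]) (use \<sigma>_pos in fastforce)
  \<comment> \<open>A partition of unity is indexed by all charts: the function of \<open>W\<close>
    is placed at the chart \<open>ch W\<close>, all other charts receive zero. Different
    \<open>W\<close> use different charts, because the domain of \<open>ch W\<close> is
    \<open>W\<close>.\<close>
  define \<theta> where "\<theta> c a = (if chart_dom c \<in> \<W> \<and> c = ch (chart_dom c) then \<eta> (chart_dom c) a / \<sigma> a else 0)" for c a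
  have \<theta>_ch: "\<theta> (ch W) a = \<eta> W a / \<sigma> a" if "W \<in> \<W>" for W a
    using that by (simp add: \<theta>_def dom_ch)
  have \<theta>_nz: "\<exists>W\<in>\<W>. c = ch W \<and> \<eta> W a \<noteq> 0" if "\<theta> c a \<noteq> 0" for c a
    using that unfolding \<theta>_def by (metis div_0)
  have "smooth_partition_of_unity M \<theta>"
    unfolding smooth_partition_of_unity_def
  proof (intro conjI allI impI ballI)
    fix c assume "\<not> red_chart M c"
    then have "\<not> (chart_dom c \<in> \<W> \<and> c = ch (chart_dom c))" using ch[of "chart_dom c"] by auto
    then show "\<theta> c = (\<lambda>a. 0)" unfolding \<theta>_def by (simp only: if_False)
  next
    fix c
    show "(\<lambda>a. complex_of_real (\<theta> c a)) \<in> carrier (RED TT)"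
    proof (cases "chart_dom c \<in> \<W> \<and> c = ch (chart_dom c)")
      case True
      have "(\<lambda>b. complex_of_real (\<eta> (chart_dom c) b) * (if b \<in> TT then inverse (complex_of_real (\<sigma> b)) else 0)) \<in> carrier (RED TT)"
        by (rule RED_mult[OF PD(6) inv_red]) (use True in blast)
      moreover have "(\<lambda>b. complex_of_real (\<eta> (chart_dom c) b) * (if b \<in> TT then inverse (complex_of_real (\<sigma> b)) else 0)) =
          (\<lambda>a. complex_of_real (\<theta> c a))"
        using True \<sigma>_off by (auto simp: \<theta>_def fun_eq_iff divide_inverse)
      ultimately show ?thesis by simp
    next
      case False
      then have "(\<lambda>a. complex_of_real (\<theta> c a)) = (\<lambda>a. if a \<in> TT then 0 else 0)" by (auto simp: \<theta>_def)
      then show ?thesis using RED_const[OF openin_topspace, of 0] by simp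
    qed
  next
    fix c a
    have "\<sigma> a \<ge> 0" using \<sigma>_pos[of a] \<sigma>_off[of a] by (cases "a \<in> TT") auto
    then show "0 \<le> \<theta> c a" using PD(3)[of "chart_dom c" a] by (simp add: \<theta>_def)
  next
    fix c
    show "base M closure_of {a. \<theta> c a \<noteq> 0} \<subseteq> chart_dom c"
    proof (cases "chart_dom c \<in> \<W> \<and> c = ch (chart_dom c)")
      case True
      then have "{a. \<theta> c a \<noteq> 0} \<subseteq> K (chart_dom c)" using PD(4)[of "chart_dom c"] by (auto simp: \<theta>_def)
      then show ?thesis using closure_in_compact PD(1,2) True by blast
    next
      case False
      then have "{a. \<theta> c a \<noteq> 0} = {}" by (auto simp: \<theta>_def)
      then show ?thesis by simp
    qed
  next
    fix a assume "a \<in> TT"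
    then obtain N where N: "opn N" "a \<in> N" "finite {W \<in> \<W>. W \<inter> N \<noteq> {}}" using lf by blast
    have "{c. \<exists>b\<in>N. \<theta> c b \<noteq> 0} \<subseteq> ch ` {W \<in> \<W>. W \<inter> N \<noteq> {}}"
    proof
      fix c assume "c \<in> {c. \<exists>b\<in>N. \<theta> c b \<noteq> 0}"
      then obtain b W where "b \<in> N" "W \<in> \<W>" "c = ch W" "\<eta> W b \<noteq> 0" using \<theta>_nz by blast
      then show "c \<in> ch ` {W \<in> \<W>. W \<inter> N \<noteq> {}}" using sub[of b N] by blast
    qed
    then show "\<exists>N. opn N \<and> a \<in> N \<and> finite {c. \<exists>b\<in>N. \<theta> c b \<noteq> 0}"
      using N finite_subset finite_imageI by meson
  next
    fix a assume a: "a \<in> TT"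
    have "{c. \<theta> c a \<noteq> 0} = ch ` {W. W \<in> \<W> \<and> \<eta> W a \<noteq> 0}"
    proof
      show "{c. \<theta> c a \<noteq> 0} \<subseteq> ch ` {W. W \<in> \<W> \<and> \<eta> W a \<noteq> 0}" using \<theta>_nz by blast
      show "ch ` {W. W \<in> \<W> \<and> \<eta> W a \<noteq> 0} \<subseteq> {c. \<theta> c a \<noteq> 0}" using \<theta>_ch \<sigma>_pos[OF a] by auto
    qed
    moreover have "inj_on ch A" for A by (rule inj_onI) (metis dom_ch)
    ultimately have "(\<Sum>c | \<theta> c a \<noteq> 0. \<theta> c a) = (\<Sum>W | W \<in> \<W> \<and> \<eta> W a \<noteq> 0. \<theta> (ch W) a)"
      by (simp add: sum.reindex)
    also have "\<dots> = (\<Sum>W | W \<in> \<W> \<and> \<eta> W a \<noteq> 0. \<eta> W a / \<sigma> a)"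
      by (rule sum.cong) (auto simp: \<theta>_ch)
    also have "\<dots> = 1" unfolding sum_divide_distrib[symmetric] using \<sigma>_pos[OF a] by (simp add: \<sigma>_def[symmetric])
    finally show "(\<Sum>c | \<theta> c a \<noteq> 0. \<theta> c a) = 1" .
  qed
  then show ?thesis by blast
qed

end

section \<open>The integral of a density\<close>

text \<open>Points of the product measure space are undefined from index \<open>n\<close> on, and
  \<open>t\<close> replaces these entries by zero. \<open>G \<circ> t\<close> is continuous on the
  space of all functions, hence measurable; it is bounded and vanishes off a box of finite
  measure.\<close>

lemma integrable_truncation:
  fixes G :: "(nat \<Rightarrow> real) \<Rightarrow> complex"
  assumes cont: "continuous_map (Euclidean_space n) euclidean G"
    and K: "compactin (Euclidean_space n) K" and off: "\<And>y. y \<in> topspace (Euclidean_space n) \<Longrightarrow> y \<notin> K \<Longrightarrow> G y = 0"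
  shows "integrable (Pi\<^sub>M {..<n} (\<lambda>_. lborel)) (\<lambda>x. G (\<lambda>i. if i < n then x i else 0))"
proof -
  let ?M = "Pi\<^sub>M {..<n} (\<lambda>_. lborel :: real measure)"
  define t :: "(nat \<Rightarrow> real) \<Rightarrow> nat \<Rightarrow> real" where "t x = (\<lambda>i. if i < n then x i else 0)" for x
  have t_in: "t x \<in> topspace (Euclidean_space n)" for x by (simp add: t_def topspace_Euclidean_space)
  have tt: "t (t x) = t x" for x by (auto simp: t_def)
  have "continuous_map euclidean (Euclidean_space n) t"
    unfolding t_def[abs_def] continuous_map_componentwise_Euclidean_space
    by (auto intro!: continuous_intros continuous_on_product_coordinates)
  from continuous_map_compose[OF this cont] have "continuous_on UNIV (G \<circ> t)" by simp
  then have Gt: "G \<circ> t \<in> borel_measurable borel" by (rule borel_measurable_continuous_onI)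
  have "(\<lambda>x i. if i < n then x i else 0) \<in> measurable ?M (Pi\<^sub>M UNIV (\<lambda>_. borel))"
  proof (rule measurable_PiM_single')
    fix i show "(\<lambda>x. if i < n then x i else 0) \<in> measurable ?M borel"
      using measurable_component_singleton[of i "{..<n}" "\<lambda>_. lborel :: real measure"]
      by (cases "i < n") auto
  qed auto
  then have tm: "t \<in> measurable ?M borel"
    unfolding t_def[abs_def] by (simp cong: measurable_cong_sets add: measurable_cong_sets[OF refl sets_PiM_equal_borel])
  \<comment> \<open>Composing \<open>G \<circ> t\<close> with the measurable map \<open>t\<close>
    applies \<open>t\<close> twice, which is the same as applying it once.\<close>
  have meas: "(\<lambda>x. G (t x)) \<in> borel_measurable ?M"
    using measurable_compose[OF tm Gt] by (simp add: tt)
  have "compactin euclidean (G ` K)" by (rule image_compactin[OF K cont])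
  then have "bounded (G ` K)" by (simp add: compact_imp_bounded)
  then obtain B where B: "\<And>y. y \<in> K \<Longrightarrow> norm (G y) \<le> B" unfolding bounded_iff by blast
  have "\<exists>r. \<forall>y\<in>K. \<bar>y i\<bar> \<le> r" for i
  proof -
    have "continuous_map (Euclidean_space n) euclideanreal (\<lambda>x. x i)"
      unfolding Euclidean_space_def by (intro continuous_map_from_subtopology continuous_map_product_projection) auto
    then have "compactin euclideanreal ((\<lambda>x. x i) ` K)" by (rule image_compactin[OF K])
    then have "bounded ((\<lambda>x. x i) ` K)" by (simp add: compact_imp_bounded)
    then show ?thesis unfolding bounded_iff by auto
  qed
  then obtain r where r: "\<And>i y. y \<in> K \<Longrightarrow> \<bar>y i\<bar> \<le> r i" by metis
  let ?A = "Pi\<^sub>E {..<n} (\<lambda>i. {- r i..r i})"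
  interpret product_sigma_finite "\<lambda>_. lborel :: real measure" ..
  have "integrable ?M (\<lambda>x. G (t x))"
  proof (rule integrableI_bounded_set[where A="?A" and B="max B 0"])
    show "?A \<in> sets ?M" by (intro sets_PiM_I_finite) auto
    have "emeasure ?M ?A = (\<Prod>i<n. emeasure lborel {- r i..r i})" by (rule emeasure_PiM) auto
    also have "\<dots> < \<infinity>" by (auto simp: emeasure_lborel_Icc_eq prod_ennreal[symmetric] less_top[symmetric] ennreal_prod_eq_top)
    finally show "emeasure ?M ?A < \<infinity>" .
    show "AE x in ?M. x \<in> ?A \<longrightarrow> norm (G (t x)) \<le> max B 0"
    proof (intro AE_I2 impI)
      fix x show "norm (G (t x)) \<le> max B 0"
        using B[of "t x"] off[OF t_in, of x] by (cases "t x \<in> K") auto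
    qed
    show "AE x in ?M. x \<notin> ?A \<longrightarrow> G (t x) = 0"
    proof (intro AE_I2 impI)
      fix x assume x: "x \<in> space ?M" "x \<notin> ?A"
      have "t x \<notin> K"
      proof
        assume K: "t x \<in> K"
        have "x i \<in> {- r i..r i}" if "i < n" for i using r[OF K, of i] that by (auto simp: t_def abs_le_iff)
        then show False using x by (auto simp: space_PiM PiE_iff)
      qed
      then show "G (t x) = 0" by (rule off[OF t_in])
    qed
  qed (rule meas)
  then show ?thesis by (simp add: t_def)
qed

context fmfd begin

text \<open>Neither is \<open>K\<close> assumed to lie in the chart nor the closure of the support
  of \<open>g\<close> to be compact, but their intersection is compact and lies in \<open>V\<close>.
  Off its image the integrand is zero, so extension by zero from the chart is continuous on the
  whole Euclidean space.\<close>

lemma chart_integrable: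
  assumes ch: "red_chart M (n, V, \<phi>)" and w: "\<omega> \<in> carrier (DEN TT)" and g: "g \<in> carrier (RED TT)"
    and K: "compactin (base M) K" "\<And>a. a \<notin> K \<Longrightarrow> \<omega> (n, V, \<phi>) a = 0"
    and S: "base M closure_of {a. g a \<noteq> 0} \<subseteq> V"
  shows "integrable (Pi\<^sub>M {..<n} (\<lambda>_. lborel)) (\<lambda>x. let y = (\<lambda>i. if i < n then x i else 0)
     in if y \<in> \<phi> ` V then g (inv_into V \<phi> y) * \<omega> (n, V, \<phi>) (inv_into V \<phi> y) else 0)"
proof -
  note c = red_chartD[OF ch]
  let ?E = "Euclidean_space n"
  define G where "G y = (if y \<in> \<phi> ` V then g (inv_into V \<phi> y) * \<omega> (n, V, \<phi>) (inv_into V \<phi> y) else 0)" for y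
  let ?S = "K \<inter> base M closure_of {a. g a \<noteq> 0}"
  have TV: "TT \<inter> V = V" using openin_subset[OF c(1)] by auto
  have SV: "?S \<subseteq> V" using S by auto
  have "compactin (base M) ?S" by (rule compact_Int_closedin[OF K(1) closedin_closure_of])
  then have "compactin (subtopology (base M) V) ?S" using SV by (simp add: compactin_subtopology)
  then have "compactin (subtopology ?E (\<phi> ` V)) (\<phi> ` ?S)"
    by (rule image_compactin[OF _ homeomorphic_imp_continuous_map[OF c(3)]])
  then have Kc: "compactin ?E (\<phi> ` ?S)" by (simp add: compactin_subtopology)
  have T2E: "Hausdorff_space ?E"
    by (simp add: Euclidean_space_def Hausdorff_space_subtopology Hausdorff_space_product_topology)
  have Gz: "G y = 0" if "y \<notin> \<phi> ` ?S" for y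
  proof (cases "y \<in> \<phi> ` V")
    case True
    then obtain a where a: "a \<in> V" "y = \<phi> a" by blast
    then have "a \<notin> ?S" using that by blast
    moreover have "g a = 0 \<or> a \<in> base M closure_of {a. g a \<noteq> 0}"
      using closure_of_subset[of "{a. g a \<noteq> 0}" "base M"] RED_off[OF g] by blast
    ultimately show ?thesis using K(2) a by (auto simp: G_def inv_into_f_f[OF c(4)])
  qed (simp add: G_def)
  have "smooth_on n (topspace ?E) G"
  proof (rule smooth_on_local[OF openin_topspace])
    fix y assume y: "y \<in> topspace ?E"
    show "\<exists>Y. openin ?E Y \<and> y \<in> Y \<and> smooth_on n Y G"
    proof (cases "y \<in> \<phi> ` V")
      case True
      have "smooth_on n (\<phi> ` V) (\<lambda>x. (g \<circ> inv_into V \<phi>) x * (\<omega> (n, V, \<phi>) \<circ> inv_into V \<phi>) x)"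
        by (rule smooth_on_mult[OF c(2) RED_smooth[OF ch openin_topspace g, unfolded TV] DEN_D(2)[OF w ch, unfolded TV]])
      then have "smooth_on n (\<phi> ` V) G" by (rule smooth_on_cong[OF c(2)]) (simp add: G_def)
      then show ?thesis using True c(2) by blast
    next
      case False
      have o: "openin ?E (topspace ?E - \<phi> ` ?S)"
        using compactin_imp_closedin[OF T2E Kc] by blast
      have "smooth_on n (topspace ?E - \<phi> ` ?S) G"
        by (rule smooth_on_cong[OF o smooth_on_const[OF o, of 0]]) (simp add: Gz)
      then show ?thesis using False y o SV by blast
    qed
  qed
  then have "continuous_map ?E euclidean G" using smooth_on_continuous by fastforce
  from integrable_truncation[OF this Kc Gz] show ?thesis by (simp add: G_def Let_def)
qed

lemma finite_partition_support:
  assumes \<theta>: "smooth_partition_of_unity M \<theta>" and K: "compactin (base M) K"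
  shows "finite {ch. \<exists>a\<in>K. \<theta> ch a \<noteq> 0}"
proof -
  have lf: "\<forall>a\<in>TT. \<exists>N. opn N \<and> a \<in> N \<and> finite {ch. \<exists>b\<in>N. \<theta> ch b \<noteq> 0}"
    using \<theta> unfolding smooth_partition_of_unity_def by blast
  let ?\<N> = "{N. opn N \<and> finite {ch. \<exists>b\<in>N. \<theta> ch b \<noteq> 0}}"
  have "\<exists>\<F>. finite \<F> \<and> \<F> \<subseteq> ?\<N> \<and> K \<subseteq> \<Union>\<F>"
    by (rule compactinD[OF K]) (use lf compactin_subset_topspace[OF K] in blast)+
  then obtain \<F> where F: "finite \<F>" "\<F> \<subseteq> ?\<N>" "K \<subseteq> \<Union>\<F>" by blast
  have "finite (\<Union>N\<in>\<F>. {ch. \<exists>b\<in>N. \<theta> ch b \<noteq> 0})" using F(1,2) by blast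
  moreover have "{ch. \<exists>a\<in>K. \<theta> ch a \<noteq> 0} \<subseteq> (\<Union>N\<in>\<F>. {ch. \<exists>b\<in>N. \<theta> ch b \<noteq> 0})" using F(3) by blast
  ultimately show ?thesis using finite_subset by blast
qed

text \<open>The same choice as the one inside \<open>density_integral\<close>.\<close>

definition PU :: "'p chart \<Rightarrow> 'p \<Rightarrow> real" where
  "PU = (SOME \<theta>. smooth_partition_of_unity M \<theta>)"

lemma PU: "smooth_partition_of_unity M PU"
  unfolding PU_def by (rule someI_ex[OF partition_of_unity_exists])

lemma PU_D: "PU ch a \<noteq> 0 \<Longrightarrow> red_chart M ch" "(\<lambda>a. complex_of_real (PU ch a)) \<in> carrier (RED TT)"
  "base M closure_of {a. PU ch a \<noteq> 0} \<subseteq> chart_dom ch"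
  using PU unfolding smooth_partition_of_unity_def by (metis, blast, blast)

text \<open>The definition sums over the charts that contribute to the given density, an index set
  that varies with the density. Adding two integrals requires a common finite index set; charts
  outside the original one contribute zero.\<close>

lemma density_integral_alt:
  assumes "finite A" "\<And>ch a. complex_of_real (PU ch a) * \<omega> ch a \<noteq> 0 \<Longrightarrow> ch \<in> A"
  shows "density_integral M \<omega> = (\<Sum>ch\<in>A. chart_integral ch (\<lambda>a. complex_of_real (PU ch a) * \<omega> ch a))"
proof -
  have z: "chart_integral ch (\<lambda>a. 0) = 0" for ch :: "'p chart"
    by (cases ch) (simp add: chart_integral_def Let_def)
  have "chart_integral ch (\<lambda>a. complex_of_real (PU ch a) * \<omega> ch a) = 0"
    if "\<not> (\<exists>a. complex_of_real (PU ch a) * \<omega> ch a \<noteq> 0)" for ch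
  proof -
    have "(\<lambda>a. complex_of_real (PU ch a) * \<omega> ch a) = (\<lambda>a. 0)" using that by blast
    then show ?thesis by (simp only: z)
  qed
  then show ?thesis unfolding density_integral_def PU_def[symmetric] Let_def
    by (intro sum.mono_neutral_left[OF assms(1)]) (use assms(2) in auto)
qed

lemma density_integral_add:
  assumes w: "\<omega> \<in> carrier (DEN TT)" "\<omega>' \<in> carrier (DEN TT)"
    and K: "compactin (base M) K" "\<And>ch a. a \<notin> K \<Longrightarrow> \<omega> ch a = 0" "\<And>ch a. a \<notin> K \<Longrightarrow> \<omega>' ch a = 0"
  shows "density_integral M (\<lambda>ch a. \<omega> ch a + \<omega>' ch a) = density_integral M \<omega> + density_integral M \<omega>'"
proof -
  let ?A = "{ch. \<exists>a\<in>K. PU ch a \<noteq> 0}"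
  have fin: "finite ?A" by (rule finite_partition_support[OF PU K(1)])
  have alt: "density_integral M \<tau> = (\<Sum>ch\<in>?A. chart_integral ch (\<lambda>a. complex_of_real (PU ch a) * \<tau> ch a))"
    if "\<And>ch a. a \<notin> K \<Longrightarrow> \<tau> ch a = 0" for \<tau>
  proof (rule density_integral_alt[OF fin])
    fix ch a assume "complex_of_real (PU ch a) * \<tau> ch a \<noteq> 0"
    then have nz: "PU ch a \<noteq> 0" "\<tau> ch a \<noteq> 0" by auto
    then have "a \<in> K" using that[of a ch] by blast
    then show "ch \<in> ?A" using nz(1) by blast
  qed
  have "chart_integral ch (\<lambda>a. complex_of_real (PU ch a) * (\<omega> ch a + \<omega>' ch a)) =
      chart_integral ch (\<lambda>a. complex_of_real (PU ch a) * \<omega> ch a) + chart_integral ch (\<lambda>a. complex_of_real (PU ch a) * \<omega>' ch a)"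
    if "ch \<in> ?A" for ch
  proof -
    obtain n V \<phi> where c: "ch = (n, V, \<phi>)" by (cases ch)
    have rc: "red_chart M (n, V, \<phi>)" using that PU_D(1) unfolding c by blast
    have S: "base M closure_of {a. complex_of_real (PU (n, V, \<phi>) a) \<noteq> 0} \<subseteq> V"
      using PU_D(3)[of "(n, V, \<phi>)"] by simp
    note i = chart_integrable[OF rc _ PU_D(2) K(1) _ S]
    show ?thesis
      unfolding c chart_integral_def prod.case
      by (subst Bochner_Integration.integral_add[symmetric, OF i[OF w(1) K(2)] i[OF w(2) K(3)]])
        (auto simp: Let_def distrib_left intro!: Bochner_Integration.integral_cong)
  qed
  then show ?thesis
    using alt[of \<omega>] alt[of \<omega>'] alt[of "\<lambda>ch a. \<omega> ch a + \<omega>' ch a"] K by (simp add: sum.distrib)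
qed

lemma density_integral_scale:
  "density_integral M (\<lambda>ch a. c * \<omega> ch a) = c * density_integral M \<omega>"
\<comment> \<open>A nonzero factor leaves the index set of the sum in
  \<open>density_integral\<close> unchanged; for \<open>c = 0\<close> that set becomes
  empty.\<close>
proof (cases "c = 0")
  case True
  then show ?thesis by (simp add: density_integral_def)
next
  case False
  have "chart_integral ch (\<lambda>a. complex_of_real (\<theta> ch a) * (c * \<omega> ch a)) =
      c * chart_integral ch (\<lambda>a. complex_of_real (\<theta> ch a) * \<omega> ch a)" for ch :: "'p chart" and \<theta>
  proof (cases ch)
    case (fields n V \<phi>)
    have "(\<lambda>x. let y = (\<lambda>i. if i < n then x i else 0) in if y \<in> \<phi> ` V
          then complex_of_real (\<theta> (n, V, \<phi>) (inv_into V \<phi> y)) * (c * \<omega> (n, V, \<phi>) (inv_into V \<phi> y)) else 0) =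
        (\<lambda>x. c * (let y = (\<lambda>i. if i < n then x i else 0) in if y \<in> \<phi> ` V
          then complex_of_real (\<theta> (n, V, \<phi>) (inv_into V \<phi> y)) * \<omega> (n, V, \<phi>) (inv_into V \<phi> y) else 0))"
      by (auto simp: Let_def)
    then show ?thesis unfolding fields chart_integral_def prod.case by (simp only: integral_mult_right_zero)
  qed
  then show ?thesis using False by (simp add: density_integral_def Let_def sum_distrib_left)
qed

lemma density_integral_zero: "density_integral M (\<lambda>ch a. 0) = 0"
  by (simp add: density_integral_def)

end

section \<open>Compactly supported formal densities\<close>

locale fmod = fmfd M
  for M :: "('p, 's) ringed_space" +
  fixes F :: "('p, 's, 'f) sheaf_data"
  assumes modF: "sheaf_of_modules M F"
begin

abbreviation "DD \<equiv> densities M"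
abbreviation "FF \<equiv> secs F"

sublocale FD: msheaf2 M F "densities M"
  by unfold_locales (fact modF den.sheaf_of_modules)+

sublocale DR: msheaf2 M "densities M" "reduction M"
  by unfold_locales (fact den.sheaf_of_modules red.sheaf_of_modules)+

lemma compact_closed: "compactin (base M) K \<Longrightarrow> closedin (base M) K"
  by (rule compactin_imp_closedin[OF T2])

lemma DEN_lin:
  assumes W: "opn W" and x: "x \<in> carrier (DEN W)" "y \<in> carrier (DEN W)"
  shows "(\<lambda>ch a. x ch a + c * y ch a) \<in> carrier (DEN W)"
proof -
  have "x \<oplus>\<^bsub>DEN W\<^esub> sheaf_cscale M DD W c y \<in> carrier (DEN W)"
    by (intro den.add_in W x FD.G.F_cscale_in)
  moreover have "x \<oplus>\<^bsub>DEN W\<^esub> sheaf_cscale M DD W c y = (\<lambda>ch a. x ch a + c * y ch a)"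
    by (intro ext) (simp add: den.val_add den.val_cscale[OF W x(2)])
  ultimately show ?thesis by simp
qed

lemma DEN_minus:
  assumes W: "opn W" and x: "x \<in> carrier (DEN W)" "y \<in> carrier (DEN W)"
  shows "x \<ominus>\<^bsub>DEN W\<^esub> y = (\<lambda>ch a. x ch a - y ch a)"
proof -
  have n: "(\<lambda>ch a. 0 + (-1) * y ch a) \<in> carrier (DEN W)"
    using DEN_lin[OF W den.zero_in[OF W] x(2), of "-1"] by (simp add: densities_simps)
  have "\<ominus>\<^bsub>DEN W\<^esub> y = (\<lambda>ch a. 0 + (-1) * y ch a)"
    by (rule FD.G.F_uminus_eq[OF W x(2) n]) (simp add: densities_simps)
  then show ?thesis by (simp add: a_minus_def densities_simps)
qed

subsection \<open>Linear combinations of operators\<close>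

text \<open>One operation for both sums and scalar multiples: the latter arise by taking the zero
  operator for \<open>D1\<close>.\<close>

definition lin :: "complex \<Rightarrow> ('p set \<Rightarrow> 'f \<Rightarrow> 'p chart \<Rightarrow> 'p \<Rightarrow> complex) \<Rightarrow> ('p set \<Rightarrow> 'f \<Rightarrow> 'p chart \<Rightarrow> 'p \<Rightarrow> complex)
    \<Rightarrow> 'p set \<Rightarrow> 'f \<Rightarrow> 'p chart \<Rightarrow> 'p \<Rightarrow> complex" where
  "lin c D1 D2 = (\<lambda>W u ch a. D1 W u ch a + c * D2 W u ch a)"

lemma lin_hom:
  assumes D1: "D1 \<in> sheaf_homs M U F DD" and D2: "D2 \<in> sheaf_homs M U F DD"
  shows "lin c D1 D2 \<in> sheaf_homs M U F DD"
  unfolding sheaf_homs_def mem_Collect_eq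
proof (intro conjI allI impI ballI funcsetI)
  fix V u assume V: "opn V \<and> V \<subseteq> U" and u: "u \<in> carrier (FF V)"
  then have o: "opn V" "V \<subseteq> U" by auto
  note h1 = FD.homD[OF D1 o u] and h2 = FD.homD[OF D2 o u]
  show l: "lin c D1 D2 V u \<in> carrier (DEN V)" unfolding lin_def by (rule DEN_lin[OF o(1) h1(1) h2(1)])
  show "lin c D1 D2 V (u \<oplus>\<^bsub>FF V\<^esub> v) = lin c D1 D2 V u \<oplus>\<^bsub>DEN V\<^esub> lin c D1 D2 V v" if "v \<in> carrier (FF V)" for v
    unfolding lin_def using h1(2)[OF that] h2(2)[OF that]
    by (intro ext) (simp add: densities_simps distrib_left)
  show "lin c D1 D2 V (sheaf_cscale M F V d u) = sheaf_cscale M DD V d (lin c D1 D2 V u)" for d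
  proof (intro ext)
    fix ch a
    show "lin c D1 D2 V (sheaf_cscale M F V d u) ch a = sheaf_cscale M DD V d (lin c D1 D2 V u) ch a"
      unfolding den.val_cscale[OF o(1) l] unfolding lin_def h1(3) h2(3)
        den.val_cscale[OF o(1) h1(1)] den.val_cscale[OF o(1) h2(1)]
      by (simp add: algebra_simps)
  qed
next
  fix V W u assume "opn V \<and> opn W \<and> W \<subseteq> V \<and> V \<subseteq> U" and u: "u \<in> carrier (FF V)"
  then have o: "opn V" "V \<subseteq> U" "opn W" "W \<subseteq> V" by auto
  show "lin c D1 D2 W (rest F V W u) = rest DD V W (lin c D1 D2 V u)"
    unfolding lin_def FD.homD(4)[OF D1 o(1,2) u o(3,4)] FD.homD(4)[OF D2 o(1,2) u o(3,4)]
    by (intro ext) (simp add: densities_simps)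
next
  fix V u assume n: "\<not> (opn V \<and> V \<subseteq> U \<and> u \<in> carrier (FF V))"
  show "lin c D1 D2 V u = \<zero>\<^bsub>DEN V\<^esub>"
    unfolding lin_def FD.hom_outside[OF D1 n] FD.hom_outside[OF D2 n] by (simp add: densities_simps)
qed

text \<open>The induction runs over all \<open>D\<close> that agree with the combination on
  sections, since a commutator of \<open>lin c D1 D2\<close> is the combination of the commutators
  only at such arguments.\<close>

lemma fold_comm_lin:
  assumes V: "opn V" and "set fs \<subseteq> carrier (RR V)"
    and "FD.natural_on V D1" "FD.natural_on V D2"
    and "\<And>W u. opn W \<Longrightarrow> W \<subseteq> V \<Longrightarrow> u \<in> carrier (FF W) \<Longrightarrow> D W u = lin c D1 D2 W u"
    and "opn W" "W \<subseteq> V" "u \<in> carrier (FF W)"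
  shows "fold (FD.comm V) fs D W u = lin c (fold (FD.comm V) fs D1) (fold (FD.comm V) fs D2) W u"
  using assms(2-)
proof (induction fs arbitrary: D D1 D2 W u)
  case (Cons f fs)
  have f: "f \<in> carrier (RR V)" "set fs \<subseteq> carrier (RR V)" using Cons.prems(1) by auto
  have "fold (FD.comm V) fs (FD.comm V f D) W u =
    lin c (fold (FD.comm V) fs (FD.comm V f D1)) (fold (FD.comm V) fs (FD.comm V f D2)) W u"
  proof (rule Cons.IH[OF f(2)])
    show "FD.natural_on V (FD.comm V f D1)" "FD.natural_on V (FD.comm V f D2)"
      by (rule FD.natural_on_comm[OF _ V f(1)]; rule Cons.prems)+
    fix W u assume W: "opn W" "W \<subseteq> V" and u: "u \<in> carrier (FF W)"
    have fW: "rest (str M) V W f \<in> carrier (RR W)" by (rule O_rest(1)[OF V W f(1)])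
    have fu: "rest (str M) V W f \<odot>\<^bsub>FF W\<^esub> u \<in> carrier (FF W)" by (rule FD.F.F_smult_in[OF W(1) fW u])
    note n1 = FD.natural_onD(1)[OF Cons.prems(2) W] and n2 = FD.natural_onD(1)[OF Cons.prems(3) W]
    note s = den.smult_in[OF W(1) fW]
    have e: "D W v = (\<lambda>ch a. D1 W v ch a + c * D2 W v ch a)" if "v \<in> carrier (FF W)" for v
      using Cons.prems(4)[OF W that] by (simp add: lin_def)
    have l: "(\<lambda>ch a. D1 W v ch a + c * D2 W v ch a) \<in> carrier (DEN W)" if "v \<in> carrier (FF W)" for v
      by (rule DEN_lin[OF W(1) n1[OF that] n2[OF that]])
    show "FD.comm V f D W u = lin c (FD.comm V f D1) (FD.comm V f D2) W u"
      unfolding commutator_def lin_def e[OF u] e[OF fu]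
        DEN_minus[OF W(1) l[OF fu] s[OF l[OF u]]] DEN_minus[OF W(1) n1[OF fu] s[OF n1[OF u]]]
        DEN_minus[OF W(1) n2[OF fu] s[OF n2[OF u]]]
      by (intro ext) (simp add: densities_simps algebra_simps)
  qed (use Cons.prems in auto)
  then show ?case by simp
qed simp

text \<open>The first \<open>Suc r\<close> commutators already give zero on sections, and further
  commutators keep it zero.\<close>

lemma order_le_mono:
  assumes D: "order_le M V F DD r D" and r: "r \<le> r'" and V': "V' \<subseteq> V"
  shows "order_le M V' F DD r' D"
  unfolding order_le_def zero_on_def
proof (intro allI impI ballI)
  fix V0 fs W u
  assume 1: "opn V0 \<and> V0 \<subseteq> V' \<and> length fs = Suc r' \<and> set fs \<subseteq> carrier (RR V0)"
    and W: "opn W \<and> W \<subseteq> V0" and u: "u \<in> carrier (FF W)"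
  let ?t = "take (Suc r) fs" and ?d = "drop (Suc r) fs"
  have "fold (FD.comm V0) ?d (fold (FD.comm V0) ?t D) W u = \<zero>\<^bsub>DEN W\<^esub>"
  proof (rule FD.fold_comm_zero)
    fix f assume "f \<in> set ?d"
    then have "f \<in> carrier (RR V0)" using 1 by (auto dest: in_set_dropD)
    then show "rest (str M) V0 W f \<in> carrier (RR W)" using 1 W O_rest(1) by blast
  next
    fix v assume v: "v \<in> carrier (FF W)"
    have "zero_on M F DD V0 (fold (FD.comm V0) ?t D)"
      using 1 r V' set_take_subset[of "Suc r" fs]
      by (intro D[unfolded order_le_def, rule_format]) auto
    then show "fold (FD.comm V0) ?t D W v = \<zero>\<^bsub>DEN W\<^esub>" using W v unfolding zero_on_def by blast
  qed (use W u in auto)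
  then show "fold (FD.comm V0) fs D W u = \<zero>\<^bsub>DEN W\<^esub>"
    by (metis append_take_drop_id fold_append comp_apply)
qed

lemma lin_order:
  assumes "order_le M V F DD r D1" "order_le M V F DD r D2" "FD.natural_on V D1" "FD.natural_on V D2"
  shows "order_le M V F DD r (lin c D1 D2)"
  unfolding order_le_def zero_on_def
proof (intro allI impI ballI)
  fix V0 fs W u
  assume 1: "opn V0 \<and> V0 \<subseteq> V \<and> length fs = Suc r \<and> set fs \<subseteq> carrier (RR V0)"
    and W: "opn W \<and> W \<subseteq> V0" and u: "u \<in> carrier (FF W)"
  have n: "FD.natural_on V0 D1" "FD.natural_on V0 D2"
    using assms(3,4) 1 unfolding FD.natural_on_def by (meson subset_trans)+
  have "fold (FD.comm V0) fs (lin c D1 D2) W u = lin c (fold (FD.comm V0) fs D1) (fold (FD.comm V0) fs D2) W u"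
    by (rule fold_comm_lin[OF _ _ n refl]) (use 1 W u in auto)
  moreover have "fold (FD.comm V0) fs D1 W u = \<zero>\<^bsub>DEN W\<^esub>" "fold (FD.comm V0) fs D2 W u = \<zero>\<^bsub>DEN W\<^esub>"
    using assms(1,2) 1 W u unfolding order_le_def zero_on_def by simp_all
  ultimately show "fold (FD.comm V0) fs (lin c D1 D2) W u = \<zero>\<^bsub>DEN W\<^esub>"
    by (simp add: lin_def densities_simps)
qed

lemma Diff_cD:
  assumes "D \<in> Diff_c M U F DD"
  shows "D \<in> sheaf_homs M U F DD" "D \<in> diff_ops M U F DD" "compactin (base M) (op_support M U F DD D)"
    "op_support M U F DD D \<subseteq> U" "zero_on M F DD (U - op_support M U F DD D) D"
proof -
  show 1: "D \<in> sheaf_homs M U F DD" "D \<in> diff_ops M U F DD" "compactin (base M) (op_support M U F DD D)"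
    using assms by (auto simp: Diff_c_def diff_ops_def)
  show "op_support M U F DD D \<subseteq> U" by (auto simp: op_support_def)
  show "zero_on M F DD (U - op_support M U F DD D) D" by (rule FD.zero_off_support[OF 1(1)])
qed

lemma lin_Diff_c:
  assumes U: "opn U" and D1: "D1 \<in> Diff_c M U F DD" and D2: "D2 \<in> Diff_c M U F DD"
  shows "lin c D1 D2 \<in> Diff_c M U F DD"
proof -
  note d1 = Diff_cD[OF D1] and d2 = Diff_cD[OF D2]
  let ?K = "op_support M U F DD D1 \<union> op_support M U F DD D2"
  have K: "compactin (base M) ?K" using d1(3) d2(3) by (rule compactin_Un)
  have "zero_on M F DD (U - ?K) (lin c D1 D2)"
    unfolding zero_on_def
  proof (intro allI impI ballI)
    fix W u assume W: "opn W \<and> W \<subseteq> U - ?K" and u: "u \<in> carrier (FF W)"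
    have "D1 W u = \<zero>\<^bsub>DEN W\<^esub>" by (rule d1(5)[unfolded zero_on_def, rule_format]) (use W u in auto)
    moreover have "D2 W u = \<zero>\<^bsub>DEN W\<^esub>" by (rule d2(5)[unfolded zero_on_def, rule_format]) (use W u in auto)
    ultimately show "lin c D1 D2 W u = \<zero>\<^bsub>DEN W\<^esub>" by (simp add: lin_def densities_simps)
  qed
  then have s: "op_support M U F DD (lin c D1 D2) \<subseteq> ?K"
    by (rule FD.op_support_subset[OF U compact_closed[OF K]])
  have "lin c D1 D2 \<in> diff_ops M U F DD"
    unfolding diff_ops_def mem_Collect_eq
  proof (intro conjI ballI lin_hom d1(1) d2(1))
    fix a assume a: "a \<in> U"
    obtain V1 r1 where 1: "opn V1" "a \<in> V1" "V1 \<subseteq> U" "order_le M V1 F DD r1 D1"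
      using d1(2) a unfolding diff_ops_def by auto
    obtain V2 r2 where 2: "opn V2" "a \<in> V2" "V2 \<subseteq> U" "order_le M V2 F DD r2 D2"
      using d2(2) a unfolding diff_ops_def by auto
    have "order_le M (V1 \<inter> V2) F DD (max r1 r2) (lin c D1 D2)"
      by (intro lin_order order_le_mono[OF 1(4)] order_le_mono[OF 2(4)] FD.natural_on_hom[OF d1(1)] FD.natural_on_hom[OF d2(1)])
        (use 1 2 in auto)
    then show "\<exists>V r. opn V \<and> a \<in> V \<and> V \<subseteq> U \<and> order_le M V F DD r (lin c D1 D2)"
      using 1 2 by (intro exI[of _ "V1 \<inter> V2"] exI[of _ "max r1 r2"]) auto
  qed
  then show ?thesis
    using FD.compactin_op_support[OF K s] d1(4) d2(4) by (simp add: Diff_c_def)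
qed

definition zop :: "'p set \<Rightarrow> 'f \<Rightarrow> 'p chart \<Rightarrow> 'p \<Rightarrow> complex" where
  "zop = (\<lambda>W u ch a. 0)"

lemma zop_zero_on: "zero_on M F DD V zop"
  by (simp add: zero_on_def zop_def densities_simps)

lemma zop_Diff_Kr:
  assumes U: "opn U"
  shows "zop \<in> Diff_Kr M U F DD K r"
proof -
  have "sheaf_cscale M DD V c (\<lambda>ch a. 0) = (\<lambda>ch a. 0)" for V c
    by (simp add: sheaf_cscale_def densities_simps)
  then have h: "zop \<in> sheaf_homs M U F DD"
    unfolding sheaf_homs_def using den.zero_in by (auto simp: zop_def densities_simps)
  have s: "op_support M U F DD zop = {}"
    unfolding op_support_def using U zop_zero_on by auto
  have "zop \<in> diff_ops M U F DD"
    unfolding diff_ops_def using h U FD.zero_on_order[OF zop_zero_on] by blast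
  then show ?thesis
    using s FD.zero_on_order[OF zop_zero_on] by (simp add: Diff_Kr_def Diff_c_def)
qed

lemma Diff_Kr_imp: "D \<in> Diff_Kr M U F DD K r \<Longrightarrow> D \<in> Diff_c M U F DD"
  by (simp add: Diff_Kr_def)

subsection \<open>Values of compactly supported operators\<close>

text \<open>Restricting the value to \<open>U - K\<close> is the same as applying \<open>D\<close>
  over \<open>U - K\<close>, where it is zero.\<close>

lemma value_off:
  assumes D: "D \<in> sheaf_homs M U F DD" and U: "opn U" and K: "closedin (base M) K"
    and z: "zero_on M F DD (U - K) D" and u: "u \<in> carrier (FF U)" and a: "a \<notin> U \<inter> K"
  shows "D U u ch a = 0"
proof (cases "a \<in> U")
  case True
  have o: "opn (U - K)" using U K by (rule openin_diff)
  have "rest DD U (U - K) (D U u) = D (U - K) (rest F U (U - K) u)"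
    using FD.homD(4)[OF D U order_refl u o] by simp
  also have "\<dots> = \<zero>\<^bsub>DEN (U - K)\<^esub>"
    using z[unfolded zero_on_def, rule_format, OF conjI[OF o order_refl]] FD.F.F_rest(1)[OF U o Diff_subset u] by simp
  finally have "rest DD U (U - K) (D U u) ch a = 0" by (simp add: densities_simps)
  then show ?thesis using True a by (simp add: densities_simps)
next
  case False
  then show ?thesis by (intro den.off[OF FD.homD(1)[OF D U order_refl u]])
qed

text \<open>Densities are functions extended by zero, so a density on \<open>U\<close> supported in
  a closed set inside \<open>U\<close> is, as the same function, a density on the whole space. This
  allows \<open>density_integral\<close> to be used for \<open>U\<close> without change.\<close>

lemma DEN_extend:
  assumes U: "opn U" and K: "closedin (base M) K" "K \<subseteq> U" and w: "\<omega> \<in> carrier (DEN U)"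
    and off: "\<And>ch a. a \<notin> K \<Longrightarrow> \<omega> ch a = 0"
  shows "\<omega> \<in> carrier (DEN TT)"
proof (rule den.local[OF openin_topspace])
  fix ch a assume "a \<notin> TT"
  then show "\<omega> ch a = 0" using openin_subset[OF U] den.off[OF w] by blast
next
  fix a assume a: "a \<in> TT"
  show "\<exists>V. opn V \<and> a \<in> V \<and> V \<subseteq> TT \<and> rest DD TT V \<omega> \<in> carrier (DEN V)"
  proof (cases "a \<in> U")
    case True
    have "rest DD TT U \<omega> = \<omega>" using den.off[OF w] by (intro ext) (simp add: densities_simps)
    then show ?thesis using True U w openin_subset[OF U] by (intro exI[of _ U]) simp
  next
    case False
    have o: "opn (TT - K)" using K by blast
    have "rest DD TT (TT - K) \<omega> = \<zero>\<^bsub>DEN (TT - K)\<^esub>" using off by (intro ext) (simp add: densities_simps)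
    then show ?thesis using False a K o den.zero_in[OF o] by (intro exI[of _ "TT - K"]) auto
  qed
qed

lemma Diff_c_value:
  assumes U: "opn U" and D: "D \<in> Diff_c M U F DD" and u: "u \<in> carrier (FF U)"
  shows "D U u \<in> carrier (DEN TT)" "a \<notin> op_support M U F DD D \<Longrightarrow> D U u ch a = 0"
proof -
  note d = Diff_cD[OF D]
  show off: "D U u ch a = 0" if "a \<notin> op_support M U F DD D" for ch a
    by (rule value_off[OF d(1) U compact_closed[OF d(3)] d(5) u]) (use that in auto)
  show "D U u \<in> carrier (DEN TT)"
    by (rule DEN_extend[OF U compact_closed[OF d(3)] d(4) FD.homD(1)[OF d(1) U order_refl u] off])
qed

abbreviation "\<rho> \<equiv> rho M F"
abbreviation "SS \<equiv> Dc_carrier M F"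

lemma rho_lin:
  assumes U: "opn U" and D: "D1 \<in> Diff_c M U F DD" "D2 \<in> Diff_c M U F DD"
  shows "\<rho> U (lin c D1 D2) = \<rho> U D1 + fscale c (\<rho> U D2)"
proof
  fix u
  show "\<rho> U (lin c D1 D2) u = (\<rho> U D1 + fscale c (\<rho> U D2)) u"
  proof (cases "u \<in> carrier (FF U)")
    case True
    note v1 = Diff_c_value[OF U D(1) True] and v2 = Diff_c_value[OF U D(2) True]
    let ?K = "op_support M U F DD D1 \<union> op_support M U F DD D2"
    have K: "compactin (base M) ?K" by (intro compactin_Un Diff_cD(3) D)
    have z: "(\<lambda>ch a. c * D2 U u ch a) \<in> carrier (DEN TT)"
      using DEN_lin[OF openin_topspace den.zero_in[OF openin_topspace] v2(1), of c] by (simp add: densities_simps)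
    have "density_integral M (\<lambda>ch a. D1 U u ch a + c * D2 U u ch a) =
        density_integral M (D1 U u) + density_integral M (\<lambda>ch a. c * D2 U u ch a)"
      by (rule density_integral_add[OF v1(1) z K]) (use v1(2) v2(2) in auto)
    then show ?thesis using True by (simp add: rho_def lin_def fscale_def density_integral_scale)
  qed (simp add: rho_def fscale_def)
qed

lemma rho_zop: "\<rho> U zop = 0"
  by (intro ext) (simp add: rho_def zop_def density_integral_zero)

lemma fscale_module: "Modules.module fscale"
  by (rule Modules.module.intro) (auto simp: fscale_def fun_eq_iff algebra_simps)

lemma vector_space_fscale: "vector_space fscale"
  using fscale_module by (simp add: Modules.module_def vector_space_def)

lemma SS_subspace:
  assumes U: "opn U"
  shows "Modules.module.subspace fscale (SS U)"
proof (rule Modules.module.subspaceI[OF fscale_module])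
  have z: "zop \<in> Diff_c M U F DD" using zop_Diff_Kr[OF U] Diff_Kr_imp by blast
  show "0 \<in> SS U" unfolding Dc_carrier_def using z rho_zop[of U] by (metis imageI)
  fix x y assume "x \<in> SS U" "y \<in> SS U"
  then obtain D1 D2 where D: "D1 \<in> Diff_c M U F DD" "D2 \<in> Diff_c M U F DD" "x = \<rho> U D1" "y = \<rho> U D2"
    unfolding Dc_carrier_def by blast
  have "x + y = \<rho> U (lin 1 D1 D2)" using rho_lin[OF U D(1,2), of 1] D by (simp add: fscale_def)
  then show "x + y \<in> SS U" unfolding Dc_carrier_def using lin_Diff_c[OF U D(1,2)] by blast
next
  fix c x assume "x \<in> SS U"
  then obtain D where D: "D \<in> Diff_c M U F DD" "x = \<rho> U D" unfolding Dc_carrier_def by blast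
  have z: "zop \<in> Diff_c M U F DD" using zop_Diff_Kr[OF U] Diff_Kr_imp by blast
  have "fscale c x = \<rho> U (lin c zop D)" using rho_lin[OF U z D(1), of c] rho_zop[of U] D(2) by simp
  then show "fscale c x \<in> SS U" unfolding Dc_carrier_def using lin_Diff_c[OF U z D(1)] by blast
qed

text \<open>Additivity in the section, not in the density: it is what expands \<open>\<eta>\<close>
  along a decomposition of the unit section.\<close>

lemma SS_additive:
  assumes x: "x \<in> SS TT" and u: "u \<in> carrier (FF TT)" "v \<in> carrier (FF TT)"
  shows "x (u \<oplus>\<^bsub>FF TT\<^esub> v) = x u + x v"
proof -
  obtain D where D: "D \<in> Diff_c M TT F DD" "x = \<rho> TT D" using x unfolding Dc_carrier_def by blast
  note d = Diff_cD[OF D(1)] and T = openin_topspace[of "base M"]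
  note vu = Diff_c_value[OF T D(1) u(1)] and vv = Diff_c_value[OF T D(1) u(2)]
  have "D TT (u \<oplus>\<^bsub>FF TT\<^esub> v) = (\<lambda>ch a. D TT u ch a + D TT v ch a)"
    using FD.homD(2)[OF d(1) T order_refl u] by (simp add: densities_simps)
  then show ?thesis
    using density_integral_add[OF vu(1) vv(1) d(3) vu(2) vv(2)] u FD.F.F_add_in[OF T u] by (simp add: D(2) rho_def)
qed

subsection \<open>The seminorms\<close>

lemma RED_continuous:
  assumes U: "opn U" and g: "g \<in> carrier (RED U)"
  shows "continuous_map (subtopology (base M) U) euclidean g"
  unfolding continuous_map_def
proof (intro conjI allI impI)
  let ?X = "subtopology (base M) U"
  have top: "topspace ?X = U" using openin_subset[OF U] by auto
  fix W :: "complex set" assume W: "openin euclidean W"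
  show "openin ?X {a \<in> topspace ?X. g a \<in> W}"
  proof (subst openin_subopen, intro ballI)
    fix a assume a: "a \<in> {a \<in> topspace ?X. g a \<in> W}"
    then have aU: "a \<in> U" "g a \<in> W" using top by auto
    then obtain n V \<phi> where ch: "red_chart M (n, V, \<phi>)" and aV: "a \<in> V"
      using red_chart_at openin_subset[OF U] by blast
    note c = red_chartD[OF ch]
    have oE: "openin (Euclidean_space n) (\<phi> ` (U \<inter> V))" by (rule c(5)[OF U])
    have tops: "topspace (subtopology (Euclidean_space n) (\<phi> ` (U \<inter> V))) = \<phi> ` (U \<inter> V)"
      using openin_subset[OF oE] by auto
    have "continuous_map (subtopology (Euclidean_space n) (\<phi> ` (U \<inter> V))) euclidean (g \<circ> inv_into V \<phi>)"
      by (rule smooth_on_continuous[OF RED_smooth[OF ch U g]])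
    from openin_continuous_map_preimage[OF this W]
    have "openin (Euclidean_space n) {y \<in> \<phi> ` (U \<inter> V). (g \<circ> inv_into V \<phi>) y \<in> W}" (is "openin _ ?Y")
      unfolding tops using openin_open_subtopology[OF oE] by blast
    then have "openin (subtopology (Euclidean_space n) (\<phi> ` V)) (?Y \<inter> \<phi> ` V)" by (rule openin_subtopology_Int)
    from openin_continuous_map_preimage[OF homeomorphic_imp_continuous_map[OF c(3)] this]
    have "openin (subtopology (base M) V) {b \<in> topspace (subtopology (base M) V). \<phi> b \<in> ?Y \<inter> \<phi> ` V}" (is "openin _ ?Z") .
    then have oZ: "opn ?Z" using openin_open_subtopology[OF c(1)] by blast
    have ZU: "b \<in> U \<and> g b \<in> W" if b: "b \<in> ?Z" for b
    proof -
      have bV: "b \<in> V" and bY: "\<phi> b \<in> ?Y" using b by auto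
      then obtain b' where b': "b' \<in> U" "b' \<in> V" "\<phi> b = \<phi> b'" by auto
      then have "b = b'" using inj_onD[OF c(4)] bV by blast
      then show ?thesis using b' bY by (auto simp: inv_into_f_f[OF c(4)])
    qed
    have "a \<in> ?Z" using aU aV openin_subset[OF U] by (auto simp: inv_into_f_f[OF c(4)])
    moreover have "openin ?X ?Z"
    proof -
      have "?Z \<inter> U = ?Z" using ZU by blast
      then show ?thesis using openin_subtopology_Int[OF oZ, of U] by simp
    qed
    moreover have "?Z \<subseteq> {a \<in> topspace ?X. g a \<in> W}" using ZU top by blast
    ultimately show "\<exists>T. openin ?X T \<and> a \<in> T \<and> T \<subseteq> {a \<in> topspace ?X. g a \<in> W}" by blast
  qed
qed auto

lemma DR_Diff_cD:
  assumes "X \<in> Diff_c M U DD (reduction M)"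
  shows "X \<in> sheaf_homs M U DD (reduction M)" "X \<in> diff_ops M U DD (reduction M)"
    "compactin (base M) (op_support M U DD (reduction M) X)" "op_support M U DD (reduction M) X \<subseteq> U"
    "zero_on M DD (reduction M) (U - op_support M U DD (reduction M) X) X"
proof -
  show 1: "X \<in> sheaf_homs M U DD (reduction M)" "X \<in> diff_ops M U DD (reduction M)"
    "compactin (base M) (op_support M U DD (reduction M) X)"
    using assms by (auto simp: Diff_c_def diff_ops_def)
  show "op_support M U DD (reduction M) X \<subseteq> U" by (auto simp: op_support_def)
  show "zero_on M DD (reduction M) (U - op_support M U DD (reduction M) X) X" by (rule DR.zero_off_support[OF 1(1)])
qed

text \<open>The values of \<open>X\<close> are continuous functions supported in a compact set.
  Without this bound the \<open>Sup\<close> in \<open>diff_seminorm\<close> would be an arbitrary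
  number and the triangle inequality would be out of reach.\<close>

lemma Diff_c_bounded:
  assumes U: "opn U" and X: "X \<in> Diff_c M U DD (reduction M)" and w: "\<omega> \<in> carrier (DEN U)"
  shows "\<exists>B. \<forall>a. cmod (X U \<omega> a) \<le> B"
proof -
  note x = DR_Diff_cD[OF X]
  let ?K = "op_support M U DD (reduction M) X"
  have g: "X U \<omega> \<in> carrier (RED U)" by (rule DR.homD(1)[OF x(1) U order_refl w])
  have "compactin (subtopology (base M) U) ?K" using x(3,4) by (simp add: compactin_subtopology)
  then have "compactin euclidean (X U \<omega> ` ?K)" by (rule image_compactin[OF _ RED_continuous[OF U g]])
  then have "bounded (X U \<omega> ` ?K)" by (simp add: compact_imp_bounded)
  then obtain B where B: "\<And>a. a \<in> ?K \<Longrightarrow> cmod (X U \<omega> a) \<le> B" unfolding bounded_iff by blast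
  have o: "opn (U - ?K)" using U compact_closed[OF x(3)] by (rule openin_diff)
  have "rest (reduction M) U (U - ?K) (X U \<omega>) = X (U - ?K) (rest DD U (U - ?K) \<omega>)"
    using DR.homD(4)[OF x(1) U order_refl w o] by simp
  also have "\<dots> = \<zero>\<^bsub>RED (U - ?K)\<^esub>"
    using x(5)[unfolded zero_on_def, rule_format, OF conjI[OF o order_refl]] den.rest_in[OF U o Diff_subset w] by simp
  finally have z: "rest (reduction M) U (U - ?K) (X U \<omega>) = \<zero>\<^bsub>RED (U - ?K)\<^esub>" .
  have "cmod (X U \<omega> a) \<le> max B 0" for a
  proof (cases "a \<in> ?K")
    case True
    then show ?thesis using B[of a] by simp
  next
    case False
    have "X U \<omega> a = 0"
    proof (cases "a \<in> U")
      case True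
      then show ?thesis using fun_cong[OF z, of a] False by (simp add: reduction_simps)
    qed (rule RED_off[OF g])
    then show ?thesis by simp
  qed
  then show ?thesis by blast
qed

lemma DEN_diff: "opn W \<Longrightarrow> x \<in> carrier (DEN W) \<Longrightarrow> y \<in> carrier (DEN W) \<Longrightarrow> x - y \<in> carrier (DEN W)"
  using DEN_lin[of W x y "-1"] by (simp add: fun_diff_def)

lemma seminorm_triangle:
  assumes U: "opn U" and X: "X \<in> Diff_c M U DD (reduction M)" and u: "u \<in> carrier (FF U)"
    and D: "D1 \<in> Diff_Kr M U F DD K r" "D2 \<in> Diff_Kr M U F DD K r" "D3 \<in> Diff_Kr M U F DD K r"
  shows "diff_seminorm M U X u (D1 - D3) \<le> diff_seminorm M U X u (D1 - D2) + diff_seminorm M U X u (D2 - D3)"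
proof -
  have v: "D U u \<in> carrier (DEN U)" if "D \<in> Diff_Kr M U F DD K r" for D
    by (rule FD.homD(1)[OF Diff_cD(1)[OF Diff_Kr_imp[OF that]] U order_refl u])
  note x = DR_Diff_cD(1)[OF X]
  let ?a = "D1 U u - D2 U u" and ?b = "D2 U u - D3 U u"
  have ab: "?a \<in> carrier (DEN U)" "?b \<in> carrier (DEN U)" by (intro DEN_diff U v D)+
  have "D1 U u - D3 U u = ?a \<oplus>\<^bsub>DEN U\<^esub> ?b" by (intro ext) (simp add: densities_simps)
  then have e: "X U (D1 U u - D3 U u) = (\<lambda>a. X U ?a a + X U ?b a)"
    using DR.homD(2)[OF x U order_refl ab] by (simp add: reduction_simps)
  let ?I = "\<lambda>\<omega>. insert 0 ((\<lambda>a. cmod (X U \<omega> a)) ` U)"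
  have bdd: "bdd_above (?I \<omega>)" if w: "\<omega> \<in> carrier (DEN U)" for \<omega>
  proof -
    obtain B where B: "\<And>a. cmod (X U \<omega> a) \<le> B" using Diff_c_bounded[OF U X w] by blast
    have "bdd_above ((\<lambda>a. cmod (X U \<omega> a)) ` U)" by (rule bdd_aboveI2[of _ _ B]) (rule B)
    then show ?thesis by simp
  qed
  have up: "cmod (X U \<omega> a) \<le> Sup (?I \<omega>)" if "a \<in> U" "\<omega> \<in> carrier (DEN U)" for \<omega> a
    by (rule cSup_upper[OF _ bdd[OF that(2)]]) (use that(1) in blast)
  have nn: "0 \<le> Sup (?I \<omega>)" if "\<omega> \<in> carrier (DEN U)" for \<omega>
    by (rule cSup_upper[OF _ bdd[OF that]]) simp
  have "Sup (insert 0 ((\<lambda>a. cmod (X U ?a a + X U ?b a)) ` U)) \<le> Sup (?I ?a) + Sup (?I ?b)"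
  proof (rule cSup_least)
    fix t assume "t \<in> insert 0 ((\<lambda>a. cmod (X U ?a a + X U ?b a)) ` U)"
    then consider "t = 0" | a where "a \<in> U" "t = cmod (X U ?a a + X U ?b a)" by blast
    then show "t \<le> Sup (?I ?a) + Sup (?I ?b)"
    proof cases
      case 1
      then show ?thesis using nn[OF ab(1)] nn[OF ab(2)] by simp
    next
      case 2
      then show ?thesis using up[OF 2(1) ab(1)] up[OF 2(1) ab(2)] norm_triangle_ineq[of "X U ?a a" "X U ?b a"] by linarith
    qed
  qed simp
  moreover have "diff_seminorm M U X u (D1 - D3) = Sup (insert 0 ((\<lambda>a. cmod (X U ?a a + X U ?b a)) ` U))"
    unfolding diff_seminorm_def minus_apply[of D1 D3 U] minus_apply[of "D1 U" "D3 U" u] e by (rule refl)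
  moreover have "diff_seminorm M U X u (D1 - D2) = Sup (?I ?a)"
    unfolding diff_seminorm_def minus_apply[of D1 D2 U] minus_apply[of "D1 U" "D2 U" u] by (rule refl)
  moreover have "diff_seminorm M U X u (D2 - D3) = Sup (?I ?b)"
    unfolding diff_seminorm_def minus_apply[of D2 D3 U] minus_apply[of "D2 U" "D3 U" u] by (rule refl)
  ultimately show ?thesis by (simp only:)
qed

lemma seminorm_zero:
  assumes U: "opn U" and X: "X \<in> Diff_c M U DD (reduction M)"
  shows "diff_seminorm M U X u 0 = 0"
proof -
  have "X U \<zero>\<^bsub>DEN U\<^esub> = \<zero>\<^bsub>RED U\<^esub>" by (rule DR.hom_zero[OF DR_Diff_cD(1)[OF X] U order_refl])
  then have "X U (0 U u) = (\<lambda>a. 0)" by (simp add: densities_simps reduction_simps zero_fun_def)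
  then have "insert 0 ((\<lambda>a. cmod (X U (0 U u) a)) ` U) = {0}" by auto
  then show ?thesis unfolding diff_seminorm_def by (simp only: cSup_singleton)
qed

text \<open>Used with \<open>U\<close> and \<open>U'\<close> different: if the values agree
  everywhere and vanish off both sets, the points of one set outside the other contribute only the
  number 0, which is in both suprema anyway.\<close>

lemma seminorm_eq:
  assumes "\<And>a. X U (D U u) a = X' U' (D' U' u') a" "\<And>a. a \<notin> U \<Longrightarrow> X U (D U u) a = 0" "\<And>a. a \<notin> U' \<Longrightarrow> X U (D U u) a = 0"
  shows "diff_seminorm M U X u D = diff_seminorm M U' X' u' D'"
proof -
  have "insert 0 ((\<lambda>a. cmod (X U (D U u) a)) ` U) = insert 0 ((\<lambda>a. cmod (X' U' (D' U' u') a)) ` U')"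
    unfolding assms(1)[symmetric] using assms(2,3) by (auto simp: image_iff) (metis norm_zero)+
  then show ?thesis by (simp add: diff_seminorm_def)
qed

text \<open>The translation of seminorms: each seminorm of the target, evaluated on a difference of
  images, is to equal one seminorm of the source.\<close>

lemma continuous_map_Diff_Kr:
  assumes U: "opn U" "opn U'"
    and L: "\<And>D. D \<in> Diff_Kr M U F DD K r \<Longrightarrow> L D \<in> Diff_Kr M U' F DD K' r'"
    and q: "\<And>X u. X \<in> Diff_c M U' DD (reduction M) \<Longrightarrow> u \<in> carrier (FF U') \<Longrightarrow>
       \<exists>X' u'. X' \<in> Diff_c M U DD (reduction M) \<and> u' \<in> carrier (FF U) \<and>
         (\<forall>D1\<in>Diff_Kr M U F DD K r. \<forall>D2\<in>Diff_Kr M U F DD K r.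
            diff_seminorm M U' X u (L D2 - L D1) = diff_seminorm M U X' u' (D2 - D1))"
  shows "continuous_map (Diff_Kr_topology M F U K r) (Diff_Kr_topology M F U' K' r') L"
  unfolding Diff_Kr_topology_def
proof (rule continuous_map_seminorm_topology)
  show "L \<in> Diff_Kr M U F DD K r \<rightarrow> Diff_Kr M U' F DD K' r'" using L by blast
  fix p assume "p \<in> {diff_seminorm M U X u |X u. X \<in> Diff_c M U DD (reduction M) \<and> u \<in> carrier (FF U)}"
  then show "p 0 = 0" using seminorm_zero[OF U(1)] by auto
next
  fix p assume "p \<in> {diff_seminorm M U' X u |X u. X \<in> Diff_c M U' DD (reduction M) \<and> u \<in> carrier (FF U')}"
  then obtain X u where p: "p = diff_seminorm M U' X u" "X \<in> Diff_c M U' DD (reduction M)" "u \<in> carrier (FF U')" by blast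
  show "\<exists>q\<in>{diff_seminorm M U X u |X u. X \<in> Diff_c M U DD (reduction M) \<and> u \<in> carrier (FF U)}.
      \<forall>D1\<in>Diff_Kr M U F DD K r. \<forall>D2\<in>Diff_Kr M U F DD K r. p (L D2 - L D1) \<le> q (D2 - D1)"
  proof -
    from q[OF p(2,3)] obtain X' u' where X': "X' \<in> Diff_c M U DD (reduction M)" "u' \<in> carrier (FF U)"
      and e: "\<forall>D1\<in>Diff_Kr M U F DD K r. \<forall>D2\<in>Diff_Kr M U F DD K r.
            diff_seminorm M U' X u (L D2 - L D1) = diff_seminorm M U X' u' (D2 - D1)"
      by (elim exE conjE) (rule that)
    show ?thesis
      by (rule bexI[of _ "diff_seminorm M U X' u'"]) (use e X' p(1) in auto)
  qed
  fix x y z assume "x \<in> Diff_Kr M U' F DD K' r'" "y \<in> Diff_Kr M U' F DD K' r'" "z \<in> Diff_Kr M U' F DD K' r'"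
  then show "p (x - z) \<le> p (x - y) + p (y - z)" unfolding p(1) by (rule seminorm_triangle[OF U(2) p(2,3)])
qed

end

section \<open>Decomposition of formal densities\<close>

context fmfd begin

text \<open>Off \<open>A\<close> the section itself is zero, including its coefficients in the
  formal directions, and not only its residue. Products \<open>h u\<close> can therefore be extended
  by zero.\<close>

definition cutoff :: "'p set \<Rightarrow> 's \<Rightarrow> 'p set \<Rightarrow> bool" where
  "cutoff V h A \<longleftrightarrow> h \<in> carrier (RR TT) \<and> compactin (base M) A \<and> A \<subseteq> V \<and>
     rest (str M) TT (TT - A) h = \<zero>\<^bsub>RR (TT - A)\<^esub>"

definition osum :: "'s list \<Rightarrow> 's" where
  "osum hs = foldr (\<lambda>h s. h \<oplus>\<^bsub>RR TT\<^esub> s) hs \<zero>\<^bsub>RR TT\<^esub>"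

lemma osum_simps [simp]: "osum [] = \<zero>\<^bsub>RR TT\<^esub>" "osum (h # hs) = h \<oplus>\<^bsub>RR TT\<^esub> osum hs"
  by (simp_all add: osum_def)

lemma osum_in: "set hs \<subseteq> carrier (RR TT) \<Longrightarrow> osum hs \<in> carrier (RR TT)"
  by (induction hs) (use cringO[OF openin_topspace] in \<open>auto simp: cring.cring_simprules\<close>)

lemma rest_mult:
  assumes "opn W" "x \<in> carrier (RR TT)" "y \<in> carrier (RR TT)"
  shows "rest (str M) TT W (x \<otimes>\<^bsub>RR TT\<^esub> y) = rest (str M) TT W x \<otimes>\<^bsub>RR W\<^esub> rest (str M) TT W y"
  by (rule ring_hom_mult[OF O_rest_hom]) (use assms openin_subset in auto)

lemma rest_plus:
  assumes "opn W" "x \<in> carrier (RR TT)" "y \<in> carrier (RR TT)"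
  shows "rest (str M) TT W (x \<oplus>\<^bsub>RR TT\<^esub> y) = rest (str M) TT W x \<oplus>\<^bsub>RR W\<^esub> rest (str M) TT W y"
  by (rule ring_hom_add[OF O_rest_hom]) (use assms openin_subset in auto)

lemma rest_TT_in: "opn W \<Longrightarrow> x \<in> carrier (RR TT) \<Longrightarrow> rest (str M) TT W x \<in> carrier (RR W)"
  by (rule O_rest(1)) (auto dest: openin_subset)

lemma rest_TT_one: "opn W \<Longrightarrow> rest (str M) TT W \<one>\<^bsub>RR TT\<^esub> = \<one>\<^bsub>RR W\<^esub>"
  by (rule ring_hom_one[OF O_rest_hom]) (auto dest: openin_subset)

text \<open>Given bump sections \<open>h\<^sub>1, \<dots>, h\<^sub>m\<close>, the sections \<open>h\<^sub>i \<Prod>\<^sub>j\<^sub>>\<^sub>i (1 - h\<^sub>j)\<close> and the remainder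
  \<open>p = \<Prod>\<^sub>j (1 - h\<^sub>j)\<close> add up to \<open>1\<close>; this avoids dividing by the sum of the bump sections.\<close>

lemma cutoff_list:
  assumes "\<And>\<gamma> h A N. (\<gamma>, h, A, N) \<in> set bs \<Longrightarrow> cutoff (U \<gamma>) h A \<and> opn N \<and> rest (str M) TT N h = \<one>\<^bsub>RR N\<^esub>"
  shows "\<exists>L p. (\<forall>(\<gamma>, h, A)\<in>set L. \<gamma> \<in> fst ` set bs \<and> cutoff (U \<gamma>) h A) \<and> p \<in> carrier (RR TT) \<and>
     osum (map (fst \<circ> snd) L) \<oplus>\<^bsub>RR TT\<^esub> p = \<one>\<^bsub>RR TT\<^esub> \<and>
     (\<forall>(\<gamma>, h, A, N)\<in>set bs. rest (str M) TT N p = \<zero>\<^bsub>RR N\<^esub>)"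
  using assms
proof (induction bs)
  case Nil
  show ?case
    by (rule exI[of _ "[]"], rule exI[of _ "\<one>\<^bsub>RR TT\<^esub>"])
      (use cringO[OF openin_topspace] in \<open>auto simp: cring.cring_simprules\<close>)
next
  case (Cons b bs)
  obtain \<gamma> h A N where b: "b = (\<gamma>, h, A, N)" by (cases b)
  have "cutoff (U \<gamma>) h A \<and> opn N \<and> rest (str M) TT N h = \<one>\<^bsub>RR N\<^esub>" by (rule Cons.prems) (simp add: b)
  then have h: "h \<in> carrier (RR TT)" "compactin (base M) A" "A \<subseteq> U \<gamma>" "rest (str M) TT (TT - A) h = \<zero>\<^bsub>RR (TT - A)\<^esub>"
    and N: "opn N" "rest (str M) TT N h = \<one>\<^bsub>RR N\<^esub>" by (auto simp: cutoff_def)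
  have "\<exists>L p. (\<forall>(\<gamma>, h, A)\<in>set L. \<gamma> \<in> fst ` set bs \<and> cutoff (U \<gamma>) h A) \<and> p \<in> carrier (RR TT) \<and>
     osum (map (fst \<circ> snd) L) \<oplus>\<^bsub>RR TT\<^esub> p = \<one>\<^bsub>RR TT\<^esub> \<and>
     (\<forall>(\<gamma>, h, A, N)\<in>set bs. rest (str M) TT N p = \<zero>\<^bsub>RR N\<^esub>)"
    by (rule Cons.IH, rule Cons.prems) simp
  then obtain L p where L: "\<forall>(\<gamma>, h, A)\<in>set L. \<gamma> \<in> fst ` set bs \<and> cutoff (U \<gamma>) h A" and p: "p \<in> carrier (RR TT)"
    and s: "osum (map (fst \<circ> snd) L) \<oplus>\<^bsub>RR TT\<^esub> p = \<one>\<^bsub>RR TT\<^esub>"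
    and z: "\<forall>(\<gamma>, h, A, N)\<in>set bs. rest (str M) TT N p = \<zero>\<^bsub>RR N\<^esub>" by (elim exE conjE) (rule that)
  interpret R: cring "RR TT" by (rule cringO[OF openin_topspace])
  \<comment> \<open>The remainder \<open>p\<close> of the tail is split as
    \<open>p h + p (1 - h)\<close>: the first summand is the new cutoff, the second the new
    remainder.\<close>
  let ?p = "p \<otimes>\<^bsub>RR TT\<^esub> (\<one>\<^bsub>RR TT\<^esub> \<ominus>\<^bsub>RR TT\<^esub> h)" and ?h = "p \<otimes>\<^bsub>RR TT\<^esub> h"
  have os: "osum (map (fst \<circ> snd) L) \<in> carrier (RR TT)"
    by (rule osum_in) (use L in \<open>auto simp: cutoff_def\<close>)
  have pin: "?p \<in> carrier (RR TT)" "?h \<in> carrier (RR TT)" using p h(1) by auto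
  have oA: "opn (TT - A)" using compactin_imp_closedin[OF T2 h(2)] by blast
  have cut: "cutoff (U \<gamma>) ?h A"
  proof -
    interpret RA: cring "RR (TT - A)" by (rule cringO[OF oA])
    show ?thesis unfolding cutoff_def
      using h pin(2) rest_mult[OF oA p h(1)] rest_TT_in[OF oA p] by simp
  qed
  have sum1: "?h \<oplus>\<^bsub>RR TT\<^esub> ?p = p" using p h(1) by algebra
  have tot: "osum (map (fst \<circ> snd) ((\<gamma>, ?h, A) # L)) \<oplus>\<^bsub>RR TT\<^esub> ?p = \<one>\<^bsub>RR TT\<^esub>"
  proof -
    have "(?h \<oplus>\<^bsub>RR TT\<^esub> osum (map (fst \<circ> snd) L)) \<oplus>\<^bsub>RR TT\<^esub> ?p = osum (map (fst \<circ> snd) L) \<oplus>\<^bsub>RR TT\<^esub> (?h \<oplus>\<^bsub>RR TT\<^esub> ?p)"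
      using os pin by (simp add: R.a_ac)
    then show ?thesis using s sum1 by simp
  qed
  \<comment> \<open>On \<open>N'\<close> one of the two factors of the new remainder is zero:
    \<open>p\<close> for the bumps of the tail, \<open>1 - h\<close> for the new one.\<close>
  have zN: "rest (str M) TT N' ?p = \<zero>\<^bsub>RR N'\<^esub>"
    if N': "opn N'" "rest (str M) TT N' p = \<zero>\<^bsub>RR N'\<^esub> \<or> rest (str M) TT N' h = \<one>\<^bsub>RR N'\<^esub>" for N'
  proof -
    interpret RN: cring "RR N'" by (rule cringO[OF N'(1)])
    have m: "\<one>\<^bsub>RR TT\<^esub> \<ominus>\<^bsub>RR TT\<^esub> h \<in> carrier (RR TT)" using h(1) by auto
    note pN = rest_TT_in[OF N'(1) p] and mN = rest_TT_in[OF N'(1) m]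
    have e: "rest (str M) TT N' ?p = rest (str M) TT N' p \<otimes>\<^bsub>RR N'\<^esub> rest (str M) TT N' (\<one>\<^bsub>RR TT\<^esub> \<ominus>\<^bsub>RR TT\<^esub> h)"
      by (rule rest_mult[OF N'(1) p m])
    from N'(2) show ?thesis
    proof
      assume "rest (str M) TT N' p = \<zero>\<^bsub>RR N'\<^esub>" then show ?thesis unfolding e using mN by simp
    next
      assume 1: "rest (str M) TT N' h = \<one>\<^bsub>RR N'\<^esub>"
      have "(\<one>\<^bsub>RR TT\<^esub> \<ominus>\<^bsub>RR TT\<^esub> h) \<oplus>\<^bsub>RR TT\<^esub> h = \<one>\<^bsub>RR TT\<^esub>" using h(1) by algebra
      then have "rest (str M) TT N' (\<one>\<^bsub>RR TT\<^esub> \<ominus>\<^bsub>RR TT\<^esub> h) \<oplus>\<^bsub>RR N'\<^esub> \<one>\<^bsub>RR N'\<^esub> = \<one>\<^bsub>RR N'\<^esub>"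
        using rest_plus[OF N'(1) m h(1)] 1 rest_TT_one[OF N'(1)] by simp
      then have "rest (str M) TT N' (\<one>\<^bsub>RR TT\<^esub> \<ominus>\<^bsub>RR TT\<^esub> h) = \<zero>\<^bsub>RR N'\<^esub>"
        using mN by (simp add: RN.add.r_cancel_one)
      then show ?thesis unfolding e using pN by simp
    qed
  qed
  show ?case
  proof (rule exI[of _ "(\<gamma>, ?h, A) # L"], rule exI[of _ ?p], intro conjI pin(1) tot)
    show "\<forall>(\<gamma>', h, A)\<in>set ((\<gamma>, ?h, A) # L). \<gamma>' \<in> fst ` set (b # bs) \<and> cutoff (U \<gamma>') h A"
      using L cut by (auto simp: b)
    show "\<forall>(\<gamma>, h, A, N)\<in>set (b # bs). rest (str M) TT N ?p = \<zero>\<^bsub>RR N\<^esub>"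
    proof clarify
      fix \<gamma>' h' A' N' assume i: "(\<gamma>', h', A', N') \<in> set (b # bs)"
      show "rest (str M) TT N' ?p = \<zero>\<^bsub>RR N'\<^esub>"
      proof (cases "(\<gamma>', h', A', N') \<in> set bs")
        case True
        have "opn N'" using Cons.prems[of \<gamma>' h' A' N'] i by simp
        then show ?thesis using z True by (intro zN) auto
      next
        case False
        then have "N' = N" using i b by auto
        then show ?thesis using zN[OF N(1)] N(2) by simp
      qed
    qed
  qed
qed

text \<open>The remainder is the zero section on a neighbourhood of \<open>K\<close>. Zero residues
  on \<open>K\<close> would not do, because an operator supported in \<open>K\<close> also sees
  derivatives and formal directions of its argument.\<close>

lemma cover_sections:
  fixes \<Gamma> :: "'g set" and U :: "'g \<Rightarrow> 'p set"
  assumes K: "compactin (base M) K" and U: "\<forall>\<gamma>\<in>\<Gamma>. opn (U \<gamma>)" "K \<subseteq> (\<Union>\<gamma>\<in>\<Gamma>. U \<gamma>)"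
  shows "\<exists>L p N. (\<forall>(\<gamma>, h, A)\<in>set L. \<gamma> \<in> \<Gamma> \<and> cutoff (U \<gamma>) h A) \<and> p \<in> carrier (RR TT) \<and>
     osum (map (fst \<circ> snd) L) \<oplus>\<^bsub>RR TT\<^esub> p = \<one>\<^bsub>RR TT\<^esub> \<and>
     opn N \<and> K \<subseteq> N \<and> rest (str M) TT N p = \<zero>\<^bsub>RR N\<^esub>"
proof -
  define good where "good q \<longleftrightarrow> (case q of (\<gamma>, h, A, N) \<Rightarrow> \<gamma> \<in> \<Gamma> \<and> cutoff (U \<gamma>) h A \<and> opn N \<and> rest (str M) TT N h = \<one>\<^bsub>RR N\<^esub>)"
    for q :: "'g \<times> 's \<times> 'p set \<times> 'p set"
  let ?N = "\<lambda>q :: 'g \<times> 's \<times> 'p set \<times> 'p set. snd (snd (snd q))"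
  have ex: "\<exists>q. good q \<and> a \<in> ?N q" if "a \<in> K" for a
  proof -
    obtain \<gamma> where g: "\<gamma> \<in> \<Gamma>" "a \<in> U \<gamma>" using U(2) \<open>a \<in> K\<close> by blast
    from bump_section[OF bspec[OF U(1) g(1)] g(2)] obtain h \<rho> A N where
      "h \<in> carrier (RR TT)" "compactin (base M) A" "A \<subseteq> U \<gamma>" "opn N" "a \<in> N" "N \<subseteq> A"
      "rest (str M) TT (TT - A) h = \<zero>\<^bsub>RR (TT - A)\<^esub>" "rest (str M) TT N h = \<one>\<^bsub>RR N\<^esub>"
      by (elim exE conjE) (rule that)
    then show ?thesis using g(1) by (intro exI[of _ "(\<gamma>, h, A, N)"]) (simp add: good_def cutoff_def)
  qed
  have "\<exists>\<F>. finite \<F> \<and> \<F> \<subseteq> ?N ` {q. good q} \<and> K \<subseteq> \<Union>\<F>"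
  proof (rule compactinD[OF K])
    show "opn V" if "V \<in> ?N ` {q. good q}" for V using that by (auto simp: good_def)
    show "K \<subseteq> \<Union>(?N ` {q. good q})" using ex by blast
  qed
  then obtain \<F> where F: "finite \<F>" "\<F> \<subseteq> ?N ` {q. good q}" "K \<subseteq> \<Union>\<F>" by (elim exE conjE) (rule that)
  from finite_subset_image[OF F(1,2)] obtain Q where Q': "Q \<subseteq> {q. good q}" "finite Q" "\<F> = ?N ` Q"
    by (elim exE conjE) (rule that)
  note Q = Q'(2,1) F(3)[unfolded Q'(3)]
  obtain bs where bs: "set bs = Q" using finite_list[OF Q(1)] by blast
  have good: "good q" if "q \<in> set bs" for q using that Q bs by auto
  have "\<exists>L p. (\<forall>(\<gamma>, h, A)\<in>set L. \<gamma> \<in> fst ` set bs \<and> cutoff (U \<gamma>) h A) \<and> p \<in> carrier (RR TT) \<and>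
     osum (map (fst \<circ> snd) L) \<oplus>\<^bsub>RR TT\<^esub> p = \<one>\<^bsub>RR TT\<^esub> \<and>
     (\<forall>(\<gamma>, h, A, N)\<in>set bs. rest (str M) TT N p = \<zero>\<^bsub>RR N\<^esub>)"
    by (rule cutoff_list) (use good in \<open>auto simp: good_def\<close>)
  then obtain L p where L: "\<forall>(\<gamma>, h, A)\<in>set L. \<gamma> \<in> fst ` set bs \<and> cutoff (U \<gamma>) h A" and p: "p \<in> carrier (RR TT)"
    and s: "osum (map (fst \<circ> snd) L) \<oplus>\<^bsub>RR TT\<^esub> p = \<one>\<^bsub>RR TT\<^esub>"
    and z: "\<forall>(\<gamma>, h, A, N)\<in>set bs. rest (str M) TT N p = \<zero>\<^bsub>RR N\<^esub>" by (elim exE conjE) (rule that)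
  let ?\<N> = "?N ` Q"
  have oN: "opn W" if "W \<in> ?\<N>" for W using that good bs by (auto simp: good_def)
  have oUN: "opn (\<Union>?\<N>)" using oN by blast
  have "rest (str M) TT (\<Union>?\<N>) p = \<zero>\<^bsub>RR (\<Union>?\<N>)\<^esub>"
  proof (rule is_sheaf_separated[OF sheafO oN rest_TT_in[OF oUN p] O_zero_in[OF oUN]])
    fix W assume W: "W \<in> ?\<N>"
    have WN: "W \<subseteq> \<Union>?\<N>" using W by blast
    have "rest (str M) (\<Union>?\<N>) W (rest (str M) TT (\<Union>?\<N>) p) = rest (str M) TT W p"
      by (rule O_rest(3)[OF openin_topspace oUN oN[OF W] WN openin_subset[OF oUN] p])
    also have "\<dots> = \<zero>\<^bsub>RR W\<^esub>" using W z bs by auto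
    also have "\<dots> = rest (str M) (\<Union>?\<N>) W \<zero>\<^bsub>RR (\<Union>?\<N>)\<^esub>"
      by (rule O_rest_zero[OF oUN oN[OF W] WN, symmetric])
    finally show "rest (str M) (\<Union>?\<N>) W (rest (str M) TT (\<Union>?\<N>) p) = rest (str M) (\<Union>?\<N>) W \<zero>\<^bsub>RR (\<Union>?\<N>)\<^esub>" .
  qed
  moreover have "\<forall>(\<gamma>, h, A)\<in>set L. \<gamma> \<in> \<Gamma> \<and> cutoff (U \<gamma>) h A"
    using L good by (fastforce simp: good_def)
  ultimately show ?thesis
    using p s oUN Q(3) by (intro exI[of _ L] exI[of _ p] exI[of _ "\<Union>?\<N>"] conjI)
qed

text \<open>Here residue 1 on \<open>K\<close> is enough: the section will multiply densities, on
  which the structure sheaf acts through residues. It is the sum of the cutoffs for the cover by the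
  single set \<open>V\<close>, indexed by \<open>unit\<close>.\<close>

lemma cutoff_one:
  assumes K: "compactin (base M) K" and V: "opn V" "K \<subseteq> V"
  shows "\<exists>g A. cutoff V g A \<and> (\<forall>a\<in>K. resv TT g a = 1)"
proof -
  have "\<exists>L p N. (\<forall>(\<gamma>, h, A)\<in>set L. \<gamma> \<in> {()} \<and> cutoff V h A) \<and> p \<in> carrier (RR TT) \<and>
     osum (map (fst \<circ> snd) L) \<oplus>\<^bsub>RR TT\<^esub> p = \<one>\<^bsub>RR TT\<^esub> \<and>
     opn N \<and> K \<subseteq> N \<and> rest (str M) TT N p = \<zero>\<^bsub>RR N\<^esub>"
    by (rule cover_sections[OF K]) (use V in auto)
  then obtain L :: "(unit \<times> 's \<times> 'p set) list" and p N where L: "\<forall>(\<gamma>, h, A)\<in>set L. \<gamma> \<in> {()} \<and> cutoff V h A" and p: "p \<in> carrier (RR TT)"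
    and s: "osum (map (fst \<circ> snd) L) \<oplus>\<^bsub>RR TT\<^esub> p = \<one>\<^bsub>RR TT\<^esub>"
    and N: "opn N" "K \<subseteq> N" "rest (str M) TT N p = \<zero>\<^bsub>RR N\<^esub>" by (elim exE conjE) (rule that)
  have L': "\<And>h A. (h, A) \<in> set (map snd L) \<Longrightarrow> cutoff V h A" using L by auto
  \<comment> \<open>Sums of cutoffs for the same \<open>V\<close> are cutoffs, the compact sets
    being united along the list.\<close>
  have "\<exists>A. cutoff V (osum (map fst L')) A" if "\<And>h A. (h, A) \<in> set L' \<Longrightarrow> cutoff V h A" for L' :: "('s \<times> 'p set) list"
    using that
  proof (induction L')
    case Nil
    have "cutoff V \<zero>\<^bsub>RR TT\<^esub> {}"
      using O_zero_in[OF openin_topspace] O_rest_zero[OF openin_topspace openin_topspace] by (simp add: cutoff_def)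
    then show ?case by auto
  next
    case (Cons x L')
    then obtain A where A: "cutoff V (osum (map fst L')) A" by auto
    obtain h B where x: "x = (h, B)" by (cases x)
    then have B: "cutoff V h B" using Cons.prems by simp
    have c: "compactin (base M) (A \<union> B)" using A B by (intro compactin_Un) (auto simp: cutoff_def)
    have oAB: "opn (TT - (A \<union> B))" using compactin_imp_closedin[OF T2 c] by blast
    have zero: "rest (str M) TT (TT - (A \<union> B)) y = \<zero>\<^bsub>RR (TT - (A \<union> B))\<^esub>" if y: "cutoff V y C" "C \<subseteq> A \<union> B" for y C
    proof -
      have oC: "opn (TT - C)" using y(1) compactin_imp_closedin[OF T2] unfolding cutoff_def by blast
      have sub: "TT - (A \<union> B) \<subseteq> TT - C" using y(2) by auto
      have "rest (str M) TT (TT - (A \<union> B)) y = rest (str M) (TT - C) (TT - (A \<union> B)) (rest (str M) TT (TT - C) y)"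
        using O_rest(3)[OF openin_topspace oC oAB sub Diff_subset, of y] y(1) by (simp add: cutoff_def)
      then show ?thesis using y(1) O_rest_zero[OF oC oAB sub] by (simp add: cutoff_def)
    qed
    interpret RA: cring "RR (TT - (A \<union> B))" by (rule cringO[OF oAB])
    interpret R: cring "RR TT" by (rule cringO[OF openin_topspace])
    have i: "h \<in> carrier (RR TT)" "osum (map fst L') \<in> carrier (RR TT)" using A B by (auto simp: cutoff_def)
    have "cutoff V (osum (map fst (x # L'))) (A \<union> B)"
      using A B c rest_plus[OF oAB i] zero[OF B] zero[OF A] i by (auto simp: cutoff_def x)
    then show ?case by blast
  qed
  from this[OF L'] obtain A where A: "cutoff V (osum (map fst (map snd L))) A" by blast
  let ?g = "osum (map fst (map snd L))"
  have g: "?g \<in> carrier (RR TT)" using A by (simp add: cutoff_def)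
  have "resv TT ?g a = 1" if a: "a \<in> K" for a
  proof -
    have aN: "a \<in> N" "a \<in> TT" using a N openin_subset[OF N(1)] by auto
    have "resv TT p a = 0"
      using resv_rest[OF openin_topspace aN(2) N(1) openin_subset[OF N(1)] aN(1) p] N(3) resv_zero[OF N(1) aN(1)] by simp
    then show ?thesis
      using resv_add[OF openin_topspace aN(2) g p] s resv_one[OF openin_topspace aN(2)] by simp
  qed
  then show ?thesis using A by blast
qed

end

context fmod begin

subsection \<open>Extension maps\<close>

lemma Diff_KrD:
  assumes D: "D \<in> Diff_Kr M V F DD K r" and V: "opn V" and K: "compactin (base M) K" "K \<subseteq> V"
  shows "D \<in> sheaf_homs M V F DD" "D \<in> diff_ops M V F DD" "zero_on M F DD (V - K) D" "order_le M V F DD r D"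
proof -
  note d = Diff_cD[OF Diff_Kr_imp[OF D]]
  show "D \<in> sheaf_homs M V F DD" "D \<in> diff_ops M V F DD" by (fact d)+
  show "order_le M V F DD r D" using D by (simp add: Diff_Kr_def)
  show "zero_on M F DD (V - K) D"
    by (rule FD.zero_on_subset[OF d(5)]) (use D in \<open>auto simp: Diff_Kr_def\<close>)
qed

lemma zext_value:
  assumes D: "D \<in> sheaf_homs M V F DD" "zero_on M F DD (V - K) D" and V: "opn V"
    and K: "compactin (base M) K" "K \<subseteq> V" and u: "u \<in> carrier (FF TT)"
  shows "FD.zext V K D TT u = D V (rest F TT V u)"
proof (intro ext)
  fix ch a
  have VT: "V \<subseteq> TT" "TT \<inter> V = V" using openin_subset[OF V] by auto
  note z = FD.zext[OF D(1) V compact_closed[OF K(1)] K(2) D(2) openin_topspace u, unfolded VT(2)]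
  have Dv: "D V (rest F TT V u) \<in> carrier (DEN V)"
    by (rule FD.homD(1)[OF D(1) V order_refl FD.F.F_rest(1)[OF openin_topspace V VT(1) u]])
  show "FD.zext V K D TT u ch a = D V (rest F TT V u) ch a"
  proof (cases "a \<in> V")
    case True
    then show ?thesis using fun_cong[OF fun_cong[OF z(2), of ch], of a] by (simp add: densities_simps)
  next
    case False
    then have "a \<notin> K" using K(2) by blast
    then have "FD.zext V K D TT u ch a = 0"
      using fun_cong[OF fun_cong[OF z(3), of ch], of a] den.off[OF z(1), of a] by (cases "a \<in> TT") (simp_all add: densities_simps)
    then show ?thesis using den.off[OF Dv False] by simp
  qed
qed

text \<open>Extending an operator by zero represents \<open>ext_map\<close> on formal densities, so
  that the continuity of \<open>ext_map\<close> can be proved on representing operators.\<close>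

lemma rho_zext:
  assumes D: "D \<in> sheaf_homs M V F DD" "zero_on M F DD (V - K) D" and V: "opn V"
    and K: "compactin (base M) K" "K \<subseteq> V"
  shows "\<rho> TT (FD.zext V K D) = ext_map M F TT V (\<rho> V D)"
proof
  fix u
  show "\<rho> TT (FD.zext V K D) u = ext_map M F TT V (\<rho> V D) u"
  proof (cases "u \<in> carrier (FF TT)")
    case True
    then show ?thesis
      using zext_value[OF assms True] FD.F.F_rest(1)[OF openin_topspace V openin_subset[OF V] True]
      by (simp add: rho_def ext_map_def)
  qed (simp add: rho_def ext_map_def)
qed

lemma ext_map_SS:
  assumes V: "opn V" and x: "\<eta> \<in> SS V"
  shows "ext_map M F TT V \<eta> \<in> SS TT"
proof -
  obtain D where D: "D \<in> Diff_c M V F DD" "\<eta> = \<rho> V D" using x unfolding Dc_carrier_def by blast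
  note d = Diff_cD[OF D(1)]
  let ?z = "FD.zext V (op_support M V F DD D) D"
  have "?z \<in> Diff_c M TT F DD" by (rule FD.zext_Diff_c(1)[OF d(2) V compact_closed[OF d(3)] d(3,4,5)])
  then show ?thesis unfolding Dc_carrier_def D(2) rho_zext[OF d(1,5) V d(3,4), symmetric] by blast
qed

lemma DR_zero_off:
  assumes X: "X \<in> sheaf_homs M TT DD (reduction M)" and K: "closedin (base M) K"
    and w: "\<omega> \<in> carrier (DEN TT)" and off: "\<And>ch a. a \<notin> K \<Longrightarrow> \<omega> ch a = 0" and a: "a \<notin> K"
  shows "X TT \<omega> a = 0"
proof (cases "a \<in> TT")
  case True
  have o: "opn (TT - K)" using K by blast
  have "rest DD TT (TT - K) \<omega> = \<zero>\<^bsub>DEN (TT - K)\<^esub>" using off by (intro ext) (simp add: densities_simps)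
  then have "rest (reduction M) TT (TT - K) (X TT \<omega>) = \<zero>\<^bsub>RED (TT - K)\<^esub>"
    using DR.homD(4)[OF X openin_topspace order_refl w o Diff_subset] DR.hom_zero[OF X o Diff_subset] by simp
  from fun_cong[OF this, of a] show ?thesis using True a by (simp add: reduction_simps)
next
  case False
  then show ?thesis by (rule RED_off[OF DR.homD(1)[OF X openin_topspace order_refl w]])
qed

lemma DR_restrict:
  assumes X: "X \<in> sheaf_homs M TT DD (reduction M)" and V: "opn V"
    and w: "\<omega> \<in> carrier (DEN TT)" "\<omega> \<in> carrier (DEN V)" and a: "a \<in> V"
  shows "X TT \<omega> a = X V \<omega> a"
proof -
  have "rest DD TT V \<omega> = \<omega>" using den.off[OF w(2)] by (intro ext) (simp add: densities_simps)
  then have "rest (reduction M) TT V (X TT \<omega>) = X V \<omega>"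
    using DR.homD(4)[OF X openin_topspace order_refl w(1) V openin_subset[OF V]] by simp
  from fun_cong[OF this, of a] show ?thesis using a by (simp add: reduction_simps)
qed

text \<open>A seminorm on the whole space is given by \<open>X\<close> and \<open>u\<close>. Over
  \<open>V\<close> the operator \<open>X\<close> has to be cut off in order to have compact support
  there, which \<open>DR.mulres g V X\<close> achieves. Since \<open>g\<close> has residue 1 on
  \<open>K\<close>, the values on densities supported in \<open>K\<close> are unchanged.\<close>

lemma continuous_zext:
  assumes V: "opn V" and K: "compactin (base M) K" "K \<subseteq> V"
  shows "continuous_map (Diff_Kr_topology M F V K r) (Diff_Kr_topology M F TT K r) (FD.zext V K)"
proof (rule continuous_map_Diff_Kr[OF V openin_topspace])
  fix D assume D: "D \<in> Diff_Kr M V F DD K r"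
  note d = Diff_KrD[OF D V K]
  show "FD.zext V K D \<in> Diff_Kr M TT F DD K r"
    using FD.zext_Diff_c[OF d(2) V compact_closed[OF K(1)] K d(3)] d(4) by (simp add: Diff_Kr_def)
next
  fix X u assume X: "X \<in> Diff_c M TT DD (reduction M)" and u: "u \<in> carrier (FF TT)"
  note x = DR_Diff_cD[OF X]
  obtain g A where g: "cutoff V g A" "\<And>a. a \<in> K \<Longrightarrow> resv TT g a = 1"
    using cutoff_one[OF K(1) V K(2)] by blast
  have gT: "g \<in> carrier (RR TT)" and A: "compactin (base M) A" "A \<subseteq> V" "rest (str M) TT (TT - A) g = \<zero>\<^bsub>RR (TT - A)\<^esub>"
    using g(1) by (auto simp: cutoff_def)
  let ?X = "DR.mulres g V X" and ?u = "rest F TT V u"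
  have VT: "V \<subseteq> TT" by (rule openin_subset[OF V])
  have X': "?X \<in> Diff_c M V DD (reduction M)"
    by (rule DR.mulres_Diff_c(1)[OF gT x(2) V compact_closed[OF A(1)] A])
  have u': "?u \<in> carrier (FF V)" by (rule FD.F.F_rest(1)[OF openin_topspace V VT u])
  have "diff_seminorm M TT X u (FD.zext V K D2 - FD.zext V K D1) = diff_seminorm M V ?X ?u (D2 - D1)"
    if D: "D1 \<in> Diff_Kr M V F DD K r" "D2 \<in> Diff_Kr M V F DD K r" for D1 D2
  proof -
    note d1 = Diff_KrD[OF D(1) V K] and d2 = Diff_KrD[OF D(2) V K]
    define \<sigma> where "\<sigma> = D2 V ?u - D1 V ?u"
    have \<sigma>V: "\<sigma> \<in> carrier (DEN V)" unfolding \<sigma>_def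
      by (intro DEN_diff V FD.homD(1)[OF d1(1) V order_refl u'] FD.homD(1)[OF d2(1) V order_refl u'])
    have off: "\<sigma> ch a = 0" if "a \<notin> K" for ch a
      using value_off[OF d1(1) V compact_closed[OF K(1)] d1(3) u', of a ch]
        value_off[OF d2(1) V compact_closed[OF K(1)] d2(3) u', of a ch] that by (simp add: \<sigma>_def)
    have \<sigma>T: "\<sigma> \<in> carrier (DEN TT)" by (rule DEN_extend[OF V compact_closed[OF K(1)] K(2) \<sigma>V off])
    have z: "(FD.zext V K D2 - FD.zext V K D1) TT u = \<sigma>"
      by (simp add: \<sigma>_def zext_value[OF d1(1,3) V K u] zext_value[OF d2(1,3) V K u])
    have m: "(D2 - D1) V ?u = \<sigma>" by (simp add: \<sigma>_def)
    have gs: "rest (str M) TT V g \<odot>\<^bsub>DEN V\<^esub> \<sigma> = \<sigma>"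
    proof (intro ext)
      fix ch a
      show "(rest (str M) TT V g \<odot>\<^bsub>DEN V\<^esub> \<sigma>) ch a = \<sigma> ch a"
      proof (cases "a \<in> K")
        case True
        then have aV: "a \<in> V" "a \<in> TT" using K(2) VT by auto
        show ?thesis using resv_rest[OF openin_topspace aV(2) V VT aV(1) gT] g(2)[OF True] by (simp add: densities_simps)
      qed (simp add: off densities_simps)
    qed
    have XV: "?X V \<sigma> = X V \<sigma>" using V \<sigma>V gs by (simp add: DR.mulres_def)
    have XVin: "X V \<sigma> \<in> carrier (RED V)" by (rule DR.homD(1)[OF x(1) V VT \<sigma>V])
    have e: "X TT \<sigma> a = X V \<sigma> a" for a
    proof (cases "a \<in> V")
      case False
      then have "a \<notin> K" using K(2) by auto
      then show ?thesis using DR_zero_off[OF x(1) compact_closed[OF K(1)] \<sigma>T off, of a] RED_off[OF XVin False] by simp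
    qed (rule DR_restrict[OF x(1) V \<sigma>T \<sigma>V])
    show ?thesis
      by (rule seminorm_eq; unfold z m) (use e XV RED_off[OF XVin] VT in auto)
  qed
  then show "\<exists>X' u'. X' \<in> Diff_c M V DD (reduction M) \<and> u' \<in> carrier (FF V) \<and>
         (\<forall>D1\<in>Diff_Kr M V F DD K r. \<forall>D2\<in>Diff_Kr M V F DD K r.
            diff_seminorm M TT X u (FD.zext V K D2 - FD.zext V K D1) = diff_seminorm M V X' u' (D2 - D1))"
    using X' u' by (intro exI[of _ ?X] exI[of _ ?u] conjI ballI)
qed

lemma topspace_D_Kr: "topspace (D_Kr M F V (K, r)) = \<rho> V ` Diff_Kr M V F DD K r"
  by (simp add: D_Kr_def Diff_Kr_topology_def)

lemma topspace_D_Kr_subset: "topspace (D_Kr M F V i) \<subseteq> SS V"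
  by (cases i) (auto simp: topspace_D_Kr Dc_carrier_def dest: Diff_Kr_imp)

lemma topspace_Dc: "topspace (Dc M F V) = SS V"
  by (simp add: Dc_def)

lemma continuous_map_D_KrI:
  assumes "continuous_map (Diff_Kr_topology M F V K r) (Diff_Kr_topology M F V' K' r) L"
    and eq: "\<And>D. D \<in> Diff_Kr M V F DD K r \<Longrightarrow> f (\<rho> V D) = \<rho> V' (L D)"
  shows "continuous_map (D_Kr M F V (K, r)) (D_Kr M F V' (K', r)) f"
  unfolding D_Kr_def prod.case
proof (rule continuous_map_from_quotient_topology)
  have "continuous_map (Diff_Kr_topology M F V K r) (quotient_topology (Diff_Kr_topology M F V' K' r) (\<rho> V')) (\<rho> V' \<circ> L)"
    by (rule continuous_map_compose[OF assms(1) continuous_map_quotient_topology])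
  then show "continuous_map (Diff_Kr_topology M F V K r) (quotient_topology (Diff_Kr_topology M F V' K' r) (\<rho> V')) (f \<circ> \<rho> V)"
    by (rule continuous_map_eq) (simp add: Diff_Kr_topology_def eq)
qed

text \<open>The step \<open>(K, r)\<close> over \<open>V\<close> is sent to the step with the same
  index over the whole space.\<close>

lemma continuous_ext_map:
  assumes V: "opn V"
  shows "continuous_map (Dc M F V) (Dc M F TT) (ext_map M F TT V)"
  unfolding Dc_def
proof (rule continuous_map_lcs_ind_lim_lcs_ind_lim[OF vector_space_fscale SS_subspace[OF V]])
  show "ext_map M F TT V \<in> SS V \<rightarrow> SS TT" using ext_map_SS[OF V] by blast
  fix i assume i: "i \<in> C_index M V"
  show "topspace (D_Kr M F V i) \<subseteq> SS V" by (rule topspace_D_Kr_subset)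
  obtain K r where Kr: "i = (K, r)" by (cases i)
  have K: "compactin (base M) K" "K \<subseteq> V" using i by (auto simp: Kr C_index_def)
  have "continuous_map (D_Kr M F V (K, r)) (D_Kr M F TT (K, r)) (ext_map M F TT V)"
  proof (rule continuous_map_D_KrI[OF continuous_zext[OF V K]])
    fix D assume "D \<in> Diff_Kr M V F DD K r"
    note d = Diff_KrD[OF this V K]
    show "ext_map M F TT V (\<rho> V D) = \<rho> TT (FD.zext V K D)" by (rule rho_zext[OF d(1,3) V K, symmetric])
  qed
  moreover have "(K, r) \<in> C_index M TT" using K openin_subset[OF V] by (auto simp: C_index_def)
  ultimately show "\<exists>j\<in>C_index M TT. continuous_map (D_Kr M F V i) (D_Kr M F TT j) (ext_map M F TT V)"
    unfolding Kr by blast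
qed (auto simp: ext_map_def fscale_def fun_eq_iff)

subsection \<open>Cutting off a formal density\<close>

text \<open>The functional \<open>\<eta>(h u)\<close> for sections \<open>u\<close> over
  \<open>V\<close> only: the product with \<open>h\<close> is extended by zero before
  \<open>\<eta>\<close> is applied. No representing operator enters, so the result depends on
  \<open>\<eta>\<close> alone.\<close>

definition cut :: "'s \<Rightarrow> 'p set \<Rightarrow> 'p set \<Rightarrow> ('f \<Rightarrow> complex) \<Rightarrow> 'f \<Rightarrow> complex" where
  "cut h A V \<eta> = (\<lambda>u. if u \<in> carrier (FF V) then \<eta> (FD.F.ext0 TT V A (rest (str M) TT V h \<odot>\<^bsub>FF V\<^esub> u)) else 0)"

context
  fixes h A V assumes h: "cutoff V h A" and V: "opn V"
begin

lemma hA: "h \<in> carrier (RR TT)" "compactin (base M) A" "A \<subseteq> V" "closedin (base M) A"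
    "rest (str M) TT (TT - A) h = \<zero>\<^bsub>RR (TT - A)\<^esub>" "opn (TT - A)" "V \<subseteq> TT" "TT \<inter> V = V"
  using h compact_closed openin_subset[OF V] by (auto simp: cutoff_def)

abbreviation "hV \<equiv> rest (str M) TT V h"

lemma hV: "hV \<in> carrier (RR V)" by (rule rest_TT_in[OF V hA(1)])

lemma hV_zero: "rest (str M) V (V - A) hV = \<zero>\<^bsub>RR (V - A)\<^esub>"
proof -
  have o: "opn (V - A)" by (rule openin_diff[OF V hA(4)])
  have "rest (str M) V (V - A) hV = rest (str M) (TT - A) (V - A) (rest (str M) TT (TT - A) h)"
    using O_rest(3)[OF openin_topspace V o Diff_subset hA(7) hA(1)]
      O_rest(3)[OF openin_topspace hA(6) o Diff_mono[OF hA(7) order_refl] Diff_subset hA(1)] by simp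
  also have "\<dots> = \<zero>\<^bsub>RR (V - A)\<^esub>"
    unfolding hA(5) by (rule O_rest_zero[OF hA(6) o]) (use hA(7) in auto)
  finally show ?thesis .
qed

lemma cut_section:
  assumes u: "u \<in> carrier (FF V)"
  shows "FD.F.ext0 TT V A (hV \<odot>\<^bsub>FF V\<^esub> u) \<in> carrier (FF TT)"
    "rest F TT V (FD.F.ext0 TT V A (hV \<odot>\<^bsub>FF V\<^esub> u)) = hV \<odot>\<^bsub>FF V\<^esub> u"
    "rest F TT (TT - A) (FD.F.ext0 TT V A (hV \<odot>\<^bsub>FF V\<^esub> u)) = \<zero>\<^bsub>FF (TT - A)\<^esub>"
proof -
  have o: "opn (V - A)" by (rule openin_diff[OF V hA(4)])
  have i: "hV \<odot>\<^bsub>FF V\<^esub> u \<in> carrier (FF V)" by (rule FD.F.F_smult_in[OF V hV u])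
  have z: "rest F V (V - A) (hV \<odot>\<^bsub>FF V\<^esub> u) = \<zero>\<^bsub>FF (V - A)\<^esub>"
    unfolding FD.F.F_rest_smult[OF V o Diff_subset hV u] hV_zero
    by (rule FD.F.F_smult_zero[OF o FD.F.F_rest(1)[OF V o Diff_subset u]])
  note E = FD.F.ext0[OF openin_topspace V hA(4,3), unfolded hA(8), OF i z]
  show "FD.F.ext0 TT V A (hV \<odot>\<^bsub>FF V\<^esub> u) \<in> carrier (FF TT)"
    "rest F TT V (FD.F.ext0 TT V A (hV \<odot>\<^bsub>FF V\<^esub> u)) = hV \<odot>\<^bsub>FF V\<^esub> u"
    "rest F TT (TT - A) (FD.F.ext0 TT V A (hV \<odot>\<^bsub>FF V\<^esub> u)) = \<zero>\<^bsub>FF (TT - A)\<^esub>" by (fact E)+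
qed

lemma cut_value:
  assumes D: "D \<in> sheaf_homs M TT F DD" and u: "u \<in> carrier (FF V)"
  shows "D TT (FD.F.ext0 TT V A (hV \<odot>\<^bsub>FF V\<^esub> u)) = FD.mulres h V D V u"
proof (intro ext)
  fix ch a
  let ?w = "FD.F.ext0 TT V A (hV \<odot>\<^bsub>FF V\<^esub> u)"
  note w = cut_section[OF u]
  have m: "FD.mulres h V D V u = D V (hV \<odot>\<^bsub>FF V\<^esub> u)" using V u by (simp add: FD.mulres_def)
  have i: "hV \<odot>\<^bsub>FF V\<^esub> u \<in> carrier (FF V)" by (rule FD.F.F_smult_in[OF V hV u])
  have 1: "rest DD TT V (D TT ?w) = D V (hV \<odot>\<^bsub>FF V\<^esub> u)"
    using FD.homD(4)[OF D openin_topspace order_refl w(1) V hA(7)] w(2) by simp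
  have 2: "rest DD TT (TT - A) (D TT ?w) = \<zero>\<^bsub>DEN (TT - A)\<^esub>"
    using FD.homD(4)[OF D openin_topspace order_refl w(1) hA(6) Diff_subset] w(3) FD.hom_zero[OF D hA(6) Diff_subset] by simp
  have Dw: "D TT ?w \<in> carrier (DEN TT)" by (rule FD.homD(1)[OF D openin_topspace order_refl w(1)])
  have Dv: "D V (hV \<odot>\<^bsub>FF V\<^esub> u) \<in> carrier (DEN V)" by (rule FD.homD(1)[OF D V hA(7) i])
  show "D TT ?w ch a = FD.mulres h V D V u ch a"
  proof (cases "a \<in> V")
    case True
    then show ?thesis using fun_cong[OF fun_cong[OF 1, of ch], of a] m by (simp add: densities_simps)
  next
    case False
    then have "a \<notin> A" using hA(3) by blast
    then have "D TT ?w ch a = 0"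
      using fun_cong[OF fun_cong[OF 2, of ch], of a] den.off[OF Dw, of a] by (cases "a \<in> TT") (simp_all add: densities_simps)
    then show ?thesis using den.off[OF Dv False] m by simp
  qed
qed

lemma cut_rho:
  assumes D: "D \<in> sheaf_homs M TT F DD"
  shows "cut h A V (\<rho> TT D) = \<rho> V (FD.mulres h V D)"
proof
  fix u
  show "cut h A V (\<rho> TT D) u = \<rho> V (FD.mulres h V D) u"
  proof (cases "u \<in> carrier (FF V)")
    case True
    then show ?thesis using cut_value[OF D True] cut_section(1)[OF True] by (simp add: cut_def rho_def)
  qed (simp add: cut_def rho_def)
qed

lemma cut_SS: assumes "\<eta> \<in> SS TT" shows "cut h A V \<eta> \<in> SS V"
proof -
  obtain D where D: "D \<in> Diff_c M TT F DD" "\<eta> = \<rho> TT D" using assms unfolding Dc_carrier_def by blast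
  have "FD.mulres h V D \<in> Diff_c M V F DD"
    by (rule FD.mulres_Diff_c(1)[OF hA(1) Diff_cD(2)[OF D(1)] V hA(4,2,3,5)])
  then show ?thesis unfolding D(2) cut_rho[OF Diff_cD(1)[OF D(1)]] Dc_carrier_def by blast
qed

text \<open>The translation opposite to that of \<open>continuous_zext\<close>: \<open>X\<close> has
  compact support in \<open>V\<close> and extends by zero to the whole space, while \<open>u\<close>
  is replaced by the zero extension of \<open>h u\<close>. The support of the result lies in
  \<open>A\<close>, whatever \<open>K\<close> was, because \<open>K\<close> need not lie in
  \<open>V\<close>.\<close>

lemma continuous_mulres:
  assumes K: "compactin (base M) K"
  shows "continuous_map (Diff_Kr_topology M F TT K r) (Diff_Kr_topology M F V A r) (FD.mulres h V)"
proof (rule continuous_map_Diff_Kr[OF openin_topspace V])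
  note KT = compactin_subset_topspace[OF K]
  fix D assume D: "D \<in> Diff_Kr M TT F DD K r"
  note d = Diff_KrD[OF D openin_topspace K KT]
  show "FD.mulres h V D \<in> Diff_Kr M V F DD A r"
    using FD.mulres_Diff_c[OF hA(1) d(2) V hA(4,2,3,5)] FD.mulres_order[OF hA(1) d(4) hA(7) order_refl]
    by (simp add: Diff_Kr_def)
next
  note KT = compactin_subset_topspace[OF K]
  fix X u assume X: "X \<in> Diff_c M V DD (reduction M)" and u: "u \<in> carrier (FF V)"
  note x = DR_Diff_cD[OF X]
  let ?C = "op_support M V DD (reduction M) X" and ?w = "FD.F.ext0 TT V A (hV \<odot>\<^bsub>FF V\<^esub> u)"
  let ?X = "DR.zext V ?C X"
  note w = cut_section[OF u]
  note C = compact_closed[OF x(3)] x(3,4)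
  have X': "?X \<in> Diff_c M TT DD (reduction M)" by (rule DR.zext_Diff_c(1)[OF x(2) V C x(5)])
  have "diff_seminorm M V X u (FD.mulres h V D2 - FD.mulres h V D1) = diff_seminorm M TT ?X ?w (D2 - D1)"
    if D: "D1 \<in> Diff_Kr M TT F DD K r" "D2 \<in> Diff_Kr M TT F DD K r" for D1 D2
  proof -
    note d1 = Diff_KrD[OF D(1) openin_topspace K KT] and d2 = Diff_KrD[OF D(2) openin_topspace K KT]
    define \<sigma> where "\<sigma> = FD.mulres h V D2 V u - FD.mulres h V D1 V u"
    have s: "(D2 - D1) TT ?w = \<sigma>" "(FD.mulres h V D2 - FD.mulres h V D1) V u = \<sigma>"
      by (simp_all add: \<sigma>_def cut_value[OF d1(1) u] cut_value[OF d2(1) u])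
    have \<sigma>V: "\<sigma> \<in> carrier (DEN V)" unfolding \<sigma>_def
      by (intro DEN_diff V FD.homD(1)[OF FD.mulres_hom[OF hA(1) d1(1) V] V order_refl u]
          FD.homD(1)[OF FD.mulres_hom[OF hA(1) d2(1) V] V order_refl u])
    have \<sigma>T: "\<sigma> \<in> carrier (DEN TT)"
      unfolding s(1)[symmetric] minus_apply[of D2 D1 TT] minus_apply[of "D2 TT" "D1 TT"]
      by (intro DEN_diff openin_topspace FD.homD(1)[OF d1(1) openin_topspace order_refl w(1)]
          FD.homD(1)[OF d2(1) openin_topspace order_refl w(1)])
    note z = DR.zext[OF x(1) V C(1,3) x(5) openin_topspace \<sigma>T, unfolded hA(8)]
    have r: "rest DD TT V \<sigma> = \<sigma>" using den.off[OF \<sigma>V] by (intro ext) (simp add: densities_simps)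
    have XVin: "X V \<sigma> \<in> carrier (RED V)" by (rule DR.homD(1)[OF x(1) V order_refl \<sigma>V])
    have e: "X V \<sigma> a = ?X TT \<sigma> a" for a
    proof (cases "a \<in> V")
      case True
      then show ?thesis using fun_cong[OF z(2), of a] by (simp add: r reduction_simps)
    next
      case False
      then have "a \<notin> ?C" using C(3) by blast
      then have "?X TT \<sigma> a = 0"
        using fun_cong[OF z(3), of a] RED_off[OF z(1), of a] by (cases "a \<in> TT") (simp_all add: reduction_simps)
      then show ?thesis using RED_off[OF XVin False] by simp
    qed
    show ?thesis
      by (rule seminorm_eq; unfold s) (use e RED_off[OF XVin] hA(7) in auto)
  qed
  then show "\<exists>X' u'. X' \<in> Diff_c M TT DD (reduction M) \<and> u' \<in> carrier (FF TT) \<and>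
         (\<forall>D1\<in>Diff_Kr M TT F DD K r. \<forall>D2\<in>Diff_Kr M TT F DD K r.
            diff_seminorm M V X u (FD.mulres h V D2 - FD.mulres h V D1) = diff_seminorm M TT X' u' (D2 - D1))"
    using X' w(1) by (intro exI[of _ ?X] exI[of _ ?w] conjI ballI)
qed

lemma continuous_cut:
  assumes i: "i \<in> C_index M TT"
  shows "continuous_map (D_Kr M F TT i) (Dc M F V) (cut h A V)"
proof -
  obtain K r where Kr: "i = (K, r)" by (cases i)
  have K: "compactin (base M) K" using i by (auto simp: Kr C_index_def)
  have "continuous_map (D_Kr M F TT (K, r)) (D_Kr M F V (A, r)) (cut h A V)"
  proof (rule continuous_map_D_KrI[OF continuous_mulres[OF K]])
    fix D assume "D \<in> Diff_Kr M TT F DD K r"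
    then show "cut h A V (\<rho> TT D) = \<rho> V (FD.mulres h V D)" by (intro cut_rho Diff_cD(1)[OF Diff_Kr_imp])
  qed
  moreover have "continuous_map (D_Kr M F V (A, r)) (Dc M F V) (\<lambda>x. x)"
    unfolding Dc_def
  proof (rule continuous_map_inclusion_lcs_ind_lim)
    show "(A, r) \<in> C_index M V" using hA by (simp add: C_index_def)
    show "topspace (D_Kr M F V (A, r)) \<subseteq> SS V" by (rule topspace_D_Kr_subset)
  qed
  ultimately have "continuous_map (D_Kr M F TT (K, r)) (Dc M F V) ((\<lambda>x. x) \<circ> cut h A V)"
    by (rule continuous_map_compose)
  then show ?thesis by (simp add: Kr o_def)
qed

text \<open>The section \<open>h\<close> vanishes off \<open>A\<close>, so the zero extension of
  \<open>h\<close> times the restriction of \<open>u\<close> is \<open>h u\<close> itself. Cutting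
  off and extending back is thus multiplication by \<open>h\<close>.\<close>

lemma ext_cut:
  "ext_map M F TT V (cut h A V \<eta>) = (\<lambda>u. if u \<in> carrier (FF TT) then \<eta> (h \<odot>\<^bsub>FF TT\<^esub> u) else 0)"
proof
  fix u
  show "ext_map M F TT V (cut h A V \<eta>) u = (if u \<in> carrier (FF TT) then \<eta> (h \<odot>\<^bsub>FF TT\<^esub> u) else 0)"
  proof (cases "u \<in> carrier (FF TT)")
    case True
    have uV: "rest F TT V u \<in> carrier (FF V)" by (rule FD.F.F_rest(1)[OF openin_topspace V hA(7) True])
    have hu: "h \<odot>\<^bsub>FF TT\<^esub> u \<in> carrier (FF TT)" by (rule FD.F.F_smult_in[OF openin_topspace hA(1) True])
    note w = cut_section[OF uV]
    have "FD.F.ext0 TT V A (hV \<odot>\<^bsub>FF V\<^esub> rest F TT V u) = h \<odot>\<^bsub>FF TT\<^esub> u"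
    proof (rule FD.F.ext0_unique[OF openin_topspace V hA(4,3) w(1) hu])
      show "rest F TT (TT \<inter> V) (FD.F.ext0 TT V A (hV \<odot>\<^bsub>FF V\<^esub> rest F TT V u)) = rest F TT (TT \<inter> V) (h \<odot>\<^bsub>FF TT\<^esub> u)"
        unfolding hA(8) w(2) FD.F.F_rest_smult[OF openin_topspace V hA(7) hA(1) True] ..
      have "rest F TT (TT - A) (h \<odot>\<^bsub>FF TT\<^esub> u) = \<zero>\<^bsub>FF (TT - A)\<^esub>"
        unfolding FD.F.F_rest_smult[OF openin_topspace hA(6) Diff_subset hA(1) True] hA(5)
        by (rule FD.F.F_smult_zero[OF hA(6) FD.F.F_rest(1)[OF openin_topspace hA(6) Diff_subset True]])
      then show "rest F TT (TT - A) (FD.F.ext0 TT V A (hV \<odot>\<^bsub>FF V\<^esub> rest F TT V u)) = rest F TT (TT - A) (h \<odot>\<^bsub>FF TT\<^esub> u)"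
        using w(3) by simp
    qed
    then show ?thesis using True uV by (simp add: ext_map_def cut_def)
  qed (simp add: ext_map_def)
qed

end

section \<open>Splitting a density and assembling the pieces\<close>

lemma SS_osum:
  assumes x: "x \<in> SS TT" and u: "u \<in> carrier (FF TT)" and hs: "set hs \<subseteq> carrier (RR TT)"
  shows "x (osum hs \<odot>\<^bsub>FF TT\<^esub> u) = (\<Sum>h\<leftarrow>hs. x (h \<odot>\<^bsub>FF TT\<^esub> u))"
  using hs
proof (induction hs)
  case Nil
  have z: "\<zero>\<^bsub>FF TT\<^esub> \<in> carrier (FF TT)" by (rule FD.F.F_zero_in[OF openin_topspace])
  have "x \<zero>\<^bsub>FF TT\<^esub> = x \<zero>\<^bsub>FF TT\<^esub> + x \<zero>\<^bsub>FF TT\<^esub>"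
    using SS_additive[OF x z z] FD.F.F_add_zero[OF openin_topspace z] by simp
  then show ?case using FD.F.F_smult_zero[OF openin_topspace u] by simp
next
  case (Cons h hs)
  then have h: "h \<in> carrier (RR TT)" and os: "osum hs \<in> carrier (RR TT)" by (auto intro: osum_in)
  have "osum (h # hs) \<odot>\<^bsub>FF TT\<^esub> u = h \<odot>\<^bsub>FF TT\<^esub> u \<oplus>\<^bsub>FF TT\<^esub> osum hs \<odot>\<^bsub>FF TT\<^esub> u"
    using FD.F.F_add_smult[OF openin_topspace h os u] by simp
  then show ?case
    using SS_additive[OF x FD.F.F_smult_in[OF openin_topspace h u] FD.F.F_smult_in[OF openin_topspace os u]] Cons by simp
qed

lemma sum_list_apply: "sum_list fs u = (\<Sum>f\<leftarrow>fs. f u)" for fs :: "('x \<Rightarrow> complex) list"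
  by (induction fs) auto

text \<open>By \<open>ext_cut\<close> the sum of the extended pieces, evaluated at \<open>u\<close>,
  is the value of the density at the sum of the \<open>h u\<close>. This differs from
  \<open>u\<close> by \<open>p u\<close>, which the density does not see.\<close>

lemma cut_sum:
  assumes D: "D \<in> sheaf_homs M TT F DD" "D \<in> Diff_c M TT F DD" and z: "zero_on M F DD (TT - K) D" and K: "compactin (base M) K"
    and L: "\<forall>(\<gamma>, h, A)\<in>set L. cutoff (U \<gamma>) h A \<and> opn (U \<gamma>)" and p: "p \<in> carrier (RR TT)"
    and s: "osum (map (fst \<circ> snd) L) \<oplus>\<^bsub>RR TT\<^esub> p = \<one>\<^bsub>RR TT\<^esub>"
    and N: "opn N" "K \<subseteq> N" "rest (str M) TT N p = \<zero>\<^bsub>RR N\<^esub>"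
  shows "(\<Sum>(\<gamma>, h, A)\<leftarrow>L. ext_map M F TT (U \<gamma>) (cut h A (U \<gamma>) (\<rho> TT D))) = \<rho> TT D"
proof
  fix u
  let ?x = "\<rho> TT D"
  have x: "?x \<in> SS TT" unfolding Dc_carrier_def using D(2) by blast
  have e: "(\<Sum>(\<gamma>, h, A)\<leftarrow>L. ext_map M F TT (U \<gamma>) (cut h A (U \<gamma>) ?x)) u =
      (\<Sum>h\<leftarrow>map (fst \<circ> snd) L. if u \<in> carrier (FF TT) then ?x (h \<odot>\<^bsub>FF TT\<^esub> u) else 0)"
    unfolding sum_list_apply map_map
    by (rule arg_cong[where f=sum_list], rule map_cong[OF refl]) (use L ext_cut in \<open>fastforce simp: o_def\<close>)
  show "(\<Sum>(\<gamma>, h, A)\<leftarrow>L. ext_map M F TT (U \<gamma>) (cut h A (U \<gamma>) ?x)) u = ?x u"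
  proof (cases "u \<in> carrier (FF TT)")
    case False
    then show ?thesis unfolding e by (simp add: rho_def map_replicate_const sum_list_replicate)
  next
    case True
    have hs: "set (map (fst \<circ> snd) L) \<subseteq> carrier (RR TT)" using L by (auto simp: cutoff_def)
    note os = osum_in[OF hs]
    have pu: "p \<odot>\<^bsub>FF TT\<^esub> u \<in> carrier (FF TT)" by (rule FD.F.F_smult_in[OF openin_topspace p True])
    have su: "osum (map (fst \<circ> snd) L) \<odot>\<^bsub>FF TT\<^esub> u \<in> carrier (FF TT)" by (rule FD.F.F_smult_in[OF openin_topspace os True])
    have "u = osum (map (fst \<circ> snd) L) \<odot>\<^bsub>FF TT\<^esub> u \<oplus>\<^bsub>FF TT\<^esub> p \<odot>\<^bsub>FF TT\<^esub> u"
      using FD.F.F_add_smult[OF openin_topspace os p True] s FD.F.F_smult_one[OF openin_topspace True] by simp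
    then have 1: "?x u = ?x (osum (map (fst \<circ> snd) L) \<odot>\<^bsub>FF TT\<^esub> u) + ?x (p \<odot>\<^bsub>FF TT\<^esub> u)"
      using SS_additive[OF x su pu] by simp
    \<comment> \<open>\<open>N\<close> and the complement of \<open>K\<close> together cover the
      space: on the former \<open>p u\<close> is zero, on the latter \<open>D\<close> has no values
      other than zero.\<close>
    have "D TT (p \<odot>\<^bsub>FF TT\<^esub> u) = (\<lambda>ch a. 0)"
    proof (intro ext)
      fix ch a
      show "D TT (p \<odot>\<^bsub>FF TT\<^esub> u) ch a = 0"
      proof (cases "a \<in> K")
        case False
        then show ?thesis by (intro value_off[OF D(1) openin_topspace compact_closed[OF K] z pu]) auto
      next
        case True': True
        have NT: "N \<subseteq> TT" by (rule openin_subset[OF N(1)])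
        have "rest F TT N (p \<odot>\<^bsub>FF TT\<^esub> u) = \<zero>\<^bsub>FF N\<^esub>"
          unfolding FD.F.F_rest_smult[OF openin_topspace N(1) NT p True] N(3)
          by (rule FD.F.F_smult_zero[OF N(1) FD.F.F_rest(1)[OF openin_topspace N(1) NT True]])
        then have "rest DD TT N (D TT (p \<odot>\<^bsub>FF TT\<^esub> u)) = \<zero>\<^bsub>DEN N\<^esub>"
          using FD.homD(4)[OF D(1) openin_topspace order_refl pu N(1) NT] FD.hom_zero[OF D(1) N(1) NT] by simp
        from fun_cong[OF fun_cong[OF this, of ch], of a] show ?thesis using True' N(2) by (auto simp: densities_simps)
      qed
    qed
    then have "?x (p \<odot>\<^bsub>FF TT\<^esub> u) = 0" using pu by (simp add: rho_def density_integral_zero)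
    then show ?thesis unfolding e using 1 SS_osum[OF x True hs] True by simp
  qed
qed

end

lemma (in fmod) decomposable:
  assumes E: "lcs sE E" "Hausdorff_space E"
    and U: "\<And>\<gamma>. \<gamma> \<in> \<Gamma> \<Longrightarrow> opn (U \<gamma>)" "(\<Union>\<gamma>\<in>\<Gamma>. U \<gamma>) = TT"
    and reg: "\<And>B. lcs_bounded fscale (Dc M F TT) B \<Longrightarrow> \<exists>i\<in>C_index M TT. lcs_bounded fscale (D_Kr M F TT i) B"
  shows "decomposable_ind_lim fscale (SS TT) (C_index M TT) (D_Kr M F TT) \<Gamma> (\<lambda>\<gamma>. Dc M F (U \<gamma>))
     (\<lambda>\<gamma>. ext_map M F TT (U \<gamma>)) sE E"
proof (rule decomposable_ind_lim.intro)
  note T = openin_topspace[of "base M"]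
  show "vector_space fscale" by (rule vector_space_fscale)
  show "Modules.module.subspace fscale (SS TT)" by (rule SS_subspace[OF T])
  show "lcs sE E" "Hausdorff_space E" by (fact E)+
  show "topspace (D_Kr M F TT i) \<subseteq> SS TT" for i by (rule topspace_D_Kr_subset)
  show "0 \<in> topspace (D_Kr M F TT i)" for i
  proof (cases i)
    case (Pair K r)
    show ?thesis unfolding Pair topspace_D_Kr using zop_Diff_Kr[OF T, of K r] rho_zop[of TT] by (metis imageI)
  qed
  show "\<exists>i\<in>C_index M TT. lcs_bounded fscale (D_Kr M F TT i) B"
    if "lcs_bounded fscale (lcs_ind_lim fscale (SS TT) (C_index M TT) (D_Kr M F TT)) B" for B
    by (rule reg) (use that in \<open>simp add: Dc_def\<close>)
  show "Modules.module.subspace fscale (topspace (Dc M F (U \<gamma>)))" if "\<gamma> \<in> \<Gamma>" for \<gamma>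
    unfolding topspace_Dc by (rule SS_subspace[OF U(1)[OF that]])
  show "lcs_bounded fscale (Dc M F (U \<gamma>)) {x}" if "\<gamma> \<in> \<Gamma>" "x \<in> topspace (Dc M F (U \<gamma>))" for \<gamma> x
    unfolding Dc_def
    by (rule lcs_ind_lim_bounded_singleton[OF vector_space_fscale SS_subspace[OF U(1)[OF that(1)]]])
      (use that(2) in \<open>simp add: topspace_Dc\<close>)
  show "continuous_map (Dc M F (U \<gamma>)) (lcs_ind_lim fscale (SS TT) (C_index M TT) (D_Kr M F TT)) (ext_map M F TT (U \<gamma>))"
    if "\<gamma> \<in> \<Gamma>" for \<gamma>
    using continuous_ext_map[OF U(1)[OF that]] by (simp only: Dc_def[of M F TT])
  show "ext_map M F TT (U \<gamma>) (x + y) = ext_map M F TT (U \<gamma>) x + ext_map M F TT (U \<gamma>) y" for \<gamma> x y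
    by (auto simp: ext_map_def)
  show "ext_map M F TT (U \<gamma>) (fscale c x) = fscale c (ext_map M F TT (U \<gamma>) x)" for \<gamma> c x
    by (auto simp: ext_map_def fscale_def)
next
  fix i assume i: "i \<in> C_index M TT"
  obtain K r where Kr: "i = (K, r)" by (cases i)
  have K: "compactin (base M) K" "K \<subseteq> TT" using i by (auto simp: Kr C_index_def)
  have oU: "\<forall>\<gamma>\<in>\<Gamma>. opn (U \<gamma>)" using U(1) by blast
  have KU: "K \<subseteq> (\<Union>\<gamma>\<in>\<Gamma>. U \<gamma>)" using K(2) U(2) by simp
  \<comment> \<open>The cutoffs depend on \<open>K\<close> alone, so the same list splits all
    densities of the step \<open>(K, r)\<close>.\<close>
  from cover_sections[OF K(1) oU KU] obtain L p N where
    L: "\<forall>(\<gamma>, h, A)\<in>set L. \<gamma> \<in> \<Gamma> \<and> cutoff (U \<gamma>) h A" and p: "p \<in> carrier (RR TT)"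
      "osum (map (fst \<circ> snd) L) \<oplus>\<^bsub>RR TT\<^esub> p = \<one>\<^bsub>RR TT\<^esub>"
    and N: "opn N" "K \<subseteq> N" "rest (str M) TT N p = \<zero>\<^bsub>RR N\<^esub>" by (elim exE conjE) (rule that)
  let ?L = "map (\<lambda>(\<gamma>, h, A). (\<gamma>, cut h A (U \<gamma>))) L"
  have L': "\<forall>(\<gamma>, h, A)\<in>set L. cutoff (U \<gamma>) h A \<and> opn (U \<gamma>)" using L U(1) by auto
  have props: "fst q \<in> \<Gamma> \<and> continuous_map (D_Kr M F TT i) (Dc M F (U (fst q))) (snd q) \<and>
      (\<forall>a. \<forall>x\<in>topspace (D_Kr M F TT i). snd q (fscale a x) = fscale a (snd q x))" if qL: "q \<in> set ?L" for q
  proof -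
    obtain \<gamma> h A where q: "(\<gamma>, h, A) \<in> set L" "q = (\<gamma>, cut h A (U \<gamma>))" using qL by auto
    have g: "\<gamma> \<in> \<Gamma>" "cutoff (U \<gamma>) h A" using L q(1) by auto
    show ?thesis unfolding q(2)
      using g(1) continuous_cut[OF g(2) U(1)[OF g(1)] i] by (auto simp: cut_def fscale_def fun_eq_iff)
  qed
  have sum: "(\<Sum>q\<leftarrow>?L. ext_map M F TT (U (fst q)) (snd q x)) = x" if xT: "x \<in> topspace (D_Kr M F TT i)" for x
  proof -
    obtain D where D: "D \<in> Diff_Kr M TT F DD K r" "x = \<rho> TT D" using xT by (auto simp: Kr topspace_D_Kr)
    note d = Diff_KrD[OF D(1) openin_topspace K]
    have "(\<Sum>(\<gamma>, h, A)\<leftarrow>L. ext_map M F TT (U \<gamma>) (cut h A (U \<gamma>) x)) = x"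
      unfolding D(2) by (rule cut_sum[OF d(1) Diff_Kr_imp[OF D(1)] d(3) K(1) L' p N])
    then show ?thesis by (simp add: case_prod_unfold o_def)
  qed
  show "\<exists>L. (\<forall>q\<in>set L. fst q \<in> \<Gamma> \<and> continuous_map (D_Kr M F TT i) (Dc M F (U (fst q))) (snd q) \<and>
          (\<forall>a. \<forall>x\<in>topspace (D_Kr M F TT i). snd q (fscale a x) = fscale a (snd q x))) \<and>
          (\<forall>x\<in>topspace (D_Kr M F TT i). (\<Sum>q\<leftarrow>L. ext_map M F TT (U (fst q)) (snd q x)) = x)"
    by (rule exI[of _ ?L], rule conjI; rule ballI) (fact props, fact sum)
next
  \<comment> \<open>A single density is split over the support of a representing operator.\<close>
  fix x assume "x \<in> SS TT"
  then obtain D where D: "D \<in> Diff_c M TT F DD" "x = \<rho> TT D" unfolding Dc_carrier_def by blast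
  note d = Diff_cD[OF D(1)]
  have oU: "\<forall>\<gamma>\<in>\<Gamma>. opn (U \<gamma>)" using U(1) by blast
  have KU: "op_support M TT F DD D \<subseteq> (\<Union>\<gamma>\<in>\<Gamma>. U \<gamma>)" using d(4) U(2) by simp
  from cover_sections[OF d(3) oU KU] obtain L p N where
    L: "\<forall>(\<gamma>, h, A)\<in>set L. \<gamma> \<in> \<Gamma> \<and> cutoff (U \<gamma>) h A" and p: "p \<in> carrier (RR TT)"
      "osum (map (fst \<circ> snd) L) \<oplus>\<^bsub>RR TT\<^esub> p = \<one>\<^bsub>RR TT\<^esub>"
    and N: "opn N" "op_support M TT F DD D \<subseteq> N" "rest (str M) TT N p = \<zero>\<^bsub>RR N\<^esub>" by (elim exE conjE) (rule that)
  let ?L = "map (\<lambda>(\<gamma>, h, A). (\<gamma>, cut h A (U \<gamma>) x)) L"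
  have L': "\<forall>(\<gamma>, h, A)\<in>set L. cutoff (U \<gamma>) h A \<and> opn (U \<gamma>)" using L U(1) by auto
  have xS: "x \<in> SS TT" by fact
  have props: "fst q \<in> \<Gamma> \<and> snd q \<in> topspace (Dc M F (U (fst q)))" if qL: "q \<in> set ?L" for q
  proof -
    obtain \<gamma> h A where q: "(\<gamma>, h, A) \<in> set L" "q = (\<gamma>, cut h A (U \<gamma>) x)" using qL by auto
    have g: "\<gamma> \<in> \<Gamma>" "cutoff (U \<gamma>) h A" using L q(1) by auto
    show ?thesis unfolding q(2) topspace_Dc using g(1) cut_SS[OF g(2) U(1)[OF g(1)] xS] by simp
  qed
  have "(\<Sum>(\<gamma>, h, A)\<leftarrow>L. ext_map M F TT (U \<gamma>) (cut h A (U \<gamma>) x)) = x"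
    unfolding D(2) by (rule cut_sum[OF d(1) D(1) d(5) d(3) L' p N])
  then have sum: "(\<Sum>q\<leftarrow>?L. ext_map M F TT (U (fst q)) (snd q)) = x" by (simp add: case_prod_unfold o_def)
  show "\<exists>L. (\<forall>q\<in>set L. fst q \<in> \<Gamma> \<and> snd q \<in> topspace (Dc M F (U (fst q)))) \<and>
          (\<Sum>q\<leftarrow>L. ext_map M F TT (U (fst q)) (snd q)) = x"
    by (rule exI[of _ ?L], rule conjI[OF ballI sum]) (rule props)
qed

theorem proposition3p4:
  fixes M :: "('p, 's) ringed_space"
    and F :: "('p, 's, 'f) sheaf_data"
    and sE :: "complex \<Rightarrow> 'e::ab_group_add \<Rightarrow> 'e"
    and E :: "'e topology"
    and \<Gamma> :: "'g set"
    and U :: "'g \<Rightarrow> 'p set"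
  assumes "formal_manifold M"
    and "sheaf_of_modules M F"
    and "quasi_complete_lcs sE E"
    and "\<And>\<gamma>. \<gamma> \<in> \<Gamma> \<Longrightarrow> openin (base M) (U \<gamma>)"
    and "(\<Union>\<gamma>\<in>\<Gamma>. U \<gamma>) = topspace (base M)"
    and "regular_ind_lim fscale (Dc_carrier M F (topspace (base M)))
           (C_index M (topspace (base M))) C_le (D_Kr M F (topspace (base M)))"
  shows "let X = gen_functions M F sE E (topspace (base M));
             Y = product_topology (\<lambda>\<gamma>. gen_functions M F sE E (U \<gamma>)) \<Gamma>;
             \<Phi> = gen_restrict_family M F \<Gamma> U
         in (\<forall>u\<in>topspace X. \<forall>v\<in>topspace X. \<forall>\<gamma>\<in>\<Gamma>. \<Phi> (u + v) \<gamma> = \<Phi> u \<gamma> + \<Phi> v \<gamma>) \<and>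
            (\<forall>c. \<forall>u\<in>topspace X. \<forall>\<gamma>\<in>\<Gamma>. \<Phi> (\<lambda>\<eta>. sE c (u \<eta>)) \<gamma> = (\<lambda>\<eta>. sE c (\<Phi> u \<gamma> \<eta>))) \<and>
            embedding_map X Y \<Phi> \<and>
            closedin Y (\<Phi> ` topspace X)"
proof -
  interpret fmod M F
    by (intro fmod.intro fmfd.intro fmod_axioms.intro assms(1,2))
  have E: "lcs sE E" "Hausdorff_space E" using assms(3) by (simp_all add: quasi_complete_lcs_def)
  have reg: "\<exists>i\<in>C_index M TT. lcs_bounded fscale (D_Kr M F TT i) B" if "lcs_bounded fscale (Dc M F TT) B" for B
    using assms(6) that unfolding regular_ind_lim_def Dc_def by blast
  interpret d: decomposable_ind_lim fscale "SS TT" "C_index M TT" "D_Kr M F TT" \<Gamma> "\<lambda>\<gamma>. Dc M F (U \<gamma>)"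
     "\<lambda>\<gamma>. ext_map M F TT (U \<gamma>)" sE E
    by (rule decomposable[OF E assms(4,5) reg])
  \<comment> \<open>Restrictions are \<open>0\<close> off the carrier, and homogeneity of the
    restriction map has to hold at these arguments as well.\<close>
  have sE0: "sE c 0 = 0" for c by (rule d.sE.scale_zero_right)
  have X: "gen_functions M F sE E TT = strong_topology fscale d.X sE E"
    by (simp only: gen_functions_def Dc_def)
  have Y: "product_topology (\<lambda>\<gamma>. gen_functions M F sE E (U \<gamma>)) \<Gamma> = d.prod_space"
    by (simp only: d.prod_space_def gen_functions_def)
  have \<Phi>: "gen_restrict_family M F \<Gamma> U = d.family"
    by (intro ext) (simp only: gen_restrict_family_def d.family_def gen_restrict_def d.pull_def)
  show ?thesis
    unfolding Let_def X Y \<Phi> topspace_strong_topology[OF E(1)]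
  proof (intro conjI d.embedding_family d.closedin_family_image)
    show "\<forall>u\<in>d.L\<^sub>X. \<forall>v\<in>d.L\<^sub>X. \<forall>\<gamma>\<in>\<Gamma>. d.family (u + v) \<gamma> = d.family u \<gamma> + d.family v \<gamma>"
      by (simp add: d.family_def d.pull_def fun_eq_iff)
    show "\<forall>c. \<forall>u\<in>d.L\<^sub>X. \<forall>\<gamma>\<in>\<Gamma>. d.family (\<lambda>\<eta>. sE c (u \<eta>)) \<gamma> = (\<lambda>\<eta>. sE c (d.family u \<gamma> \<eta>))"
      by (simp add: d.family_def d.pull_def fun_eq_iff sE0)
  qed
qed

end
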